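(* Let $b:\mathbb{R}\to\mathbb{R}$ and $\sigma:\mathbb{R}\to(0,\infty)$ be continuous with period 1, and let $X$ solve $dX_t=b(X_t)dt+\sigma(X_t)dW_t$, $X_0=y\in\mathbb{R}$. Then the law of $(J^+_t,J^-_t)$ satisfies a large deviation principle with rate $t$ and a good rate function $I_1:\mathbb{R}^2\to[0,\infty]$ which is convex.
   Context: $W$ is a standard Brownian motion; the SDE has a weak solution unique in law. Cycle forming times: $T_0=0$, $T_n=\inf\{t\ge T_{n-1}:|X_t-X_{T_{n-1}}|=1\}$. $N_t=\inf\{n\ge0:T_{n+1}>t\}$, $N^+_t=\sum_{n=1}^{N_t}1_{\{X_{T_n}-X_{T_{n-1}}=1\}}$, $N^-_t=\sum_{n=1}^{N_t}1_{\{X_{T_n}-X_{T_{n-1}}=-1\}}$; empirical circulations $J^\pm_t=N^\pm_t/t$. A family of probability measures $\{\mu_t\}_{t>0}$ on a Polish space $E$ satisfies a large deviation principle with rate $t$ and good rate function $I:E\to[0,\infty]$ if all level sets $\{I\le\alpha\}$ are compact, $\limsup_{t\to\infty}\frac1t\log\mu_t(F)\le-\inf_F I$ for closed $F$, and $\liminf_{t\to\infty}\frac1t\log\mu_t(U)\ge-\inf_U I$ for open $U$. *)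

theory Defs
  imports "HOL-Probability.Probability"
begin

definition is_filtration :: "'a measure \<Rightarrow> (real \<Rightarrow> 'a measure) \<Rightarrow> bool" where
  "is_filtration M F \<longleftrightarrow>
     (\<forall>t. subalgebra M (F t)) \<and> (\<forall>s t. s \<le> t \<longrightarrow> sets (F s) \<subseteq> sets (F t))"

definition brownian_motion ::
  "'a measure \<Rightarrow> (real \<Rightarrow> 'a measure) \<Rightarrow> (real \<Rightarrow> 'a \<Rightarrow> real) \<Rightarrow> bool" where
  "brownian_motion M F W \<longleftrightarrow>
     (\<forall>\<omega>\<in>space M. W 0 \<omega> = 0) \<and>
     (\<forall>\<omega>\<in>space M. continuous_on {0..} (\<lambda>t. W t \<omega>)) \<and>
     (\<forall>t\<ge>0. W t \<in> borel_measurable (F t)) \<and>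
     (\<forall>s t. 0 \<le> s \<and> s < t \<longrightarrow>
        distributed M lborel (\<lambda>\<omega>. W t \<omega> - W s \<omega>) (normal_density 0 (sqrt (t - s))) \<and>
        (\<forall>A\<in>sets (F s). \<forall>B\<in>sets borel.
           measure M (A \<inter> {\<omega>\<in>space M. W t \<omega> - W s \<omega> \<in> B})
             = measure M A * measure M {\<omega>\<in>space M. W t \<omega> - W s \<omega> \<in> B}))"

definition ito_riemann_sum ::
  "(real \<Rightarrow> 'a \<Rightarrow> real) \<Rightarrow> (real \<Rightarrow> 'a \<Rightarrow> real) \<Rightarrow> real \<Rightarrow> nat \<Rightarrow> 'a \<Rightarrow> real" where
  "ito_riemann_sum H W t n \<omega> =
     (\<Sum>k<2^n. H (t * real k / 2^n) \<omega> *
        (W (t * real (Suc k) / 2^n) \<omega> - W (t * real k / 2^n) \<omega>))"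

text \<open>Weak solution of dX = b(X) dt + \<sigma>(X) dW, X_0 = y, on (M, F, W).
  The Ito integral of the continuous adapted integrand \<sigma>(X_s) is the limit in
  probability of the left-point Riemann sums.\<close>
definition weak_solution ::
  "'a measure \<Rightarrow> (real \<Rightarrow> 'a measure) \<Rightarrow> (real \<Rightarrow> 'a \<Rightarrow> real) \<Rightarrow> (real \<Rightarrow> 'a \<Rightarrow> real)
     \<Rightarrow> (real \<Rightarrow> real) \<Rightarrow> (real \<Rightarrow> real) \<Rightarrow> real \<Rightarrow> bool" where
  "weak_solution M F W X b \<sigma> y \<longleftrightarrow>
     prob_space M \<and> is_filtration M F \<and> brownian_motion M F W \<and>
     (\<forall>\<omega>\<in>space M. X 0 \<omega> = y) \<and>
     (\<forall>\<omega>\<in>space M. continuous_on {0..} (\<lambda>t. X t \<omega>)) \<and>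
     (\<forall>t\<ge>0. X t \<in> borel_measurable (F t)) \<and>
     (\<forall>t\<ge>0. \<forall>\<epsilon>>0.
        (\<lambda>n. measure M {\<omega>\<in>space M.
            \<bar>ito_riemann_sum (\<lambda>s \<omega>. \<sigma> (X s \<omega>)) W t n \<omega>
              - (X t \<omega> - y - integral {0..t} (\<lambda>s. b (X s \<omega>)))\<bar> > \<epsilon>}) \<longlonglongrightarrow> 0)"

primrec cycle_time :: "(real \<Rightarrow> 'a \<Rightarrow> real) \<Rightarrow> 'a \<Rightarrow> nat \<Rightarrow> ereal" where
  "cycle_time X \<omega> 0 = 0"
| "cycle_time X \<omega> (Suc n) =
     Inf {ereal s | s. ereal s \<ge> cycle_time X \<omega> n \<and>
            \<bar>X s \<omega> - X (real_of_ereal (cycle_time X \<omega> n)) \<omega>\<bar> = 1}"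

definition cycle_count :: "(real \<Rightarrow> 'a \<Rightarrow> real) \<Rightarrow> real \<Rightarrow> 'a \<Rightarrow> nat" where
  "cycle_count X t \<omega> = (LEAST n. cycle_time X \<omega> (Suc n) > ereal t)"

definition cycle_count_dir :: "real \<Rightarrow> (real \<Rightarrow> 'a \<Rightarrow> real) \<Rightarrow> real \<Rightarrow> 'a \<Rightarrow> nat" where
  "cycle_count_dir d X t \<omega> =
     card {n \<in> {1..cycle_count X t \<omega>}.
        X (real_of_ereal (cycle_time X \<omega> n)) \<omega>
          - X (real_of_ereal (cycle_time X \<omega> (n - 1))) \<omega> = d}"

definition circ_plus :: "(real \<Rightarrow> 'a \<Rightarrow> real) \<Rightarrow> real \<Rightarrow> 'a \<Rightarrow> real" where
  "circ_plus X t \<omega> = real (cycle_count_dir 1 X t \<omega>) / t"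

definition circ_minus :: "(real \<Rightarrow> 'a \<Rightarrow> real) \<Rightarrow> real \<Rightarrow> 'a \<Rightarrow> real" where
  "circ_minus X t \<omega> = real (cycle_count_dir (-1) X t \<omega>) / t"

definition elog :: "real \<Rightarrow> ereal" where
  "elog x = (if x \<le> 0 then -\<infinity> else ereal (ln x))"

definition good_rate_function :: "('b::topological_space \<Rightarrow> ereal) \<Rightarrow> bool" where
  "good_rate_function I \<longleftrightarrow> (\<forall>x. 0 \<le> I x) \<and> (\<forall>\<alpha>::real. compact {x. I x \<le> ereal \<alpha>})"

definition satisfies_LDP :: "(real \<Rightarrow> 'b::topological_space measure) \<Rightarrow> ('b \<Rightarrow> ereal) \<Rightarrow> bool" where
  "satisfies_LDP \<mu> I \<longleftrightarrow> good_rate_function I \<and>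
     (\<forall>C. closed C \<longrightarrow>
        Limsup at_top (\<lambda>t. ereal (1 / t) * elog (measure (\<mu> t) C)) \<le> - (INF x\<in>C. I x)) \<and>
     (\<forall>U. open U \<longrightarrow>
        Liminf at_top (\<lambda>t. ereal (1 / t) * elog (measure (\<mu> t) U)) \<ge> - (INF x\<in>U. I x))"

definition convex_ereal_fun :: "('b::real_vector \<Rightarrow> ereal) \<Rightarrow> bool" where
  "convex_ereal_fun I \<longleftrightarrow>
     (\<forall>x y. \<forall>u::real. 0 < u \<and> u < 1 \<longrightarrow>
        I (u *\<^sub>R x + (1 - u) *\<^sub>R y) \<le> ereal u * I x + ereal (1 - u) * I y)"

end

(* Encode the n-th cycle in the variable V_n = (direction) * exp (- duration).  Solve
   (sigma^2/2) g'' + b g' = l g around the starting point of the cycle; Ito's formula for exp (-l t) g (X_t),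
   used with two independent solutions g for l = k, determines the k-th moment of V_n on every event of the
   past.  As the coefficients have period 1, these moments do not depend on n or on the starting point, so
   the V_n are i.i.d. and the cycle counts N = (N^+, N^-) are a renewal functional of them.  The same formula
   with l = 1, started from a fixed time s, shows that the cycle running at time s ends before s + K with
   conditional probability at least c > 0.  Concatenation then gives
     P (|N_{s+K+t} - (p+q)| <= r1 + r2 + m) >= c P (|N_s - p| <= r1) P (|N_t - q| <= r2)
   with constants K, m, c.  Together with exponential tightness, which follows from
   E exp (- T_n) = rho^n with rho < 1, this yields the principle and the convexity by the Ruelle-Lanford argument. *)
theory Submission
  imports Defs "HOL-Real_Asymp.Real_Asymp"
begin

section \<open>The Ruelle-Lanford argument\<close>

text \<open>The Markov property of X is not part of the data: there is one weak solution, whose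
  stochastic integral is known only as a limit in probability of dyadic Riemann sums. Renewal is
  therefore extracted from Ito's formula. It works at the cycle times because cycle n starts at one
  of finitely many integer translates of y and ends at one of two points: a combination of two
  independent eigenfunctions takes any prescribed values there, and boundedness of V_n turns the
  moments into a law. At a fixed time s the position inside the running cycle is arbitrary, so there
  is no exact renewal; this is the origin of the constants. None of them grows with time, so they
  disappear after taking logarithms and dividing by t. Convexity comes from the same inequality, by
  spending a fraction u of the time near one point and the rest near another.\<close>

lemma ereal_le_uminus: "a \<le> - b \<longleftrightarrow> b \<le> - a" for a b :: ereal
  by (metis ereal_minus_le_minus ereal_uminus_uminus)

text \<open>What the probabilistic part has to deliver. By \<open>superadd\<close> two blocks are
  joined at the price of a time gap \<open>K\<close>, a radius \<open>m\<close> and a factor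
  \<open>c\<close>; \<open>locally_tight\<close> pays for a last block of bounded length, and
  \<open>exp_tight\<close> reduces closed sets to compact ones.\<close>

locale approx_superadditive = prob_space M for M :: "'a measure" +
  fixes Z :: "real \<Rightarrow> 'a \<Rightarrow> 'b::euclidean_space" and K m c :: real
  assumes Z_measurable [measurable]: "\<And>t. Z t \<in> borel_measurable M"
    and K_nonneg: "0 \<le> K" and m_nonneg: "0 \<le> m" and c_pos: "0 < c" and c_le_1: "c \<le> 1"
    and superadd: "\<And>s t p q r1 r2. 0 \<le> s \<Longrightarrow> 0 \<le> t \<Longrightarrow>
        c * prob {\<omega>\<in>space M. norm (Z s \<omega> - p) \<le> r1} * prob {\<omega>\<in>space M. norm (Z t \<omega> - q) \<le> r2}
        \<le> prob {\<omega>\<in>space M. norm (Z (s + K + t) \<omega> - (p + q)) \<le> r1 + r2 + m}"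
    and locally_tight: "\<And>T. 0 \<le> T \<Longrightarrow> \<exists>R. \<forall>t\<in>{0..T}. 1/2 \<le> prob {\<omega>\<in>space M. norm (Z t \<omega>) \<le> R}"
    and exp_tight: "\<And>\<alpha>. \<exists>R>0. \<forall>\<^sub>F t in at_top. prob {\<omega>\<in>space M. norm (Z t \<omega>) > R * t} \<le> exp (- \<alpha> * t)"
begin

definition mass :: "real \<Rightarrow> 'b \<Rightarrow> real \<Rightarrow> real" where
  "mass t p r = prob {\<omega>\<in>space M. norm (Z t \<omega> - p) \<le> r}"

text \<open>The radius shrinks only after t has grown, and the infimum over the exponents comes
  last, so \<open>rate\<close> is the local decay exponent of Z t / t at x. It is infinite if no
  exponent works, the infimum of the empty set being infinity.\<close>

definition rates :: "'b \<Rightarrow> real set" where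
  "rates x = {\<alpha>. \<forall>\<epsilon>>0. \<forall>\<^sub>F t in at_top. exp (- \<alpha> * t) \<le> mass t (t *\<^sub>R x) (\<epsilon> * t)}"

definition rate :: "'b \<Rightarrow> ereal" where
  "rate x = Inf (ereal ` rates x)"

lemma mass_le_1: "mass t p r \<le> 1"
  unfolding mass_def by simp

lemma mass_mono: 
  assumes "norm (p - q) + r \<le> r'" shows "mass t p r \<le> mass t q r'"
  unfolding mass_def
proof (rule finite_measure_mono)
  show "{\<omega> \<in> space M. norm (Z t \<omega> - p) \<le> r} \<subseteq> {\<omega> \<in> space M. norm (Z t \<omega> - q) \<le> r'}"
  proof safe
    fix \<omega> assume "norm (Z t \<omega> - p) \<le> r"
    moreover have "norm (Z t \<omega> - q) \<le> norm (Z t \<omega> - p) + norm (p - q)"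
      using norm_triangle_ineq[of "Z t \<omega> - p" "p - q"] by simp
    ultimately show "norm (Z t \<omega> - q) \<le> r'" using assms by simp
  qed
qed measurable

lemma mass_superadd:
  "0 \<le> s \<Longrightarrow> 0 \<le> t \<Longrightarrow> c * mass s p r1 * mass t q r2 \<le> mass (s + K + t) (p + q) (r1 + r2 + m)"
  unfolding mass_def by (rule superadd)

text \<open>A given time is rarely a multiple of \<open>s + K\<close>, so a last block of free
  length \<open>t\<close> with target 0 fills up the remainder.\<close>

lemma mass_iterate:
  assumes "0 \<le> s" "0 \<le> t"
  shows "(c * mass s p r) ^ k * mass t 0 R \<le> mass (real k * (s + K) + t) (real k *\<^sub>R p) (real k * (r + m) + R)"
proof (induction k)
  case 0
  then show ?case by simp
next
  case (Suc k)
  have nn: "0 \<le> c * mass s p r" using c_pos by (simp add: mass_def)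
  have "(c * mass s p r) ^ Suc k * mass t 0 R = c * mass s p r * ((c * mass s p r) ^ k * mass t 0 R)"
    by simp
  also have "\<dots> \<le> c * mass s p r * mass (real k * (s + K) + t) (real k *\<^sub>R p) (real k * (r + m) + R)"
    by (rule mult_left_mono[OF Suc nn])
  also have "\<dots> \<le> mass (s + K + (real k * (s + K) + t)) (p + real k *\<^sub>R p) (r + (real k * (r + m) + R) + m)"
    using assms K_nonneg by (intro mass_superadd) auto
  also have "\<dots> = mass (real (Suc k) * (s + K) + t) (real (Suc k) *\<^sub>R p) (real (Suc k) * (r + m) + R)"
    by (simp add: algebra_simps)
  finally show ?case .
qed

lemma rates_nonneg:
  assumes "\<alpha> \<in> rates x" shows "0 \<le> \<alpha>"
proof -
  have "\<forall>\<^sub>F t in at_top. exp (- \<alpha> * t) \<le> mass t (t *\<^sub>R x) (1 * t)"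
    using assms zero_less_one unfolding rates_def by blast
  from eventually_happens[OF eventually_conj[OF this eventually_gt_at_top[of 0]]]
  obtain t where "t > 0" "exp (- \<alpha> * t) \<le> mass t (t *\<^sub>R x) (1 * t)" by auto
  then have "exp (- \<alpha> * t) \<le> 1" "t > 0" using mass_le_1[of t "t *\<^sub>R x" "1 * t"] by linarith+
  then show ?thesis by (simp add: zero_le_mult_iff)
qed

lemma rate_nonneg: "0 \<le> rate x"
  unfolding rate_def by (rule Inf_greatest) (auto dest: rates_nonneg)

text \<open>Approximate superadditivity upgrades a lower bound along some sequence of times to one at
  all large times.\<close>
lemma frequently_imp_rates:
  assumes freq: "\<And>\<epsilon>. \<epsilon> > 0 \<Longrightarrow> \<exists>\<^sub>F t in at_top. exp (- \<alpha> * t) \<le> mass t (t *\<^sub>R x) (\<epsilon> * t)"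
    and less: "\<alpha> < \<alpha>'"
  shows "\<alpha>' \<in> rates x"
  unfolding rates_def
proof (safe)
  fix \<epsilon> :: real assume eps: "\<epsilon> > 0"
  define D where "D = \<alpha>' - \<alpha>"
  have D: "D > 0" using less by (simp add: D_def)
  \<comment> \<open>Block length from which the costs of one joint are small relative errors:
    \<open>m\<close> and \<open>K * norm x\<close> stay below \<open>t0 * (\<epsilon>/8)\<close>,
    and \<open>ln (1 / c)\<close> below half of the available gap \<open>D\<close> times
    \<open>t0\<close>.\<close>
  define t1 where "t1 = max 1 (max (8 * m / \<epsilon>) (max (8 * norm x * K / \<epsilon>) (2 * ln (1 / c) / D)))"
  obtain t0 where t0: "t0 \<ge> t1" and low: "exp (- \<alpha> * t0) \<le> mass t0 (t0 *\<^sub>R x) (\<epsilon>/4 * t0)"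
    using frequently_eventually_frequently[OF freq[of "\<epsilon>/4"] eventually_ge_at_top[of t1]] eps
    by (auto dest!: frequently_ex)
  have t0_1: "t0 \<ge> 1" and m_t0: "m \<le> t0 * (\<epsilon>/8)" and xK: "K * norm x \<le> t0 * (\<epsilon>/8)"
    and lnc: "ln (1 / c) \<le> t0 * (D / 2)"
    using t0 eps D by (auto simp: t1_def field_simps)
  have "exp (- \<alpha> * t0) \<le> 1" using low mass_le_1 by (rule order_trans)
  then have \<alpha>: "0 \<le> \<alpha>" using t0_1 by (simp add: zero_le_mult_iff)
  define h where "h = t0 + K"
  have h: "h \<ge> t0" "h > 0" using K_nonneg t0_1 by (auto simp: h_def)
  obtain R where "\<forall>t\<in>{0..h}. 1/2 \<le> prob {\<omega>\<in>space M. norm (Z t \<omega>) \<le> R}"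
    using locally_tight[of h] h by force
  then have R: "1/2 \<le> mass t 0 R" if "0 \<le> t" "t \<le> h" for t
    using that by (simp add: mass_def)
  have ev1: "\<forall>\<^sub>F t in at_top. R + h * norm x \<le> \<epsilon> / 4 * t"
    using eventually_ge_at_top[of "(R + h * norm x) / (\<epsilon>/4)"] 
    by eventually_elim (use eps in \<open>simp add: field_simps\<close>)
  have ev2: "\<forall>\<^sub>F t in at_top. ln 2 \<le> D / 2 * t"
    using eventually_ge_at_top[of "ln 2 / (D/2)"] 
    by eventually_elim (use D in \<open>simp add: field_simps\<close>)
  show "\<forall>\<^sub>F t in at_top. exp (- \<alpha>' * t) \<le> mass t (t *\<^sub>R x) (\<epsilon> * t)"
    using ev1 ev2 eventually_ge_at_top[of 0]
  proof eventually_elim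
    case (elim t)
    \<comment> \<open>\<open>t\<close> consists of \<open>k\<close> blocks of length
      \<open>h = t0 + K\<close> and a remainder \<open>r\<close> in [0, h];
      \<open>locally_tight\<close> serves all such remainders with one radius \<open>R\<close> and
      probability 1/2.\<close>
    define k where "k = nat \<lfloor>t / h\<rfloor>"
    define r where "r = t - real k * h"
    have rk: "real k = of_int \<lfloor>t / h\<rfloor>" using elim h by (simp add: k_def)
    have "real k \<le> t / h" "t / h < real k + 1" unfolding rk by linarith+
    then have r: "0 \<le> r" "r \<le> h" using h by (auto simp: r_def field_simps)
    have kt0: "real k * t0 \<le> t" 
      using r h mult_left_mono[of t0 h "real k"] by (simp add: r_def)
    have "exp (- \<alpha>' * t) \<le> (c * exp (- \<alpha> * t0)) ^ k * (1/2)"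
    proof -
      have "real k * ln (1/c) \<le> real k * (t0 * (D/2))" by (rule mult_left_mono[OF lnc]) simp
      also have "\<dots> = real k * t0 * (D / 2)" by simp
      also have "\<dots> \<le> t * (D / 2)" using kt0 D by (intro mult_right_mono) auto
      finally have a: "real k * ln (1/c) \<le> t * (D / 2)" .
      have b: "\<alpha> * (real k * t0) \<le> \<alpha> * t" using kt0 \<alpha> by (intro mult_left_mono)
      have "(c * exp (- \<alpha> * t0)) ^ k * (1/2) = exp (real k * (ln c - \<alpha> * t0) - ln 2)"
        using c_pos by (simp add: exp_diff exp_of_nat_mult exp_minus divide_simps power_divide)
      moreover have "- \<alpha>' * t \<le> real k * (ln c - \<alpha> * t0) - ln 2"
        using a b elim(2) c_pos by (simp add: D_def ln_div algebra_simps) 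
      ultimately show ?thesis by simp
    qed
    also have "\<dots> \<le> (c * mass t0 (t0 *\<^sub>R x) (\<epsilon>/4 * t0)) ^ k * mass r 0 R"
    proof (rule mult_mono[OF _ R[OF r]])
      show "(c * exp (- \<alpha> * t0)) ^ k \<le> (c * mass t0 (t0 *\<^sub>R x) (\<epsilon>/4 * t0)) ^ k"
        using low c_pos by (intro power_mono mult_left_mono) auto
    qed (use c_pos in \<open>auto simp: mass_def\<close>)
    also have "\<dots> \<le> mass (real k * (t0 + K) + r) (real k *\<^sub>R (t0 *\<^sub>R x)) (real k * (\<epsilon>/4 * t0 + m) + R)"
      using t0_1 r by (intro mass_iterate) auto
    also have "real k * (t0 + K) + r = t" by (simp add: r_def h_def)
    also have "mass t (real k *\<^sub>R (t0 *\<^sub>R x)) (real k * (\<epsilon>/4 * t0 + m) + R) \<le> mass t (t *\<^sub>R x) (\<epsilon> * t)"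
    proof (rule mass_mono)
      have "norm (real k *\<^sub>R (t0 *\<^sub>R x) - t *\<^sub>R x) = norm ((real k * t0 - t) *\<^sub>R x)"
        by (simp add: scaleR_left_diff_distrib)
      also have "\<dots> = (t - real k * t0) * norm x" using kt0 by simp
      also have "\<dots> = (real k * K + r) * norm x" by (simp add: r_def h_def algebra_simps)
      also have "\<dots> \<le> real k * (K * norm x) + h * norm x"
        using mult_right_mono[OF r(2), of "norm x"] by (simp add: algebra_simps)
      finally have 1: "norm (real k *\<^sub>R (t0 *\<^sub>R x) - t *\<^sub>R x) \<le> real k * (K * norm x) + h * norm x" .
      \<comment> \<open>The displacement of the centre and the accumulated radius add up to at most
        3/4 of \<open>\<epsilon> * t\<close>.\<close>
      define a where "a = real k * t0 * \<epsilon>"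
      have "real k * (K * norm x) \<le> real k * (t0 * (\<epsilon>/8))" by (intro mult_left_mono xK) simp
      then have 2: "real k * (K * norm x) \<le> a / 8" by (simp add: a_def)
      have "real k * m \<le> real k * (t0 * (\<epsilon>/8))" by (intro mult_left_mono m_t0) simp
      then have 3: "real k * m \<le> a / 8" by (simp add: a_def)
      have 4: "a \<le> \<epsilon> * t" unfolding a_def mult.commute[of \<epsilon>] using kt0 eps by (intro mult_right_mono) auto
      have 5: "0 \<le> \<epsilon> * t" using eps elim by simp
      have 6: "real k * (\<epsilon>/4 * t0 + m) = a / 4 + real k * m" by (simp add: a_def algebra_simps)
      show "norm (real k *\<^sub>R (t0 *\<^sub>R x) - t *\<^sub>R x) + (real k * (\<epsilon>/4 * t0 + m) + R) \<le> \<epsilon> * t"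
        unfolding 6 using 1 2 3 4 5 elim(1) by linarith
    qed
    finally show ?case .
  qed
qed

text \<open>Contrapositive of \<open>frequently_imp_rates\<close> at an exponent between
  \<open>\<alpha>\<close> and \<open>rate x\<close>. An exponent could be missing from
  \<open>rates\<close> because the lower bound fails along a sequence of times only; superadditivity
  turns this into an upper bound at all large times.\<close>

lemma less_rate_imp_mass_less:
  assumes "ereal \<alpha> < rate x"
  obtains \<epsilon> where "\<epsilon> > 0" "\<forall>\<^sub>F t in at_top. mass t (t *\<^sub>R x) (\<epsilon> * t) \<le> exp (- \<alpha> * t)"
proof -
  obtain \<alpha>' where \<alpha>': "ereal \<alpha> < ereal \<alpha>'" "ereal \<alpha>' < rate x"
    using ereal_dense3[OF assms] by (metis (no_types) assms ereal_dense2)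
  then have "\<alpha>' \<notin> rates x" unfolding rate_def by (meson Inf_lower image_eqI leD)
  then obtain \<epsilon> where "\<epsilon> > 0" "\<not> (\<exists>\<^sub>F t in at_top. exp (- \<alpha> * t) \<le> mass t (t *\<^sub>R x) (\<epsilon> * t))"
    using frequently_imp_rates[of \<alpha> x \<alpha>'] \<alpha>' by auto
  then show ?thesis
    by (intro that[of \<epsilon>]) (auto simp: not_frequently elim!: eventually_mono)
qed

lemma le_rateI:
  assumes "\<epsilon> > 0" "\<forall>\<^sub>F t in at_top. mass t (t *\<^sub>R x) (\<epsilon> * t) \<le> exp (- \<alpha> * t)"
  shows "ereal \<alpha> \<le> rate x"
  unfolding rate_def
proof (rule Inf_greatest, safe)
  fix \<beta> assume "\<beta> \<in> rates x"
  then have "\<forall>\<^sub>F t in at_top. exp (- \<beta> * t) \<le> mass t (t *\<^sub>R x) (\<epsilon> * t)"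
    using assms(1) by (auto simp: rates_def)
  with assms(2) eventually_gt_at_top[of 0] have "\<forall>\<^sub>F t::real in at_top. \<alpha> \<le> \<beta>"
  proof eventually_elim
    case (elim t)
    then have "exp (- \<beta> * t) \<le> exp (- \<alpha> * t)" by linarith
    then have "\<alpha> * t \<le> \<beta> * t" by simp
    then show ?case using elim(2) by simp
  qed
  then show "ereal \<alpha> \<le> ereal \<beta>" by (auto dest: eventually_happens)
qed

lemma rate_less_imp_rates:
  assumes "rate x < ereal \<alpha>" shows "\<alpha> \<in> rates x"
proof -
  obtain \<beta> where \<beta>: "\<beta> \<in> rates x" "\<beta> < \<alpha>"
    using assms unfolding rate_def by (auto simp: Inf_less_iff)
  show ?thesis unfolding rates_def
  proof safe
    fix \<epsilon> :: real assume "\<epsilon> > 0"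
    then have "\<forall>\<^sub>F t in at_top. exp (- \<beta> * t) \<le> mass t (t *\<^sub>R x) (\<epsilon> * t)"
      using \<beta> by (auto simp: rates_def)
    then show "\<forall>\<^sub>F t in at_top. exp (- \<alpha> * t) \<le> mass t (t *\<^sub>R x) (\<epsilon> * t)"
      using eventually_gt_at_top[of 0]
    proof eventually_elim
      case (elim t)
      then have "exp (- \<alpha> * t) \<le> exp (- \<beta> * t)" using \<beta> by simp
      then show ?case using elim by linarith
    qed
  qed
qed

text \<open>Lower semicontinuity: for y within \<open>\<epsilon>/2\<close> of x, the ball of half
  the radius about y lies inside the ball that witnesses a large rate at x.\<close>

lemma closed_rate_level: "closed {x. rate x \<le> ereal \<alpha>}"
proof -
  have "open {x. ereal \<alpha> < rate x}"
    unfolding open_dist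
  proof safe
    fix x assume "ereal \<alpha> < rate x"
    then obtain \<beta> where \<beta>: "ereal \<alpha> < ereal \<beta>" "ereal \<beta> < rate x"
      by (metis (no_types) ereal_dense2)
    obtain \<epsilon> where \<epsilon>: "\<epsilon> > 0" "\<forall>\<^sub>F t in at_top. mass t (t *\<^sub>R x) (\<epsilon> * t) \<le> exp (- \<beta> * t)"
      using less_rate_imp_mass_less[OF \<beta>(2)] by blast
    show "\<exists>e>0. \<forall>y. dist y x < e \<longrightarrow> y \<in> {x. ereal \<alpha> < rate x}"
    proof (intro exI[of _ "\<epsilon>/2"] conjI allI impI)
      fix y assume y: "dist y x < \<epsilon>/2"
      have "\<forall>\<^sub>F t in at_top. mass t (t *\<^sub>R y) (\<epsilon>/2 * t) \<le> exp (- \<beta> * t)"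
        using \<epsilon>(2) eventually_gt_at_top[of 0]
      proof eventually_elim
        case (elim t)
        have "mass t (t *\<^sub>R y) (\<epsilon>/2 * t) \<le> mass t (t *\<^sub>R x) (\<epsilon> * t)"
        proof (rule mass_mono)
          have "norm (t *\<^sub>R y - t *\<^sub>R x) = t * dist y x"
            using elim by (simp add: dist_norm flip: scaleR_diff_right)
          also have "\<dots> \<le> t * (\<epsilon>/2)" using y elim by (intro mult_left_mono) auto
          finally show "norm (t *\<^sub>R y - t *\<^sub>R x) + \<epsilon>/2 * t \<le> \<epsilon> * t" 
            by (simp add: mult.commute)
        qed
        then show ?case using elim by linarith
      qed
      then have "ereal \<beta> \<le> rate y" using \<epsilon>(1) by (intro le_rateI[of "\<epsilon>/2"]) auto
      with \<beta>(1) show "y \<in> {x. ereal \<alpha> < rate x}" unfolding mem_Collect_eq by (rule less_le_trans)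
    qed (use \<epsilon> in auto)
  qed
  moreover have "{x. rate x \<le> ereal \<alpha>} = - {x. ereal \<alpha> < rate x}" by auto
  ultimately show ?thesis by (simp add: closed_def)
qed

text \<open>If x lies beyond \<open>R + 1\<close>, the ball of radius t about t x is contained in
  the tail event of \<open>exp_tight\<close>. The tail exponent \<open>\<alpha> + 1\<close> leaves a
  strict margin.\<close>

lemma bounded_rate_level: "bounded {x. rate x \<le> ereal \<alpha>}"
proof -
  obtain R where R: "R > 0" "\<forall>\<^sub>F t in at_top. prob {\<omega>\<in>space M. norm (Z t \<omega>) > R * t} \<le> exp (- (\<alpha> + 1) * t)"
    using exp_tight by blast
  have "norm x \<le> R + 1" if "rate x \<le> ereal \<alpha>" for x
  proof (rule ccontr)
    assume x: "\<not> norm x \<le> R + 1"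
    have "\<forall>\<^sub>F t in at_top. mass t (t *\<^sub>R x) (1 * t) \<le> exp (- (\<alpha> + 1) * t)"
      using R(2) eventually_gt_at_top[of 0]
    proof eventually_elim
      case (elim t)
      have "mass t (t *\<^sub>R x) (1 * t) \<le> prob {\<omega>\<in>space M. norm (Z t \<omega>) > R * t}"
        unfolding mass_def
      proof (rule finite_measure_mono)
        show "{\<omega> \<in> space M. norm (Z t \<omega> - t *\<^sub>R x) \<le> 1 * t} \<subseteq> {\<omega> \<in> space M. R * t < norm (Z t \<omega>)}"
        proof safe
          fix \<omega> assume "norm (Z t \<omega> - t *\<^sub>R x) \<le> 1 * t"
          moreover have "norm (t *\<^sub>R x) \<le> norm (Z t \<omega> - t *\<^sub>R x) + norm (Z t \<omega>)"
            by (metis norm_minus_commute norm_triangle_sub add.commute)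
          moreover have "norm (t *\<^sub>R x) > t * (R + 1)"
            using elim x by simp
          ultimately show "R * t < norm (Z t \<omega>)" by (simp add: algebra_simps)
        qed
      qed measurable
      then show ?case using elim by linarith
    qed
    then have "ereal (\<alpha> + 1) \<le> rate x" by (intro le_rateI[of 1]) auto
    then have "ereal (\<alpha> + 1) \<le> ereal \<alpha>" using that by (rule order_trans)
    then show False by simp
  qed
  then show ?thesis unfolding bounded_iff by auto
qed

lemma good_rate: "good_rate_function rate"
  unfolding good_rate_function_def
  using rate_nonneg closed_rate_level bounded_rate_level by (auto simp: compact_eq_bounded_closed)

text \<open>Up to the gap \<open>K\<close>, the time is divided in the ratio u : 1 - u, the first
  stretch following x and the second y; the two displacements add up to the convex
  combination.\<close>

lemma convex_rate: "convex_ereal_fun rate"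
  unfolding convex_ereal_fun_def
proof (intro allI impI)
  fix x y :: 'b and u :: real assume u: "0 < u \<and> u < 1"
  show "rate (u *\<^sub>R x + (1 - u) *\<^sub>R y) \<le> ereal u * rate x + ereal (1 - u) * rate y"
  proof (cases "rate x = \<infinity> \<or> rate y = \<infinity>")
    case True
    then have "ereal u * rate x + ereal (1 - u) * rate y = \<infinity>"
      using u rate_nonneg[of x] rate_nonneg[of y] 
      by (cases "rate x"; cases "rate y") auto
    then show ?thesis by (simp only: ereal_less_eq)
  next
    case False
    then obtain a1 a2 where a: "rate x = ereal a1" "rate y = ereal a2"
      using rate_nonneg[of x] rate_nonneg[of y] by (cases "rate x"; cases "rate y") auto
    define z where "z = u *\<^sub>R x + (1 - u) *\<^sub>R y"
    have "rate z \<le> ereal (u * a1 + (1 - u) * a2)"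
    proof (rule ereal_le_epsilon2)
      fix e :: real assume e: "0 < e"
      \<comment> \<open>Of the slack \<open>e\<close>, one half lifts both exponents above the
        rates, hence into \<open>rates\<close>; the other half absorbs
        \<open>ln (1/c)\<close>.\<close>
      define b1 where "b1 = a1 + e/2"
      define b2 where "b2 = a2 + e/2"
      have b: "b1 \<in> rates x" "b2 \<in> rates y"
        using a e by (auto intro!: rate_less_imp_rates simp: b1_def b2_def)
      have b0: "0 \<le> b1" "0 \<le> b2" using b rates_nonneg by auto
      have "u * a1 + (1 - u) * a2 + e \<in> rates z"
        unfolding rates_def
      proof safe
        fix \<epsilon> :: real assume \<epsilon>: "\<epsilon> > 0"
        have 1: "\<forall>\<^sub>F t in at_top. exp (- b1 * t) \<le> mass t (t *\<^sub>R x) (\<epsilon>/2 * t)"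
          and 2: "\<forall>\<^sub>F t in at_top. exp (- b2 * t) \<le> mass t (t *\<^sub>R y) (\<epsilon>/2 * t)"
          using b half_gt_zero[OF \<epsilon>] unfolding rates_def by blast+
        have lim: "filterlim (\<lambda>t. u * (t - K)) at_top at_top" "filterlim (\<lambda>t. (1 - u) * (t - K)) at_top at_top"
          using u filterlim_tendsto_pos_mult_at_top[OF tendsto_const _ filterlim_tendsto_add_at_top[OF tendsto_const[of "- K"] filterlim_ident]]
          by auto
        have ev3: "\<forall>\<^sub>F t in at_top. m + K * norm z \<le> \<epsilon> / 2 * t"
          using eventually_ge_at_top[of "(m + K * norm z) / (\<epsilon>/2)"] 
          by eventually_elim (use \<epsilon> in \<open>simp add: field_simps\<close>)
        have ev4: "\<forall>\<^sub>F t in at_top. ln (1/c) \<le> e / 2 * t"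
          using eventually_ge_at_top[of "ln (1/c) / (e/2)"] 
          by eventually_elim (use e in \<open>simp add: field_simps\<close>)
        show "\<forall>\<^sub>F t in at_top. exp (- (u * a1 + (1 - u) * a2 + e) * t) \<le> mass t (t *\<^sub>R z) (\<epsilon> * t)"
          using eventually_compose_filterlim[OF 1 lim(1)] eventually_compose_filterlim[OF 2 lim(2)]
            eventually_ge_at_top[of K] ev3 ev4
        proof eventually_elim
          case (elim t)
          define s where "s = t - K"
          have s: "0 \<le> s" "t = u * s + K + (1 - u) * s" "s \<le> t" 
            using elim K_nonneg by (auto simp: s_def algebra_simps)
          have "exp (- (u * a1 + (1 - u) * a2 + e) * t) \<le> c * exp (- b1 * (u * s)) * exp (- b2 * ((1 - u) * s))"
          proof -
            have "c * exp (- b1 * (u * s)) * exp (- b2 * ((1 - u) * s)) = exp (ln c - b1 * (u * s) - b2 * ((1 - u) * s))"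
              using c_pos by (simp add: exp_diff exp_minus divide_simps)
            moreover have "b1 * (u * s) \<le> b1 * (u * t)" "b2 * ((1 - u) * s) \<le> b2 * ((1 - u) * t)"
              using b0 u s by (auto intro!: mult_left_mono)
            moreover have "b1 * (u * t) + b2 * ((1 - u) * t) + e/2 * t = (u * a1 + (1 - u) * a2 + e) * t"
              by (simp add: b1_def b2_def field_simps)
            moreover have "- ln c \<le> e / 2 * t" using elim(5) c_pos by (simp add: ln_div)
            ultimately show ?thesis unfolding mult_minus_left by simp
          qed
          also have "\<dots> \<le> c * mass (u * s) ((u * s) *\<^sub>R x) (\<epsilon>/2 * (u * s)) *
              mass ((1 - u) * s) (((1 - u) * s) *\<^sub>R y) (\<epsilon>/2 * ((1 - u) * s))"
            using elim(1,2) c_pos by (intro mult_mono mult_left_mono) (auto simp: s_def mass_def)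
          also have "\<dots> \<le> mass (u * s + K + (1 - u) * s) ((u * s) *\<^sub>R x + ((1 - u) * s) *\<^sub>R y)
              (\<epsilon>/2 * (u * s) + \<epsilon>/2 * ((1 - u) * s) + m)"
            using u s by (intro mass_superadd) auto
          also have "u * s + K + (1 - u) * s = t" using s by simp
          also have "(u * s) *\<^sub>R x + ((1 - u) * s) *\<^sub>R y = s *\<^sub>R z"
            by (simp add: z_def algebra_simps)
          also have "mass t (s *\<^sub>R z) (\<epsilon>/2 * (u * s) + \<epsilon>/2 * ((1 - u) * s) + m) \<le> mass t (t *\<^sub>R z) (\<epsilon> * t)"
          proof (rule mass_mono)
            have "norm (s *\<^sub>R z - t *\<^sub>R z) = norm (- (K *\<^sub>R z))"
              by (simp add: s_def algebra_simps)
            then have "norm (s *\<^sub>R z - t *\<^sub>R z) = K * norm z" using K_nonneg by simp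
            moreover have "\<epsilon>/2 * (u * s) + \<epsilon>/2 * ((1 - u) * s) = \<epsilon>/2 * s" by (simp add: field_simps)
            moreover have "\<epsilon>/2 * s \<le> \<epsilon>/2 * t" using s \<epsilon> by (intro mult_left_mono) auto
            ultimately show "norm (s *\<^sub>R z - t *\<^sub>R z) + (\<epsilon>/2 * (u * s) + \<epsilon>/2 * ((1 - u) * s) + m) \<le> \<epsilon> * t"
              using elim(4) by simp
          qed
          finally show ?case .
        qed
      qed
      then show "rate z \<le> ereal (u * a1 + (1 - u) * a2) + ereal e"
        unfolding rate_def by (auto intro: Inf_lower)
    qed
    then show ?thesis by (simp add: a z_def)
  qed
qed

lemma LDP_lower:
  assumes "open U" "x \<in> U" "rate x < ereal \<alpha>"
  shows "\<forall>\<^sub>F t in at_top. exp (- \<alpha> * t) \<le> prob {\<omega>\<in>space M. Z t \<omega> /\<^sub>R t \<in> U}"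
proof -
  obtain \<epsilon> where \<epsilon>: "\<epsilon> > 0" "cball x \<epsilon> \<subseteq> U" using assms open_contains_cball by blast
  have "\<forall>\<^sub>F t in at_top. exp (- \<alpha> * t) \<le> mass t (t *\<^sub>R x) (\<epsilon> * t)"
    using rate_less_imp_rates[OF assms(3)] \<epsilon> by (auto simp: rates_def)
  then show ?thesis using eventually_gt_at_top[of 0]
  proof eventually_elim
    case (elim t)
    have [measurable]: "U \<in> sets borel" using assms by simp
    have "mass t (t *\<^sub>R x) (\<epsilon> * t) \<le> prob {\<omega>\<in>space M. Z t \<omega> /\<^sub>R t \<in> U}"
      unfolding mass_def
    proof (rule finite_measure_mono)
      show "{\<omega> \<in> space M. norm (Z t \<omega> - t *\<^sub>R x) \<le> \<epsilon> * t} \<subseteq> {\<omega> \<in> space M. Z t \<omega> /\<^sub>R t \<in> U}"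
      proof safe
        fix \<omega> assume *: "norm (Z t \<omega> - t *\<^sub>R x) \<le> \<epsilon> * t"
        have "Z t \<omega> /\<^sub>R t - x = (Z t \<omega> - t *\<^sub>R x) /\<^sub>R t"
          using elim by (simp add: algebra_simps)
        then have "norm (Z t \<omega> /\<^sub>R t - x) = norm (Z t \<omega> - t *\<^sub>R x) / t"
          using elim by (simp add: divide_inverse_commute)
        also have "\<dots> \<le> \<epsilon>" using * elim by (simp add: divide_le_eq)
        finally have "norm (Z t \<omega> /\<^sub>R t - x) \<le> \<epsilon>" .
        then show "Z t \<omega> /\<^sub>R t \<in> U" using \<epsilon>(2) by (auto simp: dist_norm norm_minus_commute)
      qed
    qed measurable
    then show ?case using elim by linarith
  qed
qed

text \<open>The compact part of C is covered by finitely many balls of small mass. \<open>A\<close>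
  counts these balls and the tail event, and drops out because \<open>ln A / t\<close> tends to
  0.\<close>

lemma LDP_upper:
  assumes C: "closed C" and \<alpha>: "\<And>x. x \<in> C \<Longrightarrow> ereal \<alpha> < rate x"
  obtains A where "A > 0" "\<forall>\<^sub>F t in at_top. prob {\<omega>\<in>space M. Z t \<omega> /\<^sub>R t \<in> C} \<le> A * exp (- \<alpha> * t)"
proof -
  obtain R where R: "R > 0" "\<forall>\<^sub>F t in at_top. prob {\<omega>\<in>space M. norm (Z t \<omega>) > R * t} \<le> exp (- \<alpha> * t)"
    using exp_tight by blast
  have "\<forall>x\<in>C. \<exists>\<epsilon>>0. \<forall>\<^sub>F t in at_top. mass t (t *\<^sub>R x) (\<epsilon> * t) \<le> exp (- \<alpha> * t)"
    using \<alpha> less_rate_imp_mass_less by metis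
  then obtain \<epsilon> where \<epsilon>: "\<And>x. x \<in> C \<Longrightarrow> \<epsilon> x > 0"
      "\<And>x. x \<in> C \<Longrightarrow> \<forall>\<^sub>F t in at_top. mass t (t *\<^sub>R x) (\<epsilon> x * t) \<le> exp (- \<alpha> * t)"
    by metis
  have cpt: "compact (C \<inter> cball 0 R)" using C by (simp add: closed_Int_compact)
  have cov: "C \<inter> cball 0 R \<subseteq> (\<Union>x\<in>C \<inter> cball 0 R. ball x (\<epsilon> x))" using \<epsilon>(1) by fastforce
  obtain D where D: "D \<subseteq> C \<inter> cball 0 R" "finite D" "C \<inter> cball 0 R \<subseteq> (\<Union>x\<in>D. ball x (\<epsilon> x))"
    using compactE_image[OF cpt _ cov] by auto
  have evD: "\<forall>\<^sub>F t in at_top. \<forall>x\<in>D. mass t (t *\<^sub>R x) (\<epsilon> x * t) \<le> exp (- \<alpha> * t)"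
    using D \<epsilon>(2) by (intro eventually_ball_finite) auto
  show ?thesis
  proof (rule that[of "real (card D) + 1"])
    show "\<forall>\<^sub>F t in at_top. prob {\<omega>\<in>space M. Z t \<omega> /\<^sub>R t \<in> C} \<le> (real (card D) + 1) * exp (- \<alpha> * t)"
      using evD R(2) eventually_gt_at_top[of 0]
    proof eventually_elim
      case (elim t)
      have [measurable]: "C \<in> sets borel" using C by simp
      let ?A = "\<lambda>x. {\<omega> \<in> space M. norm (Z t \<omega> - t *\<^sub>R x) \<le> \<epsilon> x * t}"
      let ?B = "{\<omega>\<in>space M. norm (Z t \<omega>) > R * t}"
      have "prob {\<omega>\<in>space M. Z t \<omega> /\<^sub>R t \<in> C} \<le> prob ((\<Union>x\<in>D. ?A x) \<union> ?B)"
      proof (rule finite_measure_mono)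
        show "(\<Union>x\<in>D. ?A x) \<union> ?B \<in> events" using D(2) by (auto intro!: sets.finite_UN)
        have "\<omega> \<in> (\<Union>x\<in>D. ?A x)" 
          if w: "\<omega> \<in> space M" "Z t \<omega> /\<^sub>R t \<in> C" "\<not> R * t < norm (Z t \<omega>)" for \<omega>
        proof -
          have "norm (Z t \<omega> /\<^sub>R t) = norm (Z t \<omega>) / t" using elim by (simp add: divide_inverse_commute)
          then have "norm (Z t \<omega> /\<^sub>R t) \<le> R" using w elim by (simp add: field_simps)
          then obtain x where x: "x \<in> D" "dist x (Z t \<omega> /\<^sub>R t) < \<epsilon> x" using D(3) w by auto
          have "t *\<^sub>R (Z t \<omega> /\<^sub>R t) - t *\<^sub>R x = Z t \<omega> - t *\<^sub>R x" using elim by simp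
          then have "norm (Z t \<omega> - t *\<^sub>R x) = t * norm (Z t \<omega> /\<^sub>R t - x)"
            using elim by (metis scaleR_diff_right norm_scaleR abs_of_pos)
          also have "\<dots> \<le> t * \<epsilon> x" using x elim by (intro mult_left_mono) (auto simp: dist_norm norm_minus_commute)
          finally show "\<omega> \<in> (\<Union>x\<in>D. ?A x)" using w x by (auto simp: mult.commute)
        qed
        then show "{\<omega>\<in>space M. Z t \<omega> /\<^sub>R t \<in> C} \<subseteq> (\<Union>x\<in>D. ?A x) \<union> ?B" by blast
      qed
      also have "\<dots> \<le> prob (\<Union>x\<in>D. ?A x) + prob ?B"
        by (rule measure_Un_le) (use D(2) in \<open>auto intro!: sets.finite_UN\<close>)
      also have "prob (\<Union>x\<in>D. ?A x) \<le> (\<Sum>x\<in>D. prob (?A x))"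
        by (rule finite_measure_subadditive_finite) (use D(2) in auto)
      also have "\<dots> \<le> (\<Sum>x\<in>D. exp (- \<alpha> * t))"
        using elim(1) by (intro sum_mono) (auto simp: mass_def)
      also have "\<dots> = real (card D) * exp (- \<alpha> * t)" by simp
      finally show ?case using elim(2) by (simp add: algebra_simps)
    qed
  qed simp
qed

theorem LDP: "satisfies_LDP (\<lambda>t. distr M borel (\<lambda>\<omega>. Z t \<omega> /\<^sub>R t)) rate"
  unfolding satisfies_LDP_def
proof (intro conjI allI impI)
  have m: "measure (distr M borel (\<lambda>\<omega>. Z t \<omega> /\<^sub>R t)) S = prob {\<omega>\<in>space M. Z t \<omega> /\<^sub>R t \<in> S}"
    if "S \<in> sets borel" for S t
    using that by (subst measure_distr) (auto simp: vimage_def Int_def conj_commute)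
  show "good_rate_function rate" by (rule good_rate)
  fix C :: "'b set" 
  let ?L = "\<lambda>t. ereal (1 / t) * elog (prob {\<omega>\<in>space M. Z t \<omega> /\<^sub>R t \<in> C})"
  {
    assume C: "closed C"
    \<comment> \<open>Comparison with levels strictly below the infimum (strictly above it for open
      sets) treats finite and infinite infima alike.\<close>
    have "(INF x\<in>C. rate x) \<le> - Limsup at_top ?L"
    proof (rule dense_le)
      fix a assume a: "a < (INF x\<in>C. rate x)"
      show "a \<le> - Limsup at_top ?L"
      proof (cases a)
        case (real \<alpha>)
        have "ereal \<alpha> < rate x" if "x \<in> C" for x 
          using a INF_lower[OF that, of rate] unfolding real by (rule less_le_trans)
        then obtain A where A: "A > 0" "\<forall>\<^sub>F t in at_top. prob {\<omega>\<in>space M. Z t \<omega> /\<^sub>R t \<in> C} \<le> A * exp (- \<alpha> * t)"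
          by (rule LDP_upper[OF C])
        have "Limsup at_top ?L \<le> Limsup at_top (\<lambda>t. ereal (ln A / t - \<alpha>))"
        proof (rule Limsup_mono)
          show "\<forall>\<^sub>F t in at_top. ?L t \<le> ereal (ln A / t - \<alpha>)"
            using A(2) eventually_gt_at_top[of 0]
          proof eventually_elim
            case (elim t)
            let ?p = "prob {\<omega>\<in>space M. Z t \<omega> /\<^sub>R t \<in> C}"
            show ?case
            proof (cases "?p \<le> 0")
              case True
              then show ?thesis using elim by (simp add: elog_def)
            next
              case False
              then have "ln ?p \<le> ln (A * exp (- \<alpha> * t))" using elim by simp
              also have "\<dots> = ln A - \<alpha> * t" using A(1) by (simp add: ln_mult)
              finally show ?thesis using elim False by (simp add: elog_def field_simps)
            qed
          qed
        qed
        also have "((\<lambda>t. ln A / t - \<alpha>) \<longlongrightarrow> - \<alpha>) at_top" by real_asymp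
        then have "Limsup at_top (\<lambda>t. ereal (ln A / t - \<alpha>)) = ereal (- \<alpha>)"
          by (intro lim_imp_Limsup) auto
        finally show ?thesis unfolding real by (subst ereal_le_uminus) simp
      qed (use a in auto)
    qed
    from ereal_le_uminus[THEN iffD1, OF this]
    show "Limsup at_top (\<lambda>t. ereal (1 / t) * elog (measure (distr M borel (\<lambda>\<omega>. Z t \<omega> /\<^sub>R t)) C))
       \<le> - (INF x\<in>C. rate x)"
      using C by (simp only: m borel_closed)
  }
  {
    assume U: "open C"
    have "- Liminf at_top ?L \<le> (INF x\<in>C. rate x)"
    proof (rule dense_ge)
      fix a assume a: "(INF x\<in>C. rate x) < a"
      have nn: "0 \<le> (INF x\<in>C. rate x)" by (intro INF_greatest rate_nonneg)
      show "- Liminf at_top ?L \<le> a"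
      proof (cases a)
        case (real \<alpha>)
        then obtain x where x: "x \<in> C" "rate x < ereal \<alpha>" using a by (auto simp: INF_less_iff)
        have "ereal (- \<alpha>) \<le> Liminf at_top ?L"
        proof (rule Liminf_bounded)
          show "\<forall>\<^sub>F t in at_top. ereal (- \<alpha>) \<le> ?L t"
            using LDP_lower[OF U x] eventually_gt_at_top[of 0]
          proof eventually_elim
            case (elim t)
            let ?p = "prob {\<omega>\<in>space M. Z t \<omega> /\<^sub>R t \<in> C}"
            have p: "?p > 0" using elim(1) by (meson exp_gt_zero less_le_trans)
            have "ln (exp (- \<alpha> * t)) \<le> ln ?p" using elim p by (subst ln_le_cancel_iff) auto
            then show ?case using elim p by (simp add: elog_def field_simps)
          qed
        qed
        then show ?thesis unfolding real by (subst ereal_uminus_le_reorder) simp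
      qed (use a nn in auto)
    qed
    from ereal_uminus_le_reorder[THEN iffD1, OF this]
    show "- (INF x\<in>C. rate x) \<le> Liminf at_top (\<lambda>t. ereal (1 / t) * elog (measure (distr M borel (\<lambda>\<omega>. Z t \<omega> /\<^sub>R t)) C))"
      using U by (simp only: m borel_open)
  }
qed

end

section \<open>Moments of Brownian increments and Riemann sums\<close>

lemma periodic_add_int:
  fixes f :: "real \<Rightarrow> 'b"
  assumes "\<And>x. f (x + 1) = f x"
  shows "f (x + of_int k) = f x"
proof (induction k rule: int_induct[where k=0])
  case (step1 i)
  then show ?case using assms[of "x + of_int i"] by (simp add: add.assoc)
next
  case (step2 i)
  then show ?case using assms[of "x + of_int (i - 1)"] by (simp add: add.assoc)
qed simp

lemma periodic_continuous_bounded: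
  fixes f :: "real \<Rightarrow> real"
  assumes per: "\<And>x. f (x + 1) = f x" and cont: "continuous_on UNIV f"
  obtains C where "\<And>x. \<bar>f x\<bar> \<le> C"
proof -
  have "compact (f ` {0..1})"
    by (intro compact_continuous_image continuous_on_subset[OF cont]) auto
  then obtain C where C: "\<And>x. x \<in> {0..1} \<Longrightarrow> \<bar>f x\<bar> \<le> C"
    by (force dest!: compact_imp_bounded simp: bounded_iff)
  have "\<bar>f x\<bar> \<le> C" for x
  proof -
    have "f x = f (frac x)" using periodic_add_int[of f, OF per, of "frac x" "\<lfloor>x\<rfloor>"] by (simp add: frac_def)
    then show ?thesis using C[of "frac x"] frac_lt_1[of x] by (simp add: frac_ge_0 less_imp_le)
  qed
  then show ?thesis by (rule that)
qed

text \<open>The coefficients are only continuous, so there is no Lipschitz estimate. Near the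
  diagonal uniform continuity gives \<open>e\<close>; away from it the bound 2 C is dominated by a
  multiple of the squared distance. The mean of the right-hand side is then controlled by second
  moments of increments.\<close>

lemma periodic_quadratic_modulus:
  fixes f :: "real \<Rightarrow> real"
  assumes per: "\<And>x. f (x + 1) = f x" and cont: "continuous_on UNIV f" and e: "e > 0"
  obtains D where "D \<ge> 0" "\<And>x z. \<bar>f x - f z\<bar> \<le> e + D * (x - z)\<^sup>2"
proof -
  obtain C where C: "\<And>x. \<bar>f x\<bar> \<le> C" using periodic_continuous_bounded[OF per cont] by blast
  have C0: "0 \<le> C" using C[of 0] by simp
  have "uniformly_continuous_on {-1..2} f"
    by (intro compact_uniformly_continuous continuous_on_subset[OF cont]) auto
  then obtain d where d: "d > 0" "\<And>x z. x \<in> {-1..2} \<Longrightarrow> z \<in> {-1..2} \<Longrightarrow> dist z x < d \<Longrightarrow> dist (f z) (f x) < e"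
    using e unfolding uniformly_continuous_on_def by metis
  define h where "h = min d 1"
  have h: "h > 0" "h \<le> 1" "h \<le> d" using d by (auto simp: h_def)
  show ?thesis
  proof (rule that[of "2 * C / h\<^sup>2"])
    show "0 \<le> 2 * C / h\<^sup>2" using C0 by simp
    fix x z
    show "\<bar>f x - f z\<bar> \<le> e + 2 * C / h\<^sup>2 * (x - z)\<^sup>2"
    proof (cases "\<bar>x - z\<bar> < h")
      case True
      \<comment> \<open>Shifting both points by the integer part of x puts x into [0, 1] and z into
        [-1, 2], where uniform continuity is at hand.\<close>
      let ?k = "- \<lfloor>x\<rfloor>"
      have "0 \<le> x + of_int ?k" "x + of_int ?k \<le> 1" by linarith+
      moreover have "\<bar>(x + of_int ?k) - (z + of_int ?k)\<bar> < h" using True by simp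
      ultimately have "dist (f (x + of_int ?k)) (f (z + of_int ?k)) < e"
        using h by (intro d(2)) (simp_all add: dist_real_def, linarith+)
      then have "\<bar>f x - f z\<bar> < e" by (simp only: periodic_add_int[of f, OF per] dist_real_def)
      moreover have "0 \<le> 2 * C / h\<^sup>2 * (x - z)\<^sup>2" using C0 by simp
      ultimately show ?thesis by linarith
    next
      case False
      then have "h\<^sup>2 \<le> (x - z)\<^sup>2" using h by (metis abs_le_square_iff abs_of_pos not_less)
      then have "2 * C \<le> 2 * C / h\<^sup>2 * (x - z)\<^sup>2" using h C0 by (simp add: field_simps mult_left_mono)
      moreover have "\<bar>f x - f z\<bar> \<le> 2 * C" using C[of x] C[of z] by linarith
      ultimately show ?thesis using e by linarith
    qed
  qed
qed

lemma dist_integral_riemann_sum_le: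
  fixes f :: "real \<Rightarrow> real"
  assumes h: "h \<ge> 0" and cont: "continuous_on {0..real n * h} f"
    and e: "\<And>j s. j < n \<Longrightarrow> s \<in> {real j * h..real (Suc j) * h} \<Longrightarrow> \<bar>f s - f (real j * h)\<bar> \<le> e"
  shows "\<bar>integral {0..real n * h} f - (\<Sum>j<n. f (real j * h) * h)\<bar> \<le> real n * h * e"
  using cont e
proof (induction n)
  case 0
  then show ?case by simp
next
  case (Suc n)
  have nh: "0 \<le> real n * h" "real n * h \<le> real (Suc n) * h" using h by (auto simp: mult_right_mono)
  have int: "f integrable_on {0..real (Suc n) * h}" using Suc.prems(1) by (rule integrable_continuous_real)
  have IH: "\<bar>integral {0..real n * h} f - (\<Sum>j<n. f (real j * h) * h)\<bar> \<le> real n * h * e"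
    by (rule Suc.IH[OF continuous_on_subset[OF Suc.prems(1)] Suc.prems(2)]) (use nh in auto)
  have split: "integral {0..real (Suc n) * h} f = integral {0..real n * h} f + integral {real n * h..real (Suc n) * h} f"
    using Henstock_Kurzweil_Integration.integral_combine[OF nh int] by simp
  have int2: "f integrable_on {real n * h..real (Suc n) * h}"
    by (rule integrable_on_subinterval[OF int]) (use nh in auto)
  have "norm (integral {real n * h..real (Suc n) * h} (\<lambda>s. f s - f (real n * h))) \<le> e * (real (Suc n) * h - real n * h)"
    using nh Suc.prems(2)[of n "real n * h"] Suc.prems(2)[of n]
    by (intro integral_bound continuous_intros continuous_on_subset[OF Suc.prems(1)]) auto
  also have "integral {real n * h..real (Suc n) * h} (\<lambda>s. f s - f (real n * h)) = 
     integral {real n * h..real (Suc n) * h} f - f (real n * h) * h"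
    using nh by (subst Henstock_Kurzweil_Integration.integral_diff[OF int2]) (auto simp: algebra_simps)
  finally have "\<bar>integral {real n * h..real (Suc n) * h} f - f (real n * h) * h\<bar> \<le> h * e"
    by (simp add: algebra_simps)
  then show ?case using IH unfolding split by (simp add: algebra_simps) 
qed

locale sde = prob_space M for M :: "'a measure" +
  fixes F :: "real \<Rightarrow> 'a measure" and W X :: "real \<Rightarrow> 'a \<Rightarrow> real" and b \<sigma> :: "real \<Rightarrow> real" and y :: real
  assumes weak_sol: "weak_solution M F W X b \<sigma> y"
    and cont_b: "continuous_on UNIV b" and cont_\<sigma>: "continuous_on UNIV \<sigma>"
    and per_b: "\<And>x. b (x + 1) = b x" and per_\<sigma>: "\<And>x. \<sigma> (x + 1) = \<sigma> x"
    and \<sigma>_pos: "\<And>x. \<sigma> x > 0"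
begin

lemma subalg: "subalgebra M (F t)"
  and sets_F_mono: "s \<le> t \<Longrightarrow> sets (F s) \<subseteq> sets (F t)"
  and W_F: "0 \<le> t \<Longrightarrow> W t \<in> borel_measurable (F t)"
  and X_F: "0 \<le> t \<Longrightarrow> X t \<in> borel_measurable (F t)"
  and X_0: "\<omega> \<in> space M \<Longrightarrow> X 0 \<omega> = y"
  and X_cont: "\<omega> \<in> space M \<Longrightarrow> continuous_on {0..} (\<lambda>t. X t \<omega>)"
  and W_incr: "0 \<le> s \<Longrightarrow> s < t \<Longrightarrow> distributed M lborel (\<lambda>\<omega>. W t \<omega> - W s \<omega>) (normal_density 0 (sqrt (t - s)))"
  and W_indep: "0 \<le> s \<Longrightarrow> s < t \<Longrightarrow> A \<in> sets (F s) \<Longrightarrow> B \<in> sets borel \<Longrightarrow>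
      prob (A \<inter> {\<omega>\<in>space M. W t \<omega> - W s \<omega> \<in> B}) = prob A * prob {\<omega>\<in>space M. W t \<omega> - W s \<omega> \<in> B}"
  and riemann_conv: "0 \<le> t \<Longrightarrow> \<epsilon> > 0 \<Longrightarrow> (\<lambda>n. prob {\<omega>\<in>space M. 
      \<bar>ito_riemann_sum (\<lambda>s \<omega>. \<sigma> (X s \<omega>)) W t n \<omega> - (X t \<omega> - y - integral {0..t} (\<lambda>s. b (X s \<omega>)))\<bar> > \<epsilon>}) \<longlonglongrightarrow> 0"
  using weak_sol unfolding weak_solution_def is_filtration_def brownian_motion_def by auto

lemma space_F [simp]: "space (F t) = space M"
  using subalg unfolding subalgebra_def by auto

lemma sets_F_events: "A \<in> sets (F t) \<Longrightarrow> A \<in> events"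
  using subalg[of t] unfolding subalgebra_def by auto

lemma measurable_F_mono: "s \<le> t \<Longrightarrow> f \<in> measurable (F s) N \<Longrightarrow> f \<in> measurable (F t) N"
  using sets_F_mono[of s t] unfolding measurable_def by auto

lemma measurable_F_M: "f \<in> measurable (F s) N \<Longrightarrow> f \<in> measurable M N"
  by (rule measurable_from_subalg[OF subalg])

lemma X_M: "0 \<le> t \<Longrightarrow> X t \<in> borel_measurable M" and W_M: "0 \<le> t \<Longrightarrow> W t \<in> borel_measurable M"
  using X_F W_F measurable_F_M by blast+

lemma b_meas [measurable]: "b \<in> borel_measurable borel" and \<sigma>_meas [measurable]: "\<sigma> \<in> borel_measurable borel"
  using cont_b cont_\<sigma> by (auto intro: borel_measurable_continuous_onI)

lemma integrable_boundedI:
  "f \<in> borel_measurable M \<Longrightarrow> (\<And>\<omega>. \<omega> \<in> space M \<Longrightarrow> \<bar>f \<omega>\<bar> \<le> B) \<Longrightarrow> integrable M f" for f :: "'a \<Rightarrow> real"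
  by (rule integrable_const_bound[of _ B]) auto

text \<open>The definition of Brownian motion gives the product rule for events; the preimages of
  Borel sets are stable under intersection and generate, so it extends to independence of
  variables.\<close>

lemma W_incr_indep:
  assumes st: "0 \<le> s" "s < t" and H: "H \<in> borel_measurable (F s)"
  shows "indep_var borel H borel (\<lambda>\<omega>. W t \<omega> - W s \<omega>)"
proof -
  have HM [measurable]: "H \<in> borel_measurable M" using H by (rule measurable_F_M)
  have WM [measurable]: "(\<lambda>\<omega>. W t \<omega> - W s \<omega>) \<in> borel_measurable M" using W_M[of s] W_M[of t] st by auto
  have "indep_set {H -` A \<inter> space M |A. A \<in> sets borel} {(\<lambda>\<omega>. W t \<omega> - W s \<omega>) -` A \<inter> space M |A. A \<in> sets borel}"
  proof (rule indep_setI, safe)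
    fix A B :: "real set" assume "A \<in> sets borel" "B \<in> sets borel"
    then show "prob (H -` A \<inter> space M \<inter> ((\<lambda>\<omega>. W t \<omega> - W s \<omega>) -` B \<inter> space M)) =
       prob (H -` A \<inter> space M) * prob ((\<lambda>\<omega>. W t \<omega> - W s \<omega>) -` B \<inter> space M)"
      using W_indep[OF st measurable_sets[OF H, of A], of B] 
      by (simp add: vimage_def Int_def conj_commute)
  qed (auto intro: measurable_sets)
  moreover have "Int_stable {H -` A \<inter> space M |A. A \<in> sets borel}" for H :: "'a \<Rightarrow> real"
  proof (rule Int_stableI, safe)
    fix A B :: "real set" assume "A \<in> sets borel" "B \<in> sets borel"
    then show "\<exists>C. H -` A \<inter> space M \<inter> (H -` B \<inter> space M) = H -` C \<inter> space M \<and> C \<in> sets borel"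
      by (intro exI[of _ "A \<inter> B"]) auto
  qed
  ultimately show ?thesis
    unfolding indep_var_eq by (auto intro!: indep_set_sigma_sets)
qed

lemma W_incr_mult:
  assumes st: "0 \<le> s" "s < t" and H: "H \<in> borel_measurable (F s)" "integrable M H"
    and \<phi>: "\<phi> \<in> borel_measurable borel" "integrable M (\<lambda>\<omega>. \<phi> (W t \<omega> - W s \<omega>))"
  shows "integrable M (\<lambda>\<omega>. H \<omega> * \<phi> (W t \<omega> - W s \<omega>) :: real)"
    "expectation (\<lambda>\<omega>. H \<omega> * \<phi> (W t \<omega> - W s \<omega>)) = expectation H * expectation (\<lambda>\<omega>. \<phi> (W t \<omega> - W s \<omega>))"
proof -
  have "indep_var borel (id \<circ> H) borel (\<phi> \<circ> (\<lambda>\<omega>. W t \<omega> - W s \<omega>))"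
    by (rule indep_var_compose[OF W_incr_indep[OF st H(1)]]) (use \<phi> in auto)
  then have i: "indep_var borel H borel (\<lambda>\<omega>. \<phi> (W t \<omega> - W s \<omega>))" by (simp add: comp_def)
  show "integrable M (\<lambda>\<omega>. H \<omega> * \<phi> (W t \<omega> - W s \<omega>) :: real)"
    "expectation (\<lambda>\<omega>. H \<omega> * \<phi> (W t \<omega> - W s \<omega>)) = expectation H * expectation (\<lambda>\<omega>. \<phi> (W t \<omega> - W s \<omega>))"
    using indep_var_integrable[OF i H(2) \<phi>(2)] indep_var_lebesgue_integral[OF i H(2) \<phi>(2)] by auto
qed

lemma W_incr_moment:
  assumes st: "0 \<le> s" "s < t"
  shows "integrable M (\<lambda>\<omega>. (W t \<omega> - W s \<omega>) ^ k)"
    and "expectation (\<lambda>\<omega>. W t \<omega> - W s \<omega>) = 0"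
    and "expectation (\<lambda>\<omega>. (W t \<omega> - W s \<omega>)\<^sup>2) = t - s"
    and "expectation (\<lambda>\<omega>. (W t \<omega> - W s \<omega>) ^ 4) = 3 * (t - s)\<^sup>2"
proof -
  have p: "0 < sqrt (t - s)" using st by simp
  note D = W_incr[OF st]
  have *: "integrable M (\<lambda>\<omega>. (W t \<omega> - W s \<omega>) ^ k)" for k
    using distributed_integrable[OF D, of "\<lambda>x. x ^ k"] integrable_normal_moment[OF p, of 0 k] by simp
  show "integrable M (\<lambda>\<omega>. (W t \<omega> - W s \<omega>) ^ k)" by (rule *)
  have e: "expectation (\<lambda>\<omega>. (W t \<omega> - W s \<omega>) ^ k) = (\<integral>x. normal_density 0 (sqrt (t - s)) x * x ^ k \<partial>lborel)" for k
    using distributed_integral[OF D, of "\<lambda>x. x ^ k"] by simp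
  show "expectation (\<lambda>\<omega>. W t \<omega> - W s \<omega>) = 0"
    using e[of 1] integral_normal_moment_odd[OF p, of 0 0] by simp
  show "expectation (\<lambda>\<omega>. (W t \<omega> - W s \<omega>)\<^sup>2) = t - s"
    using e[of 2] integral_normal_moment_even[OF p, of 0 1] st by simp
  show "expectation (\<lambda>\<omega>. (W t \<omega> - W s \<omega>) ^ 4) = 3 * (t - s)\<^sup>2"
    using e[of 4] integral_normal_moment_even[OF p, of 0 2] st 
    by (simp add: fact_numeral power2_eq_square field_simps)
qed

lemma W_incr_mult_moment:
  assumes st: "0 \<le> s" "s < t" and H: "H \<in> borel_measurable (F s)" "integrable M H"
  shows "integrable M (\<lambda>\<omega>. H \<omega> * (W t \<omega> - W s \<omega>))" "expectation (\<lambda>\<omega>. H \<omega> * (W t \<omega> - W s \<omega>)) = 0"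
    "integrable M (\<lambda>\<omega>. H \<omega> * (W t \<omega> - W s \<omega>)\<^sup>2)" "expectation (\<lambda>\<omega>. H \<omega> * (W t \<omega> - W s \<omega>)\<^sup>2) = (t - s) * expectation H"
    "integrable M (\<lambda>\<omega>. H \<omega> * (W t \<omega> - W s \<omega>) ^ 4)" "expectation (\<lambda>\<omega>. H \<omega> * (W t \<omega> - W s \<omega>) ^ 4) = 3 * (t - s)\<^sup>2 * expectation H"
  using W_incr_mult[OF st H, of "\<lambda>x. x"] W_incr_mult[OF st H, of "\<lambda>x. x\<^sup>2"] W_incr_mult[OF st H, of "\<lambda>x. x ^ 4"]
    W_incr_moment(2-4)[OF st] W_incr_moment(1)[OF st, of 1] W_incr_moment(1)[OF st, of 2] W_incr_moment(1)[OF st, of 4]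
  by (auto simp: mult_ac)

text \<open>Dyadic times, to match the dyadic partitions in \<open>weak_solution\<close>. A point of
  level N is a point of every finer level (\<open>tm_refine\<close>).\<close>

definition tm :: "nat \<Rightarrow> nat \<Rightarrow> real" where "tm N j = real j / 2 ^ N"

definition dW :: "nat \<Rightarrow> nat \<Rightarrow> 'a \<Rightarrow> real" where "dW N j \<omega> = W (tm N (Suc j)) \<omega> - W (tm N j) \<omega>"

lemma tm_nonneg [simp]: "0 \<le> tm N j" and tm_less [simp]: "tm N i < tm N j \<longleftrightarrow> i < j"
  and tm_le [simp]: "tm N i \<le> tm N j \<longleftrightarrow> i \<le> j"
  and tm_Suc_diff: "tm N (Suc j) - tm N j = 1 / 2 ^ N"
  by (auto simp: tm_def divide_simps diff_divide_distrib[symmetric])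

lemma dW_F: "dW N j \<in> borel_measurable (F (tm N (Suc j)))"
  unfolding dW_def 
  using W_F[of "tm N (Suc j)"] measurable_F_mono[OF _ W_F[of "tm N j"], of "tm N (Suc j)"] by auto

lemma mart_sum_measurable:
  assumes H: "\<And>j. a \<le> j \<Longrightarrow> j < c \<Longrightarrow> H j \<in> borel_measurable (F (tm N j))"
  shows "(\<lambda>\<omega>. \<Sum>j\<in>{a..<c}. H j \<omega> * dW N j \<omega>) \<in> borel_measurable (F (tm N c))"
  by (intro borel_measurable_sum borel_measurable_times measurable_F_mono[OF _ H] measurable_F_mono[OF _ dW_F]) auto

text \<open>Discrete Ito isometry. The cross term vanishes because the partial sum times the next
  \<open>H\<close> is known at the left end of the next increment.\<close>

lemma mart_sum_L2:
  assumes ac: "a \<le> c" and H: "\<And>j. a \<le> j \<Longrightarrow> j < c \<Longrightarrow> H j \<in> borel_measurable (F (tm N j))"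
    and B: "\<And>j \<omega>. a \<le> j \<Longrightarrow> j < c \<Longrightarrow> \<bar>H j \<omega>\<bar> \<le> B"
  shows "integrable M (\<lambda>\<omega>. (\<Sum>j\<in>{a..<c}. H j \<omega> * dW N j \<omega>)\<^sup>2) \<and>
    expectation (\<lambda>\<omega>. (\<Sum>j\<in>{a..<c}. H j \<omega> * dW N j \<omega>)\<^sup>2) = (\<Sum>j\<in>{a..<c}. expectation (\<lambda>\<omega>. (H j \<omega>)\<^sup>2)) / 2 ^ N"
  using ac H B
proof (induction c rule: dec_induct)
  case base
  then show ?case by simp
next
  case (step c)
  define S where "S \<omega> = (\<Sum>j\<in>{a..<c}. H j \<omega> * dW N j \<omega>)" for \<omega>
  have IH: "integrable M (\<lambda>\<omega>. (S \<omega>)\<^sup>2)" "expectation (\<lambda>\<omega>. (S \<omega>)\<^sup>2) = (\<Sum>j\<in>{a..<c}. expectation (\<lambda>\<omega>. (H j \<omega>)\<^sup>2)) / 2 ^ N"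
    using step.IH step.prems unfolding S_def by auto
  have SF: "S \<in> borel_measurable (F (tm N c))" unfolding S_def using step.prems by (intro mart_sum_measurable) auto
  have HF: "H c \<in> borel_measurable (F (tm N c))" using step by auto
  note [measurable] = measurable_F_M[OF SF] measurable_F_M[OF HF] 
  have st: "0 \<le> tm N c" "tm N c < tm N (Suc c)" by auto
  have iS: "integrable M S" 
    by (rule square_integrable_imp_integrable[OF _ IH(1)]) measurable
  have HB: "\<bar>H c \<omega>\<bar> \<le> \<bar>B\<bar>" for \<omega>
    by (rule order_trans[OF step.prems(2) abs_ge_self]) (use step in auto)
  have iSH: "integrable M (\<lambda>\<omega>. S \<omega> * H c \<omega>)"
  proof (rule Bochner_Integration.integrable_bound[of M "\<lambda>\<omega>. B * S \<omega>"])
    show "AE \<omega> in M. norm (S \<omega> * H c \<omega>) \<le> norm (B * S \<omega>)"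
      using HB by (intro AE_I2) (auto simp: abs_mult mult.commute[of "\<bar>B\<bar>"] intro!: mult_left_mono)
  qed (use iS in auto)
  have iH2: "integrable M (\<lambda>\<omega>. (H c \<omega>)\<^sup>2)" 
    using HB by (intro integrable_boundedI[of _ "B\<^sup>2"]) (auto simp: abs_le_square_iff[symmetric])
  have i1: "integrable M (\<lambda>\<omega>. S \<omega> * H c \<omega> * dW N c \<omega>)" "expectation (\<lambda>\<omega>. S \<omega> * H c \<omega> * dW N c \<omega>) = 0"
    using W_incr_mult_moment(1,2)[OF st _ iSH] SF HF unfolding dW_def by auto
  have i2: "integrable M (\<lambda>\<omega>. (H c \<omega>)\<^sup>2 * (dW N c \<omega>)\<^sup>2)" 
      "expectation (\<lambda>\<omega>. (H c \<omega>)\<^sup>2 * (dW N c \<omega>)\<^sup>2) = 1 / 2 ^ N * expectation (\<lambda>\<omega>. (H c \<omega>)\<^sup>2)"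
    using W_incr_mult_moment(3,4)[OF st _ iH2] SF HF unfolding dW_def tm_Suc_diff by auto
  have eq: "(\<Sum>j\<in>{a..<Suc c}. H j \<omega> * dW N j \<omega>)\<^sup>2 = (S \<omega>)\<^sup>2 + 2 * (S \<omega> * H c \<omega> * dW N c \<omega>) + (H c \<omega>)\<^sup>2 * (dW N c \<omega>)\<^sup>2" for \<omega>
    using step(1) by (simp add: S_def power2_sum power_mult_distrib algebra_simps)
  show ?case unfolding eq
    using IH i1 i2 step(1) by (simp add: add_divide_distrib)
qed

text \<open>The martingale property in a form free of conditional expectations: a bounded weight
  \<open>G\<close> known at the start takes the place of conditioning.\<close>

lemma mart_sum_orth:
  assumes H: "\<And>j. a \<le> j \<Longrightarrow> j < c \<Longrightarrow> H j \<in> borel_measurable (F (tm N j))"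
    and B: "\<And>j \<omega>. a \<le> j \<Longrightarrow> j < c \<Longrightarrow> \<bar>H j \<omega>\<bar> \<le> B"
    and G: "G \<in> borel_measurable (F (tm N a))" "\<And>\<omega>. \<bar>G \<omega>\<bar> \<le> B'"
  shows "expectation (\<lambda>\<omega>. G \<omega> * (\<Sum>j\<in>{a..<c}. H j \<omega> * dW N j \<omega>)) = 0"
proof -
  have *: "integrable M (\<lambda>\<omega>. G \<omega> * H j \<omega> * dW N j \<omega>) \<and> expectation (\<lambda>\<omega>. G \<omega> * H j \<omega> * dW N j \<omega>) = 0"
    if j: "j \<in> {a..<c}" for j
  proof -
    have GH: "(\<lambda>\<omega>. G \<omega> * H j \<omega>) \<in> borel_measurable (F (tm N j))"
      using j by (intro borel_measurable_times measurable_F_mono[OF _ G(1)] H) auto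
    have "integrable M (\<lambda>\<omega>. G \<omega> * H j \<omega>)"
      using j B[of j] G(2) 
      by (intro integrable_boundedI[OF measurable_F_M[OF GH], of "B' * B"]) (auto simp: abs_mult intro!: mult_mono intro: order_trans[OF abs_ge_zero])
    then show ?thesis
      using W_incr_mult_moment(1,2)[OF _ _ GH, of "tm N (Suc j)"] by (simp add: dW_def)
  qed
  have "expectation (\<lambda>\<omega>. G \<omega> * (\<Sum>j\<in>{a..<c}. H j \<omega> * dW N j \<omega>)) = expectation (\<lambda>\<omega>. \<Sum>j\<in>{a..<c}. G \<omega> * H j \<omega> * dW N j \<omega>)"
    by (simp add: sum_distrib_left mult.assoc)
  also have "\<dots> = 0" using * by (subst Bochner_Integration.integral_sum) auto
  finally show ?thesis .
qed

end

lemma square_add_le: "(x + z)\<^sup>2 \<le> 2 * x\<^sup>2 + 2 * z\<^sup>2" for x z :: real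
  using zero_le_power2[of "x - z"] by (simp add: power2_diff power2_sum)

lemma square_diff_le: "(x - z)\<^sup>2 \<le> 2 * x\<^sup>2 + 2 * z\<^sup>2" for x z :: real
  using square_add_le[of x "- z"] by simp

section \<open>Convergence in probability\<close>

context prob_space
begin

lemma expectation_abs_le_sqrt:
  fixes Z :: "'a \<Rightarrow> real"
  assumes [measurable]: "Z \<in> borel_measurable M" and i: "integrable M (\<lambda>\<omega>. (Z \<omega>)\<^sup>2)"
  shows "expectation (\<lambda>\<omega>. \<bar>Z \<omega>\<bar>) \<le> sqrt (expectation (\<lambda>\<omega>. (Z \<omega>)\<^sup>2))"
proof -
  have iZ: "integrable M Z" by (rule square_integrable_imp_integrable[OF _ i]) measurable
  have "0 \<le> variance (\<lambda>\<omega>. \<bar>Z \<omega>\<bar>)" by (rule variance_positive)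
  also have "\<dots> = expectation (\<lambda>\<omega>. (Z \<omega>)\<^sup>2) - (expectation (\<lambda>\<omega>. \<bar>Z \<omega>\<bar>))\<^sup>2"
    using iZ i by (subst variance_eq) auto
  finally show ?thesis by (intro real_le_rsqrt) simp
qed

text \<open>Convergence to 0 in probability, measured by the mean of
  \<open>min 1 \<bar>Z\<bar>\<close>. This quantity is subadditive, which makes sums immediate, and
  it is an L1 norm, which gives almost surely convergent subsequences.\<close>

definition conv_prob :: "(nat \<Rightarrow> 'a \<Rightarrow> real) \<Rightarrow> bool" where
  "conv_prob Z \<longleftrightarrow> (\<forall>m. Z m \<in> borel_measurable M) \<and> (\<lambda>m. expectation (\<lambda>\<omega>. min 1 \<bar>Z m \<omega>\<bar>)) \<longlonglongrightarrow> 0"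

lemma integrable_min_1: "Z \<in> borel_measurable M \<Longrightarrow> integrable M (\<lambda>\<omega>. min 1 \<bar>Z \<omega>\<bar>)" for Z :: "'a \<Rightarrow> real"
  by (rule integrable_const_bound[of _ 1]) auto

lemma conv_prob_add:
  assumes "conv_prob Z" "conv_prob Y"
  shows "conv_prob (\<lambda>m \<omega>. Z m \<omega> + Y m \<omega>)"
  unfolding conv_prob_def
proof safe
  have [measurable]: "Z m \<in> borel_measurable M" "Y m \<in> borel_measurable M" for m
    using assms by (auto simp: conv_prob_def)
  show "(\<lambda>\<omega>. Z m \<omega> + Y m \<omega>) \<in> borel_measurable M" for m by measurable
  have lim: "(\<lambda>m. expectation (\<lambda>\<omega>. min 1 \<bar>Z m \<omega>\<bar>) + expectation (\<lambda>\<omega>. min 1 \<bar>Y m \<omega>\<bar>)) \<longlonglongrightarrow> 0"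
    using assms by (intro tendsto_add_zero) (auto simp: conv_prob_def)
  show "(\<lambda>m. expectation (\<lambda>\<omega>. min 1 \<bar>Z m \<omega> + Y m \<omega>\<bar>)) \<longlonglongrightarrow> 0"
  proof (rule tendsto_sandwich[OF _ _ tendsto_const lim])
    show "\<forall>\<^sub>F m in sequentially. expectation (\<lambda>\<omega>. min 1 \<bar>Z m \<omega> + Y m \<omega>\<bar>)
       \<le> expectation (\<lambda>\<omega>. min 1 \<bar>Z m \<omega>\<bar>) + expectation (\<lambda>\<omega>. min 1 \<bar>Y m \<omega>\<bar>)"
      by (intro always_eventually allI, subst Bochner_Integration.integral_add[symmetric])
         (auto intro!: integral_mono Bochner_Integration.integrable_add integrable_min_1)
  qed auto
qed

lemma conv_prob_uminus: "conv_prob Z \<Longrightarrow> conv_prob (\<lambda>m \<omega>. - Z m \<omega>)"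
  unfolding conv_prob_def by auto

lemma conv_probI_prob:
  assumes [measurable]: "\<And>m. Z m \<in> borel_measurable M"
    and lim: "\<And>\<epsilon>. \<epsilon> > 0 \<Longrightarrow> (\<lambda>m. prob {\<omega>\<in>space M. \<bar>Z m \<omega>\<bar> > \<epsilon>}) \<longlonglongrightarrow> 0"
  shows "conv_prob Z"
  unfolding conv_prob_def
proof safe
  show "(\<lambda>m. expectation (\<lambda>\<omega>. min 1 \<bar>Z m \<omega>\<bar>)) \<longlonglongrightarrow> 0"
  proof (rule tendstoI)
    fix e :: real assume e: "0 < e"
    have ind: "integrable M (indicator {\<omega>\<in>space M. \<bar>Z m \<omega>\<bar> > d} :: 'a \<Rightarrow> real)" for m d
      by (rule integrable_const_bound[of _ 1]) (auto split: split_indicator)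
    have le: "expectation (\<lambda>\<omega>. min 1 \<bar>Z m \<omega>\<bar>) \<le> e / 2 + prob {\<omega>\<in>space M. \<bar>Z m \<omega>\<bar> > e / 2}" for m
    proof -
      have "expectation (\<lambda>\<omega>. min 1 \<bar>Z m \<omega>\<bar>) \<le> expectation (\<lambda>\<omega>. e / 2 + indicator {\<omega>\<in>space M. \<bar>Z m \<omega>\<bar> > e / 2} \<omega>)"
      proof (rule integral_mono)
        show "integrable M (\<lambda>\<omega>. e / 2 + indicator {\<omega>\<in>space M. \<bar>Z m \<omega>\<bar> > e / 2} \<omega>)"
          by (rule Bochner_Integration.integrable_add[OF integrable_const ind])
      qed (use e in \<open>auto intro!: integrable_min_1 split: split_indicator\<close>)
      also have "\<dots> = e / 2 + prob {\<omega>\<in>space M. \<bar>Z m \<omega>\<bar> > e / 2}"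
        by (subst Bochner_Integration.integral_add[OF integrable_const ind]) (auto simp: prob_space)
      finally show ?thesis .
    qed
    have "\<forall>\<^sub>F m in sequentially. prob {\<omega>\<in>space M. \<bar>Z m \<omega>\<bar> > e / 2} < e / 2"
      using order_tendstoD(2)[OF lim[of "e / 2"], of "e / 2"] e by auto
    then show "\<forall>\<^sub>F m in sequentially. dist (expectation (\<lambda>\<omega>. min 1 \<bar>Z m \<omega>\<bar>)) 0 < e"
    proof eventually_elim
      case (elim m)
      have "0 \<le> expectation (\<lambda>\<omega>. min 1 \<bar>Z m \<omega>\<bar>)" by (intro integral_nonneg_AE) auto
      then show ?case using elim le[of m] by (simp add: dist_real_def)
    qed
  qed
qed measurable

lemma conv_probI_pointwise:
  assumes [measurable]: "\<And>m. Z m \<in> borel_measurable M"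
    and lim: "\<And>\<omega>. \<omega> \<in> space M \<Longrightarrow> (\<lambda>m. Z m \<omega>) \<longlonglongrightarrow> 0"
  shows "conv_prob Z"
  unfolding conv_prob_def
proof safe
  have "(\<lambda>m. expectation (\<lambda>\<omega>. min 1 \<bar>Z m \<omega>\<bar>)) \<longlonglongrightarrow> expectation (\<lambda>\<omega>. 0)"
  proof (rule integral_dominated_convergence[where w="\<lambda>_. 1"])
    show "AE \<omega> in M. (\<lambda>m. min 1 \<bar>Z m \<omega>\<bar>) \<longlonglongrightarrow> 0"
    proof (rule AE_I2)
      fix \<omega> assume "\<omega> \<in> space M"
      from tendsto_min[OF tendsto_const tendsto_rabs[OF lim[OF this]], of 1]
      show "(\<lambda>m. min 1 \<bar>Z m \<omega>\<bar>) \<longlonglongrightarrow> 0" by simp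
    qed
  qed auto
  then show "(\<lambda>m. expectation (\<lambda>\<omega>. min 1 \<bar>Z m \<omega>\<bar>)) \<longlonglongrightarrow> 0" by simp
qed measurable

lemma conv_probI_L2:
  assumes [measurable]: "\<And>m. Z m \<in> borel_measurable M" and i: "\<And>m. integrable M (\<lambda>\<omega>. (Z m \<omega>)\<^sup>2)"
    and lim: "(\<lambda>m. expectation (\<lambda>\<omega>. (Z m \<omega>)\<^sup>2)) \<longlonglongrightarrow> 0"
  shows "conv_prob Z"
  unfolding conv_prob_def
proof safe
  have "(\<lambda>m. sqrt (expectation (\<lambda>\<omega>. (Z m \<omega>)\<^sup>2))) \<longlonglongrightarrow> 0"
    using tendsto_real_sqrt[OF lim] by simp
  then show "(\<lambda>m. expectation (\<lambda>\<omega>. min 1 \<bar>Z m \<omega>\<bar>)) \<longlonglongrightarrow> 0"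
  proof (rule tendsto_sandwich[rotated 2, OF tendsto_const])
    show "\<forall>\<^sub>F m in sequentially. expectation (\<lambda>\<omega>. min 1 \<bar>Z m \<omega>\<bar>) \<le> sqrt (expectation (\<lambda>\<omega>. (Z m \<omega>)\<^sup>2))"
    proof (intro always_eventually allI)
      fix m
      have "integrable M (Z m)" by (rule square_integrable_imp_integrable[OF _ i]) measurable
      then have "expectation (\<lambda>\<omega>. min 1 \<bar>Z m \<omega>\<bar>) \<le> expectation (\<lambda>\<omega>. \<bar>Z m \<omega>\<bar>)"
        by (intro integral_mono integrable_min_1) auto
      also have "\<dots> \<le> sqrt (expectation (\<lambda>\<omega>. (Z m \<omega>)\<^sup>2))" by (intro expectation_abs_le_sqrt i) measurable
      finally show "expectation (\<lambda>\<omega>. min 1 \<bar>Z m \<omega>\<bar>) \<le> sqrt (expectation (\<lambda>\<omega>. (Z m \<omega>)\<^sup>2))" .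
    qed
  qed auto
qed measurable

text \<open>Convergence in probability with bounded second moments: Fatou along an almost surely
  convergent subsequence bounds the second moment of the limit, which gives uniform integrability.\<close>
lemma conv_prob_L2_limit:
  fixes Z :: "nat \<Rightarrow> 'a \<Rightarrow> real"
  assumes c: "conv_prob (\<lambda>m \<omega>. Z m \<omega> - Y \<omega>)"
    and Z [measurable]: "\<And>m. Z m \<in> borel_measurable M" and Y [measurable]: "Y \<in> borel_measurable M"
    and i: "\<And>m. integrable M (\<lambda>\<omega>. (Z m \<omega>)\<^sup>2)"
    and B: "\<And>m. expectation (\<lambda>\<omega>. (Z m \<omega>)\<^sup>2) \<le> B"
  shows "integrable M (\<lambda>\<omega>. (Y \<omega>)\<^sup>2)" "expectation (\<lambda>\<omega>. (Y \<omega>)\<^sup>2) \<le> B"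
    "(\<lambda>m. expectation (\<lambda>\<omega>. \<bar>Z m \<omega> - Y \<omega>\<bar>)) \<longlonglongrightarrow> 0"
proof -
  have B0: "0 \<le> B" using B[of 0] by (rule order_trans[rotated]) simp
  have "(\<lambda>m. expectation (\<lambda>\<omega>. norm (min 1 \<bar>Z m \<omega> - Y \<omega>\<bar>))) \<longlonglongrightarrow> 0"
    using c by (simp add: conv_prob_def min_def cong: if_cong)
  then have "\<exists>r. strict_mono r \<and> (AE \<omega> in M. (\<lambda>n. min 1 \<bar>Z (r n) \<omega> - Y \<omega>\<bar>) \<longlonglongrightarrow> 0)"
    by (intro tendsto_L1_AE_subseq integrable_min_1) measurable
  then obtain r where r: "strict_mono r" "AE \<omega> in M. (\<lambda>n. min 1 \<bar>Z (r n) \<omega> - Y \<omega>\<bar>) \<longlonglongrightarrow> 0"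
    by blast
  have ae: "AE \<omega> in M. ennreal ((Y \<omega>)\<^sup>2) = liminf (\<lambda>n. ennreal ((Z (r n) \<omega>)\<^sup>2))"
    using r(2)
  proof eventually_elim
    case (elim \<omega>)
    have "(\<lambda>n. Z (r n) \<omega> - Y \<omega>) \<longlonglongrightarrow> 0"
    proof (rule tendstoI)
      fix e :: real assume e: "0 < e"
      have "\<forall>\<^sub>F n in sequentially. min 1 \<bar>Z (r n) \<omega> - Y \<omega>\<bar> < min 1 e"
        using order_tendstoD(2)[OF elim, of "min 1 e"] e by auto
      then show "\<forall>\<^sub>F n in sequentially. dist (Z (r n) \<omega> - Y \<omega>) 0 < e"
        by eventually_elim (auto simp: min_def split: if_splits)
    qed
    then have "(\<lambda>n. Z (r n) \<omega>) \<longlonglongrightarrow> Y \<omega>" by (simp add: LIM_zero_iff)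
    then have "(\<lambda>n. ennreal ((Z (r n) \<omega>)\<^sup>2)) \<longlonglongrightarrow> ennreal ((Y \<omega>)\<^sup>2)"
      by (intro tendsto_ennrealI tendsto_power)
    then show ?case by (intro lim_imp_Liminf[symmetric]) auto
  qed
  have nZ: "(\<integral>\<^sup>+\<omega>. ennreal ((Z m \<omega>)\<^sup>2) \<partial>M) \<le> ennreal B" for m
    using i[of m] B[of m] by (subst nn_integral_eq_integral) (auto simp: ennreal_leI)
  have "(\<integral>\<^sup>+\<omega>. ennreal ((Y \<omega>)\<^sup>2) \<partial>M) = (\<integral>\<^sup>+\<omega>. liminf (\<lambda>n. ennreal ((Z (r n) \<omega>)\<^sup>2)) \<partial>M)"
    using ae by (rule nn_integral_cong_AE)
  also have "\<dots> \<le> liminf (\<lambda>n. \<integral>\<^sup>+\<omega>. ennreal ((Z (r n) \<omega>)\<^sup>2) \<partial>M)" by (rule nn_integral_liminf) measurable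
  also have "\<dots> \<le> liminf (\<lambda>n::nat. ennreal B)" by (intro Liminf_mono always_eventually allI nZ)
  also have "\<dots> = ennreal B" by (rule Liminf_const) simp
  finally have nY: "(\<integral>\<^sup>+\<omega>. ennreal ((Y \<omega>)\<^sup>2) \<partial>M) \<le> ennreal B" .
  show iY: "integrable M (\<lambda>\<omega>. (Y \<omega>)\<^sup>2)"
    using nY by (intro integrableI_nonneg) (auto intro: le_less_trans)
  have "ennreal (expectation (\<lambda>\<omega>. (Y \<omega>)\<^sup>2)) \<le> ennreal B"
    using nY nn_integral_eq_integral[OF iY] by auto
  then show EY: "expectation (\<lambda>\<omega>. (Y \<omega>)\<^sup>2) \<le> B" using B0 by simp
  have int: "integrable M (Z m)" "integrable M Y" for m
    using square_integrable_imp_integrable[OF Z i] square_integrable_imp_integrable[OF Y iY] by auto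
  have idiff: "integrable M (\<lambda>\<omega>. (Z m \<omega> - Y \<omega>)\<^sup>2)" for m
  proof (rule Bochner_Integration.integrable_bound)
    show "integrable M (\<lambda>\<omega>. 2 * (Z m \<omega>)\<^sup>2 + 2 * (Y \<omega>)\<^sup>2)" using i iY by auto
    show "AE \<omega> in M. norm ((Z m \<omega> - Y \<omega>)\<^sup>2) \<le> norm (2 * (Z m \<omega>)\<^sup>2 + 2 * (Y \<omega>)\<^sup>2)"
      by (intro AE_I2) (use square_diff_le in simp)
  qed measurable
  have Ediff: "expectation (\<lambda>\<omega>. (Z m \<omega> - Y \<omega>)\<^sup>2) \<le> 4 * B" for m
  proof -
    have "expectation (\<lambda>\<omega>. (Z m \<omega> - Y \<omega>)\<^sup>2) \<le> expectation (\<lambda>\<omega>. 2 * (Z m \<omega>)\<^sup>2 + 2 * (Y \<omega>)\<^sup>2)"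
    proof (rule integral_mono[OF idiff])
      fix \<omega> show "(Z m \<omega> - Y \<omega>)\<^sup>2 \<le> 2 * (Z m \<omega>)\<^sup>2 + 2 * (Y \<omega>)\<^sup>2"
        by (rule square_diff_le)
    qed (use i iY in auto)
    also have "\<dots> \<le> 4 * B" using i iY B[of m] EY by simp
    finally show ?thesis .
  qed
  show "(\<lambda>m. expectation (\<lambda>\<omega>. \<bar>Z m \<omega> - Y \<omega>\<bar>)) \<longlonglongrightarrow> 0"
  proof (rule tendstoI)
    fix e :: real assume e: "0 < e"
    \<comment> \<open>Truncation level: \<open>z \<le> K * min 1 z + z\<^sup>2 / K\<close> for
      \<open>z \<ge> 0\<close> and \<open>K \<ge> 1\<close>. The bound 4 B on the second moments
      makes the last term contribute less than e / 2.\<close>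
    define K where "K = max 1 (8 * B / e + 1)"
    have K: "K \<ge> 1" "4 * B / K < e / 2 + 0" using e B0
      by (auto simp: K_def field_simps max_def)
    have le: "expectation (\<lambda>\<omega>. \<bar>Z m \<omega> - Y \<omega>\<bar>) \<le> K * expectation (\<lambda>\<omega>. min 1 \<bar>Z m \<omega> - Y \<omega>\<bar>) + 4 * B / K" for m
    proof -
      have "expectation (\<lambda>\<omega>. \<bar>Z m \<omega> - Y \<omega>\<bar>) \<le> expectation (\<lambda>\<omega>. K * min 1 \<bar>Z m \<omega> - Y \<omega>\<bar> + (Z m \<omega> - Y \<omega>)\<^sup>2 / K)"
      proof (rule integral_mono)
        fix \<omega>
        let ?z = "\<bar>Z m \<omega> - Y \<omega>\<bar>"
        have "?z \<le> K * min 1 ?z + ?z\<^sup>2 / K"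
        proof (cases "?z \<le> K")
          case True
          have "?z \<le> K * min 1 ?z" using True K(1) mult_right_mono[of 1 K ?z] by (auto simp: min_def)
          moreover have "0 \<le> ?z\<^sup>2 / K" using K(1) by simp
          ultimately show ?thesis by linarith
        next
          case False
          then have "?z * K \<le> ?z * ?z" using K(1) by (intro mult_left_mono) auto
          then have "?z \<le> ?z\<^sup>2 / K" using K(1) by (simp add: field_simps power2_eq_square)
          moreover have "0 \<le> K * min 1 ?z" using K(1) by simp
          ultimately show ?thesis by linarith
        qed
        then show "?z \<le> K * min 1 ?z + (Z m \<omega> - Y \<omega>)\<^sup>2 / K" by simp
      qed (use int idiff in \<open>auto intro!: integrable_min_1\<close>)
      also have "\<dots> = K * expectation (\<lambda>\<omega>. min 1 \<bar>Z m \<omega> - Y \<omega>\<bar>) + expectation (\<lambda>\<omega>. (Z m \<omega> - Y \<omega>)\<^sup>2) / K"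
        using idiff by (subst Bochner_Integration.integral_add) (auto intro!: integrable_min_1)
      also have "expectation (\<lambda>\<omega>. (Z m \<omega> - Y \<omega>)\<^sup>2) / K \<le> 4 * B / K"
        using Ediff K(1) by (intro divide_right_mono) auto
      finally show ?thesis by simp
    qed
    have "(\<lambda>m. K * expectation (\<lambda>\<omega>. min 1 \<bar>Z m \<omega> - Y \<omega>\<bar>)) \<longlonglongrightarrow> K * 0"
      using c by (intro tendsto_mult_left) (simp add: conv_prob_def)
    then have "\<forall>\<^sub>F m in sequentially. K * expectation (\<lambda>\<omega>. min 1 \<bar>Z m \<omega> - Y \<omega>\<bar>) < e / 2"
      using e by (intro order_tendstoD(2)) auto
    then show "\<forall>\<^sub>F m in sequentially. dist (expectation (\<lambda>\<omega>. \<bar>Z m \<omega> - Y \<omega>\<bar>)) 0 < e"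
    proof eventually_elim
      case (elim m)
      have "0 \<le> expectation (\<lambda>\<omega>. \<bar>Z m \<omega> - Y \<omega>\<bar>)" by (intro integral_nonneg_AE) auto
      then show ?case using elim le[of m] K by (simp add: dist_real_def)
    qed
  qed
qed

end

section \<open>Euler sums and their limit\<close>

context sde
begin

definition bnd :: real where "bnd = (SOME C. 1 \<le> C \<and> (\<forall>x. \<bar>b x\<bar> \<le> C \<and> \<bar>\<sigma> x\<bar> \<le> C))"

lemma bnd_ge_1: "1 \<le> bnd" and b_bnd: "\<bar>b x\<bar> \<le> bnd" and \<sigma>_bnd: "\<bar>\<sigma> x\<bar> \<le> bnd"
proof -
  obtain C1 where "\<And>x. \<bar>b x\<bar> \<le> C1" using periodic_continuous_bounded[of b, OF per_b cont_b] by blast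
  moreover obtain C2 where "\<And>x. \<bar>\<sigma> x\<bar> \<le> C2" using periodic_continuous_bounded[of \<sigma>, OF per_\<sigma> cont_\<sigma>] by blast
  ultimately have "1 \<le> max 1 (max C1 C2) \<and> (\<forall>x. \<bar>b x\<bar> \<le> max 1 (max C1 C2) \<and> \<bar>\<sigma> x\<bar> \<le> max 1 (max C1 C2))"
    by (auto simp: le_max_iff_disj)
  then have "1 \<le> bnd \<and> (\<forall>x. \<bar>b x\<bar> \<le> bnd \<and> \<bar>\<sigma> x\<bar> \<le> bnd)"
    unfolding bnd_def by (rule someI[where P="\<lambda>C. 1 \<le> C \<and> (\<forall>x. \<bar>b x\<bar> \<le> C \<and> \<bar>\<sigma> x\<bar> \<le> C)"])
  then show "1 \<le> bnd" "\<bar>b x\<bar> \<le> bnd" "\<bar>\<sigma> x\<bar> \<le> bnd" by auto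
qed

lemma X_tm [measurable]: "X (tm N j) \<in> borel_measurable M" by (rule X_M) simp
lemma dW_M [measurable]: "dW N j \<in> borel_measurable M" by (rule measurable_F_M[OF dW_F])

lemma f_X_F: "f \<in> borel_measurable borel \<Longrightarrow> 0 \<le> s \<Longrightarrow> s \<le> t \<Longrightarrow> (\<lambda>\<omega>. f (X s \<omega>)) \<in> borel_measurable (F t)"
  for f :: "real \<Rightarrow> real"
  by (rule measurable_compose[OF measurable_F_mono[OF _ X_F]])

text \<open>The partition of [0, k / 2^n] into 2^m pieces has mesh k / 2^(n+m). Each piece consists
  of k cells of the dyadic grid, on which the integrand keeps its value at the left end of the
  piece, the point with index \<open>k * (j div k)\<close>.\<close>

lemma ito_riemann_sum_eq:
  "ito_riemann_sum (\<lambda>s \<omega>. \<sigma> (X s \<omega>)) W (tm n k) m \<omega> =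
    (\<Sum>j\<in>{0..<k * 2 ^ m}. \<sigma> (X (tm (n + m) (k * (j div k))) \<omega>) * dW (n + m) j \<omega>)"
proof (cases "k = 0")
  case True
  then show ?thesis by (simp add: ito_riemann_sum_def tm_def)
next
  case k: False
  have g: "tm n k * real i / 2 ^ m = tm (n + m) (i * k)" for i by (simp add: tm_def power_add)
  have "(\<Sum>j\<in>{0..<k * 2 ^ m}. \<sigma> (X (tm (n + m) (k * (j div k))) \<omega>) * dW (n + m) j \<omega>) =
    (\<Sum>i<2 ^ m. \<Sum>j\<in>{i * k..<i * k + k}. \<sigma> (X (tm (n + m) (k * (j div k))) \<omega>) * dW (n + m) j \<omega>)"
    by (subst sum.nat_group) (simp add: lessThan_atLeast0 mult.commute)
  also have "\<dots> = (\<Sum>i<2 ^ m. \<Sum>j\<in>{i * k..<i * k + k}. \<sigma> (X (tm (n + m) (i * k)) \<omega>) * dW (n + m) j \<omega>)"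
  proof (intro sum.cong refl)
    fix i j assume "j \<in> {i * k..<i * k + k}"
    then have "j div k = i" by (intro div_nat_eqI) (auto simp: algebra_simps)
    then show "\<sigma> (X (tm (n + m) (k * (j div k))) \<omega>) * dW (n + m) j \<omega> = \<sigma> (X (tm (n + m) (i * k)) \<omega>) * dW (n + m) j \<omega>"
      by (simp add: mult.commute)
  qed
  also have "\<dots> = (\<Sum>i<2 ^ m. \<sigma> (X (tm (n + m) (i * k)) \<omega>) * (W (tm (n + m) (Suc i * k)) \<omega> - W (tm (n + m) (i * k)) \<omega>))"
  proof (intro sum.cong refl)
    fix i
    show "(\<Sum>j\<in>{i * k..<i * k + k}. \<sigma> (X (tm (n + m) (i * k)) \<omega>) * dW (n + m) j \<omega>) =
        \<sigma> (X (tm (n + m) (i * k)) \<omega>) * (W (tm (n + m) (Suc i * k)) \<omega> - W (tm (n + m) (i * k)) \<omega>)"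
      unfolding sum_distrib_left[symmetric] dW_def
      by (subst sum_Suc_diff'[of "i * k" "i * k + k" "\<lambda>j. W (tm (n + m) j) \<omega>"]) (auto simp: add.commute)
  qed
  finally show ?thesis unfolding ito_riemann_sum_def g by simp
qed

definition euler :: "nat \<Rightarrow> nat \<Rightarrow> nat \<Rightarrow> 'a \<Rightarrow> real" where
  "euler N a c \<omega> = (\<Sum>j\<in>{a..<c}. b (X (tm N j) \<omega>) / 2 ^ N) + (\<Sum>j\<in>{a..<c}. \<sigma> (X (tm N j) \<omega>) * dW N j \<omega>)"

lemma oscillation:
  assumes w: "\<omega> \<in> space M" and f: "continuous_on UNIV f" and e: "e > (0::real)"
  shows "\<forall>\<^sub>F m in sequentially. \<forall>s s'. 0 \<le> s \<and> s \<le> T \<and> 0 \<le> s' \<and> s' \<le> T \<and> \<bar>s - s'\<bar> \<le> real k / 2 ^ (n + m) \<longrightarrow>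
    \<bar>f (X s \<omega>) - f (X s' \<omega>)\<bar> < (e::real)"
proof -
  have "continuous_on {0..T} (\<lambda>s. f (X s \<omega>))"
    by (rule continuous_on_compose2[OF f continuous_on_subset[OF X_cont[OF w]]]) auto
  then have "uniformly_continuous_on {0..T} (\<lambda>s. f (X s \<omega>))" by (rule compact_uniformly_continuous) simp
  then obtain d where d: "d > 0" "\<And>s s'. s \<in> {0..T} \<Longrightarrow> s' \<in> {0..T} \<Longrightarrow> dist s' s < d \<Longrightarrow> dist (f (X s' \<omega>)) (f (X s \<omega>)) < e"
    using e unfolding uniformly_continuous_on_def by metis
  have "(\<lambda>m. real k / 2 ^ n * (1 / 2) ^ m) \<longlonglongrightarrow> real k / 2 ^ n * 0"
    by (intro tendsto_mult_left LIMSEQ_realpow_zero) auto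
  then have "\<forall>\<^sub>F m in sequentially. real k / 2 ^ n * (1 / 2) ^ m < d"
    using d(1) by (intro order_tendstoD(2)) auto
  then show ?thesis
  proof eventually_elim
    case (elim m)
    then have "real k / 2 ^ (n + m) < d" by (simp add: power_add power_divide)
    then show ?case using d(2) by (auto simp: dist_real_def)
  qed
qed

text \<open>\<open>weak_solution\<close> freezes \<sigma> on pieces of k cells, \<open>euler\<close>
  on single cells. The difference \<open>?S\<close> is a martingale sum, small in L2 because a path
  oscillates little within a piece; the drift part is a pathwise Riemann sum; what remains is the
  convergence that a weak solution provides.\<close>

lemma euler_conv_0: "conv_prob (\<lambda>m \<omega>. euler (n + m) 0 (k * 2 ^ m) \<omega> - (X (tm n k) \<omega> - y))"
proof -
  let ?t = "tm n k"
  have t: "tm (n + m) (k * 2 ^ m) = ?t" for m by (simp add: tm_def power_add)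
  define H where "H m j \<omega> = \<sigma> (X (tm (n + m) j) \<omega>) - \<sigma> (X (tm (n + m) (k * (j div k))) \<omega>)" for m j \<omega>
  have HF: "H m j \<in> borel_measurable (F (tm (n + m) j))" for m j
    unfolding H_def using times_div_less_eq_dividend[of k j] by (intro borel_measurable_diff f_X_F) auto
  note [measurable] = measurable_F_M[OF HF]
  have HB: "\<bar>H m j \<omega>\<bar> \<le> 2 * bnd" for m j \<omega>
    unfolding H_def using \<sigma>_bnd[of "X (tm (n + m) j) \<omega>"] \<sigma>_bnd[of "X (tm (n + m) (k * (j div k))) \<omega>"] by linarith
  have H2: "(H m j \<omega>)\<^sup>2 \<le> (2 * bnd)\<^sup>2" for m j \<omega>
    by (rule power2_le_iff_abs_le[THEN iffD2, OF _ HB]) (use bnd_ge_1 in simp)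
  have kt: "real (k * 2 ^ m) / 2 ^ (n + m) = ?t" for m by (simp add: tm_def power_add)
  let ?S = "\<lambda>m \<omega>. (\<Sum>j\<in>{0..<k * 2 ^ m}. H m j \<omega> * dW (n + m) j \<omega>)"
  have 1: "conv_prob ?S"
  proof (rule conv_probI_L2)
    note L2 = mart_sum_L2[of 0 "k * 2 ^ m" "H m" "n + m" "2 * bnd" for m, OF _ HF HB]
    show "integrable M (\<lambda>\<omega>. (?S m \<omega>)\<^sup>2)" for m using L2[of m] by auto
    have "expectation (\<lambda>\<omega>. (?S m \<omega>)\<^sup>2) = expectation (\<lambda>\<omega>. (\<Sum>j\<in>{0..<k * 2 ^ m}. (H m j \<omega>)\<^sup>2) / 2 ^ (n + m))" for m
      using L2[of m] H2
      by (subst integral_divide_zero, subst Bochner_Integration.integral_sum)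
         (auto intro!: integrable_boundedI)
    moreover have "(\<lambda>m. expectation (\<lambda>\<omega>. (\<Sum>j\<in>{0..<k * 2 ^ m}. (H m j \<omega>)\<^sup>2) / 2 ^ (n + m))) \<longlonglongrightarrow> expectation (\<lambda>_. 0)"
    proof (rule integral_dominated_convergence[where w="\<lambda>_. ?t * (2 * bnd)\<^sup>2"])
      have le: "(\<Sum>j\<in>{0..<k * 2 ^ m}. (H m j \<omega>)\<^sup>2) / 2 ^ (n + m) \<le> ?t * e"
        if "\<And>j. j < k * 2 ^ m \<Longrightarrow> (H m j \<omega>)\<^sup>2 \<le> e" for m \<omega> e
      proof -
        have "(\<Sum>j\<in>{0..<k * 2 ^ m}. (H m j \<omega>)\<^sup>2) \<le> real (card {0..<k * 2 ^ m}) * e"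
          by (rule sum_bounded_above) (use that in auto)
        then have "(\<Sum>j\<in>{0..<k * 2 ^ m}. (H m j \<omega>)\<^sup>2) / 2 ^ (n + m) \<le> real (k * 2 ^ m) / 2 ^ (n + m) * e"
          by (simp add: divide_right_mono)
        then show ?thesis by (simp only: kt)
      qed
      show "AE \<omega> in M. norm ((\<Sum>j\<in>{0..<k * 2 ^ m}. (H m j \<omega>)\<^sup>2) / 2 ^ (n + m)) \<le> ?t * (2 * bnd)\<^sup>2" for m
        using le[OF H2] by (auto intro!: AE_I2 simp: abs_of_nonneg sum_nonneg)
      show "AE \<omega> in M. (\<lambda>m. (\<Sum>j\<in>{0..<k * 2 ^ m}. (H m j \<omega>)\<^sup>2) / 2 ^ (n + m)) \<longlonglongrightarrow> 0"
      proof (rule AE_I2, rule tendstoI)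
        fix \<omega> and e :: real assume w: "\<omega> \<in> space M" and e: "0 < e"
        define e' where "e' = sqrt (e / (?t + 1))"
        have t1: "?t + 1 > 0" by (simp add: add_nonneg_pos)
        have e': "e' > 0" "e'\<^sup>2 = e / (?t + 1)" using e t1 by (auto simp: e'_def)
        show "\<forall>\<^sub>F m in sequentially. dist ((\<Sum>j\<in>{0..<k * 2 ^ m}. (H m j \<omega>)\<^sup>2) / 2 ^ (n + m)) 0 < e"
          using oscillation[OF w cont_\<sigma> e'(1), of ?t k n]
        proof eventually_elim
          case (elim m)
          have "(H m j \<omega>)\<^sup>2 \<le> e'\<^sup>2" if j: "j < k * 2 ^ m" for j
          proof -
            have "0 < k" using j by (cases k) auto
            then have jd: "k * (j div k) \<le> j" "j \<le> k * (j div k) + k"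
              using mult_div_mod_eq[of k j] mod_less_divisor[of k j] by linarith+
            have "tm (n + m) j \<le> ?t" unfolding t[of m, symmetric] using j by simp
            moreover have "tm (n + m) (k * (j div k)) \<le> ?t" unfolding t[of m, symmetric] tm_le using j jd by linarith
            moreover have "\<bar>tm (n + m) j - tm (n + m) (k * (j div k))\<bar> \<le> real k / 2 ^ (n + m)"
              using jd unfolding tm_def diff_divide_distrib[symmetric] 
              by (simp add: divide_right_mono abs_divide of_nat_diff[symmetric] del: of_nat_mult of_nat_diff)
            ultimately have "\<bar>H m j \<omega>\<bar> < e'" unfolding H_def using elim by simp
            then show ?thesis using e'(1) by (subst power2_le_iff_abs_le) auto
          qed
          from le[OF this] have "(\<Sum>j\<in>{0..<k * 2 ^ m}. (H m j \<omega>)\<^sup>2) / 2 ^ (n + m) \<le> ?t * (e / (?t + 1))"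
            by (simp add: e')
          also have "\<dots> < e" using e t1 by (simp add: field_simps)
          finally show ?case by (simp add: dist_real_def abs_of_nonneg sum_nonneg)
        qed
      qed
    qed auto
    ultimately show "(\<lambda>m. expectation (\<lambda>\<omega>. (?S m \<omega>)\<^sup>2)) \<longlonglongrightarrow> 0" by simp
  qed measurable
  let ?I = "\<lambda>\<omega>. integral {0..?t} (\<lambda>s. b (X s \<omega>))"
  let ?R = "\<lambda>m \<omega>. (\<Sum>j\<in>{0..<k * 2 ^ m}. b (X (tm (n + m) j) \<omega>) / 2 ^ (n + m))"
  have R_lim: "(\<lambda>m. ?R m \<omega>) \<longlonglongrightarrow> ?I \<omega>" if w: "\<omega> \<in> space M" for \<omega>
  proof (rule tendstoI)
    fix e :: real assume e: "0 < e"
    have t1: "?t + 1 > 0" by (simp add: add_nonneg_pos)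
    have e': "e / (?t + 1) > 0" using e t1 by simp
    show "\<forall>\<^sub>F m in sequentially. dist (?R m \<omega>) (?I \<omega>) < e"
      using oscillation[OF w cont_b e', of ?t 1 n]
    proof eventually_elim
      case (elim m)
      let ?h = "1 / 2 ^ (n + m) :: real"
      have eq: "real (k * 2 ^ m) * ?h = ?t" by (simp add: tm_def power_add)
      have "\<bar>integral {0..real (k * 2 ^ m) * ?h} (\<lambda>s. b (X s \<omega>)) - (\<Sum>j<k * 2 ^ m. b (X (real j * ?h) \<omega>) * ?h)\<bar>
         \<le> real (k * 2 ^ m) * ?h * (e / (?t + 1))"
      proof (rule dist_integral_riemann_sum_le)
        show "continuous_on {0..real (k * 2 ^ m) * ?h} (\<lambda>s. b (X s \<omega>))"
          by (rule continuous_on_compose2[OF cont_b continuous_on_subset[OF X_cont[OF w]]]) auto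
        fix j s assume j: "j < k * 2 ^ m" and s: "s \<in> {real j * ?h..real (Suc j) * ?h}"
        have "real (Suc j) \<le> real (k * 2 ^ m)" using j unfolding of_nat_le_iff by simp
        then have "real (Suc j) * ?h \<le> real (k * 2 ^ m) * ?h" by (rule mult_right_mono) simp
        then have "s \<le> ?t" "real j * ?h \<le> ?t" using s unfolding eq by auto
        moreover have "0 \<le> real j * ?h" by simp
        moreover have "real (Suc j) * ?h = real j * ?h + ?h" by (simp add: field_simps)
        then have "\<bar>s - real j * ?h\<bar> \<le> real 1 / 2 ^ (n + m)" using s by auto
        moreover have "0 \<le> s" using s \<open>0 \<le> real j * ?h\<close> unfolding atLeastAtMost_iff by linarith
        ultimately have "\<bar>b (X s \<omega>) - b (X (real j * ?h) \<omega>)\<bar> < e / (?t + 1)" 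
          using elim[rule_format, of s "real j * ?h"] by blast
        then show "\<bar>b (X s \<omega>) - b (X (real j * ?h) \<omega>)\<bar> \<le> e / (?t + 1)" by simp
      qed simp
      also have "real (k * 2 ^ m) * ?h * (e / (?t + 1)) < e" unfolding eq using e t1 by (simp add: field_simps)
      also have "(\<Sum>j<k * 2 ^ m. b (X (real j * ?h) \<omega>) * ?h) = ?R m \<omega>"
        by (simp add: tm_def lessThan_atLeast0)
      finally show ?case unfolding eq by (simp add: dist_real_def abs_minus_commute)
    qed
  qed
  have I_meas [measurable]: "?I \<in> borel_measurable M"
    by (rule borel_measurable_LIMSEQ_real[OF R_lim]) auto
  have 2: "conv_prob (\<lambda>m \<omega>. ?R m \<omega> - ?I \<omega>)"
    using R_lim by (intro conv_probI_pointwise) (auto simp: LIM_zero_iff)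
  have 3: "conv_prob (\<lambda>m \<omega>. ito_riemann_sum (\<lambda>s \<omega>. \<sigma> (X s \<omega>)) W ?t m \<omega> - (X ?t \<omega> - y - ?I \<omega>))"
    using riemann_conv[of ?t] by (intro conv_probI_prob) (auto simp: ito_riemann_sum_eq)
  have eq: "euler (n + m) 0 (k * 2 ^ m) \<omega> - (X ?t \<omega> - y) =
    ?S m \<omega> + ((?R m \<omega> - ?I \<omega>) + (ito_riemann_sum (\<lambda>s \<omega>. \<sigma> (X s \<omega>)) W ?t m \<omega> - (X ?t \<omega> - y - ?I \<omega>)))" for m \<omega>
    unfolding ito_riemann_sum_eq euler_def H_def by (simp add: left_diff_distrib sum_subtractf)
  show ?thesis unfolding eq by (intro conv_prob_add 1 2 3)
qed

lemma euler_conv: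
  assumes "a \<le> c"
  shows "conv_prob (\<lambda>m \<omega>. euler (n + m) (a * 2 ^ m) (c * 2 ^ m) \<omega> - (X (tm n c) \<omega> - X (tm n a) \<omega>))"
proof -
  have split: "euler N 0 (c * 2 ^ m) \<omega> = euler N 0 (a * 2 ^ m) \<omega> + euler N (a * 2 ^ m) (c * 2 ^ m) \<omega>" for N m \<omega>
    unfolding euler_def using assms sum.atLeastLessThan_concat[of 0 "a * 2 ^ m" "c * 2 ^ m"] 
    by (simp flip: sum.atLeastLessThan_concat[of 0 "a * 2 ^ m" "c * 2 ^ m"])
  show ?thesis
    using conv_prob_add[OF euler_conv_0[of n c] conv_prob_uminus[OF euler_conv_0[of n a]]]
    unfolding split by (simp add: algebra_simps)
qed

end

section \<open>Euler steps and the Ito formula\<close>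

lemma taylor2:
  fixes g g' g'' :: "real \<Rightarrow> real"
  assumes "\<And>x. (g has_real_derivative g' x) (at x)" "\<And>x. (g' has_real_derivative g'' x) (at x)"
  obtains \<xi> where "\<bar>\<xi> - x\<bar> \<le> \<bar>h\<bar>" "g (x + h) = g x + g' x * h + g'' \<xi> / 2 * h\<^sup>2"
proof (cases "h = 0")
  case True
  then show ?thesis by (intro that[of x]) auto
next
  case False
  define diff where "diff m = (if m = 0 then g else if m = 1 then g' else g'')" for m :: nat
  have "\<exists>t. (if x + h < x then x + h < t \<and> t < x else x < t \<and> t < x + h) \<and>
     g (x + h) = (\<Sum>m<2. diff m x / fact m * (x + h - x) ^ m) + diff 2 t / fact 2 * (x + h - x) ^ 2"
    using False assms
    by (intro Taylor[of 2 diff g "min x (x + h)" "max x (x + h)" x "x + h"]) (auto simp: diff_def less_2_cases_iff)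
  then obtain t where t: "\<bar>t - x\<bar> \<le> \<bar>h\<bar>"
    "g (x + h) = (\<Sum>m<2. diff m x / fact m * (x + h - x) ^ m) + diff 2 t / fact 2 * (x + h - x) ^ 2"
    by (auto split: if_splits) (smt (verit))+
  then show ?thesis by (intro that[of t]) (auto simp: diff_def numeral_2_eq_2)
qed

text \<open>For small h the continuity of g'' near z gives \<open>\<epsilon> * h\<^sup>2\<close>;
  for h bounded away from 0 a quadratic error is at most a multiple of h^4. The fourth power is
  harmless because the fourth moment of an Euler step is of second order in its length.\<close>

lemma taylor2_remainder:
  fixes g g' g'' :: "real \<Rightarrow> real"
  assumes g: "\<And>x. (g has_real_derivative g' x) (at x)" "\<And>x. (g' has_real_derivative g'' x) (at x)"
    and B: "\<And>x. \<bar>g'' x\<bar> \<le> B" and cont: "continuous_on UNIV g''" and e: "\<epsilon> > 0"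
  obtains D where "D \<ge> 0" "\<And>x h. \<bar>x - z\<bar> \<le> 1 \<Longrightarrow> \<bar>g (x + h) - g x - g' x * h - g'' x / 2 * h\<^sup>2\<bar> \<le> \<epsilon> * h\<^sup>2 + D * h ^ 4"
proof -
  have B0: "0 \<le> B" using B[of 0] by simp
  have "uniformly_continuous_on {z-2..z+2} g''"
    by (intro compact_uniformly_continuous continuous_on_subset[OF cont]) auto
  then obtain d where d: "d > 0" "\<And>x x'. x \<in> {z-2..z+2} \<Longrightarrow> x' \<in> {z-2..z+2} \<Longrightarrow> dist x' x < d \<Longrightarrow> dist (g'' x') (g'' x) < \<epsilon>"
    using e unfolding uniformly_continuous_on_def by metis
  define \<eta> where "\<eta> = min d 1"
  have \<eta>: "\<eta> > 0" "\<eta> \<le> 1" "\<eta> \<le> d" using d by (auto simp: \<eta>_def)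
  show ?thesis
  proof (rule that[of "B / \<eta>\<^sup>2"])
    show "0 \<le> B / \<eta>\<^sup>2" using B0 by simp
    fix x h :: real assume x: "\<bar>x - z\<bar> \<le> 1"
    obtain \<xi> where \<xi>: "\<bar>\<xi> - x\<bar> \<le> \<bar>h\<bar>" "g (x + h) = g x + g' x * h + g'' \<xi> / 2 * h\<^sup>2" 
      using taylor2[OF g] by blast
    have eq: "g (x + h) - g x - g' x * h - g'' x / 2 * h\<^sup>2 = (g'' \<xi> - g'' x) / 2 * h\<^sup>2"
      unfolding \<xi>(2) by (simp add: field_simps)
    show "\<bar>g (x + h) - g x - g' x * h - g'' x / 2 * h\<^sup>2\<bar> \<le> \<epsilon> * h\<^sup>2 + B / \<eta>\<^sup>2 * h ^ 4"
    proof (cases "\<bar>h\<bar> < \<eta>")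
      case True
      have "z - 2 \<le> x" "x \<le> z + 2" "z - 2 \<le> \<xi>" "\<xi> \<le> z + 2" "\<bar>\<xi> - x\<bar> < d" using x \<xi>(1) \<eta> True by linarith+
      then have "\<bar>g'' \<xi> - g'' x\<bar> < \<epsilon>" using d(2)[of x \<xi>] by (auto simp: dist_real_def)
      then have "\<bar>(g'' \<xi> - g'' x) / 2\<bar> \<le> \<epsilon>" by simp
      then have "\<bar>(g'' \<xi> - g'' x) / 2 * h\<^sup>2\<bar> \<le> \<epsilon> * h\<^sup>2" unfolding abs_mult by (intro mult_mono) auto
      moreover have "0 \<le> B / \<eta>\<^sup>2 * h ^ 4" using B0 by simp
      ultimately show ?thesis unfolding eq by linarith
    next
      case False
      have "\<bar>(g'' \<xi> - g'' x) / 2\<bar> \<le> B" using B[of x] B[of \<xi>] by simp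
      then have "\<bar>(g'' \<xi> - g'' x) / 2 * h\<^sup>2\<bar> \<le> B * h\<^sup>2" unfolding abs_mult by (intro mult_mono) auto
      also have "\<dots> \<le> B * (h ^ 4 / \<eta>\<^sup>2)"
      proof (rule mult_left_mono[OF _ B0])
        have "\<eta>\<^sup>2 \<le> h\<^sup>2" using False \<eta>(1) by (metis abs_le_square_iff abs_of_pos not_less)
        then have "h\<^sup>2 * \<eta>\<^sup>2 \<le> h\<^sup>2 * h\<^sup>2" by (intro mult_left_mono) auto
        then show "h\<^sup>2 \<le> h ^ 4 / \<eta>\<^sup>2" using \<eta>(1) by (simp add: le_divide_eq flip: power_add)
      qed
      finally have "\<bar>(g'' \<xi> - g'' x) / 2 * h\<^sup>2\<bar> \<le> B / \<eta>\<^sup>2 * h ^ 4" by simp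
      moreover have "0 \<le> \<epsilon> * h\<^sup>2" using e by simp
      ultimately show ?thesis unfolding eq by linarith
    qed
  qed
qed

lemma (in prob_space) abs_expectation_le:
  fixes f u :: "'a \<Rightarrow> real"
  assumes "f \<in> borel_measurable M" "integrable M u" "\<And>\<omega>. \<omega> \<in> space M \<Longrightarrow> \<bar>f \<omega>\<bar> \<le> u \<omega>"
  shows "integrable M f" "\<bar>expectation f\<bar> \<le> expectation u"
proof -
  show i: "integrable M f"
    by (rule Bochner_Integration.integrable_bound[OF assms(2,1)]) (use assms(3) in \<open>force intro!: AE_I2\<close>)
  have "\<bar>expectation f\<bar> \<le> expectation (\<lambda>\<omega>. \<bar>f \<omega>\<bar>)" by (rule integral_abs_bound)
  also have "\<dots> \<le> expectation u" by (intro integral_mono assms i integrable_abs)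
  finally show "\<bar>expectation f\<bar> \<le> expectation u" .
qed

context sde
begin

text \<open>The second moment sees drift and noise, so the sum itself is of the order of the square
  root of the elapsed time. Against a weight from the past the noise averages out and only the
  drift, of first order in the elapsed time, is left; errors of this order can be added over all
  steps.\<close>

lemma L2_drift_mart:
  assumes ac: "a \<le> c" and le1: "tm N c - tm N a \<le> 1"
    and A [measurable]: "\<And>j. A j \<in> borel_measurable M" and AB: "\<And>j \<omega>. \<bar>A j \<omega>\<bar> \<le> B1"
    and H: "\<And>j. a \<le> j \<Longrightarrow> j < c \<Longrightarrow> H j \<in> borel_measurable (F (tm N j))" and HB: "\<And>j \<omega>. \<bar>H j \<omega>\<bar> \<le> B2"
    and u: "\<And>j. a \<le> j \<Longrightarrow> j < c \<Longrightarrow> expectation (\<lambda>\<omega>. \<bar>A j \<omega>\<bar>) \<le> u"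
    and v: "\<And>j. a \<le> j \<Longrightarrow> j < c \<Longrightarrow> expectation (\<lambda>\<omega>. (H j \<omega>)\<^sup>2) \<le> v"
  defines "D \<equiv> \<lambda>\<omega>. (\<Sum>j\<in>{a..<c}. A j \<omega> / 2 ^ N) + (\<Sum>j\<in>{a..<c}. H j \<omega> * dW N j \<omega>)"
  shows "D \<in> borel_measurable M" "integrable M (\<lambda>\<omega>. (D \<omega>)\<^sup>2)"
    "expectation (\<lambda>\<omega>. (D \<omega>)\<^sup>2) \<le> 2 * (tm N c - tm N a) * (B1 * u + v)"
    "\<And>G. G \<in> borel_measurable (F (tm N a)) \<Longrightarrow> (\<And>\<omega>. \<bar>G \<omega>\<bar> \<le> 1) \<Longrightarrow> \<bar>expectation (\<lambda>\<omega>. G \<omega> * D \<omega>)\<bar> \<le> (tm N c - tm N a) * u"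
proof -
  define \<delta> where "\<delta> = tm N c - tm N a"
  have \<delta>: "0 \<le> \<delta>" "\<delta> \<le> 1" "\<delta> = real (c - a) / 2 ^ N" 
    using ac le1 by (auto simp: \<delta>_def) (simp add: tm_def diff_divide_distrib of_nat_diff)
  define E where "E \<omega> = (\<Sum>j\<in>{a..<c}. A j \<omega> / 2 ^ N)" for \<omega>
  define S where "S \<omega> = (\<Sum>j\<in>{a..<c}. H j \<omega> * dW N j \<omega>)" for \<omega>
  define E' where "E' \<omega> = (\<Sum>j\<in>{a..<c}. \<bar>A j \<omega>\<bar> / 2 ^ N)" for \<omega>
  have B0: "0 \<le> B1" using AB[of 0 undefined] by linarith
  have Sm [measurable]: "S \<in> borel_measurable M"
    unfolding S_def by (rule measurable_F_M[OF mart_sum_measurable]) (use H in auto)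
  have [measurable]: "E \<in> borel_measurable M" "E' \<in> borel_measurable M" unfolding E_def E'_def by measurable
  have S2: "integrable M (\<lambda>\<omega>. (S \<omega>)\<^sup>2)" "expectation (\<lambda>\<omega>. (S \<omega>)\<^sup>2) = (\<Sum>j\<in>{a..<c}. expectation (\<lambda>\<omega>. (H j \<omega>)\<^sup>2)) / 2 ^ N"
    using mart_sum_L2[OF ac H HB] unfolding S_def by auto
  have "(\<Sum>j\<in>{a..<c}. expectation (\<lambda>\<omega>. (H j \<omega>)\<^sup>2)) \<le> real (card {a..<c}) * v"
    by (rule sum_bounded_above) (use v in auto)
  then have S2': "expectation (\<lambda>\<omega>. (S \<omega>)\<^sup>2) \<le> \<delta> * v"
    unfolding S2(2) \<delta>(3) by (simp add: divide_right_mono)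
  have iA: "integrable M (\<lambda>\<omega>. \<bar>A j \<omega>\<bar>)" for j by (rule integrable_boundedI[of _ B1]) (use AB in auto)
  have iE': "integrable M E'" unfolding E'_def by (intro Bochner_Integration.integrable_sum integrable_divide iA)
  have "expectation E' = (\<Sum>j\<in>{a..<c}. expectation (\<lambda>\<omega>. \<bar>A j \<omega>\<bar>)) / 2 ^ N"
    unfolding E'_def by (subst Bochner_Integration.integral_sum) (auto simp: sum_divide_distrib iA)
  also have "(\<Sum>j\<in>{a..<c}. expectation (\<lambda>\<omega>. \<bar>A j \<omega>\<bar>)) \<le> real (card {a..<c}) * u"
    by (rule sum_bounded_above) (use u in auto)
  finally have EE': "expectation E' \<le> \<delta> * u" unfolding \<delta>(3) by (simp add: divide_right_mono)
  have EleE': "\<bar>E \<omega>\<bar> \<le> E' \<omega>" for \<omega>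
    unfolding E_def E'_def by (rule order_trans[OF sum_abs]) simp
  have "(\<Sum>j\<in>{a..<c}. \<bar>A j \<omega>\<bar>) \<le> real (card {a..<c}) * B1" for \<omega>
    by (rule sum_bounded_above) (use AB in auto)
  then have E'b: "E' \<omega> \<le> \<delta> * B1" for \<omega>
    unfolding E'_def \<delta>(3) sum_divide_distrib[symmetric] by (simp add: divide_right_mono)
  have "\<delta> * B1 \<le> B1" using \<delta> B0 mult_right_mono[of \<delta> 1 B1] by simp
  \<comment> \<open>As the elapsed time is at most 1, the drift sum is at most \<open>B1\<close> in
    absolute value, and its square is bounded by a first moment, which \<open>u\<close>
    controls.\<close>
  have E2: "(E \<omega>)\<^sup>2 \<le> B1 * E' \<omega>" for \<omega>
  proof -
    have "(E \<omega>)\<^sup>2 = \<bar>E \<omega>\<bar> * \<bar>E \<omega>\<bar>" by (simp add: power2_eq_square)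
    also have "\<dots> \<le> B1 * E' \<omega>" 
      using EleE'[of \<omega>] E'b[of \<omega>] \<open>\<delta> * B1 \<le> B1\<close> by (intro mult_mono) auto
    finally show ?thesis .
  qed
  have D: "D = (\<lambda>\<omega>. E \<omega> + S \<omega>)" unfolding D_def E_def S_def ..
  show Dm [measurable]: "D \<in> borel_measurable M" unfolding D by measurable
  have "expectation (\<lambda>\<omega>. 2 * (B1 * E' \<omega>) + 2 * (S \<omega>)\<^sup>2) = 2 * (B1 * expectation E') + 2 * expectation (\<lambda>\<omega>. (S \<omega>)\<^sup>2)"
    using iE' S2(1) by simp
  also have "\<dots> \<le> 2 * (B1 * (\<delta> * u)) + 2 * (\<delta> * v)"
    using EE' S2' B0 by (intro add_mono mult_left_mono) auto
  finally have e: "expectation (\<lambda>\<omega>. 2 * (B1 * E' \<omega>) + 2 * (S \<omega>)\<^sup>2) \<le> 2 * \<delta> * (B1 * u + v)" by (simp add: algebra_simps)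
  have b: "\<bar>(D \<omega>)\<^sup>2\<bar> \<le> 2 * (B1 * E' \<omega>) + 2 * (S \<omega>)\<^sup>2" for \<omega>
    using square_add_le[of "E \<omega>" "S \<omega>"] E2[of \<omega>] unfolding D by simp
  have i: "integrable M (\<lambda>\<omega>. 2 * (B1 * E' \<omega>) + 2 * (S \<omega>)\<^sup>2)" using iE' S2(1) by simp
  show "integrable M (\<lambda>\<omega>. (D \<omega>)\<^sup>2)" by (rule abs_expectation_le(1)[OF _ i b]) measurable
  have "\<bar>expectation (\<lambda>\<omega>. (D \<omega>)\<^sup>2)\<bar> \<le> expectation (\<lambda>\<omega>. 2 * (B1 * E' \<omega>) + 2 * (S \<omega>)\<^sup>2)"
    by (rule abs_expectation_le(2)[OF _ i b]) measurable
  then show "expectation (\<lambda>\<omega>. (D \<omega>)\<^sup>2) \<le> 2 * (tm N c - tm N a) * (B1 * u + v)"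
    using e unfolding \<delta>_def by linarith
  fix G assume G: "G \<in> borel_measurable (F (tm N a))" "\<And>\<omega>. \<bar>G \<omega>\<bar> \<le> (1::real)"
  note [measurable] = measurable_F_M[OF G(1)]
  have GS: "expectation (\<lambda>\<omega>. G \<omega> * S \<omega>) = 0" unfolding S_def by (rule mart_sum_orth[OF H HB G])
  have bE: "\<bar>G \<omega> * E \<omega>\<bar> \<le> E' \<omega>" for \<omega>
    using mult_mono[OF G(2)[of \<omega>] EleE'[of \<omega>]] by (simp add: abs_mult)
  have GE: "integrable M (\<lambda>\<omega>. G \<omega> * E \<omega>)" "\<bar>expectation (\<lambda>\<omega>. G \<omega> * E \<omega>)\<bar> \<le> expectation E'"
    by (rule abs_expectation_le[OF _ iE' bE]; measurable)+
  have iS: "integrable M S" by (rule square_integrable_imp_integrable[OF Sm S2(1)])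
  have iGS: "integrable M (\<lambda>\<omega>. G \<omega> * S \<omega>)"
  proof (rule abs_expectation_le(1)[OF _ integrable_abs[OF iS]])
    show "\<bar>G \<omega> * S \<omega>\<bar> \<le> \<bar>S \<omega>\<bar>" for \<omega>
      using mult_right_mono[OF G(2)[of \<omega>], of "\<bar>S \<omega>\<bar>"] by (simp add: abs_mult)
  qed measurable
  have "expectation (\<lambda>\<omega>. G \<omega> * D \<omega>) = expectation (\<lambda>\<omega>. G \<omega> * E \<omega>) + expectation (\<lambda>\<omega>. G \<omega> * S \<omega>)"
    unfolding D distrib_left by (rule Bochner_Integration.integral_add[OF GE(1) iGS])
  then show "\<bar>expectation (\<lambda>\<omega>. G \<omega> * D \<omega>)\<bar> \<le> (tm N c - tm N a) * u"
    using GE(2) EE' GS unfolding \<delta>_def by linarith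
qed

lemma tm_refine: "tm (n + m) (a * 2 ^ m) = tm n a"
  by (simp add: tm_def power_add)

text \<open>The Euler sums satisfy this bound at every level of refinement, with
  \<open>2 * (bnd * bnd + bnd\<^sup>2)\<close>; \<open>conv_prob_L2_limit\<close> hands it on to the
  increments of X.\<close>

lemma incr_L2:
  assumes ac: "a \<le> c" and le1: "tm n c - tm n a \<le> 1"
  shows "integrable M (\<lambda>\<omega>. (X (tm n c) \<omega> - X (tm n a) \<omega>)\<^sup>2)"
    "expectation (\<lambda>\<omega>. (X (tm n c) \<omega> - X (tm n a) \<omega>)\<^sup>2) \<le> 4 * bnd\<^sup>2 * (tm n c - tm n a)"
proof -
  have \<sigma>2: "(\<sigma> x)\<^sup>2 \<le> bnd\<^sup>2" for x using \<sigma>_bnd[of x] bnd_ge_1 by (simp add: power2_le_iff_abs_le)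
  have e1: "expectation (\<lambda>\<omega>. \<bar>b (X (tm N j) \<omega>)\<bar>) \<le> bnd" for N j
    using b_bnd by (intro integral_le_const integrable_boundedI[of _ bnd] AE_I2) auto
  have e2: "expectation (\<lambda>\<omega>. (\<sigma> (X (tm N j) \<omega>))\<^sup>2) \<le> bnd\<^sup>2" for N j
    using \<sigma>2 by (intro integral_le_const integrable_boundedI[of _ "bnd\<^sup>2"] AE_I2) auto
  have \<sigma>F: "(\<lambda>\<omega>. \<sigma> (X (tm N j) \<omega>)) \<in> borel_measurable (F (tm N j))" for N j by (rule f_X_F) auto
  have D: "euler (n + m) (a * 2 ^ m) (c * 2 ^ m) \<in> borel_measurable M"
    "integrable M (\<lambda>\<omega>. (euler (n + m) (a * 2 ^ m) (c * 2 ^ m) \<omega>)\<^sup>2)"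
    "expectation (\<lambda>\<omega>. (euler (n + m) (a * 2 ^ m) (c * 2 ^ m) \<omega>)\<^sup>2) \<le> 2 * (tm n c - tm n a) * (bnd * bnd + bnd\<^sup>2)" for m
    using L2_drift_mart(1-3)[of "a * 2 ^ m" "c * 2 ^ m" "n + m" "\<lambda>j \<omega>. b (X (tm (n + m) j) \<omega>)" bnd 
        "\<lambda>j \<omega>. \<sigma> (X (tm (n + m) j) \<omega>)" bnd bnd "bnd\<^sup>2"] ac le1 e1 e2 b_bnd \<sigma>_bnd \<sigma>F
    unfolding tm_refine euler_def[abs_def] by auto
  have D3: "expectation (\<lambda>\<omega>. (euler (n + m) (a * 2 ^ m) (c * 2 ^ m) \<omega>)\<^sup>2) \<le> 4 * bnd\<^sup>2 * (tm n c - tm n a)" for m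
    using D(3)[of m] by (simp add: power2_eq_square algebra_simps)
  show "integrable M (\<lambda>\<omega>. (X (tm n c) \<omega> - X (tm n a) \<omega>)\<^sup>2)"
    "expectation (\<lambda>\<omega>. (X (tm n c) \<omega> - X (tm n a) \<omega>)\<^sup>2) \<le> 4 * bnd\<^sup>2 * (tm n c - tm n a)"
    by (rule conv_prob_L2_limit(1,2)[OF euler_conv[OF ac] D(1) _ D(2) D3]; measurable)+
qed

definition euler_err :: "nat \<Rightarrow> nat \<Rightarrow> nat \<Rightarrow> 'a \<Rightarrow> real" where
  "euler_err n a c \<omega> = X (tm n c) \<omega> - X (tm n a) \<omega> - b (X (tm n a) \<omega>) * (tm n c - tm n a)
     - \<sigma> (X (tm n a) \<omega>) * (W (tm n c) \<omega> - W (tm n a) \<omega>)"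

lemma W_tm [measurable]: "W (tm N j) \<in> borel_measurable M" by (rule W_M) simp

lemma euler_err_M [measurable]: "euler_err n a c \<in> borel_measurable M"
  unfolding euler_err_def by measurable

text \<open>The squared difference of \<sigma> is at most 2 \<open>bnd\<close> times the absolute
  difference, so the quadratic modulus of \<sigma>, taken at \<open>e / (2 * bnd)\<close>, serves
  for the square as well.\<close>

lemma coefficient_modulus:
  assumes e: "e > 0"
  obtains D where "D \<ge> 0" "\<And>x z. \<bar>b x - b z\<bar> \<le> e + D * (x - z)\<^sup>2" "\<And>x z. (\<sigma> x - \<sigma> z)\<^sup>2 \<le> e + D * (x - z)\<^sup>2"
proof -
  obtain D1 where D1: "D1 \<ge> 0" "\<And>x z. \<bar>b x - b z\<bar> \<le> e + D1 * (x - z)\<^sup>2"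
    using periodic_quadratic_modulus[of b, OF per_b cont_b e] by blast
  have e2: "e / (2 * bnd) > 0" using e bnd_ge_1 by simp
  obtain D2 where D2: "D2 \<ge> 0" "\<And>x z. \<bar>\<sigma> x - \<sigma> z\<bar> \<le> e / (2 * bnd) + D2 * (x - z)\<^sup>2"
    using periodic_quadratic_modulus[of \<sigma>, OF per_\<sigma> cont_\<sigma> e2] by blast
  show ?thesis
  proof (rule that[of "D1 + 2 * bnd * D2"])
    show "0 \<le> D1 + 2 * bnd * D2" using D1 D2 bnd_ge_1 by simp
    fix x z
    have "0 \<le> 2 * bnd * D2 * (x - z)\<^sup>2" "0 \<le> D1 * (x - z)\<^sup>2" using D1 D2 bnd_ge_1 by simp_all
    moreover have "(\<sigma> x - \<sigma> z)\<^sup>2 \<le> e + 2 * bnd * D2 * (x - z)\<^sup>2"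
    proof -
      have "(\<sigma> x - \<sigma> z)\<^sup>2 = \<bar>\<sigma> x - \<sigma> z\<bar> * \<bar>\<sigma> x - \<sigma> z\<bar>" by (simp add: power2_eq_square)
      also have "\<dots> \<le> (2 * bnd) * (e / (2 * bnd) + D2 * (x - z)\<^sup>2)"
        using D2(2)[of x z] \<sigma>_bnd[of x] \<sigma>_bnd[of z] bnd_ge_1 by (intro mult_mono) linarith+
      also have "\<dots> = e + 2 * bnd * D2 * (x - z)\<^sup>2" using bnd_ge_1 by (simp add: distrib_left)
      finally show ?thesis .
    qed
    ultimately show "\<bar>b x - b z\<bar> \<le> e + (D1 + 2 * bnd * D2) * (x - z)\<^sup>2" 
      "(\<sigma> x - \<sigma> z)\<^sup>2 \<le> e + (D1 + 2 * bnd * D2) * (x - z)\<^sup>2"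
      using D1(2)[of x z] unfolding distrib_right by linarith+
  qed
qed

lemma euler_err_small:
  assumes e: "e > 0"
  obtains Q where "Q \<ge> 0" 
    "\<And>n a c. a \<le> c \<Longrightarrow> tm n c - tm n a \<le> 1 \<Longrightarrow> integrable M (\<lambda>\<omega>. (euler_err n a c \<omega>)\<^sup>2)"
    "\<And>n a c. a \<le> c \<Longrightarrow> tm n c - tm n a \<le> 1 \<Longrightarrow> 
       expectation (\<lambda>\<omega>. (euler_err n a c \<omega>)\<^sup>2) \<le> 2 * (2 * bnd + 1) * (tm n c - tm n a) * (e + Q * (tm n c - tm n a))"
    "\<And>n a c G. a \<le> c \<Longrightarrow> tm n c - tm n a \<le> 1 \<Longrightarrow> G \<in> borel_measurable (F (tm n a)) \<Longrightarrow> (\<And>\<omega>. \<bar>G \<omega>\<bar> \<le> 1) \<Longrightarrow>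
       \<bar>expectation (\<lambda>\<omega>. G \<omega> * euler_err n a c \<omega>)\<bar> \<le> (tm n c - tm n a) * (e + Q * (tm n c - tm n a))"
proof -
  obtain D where D: "D \<ge> 0" "\<And>x z. \<bar>b x - b z\<bar> \<le> e + D * (x - z)\<^sup>2" "\<And>x z. (\<sigma> x - \<sigma> z)\<^sup>2 \<le> e + D * (x - z)\<^sup>2"
    using coefficient_modulus[OF e] by blast
  \<comment> \<open>The modulus constant \<open>D\<close> times the bound
    \<open>4 * bnd\<^sup>2\<close> for squared increments per unit of time
    (\<open>incr_L2\<close>).\<close>
  define Q where "Q = D * (4 * bnd\<^sup>2)"
  have *: "integrable M (\<lambda>\<omega>. (euler_err n a c \<omega>)\<^sup>2) \<and>
     expectation (\<lambda>\<omega>. (euler_err n a c \<omega>)\<^sup>2) \<le> 2 * (2 * bnd + 1) * (tm n c - tm n a) * (e + Q * (tm n c - tm n a)) \<and>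
     (\<forall>G. G \<in> borel_measurable (F (tm n a)) \<longrightarrow> (\<forall>\<omega>. \<bar>G \<omega>\<bar> \<le> 1) \<longrightarrow>
       \<bar>expectation (\<lambda>\<omega>. G \<omega> * euler_err n a c \<omega>)\<bar> \<le> (tm n c - tm n a) * (e + Q * (tm n c - tm n a)))"
    if ac: "a \<le> c" and le1: "tm n c - tm n a \<le> 1" for n a c
  proof -
    define \<delta> where "\<delta> = tm n c - tm n a"
    define x where "x \<omega> = X (tm n a) \<omega>" for \<omega>
    define v where "v = e + Q * \<delta>"
    define A where "A m j \<omega> = b (X (tm (n + m) j) \<omega>) - b (x \<omega>)" for m j \<omega>
    define H where "H m j \<omega> = \<sigma> (X (tm (n + m) j) \<omega>) - \<sigma> (x \<omega>)" for m j \<omega>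
    have xm [measurable]: "x \<in> borel_measurable M" unfolding x_def by measurable
    have Am [measurable]: "A m j \<in> borel_measurable M" for m j unfolding A_def by measurable
    have Hm [measurable]: "H m j \<in> borel_measurable M" for m j unfolding H_def by measurable
    have AB: "\<bar>A m j \<omega>\<bar> \<le> 2 * bnd" for m j \<omega>
      unfolding A_def using b_bnd[of "X (tm (n + m) j) \<omega>"] b_bnd[of "x \<omega>"] by linarith
    have HB: "\<bar>H m j \<omega>\<bar> \<le> 2 * bnd" for m j \<omega>
      unfolding H_def using \<sigma>_bnd[of "X (tm (n + m) j) \<omega>"] \<sigma>_bnd[of "x \<omega>"] by linarith
    have HF: "H m j \<in> borel_measurable (F (tm (n + m) j))" if "a * 2 ^ m \<le> j" for m j
    proof -
      have "tm n a \<le> tm (n + m) j" using that unfolding tm_refine[of n m a, symmetric] by simp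
      then show ?thesis unfolding H_def x_def by (intro borel_measurable_diff f_X_F) auto
    qed
    have uv: "expectation (\<lambda>\<omega>. \<bar>A m j \<omega>\<bar>) \<le> v" "expectation (\<lambda>\<omega>. (H m j \<omega>)\<^sup>2) \<le> v" 
      if j: "a * 2 ^ m \<le> j" "j < c * 2 ^ m" for m j
    proof -
      have d: "tm (n + m) j - tm n a \<le> \<delta>" 
        using j(2) unfolding \<delta>_def tm_refine[of n m c, symmetric] by simp
      have inc: "integrable M (\<lambda>\<omega>. (X (tm (n + m) j) \<omega> - x \<omega>)\<^sup>2)"
         "expectation (\<lambda>\<omega>. (X (tm (n + m) j) \<omega> - x \<omega>)\<^sup>2) \<le> 4 * bnd\<^sup>2 * (tm (n + m) j - tm n a)"
        using incr_L2[of "a * 2 ^ m" j "n + m"] j d le1 unfolding tm_refine \<delta>_def x_def by auto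
      have "4 * bnd\<^sup>2 * (tm (n + m) j - tm n a) \<le> 4 * bnd\<^sup>2 * \<delta>" by (rule mult_left_mono[OF d]) simp
      then have "D * expectation (\<lambda>\<omega>. (X (tm (n + m) j) \<omega> - x \<omega>)\<^sup>2) \<le> D * (4 * bnd\<^sup>2 * \<delta>)"
        using inc(2) D(1) by (intro mult_left_mono) linarith+
      then have 1: "expectation (\<lambda>\<omega>. e + D * (X (tm (n + m) j) \<omega> - x \<omega>)\<^sup>2) \<le> v"
        using inc(1) by (simp add: v_def Q_def prob_space mult.assoc)
      have i: "integrable M (\<lambda>\<omega>. e + D * (X (tm (n + m) j) \<omega> - x \<omega>)\<^sup>2)" using inc(1) by simp
      have "\<bar>expectation (\<lambda>\<omega>. \<bar>A m j \<omega>\<bar>)\<bar> \<le> expectation (\<lambda>\<omega>. e + D * (X (tm (n + m) j) \<omega> - x \<omega>)\<^sup>2)"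
        by (rule abs_expectation_le(2)[OF _ i]) (use D(2) in \<open>auto simp: A_def\<close>)
      then show "expectation (\<lambda>\<omega>. \<bar>A m j \<omega>\<bar>) \<le> v" using 1 by linarith
      have "\<bar>expectation (\<lambda>\<omega>. (H m j \<omega>)\<^sup>2)\<bar> \<le> expectation (\<lambda>\<omega>. e + D * (X (tm (n + m) j) \<omega> - x \<omega>)\<^sup>2)"
        by (rule abs_expectation_le(2)[OF _ i]) (use D(3) in \<open>auto simp: H_def\<close>)
      then show "expectation (\<lambda>\<omega>. (H m j \<omega>)\<^sup>2) \<le> v" using 1 by linarith
    qed
    define Z where "Z m \<omega> = (\<Sum>j\<in>{a * 2 ^ m..<c * 2 ^ m}. A m j \<omega> / 2 ^ (n + m)) +
       (\<Sum>j\<in>{a * 2 ^ m..<c * 2 ^ m}. H m j \<omega> * dW (n + m) j \<omega>)" for m \<omega>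
    have ac': "a * 2 ^ m \<le> c * 2 ^ m" for m using ac by simp
    \<comment> \<open>Frozen coefficients summed over the refined grid reproduce the single coarse
      Euler step exactly, so \<open>Z m\<close> tends to \<open>euler_err\<close>.\<close>
    have Zeq: "Z m \<omega> = euler (n + m) (a * 2 ^ m) (c * 2 ^ m) \<omega> - b (x \<omega>) * \<delta> - \<sigma> (x \<omega>) * (W (tm n c) \<omega> - W (tm n a) \<omega>)" for m \<omega>
    proof -
      have 1: "(\<Sum>j\<in>{a * 2 ^ m..<c * 2 ^ m}. dW (n + m) j \<omega>) = W (tm n c) \<omega> - W (tm n a) \<omega>"
        unfolding dW_def using ac' by (subst sum_Suc_diff') (auto simp: tm_refine)
      have 2: "(\<Sum>j\<in>{a * 2 ^ m..<c * 2 ^ m}. 1 / 2 ^ (n + m)) = \<delta>"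
        using ac by (simp add: \<delta>_def tm_def of_nat_diff power_add field_simps)
      have "Z m \<omega> = euler (n + m) (a * 2 ^ m) (c * 2 ^ m) \<omega> - b (x \<omega>) * (\<Sum>j\<in>{a * 2 ^ m..<c * 2 ^ m}. 1 / 2 ^ (n + m))
         - \<sigma> (x \<omega>) * (\<Sum>j\<in>{a * 2 ^ m..<c * 2 ^ m}. dW (n + m) j \<omega>)"
        unfolding Z_def euler_def A_def H_def 
        by (simp add: left_diff_distrib sum_subtractf diff_divide_distrib sum_distrib_left)
      then show ?thesis unfolding 1 2 .
    qed
    have conv: "conv_prob (\<lambda>m \<omega>. Z m \<omega> - euler_err n a c \<omega>)"
    proof -
      have "Z m \<omega> - euler_err n a c \<omega> = euler (n + m) (a * 2 ^ m) (c * 2 ^ m) \<omega> - (X (tm n c) \<omega> - X (tm n a) \<omega>)" for m \<omega>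
        unfolding Zeq euler_err_def x_def \<delta>_def by simp
      then show ?thesis using euler_conv[OF ac, of n] by simp
    qed
    have Zf: "(\<lambda>\<omega>. (\<Sum>j\<in>{a * 2 ^ m..<c * 2 ^ m}. A m j \<omega> / 2 ^ (n + m)) +
       (\<Sum>j\<in>{a * 2 ^ m..<c * 2 ^ m}. H m j \<omega> * dW (n + m) j \<omega>)) = Z m" for m unfolding Z_def ..
    have le1': "tm (n + m) (c * 2 ^ m) - tm (n + m) (a * 2 ^ m) \<le> 1" for m using le1 by (simp add: tm_refine)
    have L2: "Z m \<in> borel_measurable M" "integrable M (\<lambda>\<omega>. (Z m \<omega>)\<^sup>2)"
      "expectation (\<lambda>\<omega>. (Z m \<omega>)\<^sup>2) \<le> 2 * \<delta> * (2 * bnd * v + v)"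
      "\<And>G. G \<in> borel_measurable (F (tm n a)) \<Longrightarrow> (\<And>\<omega>. \<bar>G \<omega>\<bar> \<le> 1) \<Longrightarrow> \<bar>expectation (\<lambda>\<omega>. G \<omega> * Z m \<omega>)\<bar> \<le> \<delta> * v" for m
    proof -
      note * = L2_drift_mart[of "a * 2 ^ m" "c * 2 ^ m" "n + m" "A m" "2 * bnd" "H m" "2 * bnd" v v, 
          OF ac' le1' Am AB _ HB, unfolded Zf]
      have Zm: "Z m \<omega> = (\<Sum>j\<in>{a * 2 ^ m..<c * 2 ^ m}. A m j \<omega> / 2 ^ (n + m)) +
       (\<Sum>j\<in>{a * 2 ^ m..<c * 2 ^ m}. H m j \<omega> * dW (n + m) j \<omega>)" for \<omega> by (simp add: Z_def)
      show "Z m \<in> borel_measurable M" by (rule *(1)) (simp_all add: HF uv)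
      show "integrable M (\<lambda>\<omega>. (Z m \<omega>)\<^sup>2)" unfolding Zm by (rule *(2)) (simp_all add: HF uv)
      show "expectation (\<lambda>\<omega>. (Z m \<omega>)\<^sup>2) \<le> 2 * \<delta> * (2 * bnd * v + v)"
        unfolding Zm \<delta>_def tm_refine[of n m a, symmetric] tm_refine[of n m c, symmetric]
        by (rule *(3)) (simp_all add: HF uv)
      fix G assume "G \<in> borel_measurable (F (tm n a))" "\<And>\<omega>. \<bar>G \<omega>\<bar> \<le> (1::real)"
      then show "\<bar>expectation (\<lambda>\<omega>. G \<omega> * Z m \<omega>)\<bar> \<le> \<delta> * v"
        unfolding Zm \<delta>_def tm_refine[of n m a, symmetric] tm_refine[of n m c, symmetric]
        by (intro *(4)) (simp_all add: HF uv)
    qed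
    have Zm [measurable]: "Z m \<in> borel_measurable M" for m using L2(1) .
    have Z2: "expectation (\<lambda>\<omega>. (Z m \<omega>)\<^sup>2) \<le> 2 * (2 * bnd + 1) * \<delta> * v" for m
      using L2(3)[of m] by (simp add: algebra_simps)
    note lim = conv_prob_L2_limit[OF conv Zm euler_err_M L2(2) Z2]
    show ?thesis unfolding \<delta>_def[symmetric] v_def[symmetric]
    proof (intro conjI allI impI lim(1,2))
      fix G assume G: "G \<in> borel_measurable (F (tm n a))" "\<forall>\<omega>. \<bar>G \<omega>\<bar> \<le> (1::real)"
      note [measurable] = measurable_F_M[OF G(1)]
      have iZ: "integrable M (Z m)" for m by (rule square_integrable_imp_integrable[OF Zm L2(2)])
      have iE: "integrable M (euler_err n a c)" by (rule square_integrable_imp_integrable[OF euler_err_M lim(1)])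
      have Gle: "\<bar>G \<omega> * z\<bar> \<le> \<bar>z\<bar>" for \<omega> z
        using mult_right_mono[OF G(2)[rule_format, of \<omega>], of "\<bar>z\<bar>"] by (simp add: abs_mult)
      have iGZ: "integrable M (\<lambda>\<omega>. G \<omega> * Z m \<omega>)" for m
        by (rule abs_expectation_le(1)[OF _ integrable_abs[OF iZ[of m]] Gle]) measurable
      have iGE: "integrable M (\<lambda>\<omega>. G \<omega> * euler_err n a c \<omega>)"
        by (rule abs_expectation_le(1)[OF _ integrable_abs[OF iE] Gle]) measurable
      have le: "\<bar>expectation (\<lambda>\<omega>. G \<omega> * euler_err n a c \<omega>)\<bar> \<le> \<delta> * v + expectation (\<lambda>\<omega>. \<bar>Z m \<omega> - euler_err n a c \<omega>\<bar>)" for m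
      proof -
        have "expectation (\<lambda>\<omega>. G \<omega> * Z m \<omega>) - expectation (\<lambda>\<omega>. G \<omega> * euler_err n a c \<omega>) = 
          expectation (\<lambda>\<omega>. G \<omega> * (Z m \<omega> - euler_err n a c \<omega>))"
          unfolding right_diff_distrib by (rule Bochner_Integration.integral_diff[OF iGZ iGE, symmetric])
        moreover have "\<bar>expectation (\<lambda>\<omega>. G \<omega> * (Z m \<omega> - euler_err n a c \<omega>))\<bar> \<le> expectation (\<lambda>\<omega>. \<bar>Z m \<omega> - euler_err n a c \<omega>\<bar>)"
          using iZ[of m] iE by (intro abs_expectation_le(2) Gle) auto
        moreover have "\<bar>expectation (\<lambda>\<omega>. G \<omega> * Z m \<omega>)\<bar> \<le> \<delta> * v" using L2(4)[of G m] G by blast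
        ultimately show ?thesis by linarith
      qed
      have "(\<lambda>m. \<delta> * v + expectation (\<lambda>\<omega>. \<bar>Z m \<omega> - euler_err n a c \<omega>\<bar>)) \<longlonglongrightarrow> \<delta> * v + 0"
        by (intro tendsto_add tendsto_const lim(3))
      then show "\<bar>expectation (\<lambda>\<omega>. G \<omega> * euler_err n a c \<omega>)\<bar> \<le> \<delta> * v"
        using le by (intro LIMSEQ_le_const[where X="\<lambda>m. \<delta> * v + expectation (\<lambda>\<omega>. \<bar>Z m \<omega> - euler_err n a c \<omega>\<bar>)"]) auto
    qed
  qed
  show ?thesis by (rule that[of Q]) (use * D(1) in \<open>auto simp: Q_def\<close>)
qed

end

context sde
begin

text \<open>The one-step Ito formula: compare the solution with the Euler step \<open>x + h\<close>, expand to second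
  order there, and bound the Euler error \<open>d\<close> by its second moment.\<close>
lemma ito_step:
  fixes g g' g'' :: "real \<Rightarrow> real"
  assumes g: "\<And>x. (g has_real_derivative g' x) (at x)" "\<And>x. (g' has_real_derivative g'' x) (at x)"
    and B: "1 \<le> B" "\<And>x. \<bar>g x\<bar> \<le> B" "\<And>x. \<bar>g' x\<bar> \<le> B" "\<And>x. \<bar>g'' x\<bar> \<le> B" 
    and cont: "continuous_on UNIV g''" and e: "\<epsilon> > 0"
  obtains \<delta>0 where "0 < \<delta>0" 
    "\<And>n a c G. a < c \<Longrightarrow> tm n c - tm n a \<le> \<delta>0 \<Longrightarrow> G \<in> borel_measurable (F (tm n a)) \<Longrightarrow> (\<And>\<omega>. \<bar>G \<omega>\<bar> \<le> 1) \<Longrightarrow>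
       (\<And>\<omega>. \<omega> \<in> space M \<Longrightarrow> G \<omega> \<noteq> 0 \<Longrightarrow> \<bar>X (tm n a) \<omega> - z\<bar> \<le> 1) \<Longrightarrow>
       \<bar>expectation (\<lambda>\<omega>. G \<omega> * (g (X (tm n c) \<omega>) - g (X (tm n a) \<omega>) - (tm n c - tm n a) * 
          (b (X (tm n a) \<omega>) * g' (X (tm n a) \<omega>) + (\<sigma> (X (tm n a) \<omega>))\<^sup>2 / 2 * g'' (X (tm n a) \<omega>))))\<bar> \<le> \<epsilon> * (tm n c - tm n a)"
proof -
  define K where "K = bnd"
  have K: "1 \<le> K" using bnd_ge_1 by (simp add: K_def)
  \<comment> \<open>Each error of first order in \<delta> is allotted \<epsilon>/8:
    \<open>e1\<close> is tuned to the Taylor remainder of the Euler step, \<open>\<eta>\<close> to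
    the mixed term of step and error, \<open>e0\<close> to the Euler error. \<open>L\<close>
    collects the coefficients of second order, and \<open>\<delta>0\<close> makes their contribution
    at most another \<epsilon>/8.\<close>
  define e1 where "e1 = \<epsilon> / (32 * K\<^sup>2)"
  have e1: "e1 > 0" "e1 * (4 * K\<^sup>2) = \<epsilon> / 8" using e K by (auto simp: e1_def)
  obtain D where D: "D \<ge> 0" "\<And>x h. \<bar>x - z\<bar> \<le> 1 \<Longrightarrow> \<bar>g (x + h) - g x - g' x * h - g'' x / 2 * h\<^sup>2\<bar> \<le> e1 * h\<^sup>2 + D * h ^ 4"
    using taylor2_remainder[OF g B(4) cont e1(1)] by metis
  define \<eta> where "\<eta> = \<epsilon> / (16 * B * K\<^sup>2)"
  have \<eta>: "\<eta> > 0" "B / 2 * \<eta> * (4 * K\<^sup>2) = \<epsilon> / 8" using e K B(1) by (auto simp: \<eta>_def)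
  define R where "R = 2 * (2 * K + 1)"
  have R: "R > 0" using K by (simp add: R_def)
  define C where "C = B + B / (2 * \<eta>)"
  have C: "C > 0" using B(1) \<eta> by (simp add: C_def add_pos_pos)
  define P where "P = C * R + B"
  have P: "P > 0" using C R B(1) by (simp add: P_def add_pos_pos)
  define e0 where "e0 = \<epsilon> / (8 * P)"
  have e0: "e0 > 0" "P * e0 = \<epsilon> / 8" using e P by (auto simp: e0_def)
  obtain Q where Q: "Q \<ge> 0" 
    "\<And>n a c. a \<le> c \<Longrightarrow> tm n c - tm n a \<le> 1 \<Longrightarrow> integrable M (\<lambda>\<omega>. (euler_err n a c \<omega>)\<^sup>2)"
    "\<And>n a c. a \<le> c \<Longrightarrow> tm n c - tm n a \<le> 1 \<Longrightarrow> 
       expectation (\<lambda>\<omega>. (euler_err n a c \<omega>)\<^sup>2) \<le> 2 * (2 * bnd + 1) * (tm n c - tm n a) * (e0 + Q * (tm n c - tm n a))"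
    "\<And>n a c G. a \<le> c \<Longrightarrow> tm n c - tm n a \<le> 1 \<Longrightarrow> G \<in> borel_measurable (F (tm n a)) \<Longrightarrow> (\<And>\<omega>. \<bar>G \<omega>\<bar> \<le> 1) \<Longrightarrow>
       \<bar>expectation (\<lambda>\<omega>. G \<omega> * euler_err n a c \<omega>)\<bar> \<le> (tm n c - tm n a) * (e0 + Q * (tm n c - tm n a))"
    by (rule euler_err_small[OF e0(1)]) blast
  define L where "L = 1 + 32 * D * K ^ 4 + B * K\<^sup>2 / 2 + P * Q"
  have L: "L \<ge> 1" using D(1) B(1) P Q(1) by (simp add: L_def)
  define \<delta>0 where "\<delta>0 = min 1 (\<epsilon> / (8 * L))"
  have \<delta>0: "0 < \<delta>0" "\<delta>0 \<le> 1" "L * \<delta>0 \<le> \<epsilon> / 8" 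
    using e L by (auto simp: \<delta>0_def min_def field_simps)
  have contg: "continuous_on UNIV g" "continuous_on UNIV g'"
    using g by (auto intro!: DERIV_continuous_on simp: has_field_derivative_at_within)
  have [measurable]: "g \<in> borel_measurable borel" "g' \<in> borel_measurable borel" "g'' \<in> borel_measurable borel"
    using contg cont by (auto intro: borel_measurable_continuous_onI)
  have lip: "\<bar>g' u - g' v\<bar> \<le> B * \<bar>u - v\<bar>" for u v
    using field_differentiable_bound[of UNIV g' g'' B u v] g(2) B(4) by simp
  show ?thesis
  proof (rule that[OF \<delta>0(1)])
    fix n a c and G :: "'a \<Rightarrow> real"
    assume ac: "a < c" and small: "tm n c - tm n a \<le> \<delta>0" and G: "G \<in> borel_measurable (F (tm n a))"
      "\<And>\<omega>. \<bar>G \<omega>\<bar> \<le> 1" "\<And>\<omega>. \<omega> \<in> space M \<Longrightarrow> G \<omega> \<noteq> 0 \<Longrightarrow> \<bar>X (tm n a) \<omega> - z\<bar> \<le> 1"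
    define \<delta> where "\<delta> = tm n c - tm n a"
    define s where "s = tm n a"
    define t where "t = tm n c"
    have st: "0 \<le> s" "s < t" using ac by (auto simp: s_def t_def)
    have \<delta>: "0 < \<delta>" "\<delta> \<le> \<delta>0" "\<delta> \<le> 1" "t - s = \<delta>" using ac small \<delta>0 by (auto simp: \<delta>_def s_def t_def)
    define v where "v = e0 + Q * \<delta>"
    have v: "0 \<le> v" using e0 Q(1) \<delta> by (simp add: v_def)
    define x where "x = X s"
    define w where "w \<omega> = W t \<omega> - W s \<omega>" for \<omega>
    define h where "h \<omega> = b (x \<omega>) * \<delta> + \<sigma> (x \<omega>) * w \<omega>" for \<omega>
    define d where "d = euler_err n a c"
    have Xt: "X t \<omega> = x \<omega> + h \<omega> + d \<omega>" for \<omega>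
      by (simp add: d_def euler_err_def x_def h_def w_def \<delta>_def s_def t_def)
    have xF: "x \<in> borel_measurable (F s)" unfolding x_def using st by (intro X_F)
    have GF: "G \<in> borel_measurable (F s)" using G(1) by (simp add: s_def)
    have [measurable]: "x \<in> borel_measurable M" "w \<in> borel_measurable M" "d \<in> borel_measurable M" "G \<in> borel_measurable M"
      "X t \<in> borel_measurable M"
      using measurable_F_M[OF xF] measurable_F_M[OF GF] W_M[of s] W_M[of t] X_M[of t] st by (auto simp: w_def[abs_def] d_def)
    have [measurable]: "h \<in> borel_measurable M" unfolding h_def by measurable
    have fxF: "(\<lambda>\<omega>. f (x \<omega>)) \<in> borel_measurable (F s)" if "f \<in> borel_measurable borel" for f :: "real \<Rightarrow> real"
      using that xF by measurable
    have iw2: "integrable M (\<lambda>\<omega>. (w \<omega>)\<^sup>2)" "expectation (\<lambda>\<omega>. (w \<omega>)\<^sup>2) = \<delta>"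
      and iw4: "integrable M (\<lambda>\<omega>. (w \<omega>) ^ 4)" "expectation (\<lambda>\<omega>. (w \<omega>) ^ 4) = 3 * \<delta>\<^sup>2"
      using W_incr_moment(1)[OF st, of 2] W_incr_moment(3)[OF st] W_incr_moment(1)[OF st, of 4] W_incr_moment(4)[OF st]
      unfolding \<delta>(4) w_def by auto
    have bK: "\<bar>b u\<bar> \<le> K" "\<bar>\<sigma> u\<bar> \<le> K" "(b u)\<^sup>2 \<le> K\<^sup>2" "(\<sigma> u)\<^sup>2 \<le> K\<^sup>2" for u
      using b_bnd[of u] \<sigma>_bnd[of u] K by (auto simp: K_def power2_le_iff_abs_le)
    have h2: "(h \<omega>)\<^sup>2 \<le> 2 * K\<^sup>2 * \<delta>\<^sup>2 + 2 * K\<^sup>2 * (w \<omega>)\<^sup>2" for \<omega>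
    proof -
      have "(b (x \<omega>))\<^sup>2 * \<delta>\<^sup>2 \<le> K\<^sup>2 * \<delta>\<^sup>2" "(\<sigma> (x \<omega>))\<^sup>2 * (w \<omega>)\<^sup>2 \<le> K\<^sup>2 * (w \<omega>)\<^sup>2"
        by (auto intro!: mult_right_mono bK)
      then show ?thesis using square_add_le[of "b (x \<omega>) * \<delta>" "\<sigma> (x \<omega>) * w \<omega>"] 
        unfolding h_def power_mult_distrib by linarith
    qed
    have h4: "(h \<omega>) ^ 4 \<le> 8 * K ^ 4 * \<delta> ^ 4 + 8 * K ^ 4 * (w \<omega>) ^ 4" for \<omega>
    proof -
      have "(h \<omega>) ^ 4 = ((h \<omega>)\<^sup>2)\<^sup>2" by simp
      also have "\<dots> \<le> (2 * K\<^sup>2 * \<delta>\<^sup>2 + 2 * K\<^sup>2 * (w \<omega>)\<^sup>2)\<^sup>2" by (intro power_mono h2) simp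
      also have "\<dots> \<le> 2 * (2 * K\<^sup>2 * \<delta>\<^sup>2)\<^sup>2 + 2 * (2 * K\<^sup>2 * (w \<omega>)\<^sup>2)\<^sup>2" by (rule square_add_le)
      also have "\<dots> = 8 * K ^ 4 * \<delta> ^ 4 + 8 * K ^ 4 * (w \<omega>) ^ 4" by (simp add: power_mult_distrib)
      finally show ?thesis .
    qed
    have \<delta>2: "\<delta>\<^sup>2 \<le> \<delta>" "\<delta> ^ 4 \<le> \<delta>\<^sup>2" using \<delta> power_decreasing[of 1 2 \<delta>] power_decreasing[of 2 4 \<delta>] by auto
    have ih2: "integrable M (\<lambda>\<omega>. (h \<omega>)\<^sup>2)" and Eh2: "expectation (\<lambda>\<omega>. (h \<omega>)\<^sup>2) \<le> 4 * K\<^sup>2 * \<delta>"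
    proof -
      have i: "integrable M (\<lambda>\<omega>. 2 * K\<^sup>2 * \<delta>\<^sup>2 + 2 * K\<^sup>2 * (w \<omega>)\<^sup>2)" using iw2 by simp
      have le: "\<bar>(h \<omega>)\<^sup>2\<bar> \<le> 2 * K\<^sup>2 * \<delta>\<^sup>2 + 2 * K\<^sup>2 * (w \<omega>)\<^sup>2" for \<omega> using h2[of \<omega>] by simp
      show "integrable M (\<lambda>\<omega>. (h \<omega>)\<^sup>2)" by (rule abs_expectation_le(1)[OF _ i le]) measurable
      have "\<bar>expectation (\<lambda>\<omega>. (h \<omega>)\<^sup>2)\<bar> \<le> expectation (\<lambda>\<omega>. 2 * K\<^sup>2 * \<delta>\<^sup>2 + 2 * K\<^sup>2 * (w \<omega>)\<^sup>2)" 
        by (rule abs_expectation_le(2)[OF _ i le]) measurable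
      also have "\<dots> = 2 * K\<^sup>2 * \<delta>\<^sup>2 + 2 * K\<^sup>2 * \<delta>" using iw2 by (simp add: prob_space)
      also have "2 * K\<^sup>2 * \<delta>\<^sup>2 \<le> 2 * K\<^sup>2 * \<delta>" using \<delta>2 by (intro mult_left_mono) auto
      finally show "expectation (\<lambda>\<omega>. (h \<omega>)\<^sup>2) \<le> 4 * K\<^sup>2 * \<delta>" by (simp add: mult_ac)
    qed
    have ih4: "integrable M (\<lambda>\<omega>. (h \<omega>) ^ 4)" and Eh4: "expectation (\<lambda>\<omega>. (h \<omega>) ^ 4) \<le> 32 * K ^ 4 * \<delta>\<^sup>2"
    proof -
      have i: "integrable M (\<lambda>\<omega>. 8 * K ^ 4 * \<delta> ^ 4 + 8 * K ^ 4 * (w \<omega>) ^ 4)" using iw4 by simp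
      have le: "\<bar>(h \<omega>) ^ 4\<bar> \<le> 8 * K ^ 4 * \<delta> ^ 4 + 8 * K ^ 4 * (w \<omega>) ^ 4" for \<omega> using h4[of \<omega>] by simp
      show "integrable M (\<lambda>\<omega>. (h \<omega>) ^ 4)" by (rule abs_expectation_le(1)[OF _ i le]) measurable
      have "\<bar>expectation (\<lambda>\<omega>. (h \<omega>) ^ 4)\<bar> \<le> expectation (\<lambda>\<omega>. 8 * K ^ 4 * \<delta> ^ 4 + 8 * K ^ 4 * (w \<omega>) ^ 4)" 
        by (rule abs_expectation_le(2)[OF _ i le]) measurable
      also have "\<dots> = 8 * K ^ 4 * \<delta> ^ 4 + 8 * K ^ 4 * (3 * \<delta>\<^sup>2)" using iw4 by (simp add: prob_space)
      also have "8 * K ^ 4 * \<delta> ^ 4 \<le> 8 * K ^ 4 * \<delta>\<^sup>2" using \<delta>2 by (intro mult_left_mono) auto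
      finally show "expectation (\<lambda>\<omega>. (h \<omega>) ^ 4) \<le> 32 * K ^ 4 * \<delta>\<^sup>2" by (simp add: mult_ac)
    qed
    have id2: "integrable M (\<lambda>\<omega>. (d \<omega>)\<^sup>2)" and Ed2: "expectation (\<lambda>\<omega>. (d \<omega>)\<^sup>2) \<le> R * \<delta> * v"
      using Q(2,3)[of a c n] ac \<delta> unfolding d_def \<delta>_def[symmetric] R_def K_def v_def by auto
    have Gle: "\<bar>G \<omega> * u\<bar> \<le> \<bar>u\<bar>" for \<omega> u
      using mult_right_mono[OF G(2)[of \<omega>], of "\<bar>u\<bar>"] by (simp add: abs_mult)

    \<comment> \<open>The increment of g is split at x + h: \<open>T1\<close> is the remainder of
      the Euler step h, \<open>T4\<close> that of the Euler error d with the slope frozen at x, and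
      \<open>T5\<close> is the linear effect of d.\<close>
    define T1 where "T1 \<omega> = G \<omega> * (g (x \<omega> + h \<omega>) - g (x \<omega>) - g' (x \<omega>) * h \<omega> - g'' (x \<omega>) / 2 * (h \<omega>)\<^sup>2)" for \<omega>
    have [measurable]: "T1 \<in> borel_measurable M" unfolding T1_def by measurable
    have T1le: "\<bar>T1 \<omega>\<bar> \<le> e1 * (h \<omega>)\<^sup>2 + D * (h \<omega>) ^ 4" if w: "\<omega> \<in> space M" for \<omega>
    proof (cases "G \<omega> = 0")
      case True
      then show ?thesis using e1 D(1) by (simp add: T1_def)
    next
      case False
      then have "\<bar>x \<omega> - z\<bar> \<le> 1" using G(3)[OF w] by (simp add: x_def s_def)
      from order_trans[OF Gle D(2)[OF this, of "h \<omega>"]] show ?thesis unfolding T1_def .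
    qed
    have i1: "integrable M (\<lambda>\<omega>. e1 * (h \<omega>)\<^sup>2 + D * (h \<omega>) ^ 4)" using ih2 ih4 by simp
    have iT1: "integrable M T1" and ET1: "\<bar>expectation T1\<bar> \<le> \<epsilon> / 8 * \<delta> + 32 * D * K ^ 4 * \<delta>\<^sup>2"
    proof -
      show "integrable M T1" by (rule abs_expectation_le(1)[OF _ i1 T1le]) measurable
      have "\<bar>expectation T1\<bar> \<le> expectation (\<lambda>\<omega>. e1 * (h \<omega>)\<^sup>2 + D * (h \<omega>) ^ 4)" 
        by (rule abs_expectation_le(2)[OF _ i1 T1le]) measurable
      also have "\<dots> = e1 * expectation (\<lambda>\<omega>. (h \<omega>)\<^sup>2) + D * expectation (\<lambda>\<omega>. (h \<omega>) ^ 4)" using ih2 ih4 by simp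
      also have "\<dots> \<le> e1 * (4 * K\<^sup>2 * \<delta>) + D * (32 * K ^ 4 * \<delta>\<^sup>2)"
        using Eh2 Eh4 e1 D(1) by (intro add_mono mult_left_mono) auto
      also have "e1 * (4 * K\<^sup>2 * \<delta>) = \<epsilon> / 8 * \<delta>" using e1(2) by (simp only: mult.assoc[symmetric])
      finally show "\<bar>expectation T1\<bar> \<le> \<epsilon> / 8 * \<delta> + 32 * D * K ^ 4 * \<delta>\<^sup>2" by (simp add: mult_ac)
    qed

    define T4 where "T4 \<omega> = G \<omega> * (g (X t \<omega>) - g (x \<omega> + h \<omega>) - g' (x \<omega>) * d \<omega>)" for \<omega>
    have [measurable]: "T4 \<in> borel_measurable M" unfolding T4_def by measurable
    have T4le: "\<bar>T4 \<omega>\<bar> \<le> B / 2 * \<eta> * (h \<omega>)\<^sup>2 + C * (d \<omega>)\<^sup>2" for \<omega>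
    proof -
      obtain \<xi> where \<xi>: "g (x \<omega> + h \<omega> + d \<omega>) = g (x \<omega> + h \<omega>) + g' (x \<omega> + h \<omega>) * d \<omega> + g'' \<xi> / 2 * (d \<omega>)\<^sup>2"
        using taylor2[OF g] by blast
      have "\<bar>T4 \<omega>\<bar> \<le> \<bar>g (X t \<omega>) - g (x \<omega> + h \<omega>) - g' (x \<omega>) * d \<omega>\<bar>" unfolding T4_def by (rule Gle)
      also have "g (X t \<omega>) - g (x \<omega> + h \<omega>) - g' (x \<omega>) * d \<omega> = (g' (x \<omega> + h \<omega>) - g' (x \<omega>)) * d \<omega> + g'' \<xi> / 2 * (d \<omega>)\<^sup>2"
        unfolding Xt \<xi> by (simp add: algebra_simps)
      also have "\<bar>\<dots>\<bar> \<le> \<bar>g' (x \<omega> + h \<omega>) - g' (x \<omega>)\<bar> * \<bar>d \<omega>\<bar> + \<bar>g'' \<xi> / 2\<bar> * (d \<omega>)\<^sup>2"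
        by (rule order_trans[OF abs_triangle_ineq]) (simp add: abs_mult)
      also have "\<dots> \<le> B * \<bar>h \<omega>\<bar> * \<bar>d \<omega>\<bar> + B * (d \<omega>)\<^sup>2"
      proof (intro add_mono mult_right_mono)
        show "\<bar>g' (x \<omega> + h \<omega>) - g' (x \<omega>)\<bar> \<le> B * \<bar>h \<omega>\<bar>" using lip[of "x \<omega> + h \<omega>" "x \<omega>"] by simp
        show "\<bar>g'' \<xi> / 2\<bar> \<le> B" using B(4)[of \<xi>] B(1) by simp
      qed auto
      \<comment> \<open>Young's inequality with weight \<eta>: the part with
        \<open>(h \<omega>)\<^sup>2\<close> must be small relative to \<delta>, while the part with
        \<open>(d \<omega>)\<^sup>2\<close> tolerates a large factor, its mean being at most
        \<open>R * \<delta> * v\<close> with small v.\<close>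
      also have "B * \<bar>h \<omega>\<bar> * \<bar>d \<omega>\<bar> \<le> B / 2 * \<eta> * (h \<omega>)\<^sup>2 + B / (2 * \<eta>) * (d \<omega>)\<^sup>2"
      proof -
        have "0 \<le> (\<eta> * \<bar>h \<omega>\<bar> - \<bar>d \<omega>\<bar>)\<^sup>2 / \<eta>" using \<eta> by simp
        also have "(\<eta> * \<bar>h \<omega>\<bar> - \<bar>d \<omega>\<bar>)\<^sup>2 = \<eta> * (\<eta> * (h \<omega>)\<^sup>2) + (d \<omega>)\<^sup>2 - \<eta> * (2 * (\<bar>h \<omega>\<bar> * \<bar>d \<omega>\<bar>))"
          by (simp add: power2_diff power_mult_distrib power2_eq_square[of \<eta>])
        also have "\<dots> / \<eta> = \<eta> * (h \<omega>)\<^sup>2 + (d \<omega>)\<^sup>2 / \<eta> - 2 * (\<bar>h \<omega>\<bar> * \<bar>d \<omega>\<bar>)"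
          using \<eta> by (simp add: add_divide_distrib diff_divide_distrib)
        finally have "\<bar>h \<omega>\<bar> * \<bar>d \<omega>\<bar> \<le> (\<eta> * (h \<omega>)\<^sup>2 + (d \<omega>)\<^sup>2 / \<eta>) / 2" by simp
        then have "B * (\<bar>h \<omega>\<bar> * \<bar>d \<omega>\<bar>) \<le> B * ((\<eta> * (h \<omega>)\<^sup>2 + (d \<omega>)\<^sup>2 / \<eta>) / 2)" using B(1) by (intro mult_left_mono) auto
        also have "\<dots> = B / 2 * \<eta> * (h \<omega>)\<^sup>2 + B / (2 * \<eta>) * (d \<omega>)\<^sup>2" using \<eta> by (simp add: field_simps)
        finally show ?thesis by simp
      qed
      finally show ?thesis unfolding C_def distrib_right by simp
    qed
    have i4: "integrable M (\<lambda>\<omega>. B / 2 * \<eta> * (h \<omega>)\<^sup>2 + C * (d \<omega>)\<^sup>2)" using ih2 id2 by simp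
    have iT4: "integrable M T4" and ET4: "\<bar>expectation T4\<bar> \<le> \<epsilon> / 8 * \<delta> + C * R * v * \<delta>"
    proof -
      show "integrable M T4" by (rule abs_expectation_le(1)[OF _ i4 T4le]) measurable
      have "\<bar>expectation T4\<bar> \<le> expectation (\<lambda>\<omega>. B / 2 * \<eta> * (h \<omega>)\<^sup>2 + C * (d \<omega>)\<^sup>2)" 
        by (rule abs_expectation_le(2)[OF _ i4 T4le]) measurable
      also have "\<dots> = B / 2 * \<eta> * expectation (\<lambda>\<omega>. (h \<omega>)\<^sup>2) + C * expectation (\<lambda>\<omega>. (d \<omega>)\<^sup>2)" using ih2 id2 by simp
      also have "\<dots> \<le> B / 2 * \<eta> * (4 * K\<^sup>2 * \<delta>) + C * (R * \<delta> * v)"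
        using Eh2 Ed2 \<eta> B(1) C by (intro add_mono mult_left_mono) auto
      also have "B / 2 * \<eta> * (4 * K\<^sup>2 * \<delta>) = \<epsilon> / 8 * \<delta>" using \<eta>(2) by (simp only: mult.assoc[symmetric])
      finally show "\<bar>expectation T4\<bar> \<le> \<epsilon> / 8 * \<delta> + C * R * v * \<delta>" by (simp add: mult_ac)
    qed

    \<comment> \<open>The second moment bounds the absolute mean of d only at the order of the
      square root of \<delta>, too large to be summed over all steps. The weighted bound of
      \<open>euler_err_small\<close>, with weight \<open>G * g' / B\<close>, has the order
      \<delta>.\<close>
    define T5 where "T5 \<omega> = G \<omega> * g' (x \<omega>) * d \<omega>" for \<omega>
    have iT5: "integrable M T5" and ET5: "\<bar>expectation T5\<bar> \<le> B * v * \<delta>"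
    proof -
      let ?G = "\<lambda>\<omega>. G \<omega> * g' (x \<omega>) / B"
      have GB: "\<bar>?G \<omega>\<bar> \<le> 1" for \<omega>
        using order_trans[OF Gle[of \<omega> "g' (x \<omega>)"] B(3)[of "x \<omega>"]] B(1) by (simp add: abs_divide)
      define q where "q = expectation (\<lambda>\<omega>. ?G \<omega> * d \<omega>)"
      have "\<bar>q\<bar> \<le> \<delta> * v"
        unfolding q_def d_def \<delta>_def v_def using ac \<delta>(3) GF
        by (intro Q(4) GB) (auto simp: \<delta>_def s_def[symmetric] intro!: borel_measurable_divide borel_measurable_times fxF)
      moreover have "expectation T5 = B * q"
        unfolding T5_def q_def using B(1) by (subst integral_mult_right_zero[symmetric]) (auto intro!: Bochner_Integration.integral_cong)
      ultimately show "\<bar>expectation T5\<bar> \<le> B * v * \<delta>" using B(1) mult_left_mono[of _ "\<delta> * v" B] by (simp add: abs_mult mult_ac)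
      have "\<bar>T5 \<omega>\<bar> \<le> B * \<bar>d \<omega>\<bar>" for \<omega>
        using mult_right_mono[OF order_trans[OF Gle[of \<omega> "g' (x \<omega>)"] B(3)[of "x \<omega>"]], of "\<bar>d \<omega>\<bar>"] 
        by (simp add: T5_def abs_mult)
      moreover have "integrable M (\<lambda>\<omega>. B * \<bar>d \<omega>\<bar>)" 
        using square_integrable_imp_integrable[OF _ id2] by auto
      moreover have "T5 \<in> borel_measurable M" unfolding T5_def by measurable
      ultimately show "integrable M T5" by (intro abs_expectation_le(1)[of T5])
    qed

    \<comment> \<open>Coefficients of w, w^2, \<delta> w and \<delta>^2 in the expansion of the
      Euler step. All are known at time s, so the terms odd in w vanish in the mean, w^2 cancels
      against the second-order part of the generator, and only the \<delta>^2 term survives.\<close>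
    define G1 where "G1 \<omega> = G \<omega> * g' (x \<omega>) * \<sigma> (x \<omega>)" for \<omega>
    define G2 where "G2 \<omega> = G \<omega> * g'' (x \<omega>) / 2 * (\<sigma> (x \<omega>))\<^sup>2" for \<omega>
    define G3 where "G3 \<omega> = G \<omega> * g'' (x \<omega>) * (b (x \<omega>) * \<sigma> (x \<omega>))" for \<omega>
    define G4 where "G4 \<omega> = G \<omega> * g'' (x \<omega>) / 2 * (b (x \<omega>))\<^sup>2" for \<omega>
    have GF': "G1 \<in> borel_measurable (F s)" "G2 \<in> borel_measurable (F s)" "G3 \<in> borel_measurable (F s)" "G4 \<in> borel_measurable (F s)"
      unfolding G1_def G2_def G3_def G4_def using GF 
      by (auto intro!: borel_measurable_divide borel_measurable_times borel_measurable_power fxF)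
    have G'le: "\<bar>G \<omega> * g' (x \<omega>)\<bar> \<le> B" "\<bar>G \<omega> * g'' (x \<omega>)\<bar> \<le> B" "\<bar>G \<omega> * g'' (x \<omega>) / 2\<bar> \<le> B / 2" for \<omega>
      using order_trans[OF Gle[of \<omega> "g' (x \<omega>)"] B(3)[of "x \<omega>"]] order_trans[OF Gle[of \<omega> "g'' (x \<omega>)"] B(4)[of "x \<omega>"]] by auto
    have Gle': "\<bar>G1 \<omega>\<bar> \<le> B * K" "\<bar>G2 \<omega>\<bar> \<le> B / 2 * K\<^sup>2" "\<bar>G3 \<omega>\<bar> \<le> B * (K * K)" and G4le: "\<bar>G4 \<omega>\<bar> \<le> B / 2 * K\<^sup>2" for \<omega>
      unfolding G1_def G2_def G3_def G4_def abs_mult[of "_ * g' _"] abs_mult[of "_ * g'' _"] abs_mult[of "_ / 2"] abs_mult[of "b _"]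
      using G'le[of \<omega>] B(1) K bK by (auto intro!: mult_mono simp: abs_power2)
    have iG: "integrable M G1" "integrable M G2" "integrable M G3" "integrable M G4"
      using GF'[THEN measurable_F_M] Gle' G4le by (blast intro: integrable_boundedI)+
    have m1: "integrable M (\<lambda>\<omega>. G1 \<omega> * w \<omega>)" "expectation (\<lambda>\<omega>. G1 \<omega> * w \<omega>) = 0"
      and m3: "integrable M (\<lambda>\<omega>. G3 \<omega> * w \<omega>)" "expectation (\<lambda>\<omega>. G3 \<omega> * w \<omega>) = 0"
      and m2: "integrable M (\<lambda>\<omega>. G2 \<omega> * (w \<omega>)\<^sup>2)" "expectation (\<lambda>\<omega>. G2 \<omega> * (w \<omega>)\<^sup>2) = \<delta> * expectation G2"
      using W_incr_mult_moment[OF st GF'(1) iG(1)] W_incr_mult_moment[OF st GF'(2) iG(2)] W_incr_mult_moment[OF st GF'(3) iG(3)]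
      unfolding \<delta>(4) w_def by auto
    have E4: "\<bar>expectation G4\<bar> \<le> B / 2 * K\<^sup>2"
    proof -
      have "\<bar>expectation G4\<bar> \<le> expectation (\<lambda>_. B / 2 * K\<^sup>2)"
        by (rule abs_expectation_le(2)) (use G4le iG(4) in auto)
      then show ?thesis by (simp add: prob_space)
    qed
    have E4': "\<bar>\<delta>\<^sup>2 * expectation G4\<bar> \<le> \<delta>\<^sup>2 * (B / 2 * K\<^sup>2)"
      unfolding abs_mult abs_power2 by (rule mult_left_mono[OF E4]) simp
    have "G \<omega> * (g (X t \<omega>) - g (x \<omega>) - \<delta> * (b (x \<omega>) * g' (x \<omega>) + (\<sigma> (x \<omega>))\<^sup>2 / 2 * g'' (x \<omega>))) =
      T1 \<omega> + (T4 \<omega> + (T5 \<omega> + (G1 \<omega> * w \<omega> + ((G2 \<omega> * (w \<omega>)\<^sup>2 - \<delta> * G2 \<omega>) + (\<delta> * (G3 \<omega> * w \<omega>) + \<delta>\<^sup>2 * G4 \<omega>)))))" for \<omega>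
      unfolding T1_def T4_def T5_def G1_def G2_def G3_def G4_def h_def
      by (simp add: field_simps power2_eq_square)
    then have "expectation (\<lambda>\<omega>. G \<omega> * (g (X t \<omega>) - g (x \<omega>) - \<delta> * (b (x \<omega>) * g' (x \<omega>) + (\<sigma> (x \<omega>))\<^sup>2 / 2 * g'' (x \<omega>)))) =
      expectation (\<lambda>\<omega>. T1 \<omega> + (T4 \<omega> + (T5 \<omega> + (G1 \<omega> * w \<omega> + ((G2 \<omega> * (w \<omega>)\<^sup>2 - \<delta> * G2 \<omega>) + (\<delta> * (G3 \<omega> * w \<omega>) + \<delta>\<^sup>2 * G4 \<omega>))))))"
      by presburger
    also have "\<dots> = expectation T1 + expectation T4 + expectation T5 + \<delta>\<^sup>2 * expectation G4"
      using iT1 iT4 iT5 m1 m2 m3 iG by simp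
    also have "\<bar>\<dots>\<bar> \<le> \<epsilon> / 8 * \<delta> + 32 * D * K ^ 4 * \<delta>\<^sup>2 + (\<epsilon> / 8 * \<delta> + C * R * v * \<delta>) + B * v * \<delta> + \<delta>\<^sup>2 * (B / 2 * K\<^sup>2)"
      using ET1 ET4 ET5 E4' by linarith
    also have "\<dots> = \<delta> * (\<epsilon> / 4 + \<delta> * (32 * D * K ^ 4 + B * K\<^sup>2 / 2) + P * v)"
      by (simp add: P_def power2_eq_square algebra_simps)
    also have "\<dots> = \<delta> * (\<epsilon> / 4 + \<epsilon> / 8 + (L - 1) * \<delta>)"
      unfolding v_def distrib_left[of P] e0(2) by (simp add: L_def algebra_simps)
    also have "\<dots> \<le> \<delta> * \<epsilon>"
    proof (rule mult_left_mono)
      have "(L - 1) * \<delta> \<le> L * \<delta>0" using L \<delta> by (intro mult_mono) auto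
      then show "\<epsilon> / 4 + \<epsilon> / 8 + (L - 1) * \<delta> \<le> \<epsilon>" using \<delta>0(3) e by linarith
    qed (use \<delta> in simp)
    finally show "\<bar>expectation (\<lambda>\<omega>. G \<omega> * (g (X (tm n c) \<omega>) - g (X (tm n a) \<omega>) - (tm n c - tm n a) * 
          (b (X (tm n a) \<omega>) * g' (X (tm n a) \<omega>) + (\<sigma> (X (tm n a) \<omega>))\<^sup>2 / 2 * g'' (X (tm n a) \<omega>))))\<bar> \<le> \<epsilon> * (tm n c - tm n a)"
      by (simp add: x_def s_def t_def \<delta>_def mult.commute)
  qed
qed

end

section \<open>Ito's formula between two random times\<close>

context sde
begin

text \<open>By continuity the values at dyadic times just below T converge to the value at T; only
  times up to u are sampled, so it is enough that A knows X up to u.\<close>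

lemma X_random_time:
  assumes A: "space A = space M" "\<And>v. 0 \<le> v \<Longrightarrow> v \<le> u \<Longrightarrow> X v \<in> borel_measurable A"
    and T: "T \<in> borel_measurable A" "\<And>\<omega>. \<omega> \<in> space M \<Longrightarrow> 0 \<le> T \<omega>" "\<And>\<omega>. \<omega> \<in> space M \<Longrightarrow> T \<omega> \<le> u"
  shows "(\<lambda>\<omega>. X (T \<omega>) \<omega>) \<in> borel_measurable A"
proof (cases "space M = {}")
  case True
  then show ?thesis using A(1) by (simp add: measurable_def)
next
  case False
  then obtain \<omega>0 where w0: "\<omega>0 \<in> space M" by auto
  have u: "0 \<le> u" using T(2,3)[OF w0] by simp
  define k where "k N \<omega> = nat \<lfloor>T \<omega> * 2 ^ N\<rfloor>" for N \<omega>
  \<comment> \<open>Rounding down never exceeds u, so \<open>min\<close> changes no value that is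
    attained; it makes the candidate for every index i measurable with respect to A.\<close>
  define a where "a N \<omega> = X (min (real (k N \<omega>) / 2 ^ N) u) \<omega>" for N \<omega>
  have am: "a N \<in> borel_measurable A" for N
  proof -
    have [measurable]: "k N \<in> measurable A (count_space UNIV)" unfolding k_def using T(1) by measurable
    have "X (min (real i / 2 ^ N) u) \<in> borel_measurable A" for i using u by (intro A(2)) auto
    then show ?thesis unfolding a_def by (rule measurable_compose_countable) measurable
  qed
  show ?thesis
  proof (rule borel_measurable_LIMSEQ_real[OF _ am])
    fix \<omega> assume "\<omega> \<in> space A"
    then have w: "\<omega> \<in> space M" using A by simp
    note T01 = T(2,3)[OF w]
    have "(\<lambda>N. real (k N \<omega>) / 2 ^ N) \<longlonglongrightarrow> T \<omega>"
    proof (rule real_tendsto_sandwich)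
      have kb: "T \<omega> * 2 ^ N - 1 \<le> real (k N \<omega>) \<and> real (k N \<omega>) \<le> T \<omega> * 2 ^ N" for N
      proof -
        have "real (k N \<omega>) = of_int \<lfloor>T \<omega> * 2 ^ N\<rfloor>" using T01 by (simp add: k_def)
        then show ?thesis by linarith
      qed
      show "\<forall>\<^sub>F N in sequentially. T \<omega> - (1 / 2) ^ N \<le> real (k N \<omega>) / 2 ^ N"
      proof (intro always_eventually allI)
        show "T \<omega> - (1 / 2) ^ N \<le> real (k N \<omega>) / 2 ^ N" for N
          using divide_right_mono[OF conjunct1[OF kb[of N]], of "2 ^ N"] by (simp add: diff_divide_distrib power_one_over)
      qed
      show "\<forall>\<^sub>F N in sequentially. real (k N \<omega>) / 2 ^ N \<le> T \<omega>"
        using kb by (intro always_eventually allI) (simp add: divide_le_eq)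
      have "(\<lambda>N. T \<omega> - (1 / 2) ^ N) \<longlonglongrightarrow> T \<omega> - 0"
        by (intro tendsto_diff tendsto_const LIMSEQ_realpow_zero) auto
      then show "(\<lambda>N. T \<omega> - (1 / 2) ^ N) \<longlonglongrightarrow> T \<omega>" by simp
    qed auto
    then have "(\<lambda>N. min (real (k N \<omega>) / 2 ^ N) u) \<longlonglongrightarrow> min (T \<omega>) u" by (intro tendsto_min tendsto_const)
    then have "(\<lambda>N. min (real (k N \<omega>) / 2 ^ N) u) \<longlonglongrightarrow> T \<omega>" using T01 by (simp add: min_def)
    then show "(\<lambda>N. a N \<omega>) \<longlonglongrightarrow> X (T \<omega>) \<omega>"
      unfolding a_def using T01 u 
      by (intro continuous_on_tendsto_compose[OF X_cont[OF w]]) auto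
  qed
qed

text \<open>The eigenvalue equation makes exp (- l t) g (X t) a martingale while X stays near z.
  Optional stopping is carried out by hand on the grid: Y times the indicator of S \<le> t < T is
  known at each grid time t, hence an admissible weight for \<open>ito_step\<close>, and the
  weighted increments telescope.\<close>

theorem ito_stopping:
  fixes g g' g'' :: "real \<Rightarrow> real"
  assumes g: "\<And>x. (g has_real_derivative g' x) (at x)" "\<And>x. (g' has_real_derivative g'' x) (at x)"
    and B: "1 \<le> B" "\<And>x. \<bar>g x\<bar> \<le> B" "\<And>x. \<bar>g' x\<bar> \<le> B" "\<And>x. \<bar>g'' x\<bar> \<le> B" 
    and cont: "continuous_on UNIV g''" and l: "0 \<le> l"
    and eigen: "\<And>x. \<bar>x - z\<bar> \<le> 1 \<Longrightarrow> b x * g' x + (\<sigma> x)\<^sup>2 / 2 * g'' x = l * g x"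
    and S [measurable]: "S \<in> borel_measurable M" and T [measurable]: "T \<in> borel_measurable M" 
    and Y [measurable]: "Y \<in> borel_measurable M"
    and ST: "\<And>\<omega>. \<omega> \<in> space M \<Longrightarrow> 0 \<le> S \<omega>" "\<And>\<omega>. \<omega> \<in> space M \<Longrightarrow> S \<omega> \<le> T \<omega>" "\<And>\<omega>. \<omega> \<in> space M \<Longrightarrow> T \<omega> \<le> L"
    and Y1: "\<And>\<omega>. \<bar>Y \<omega>\<bar> \<le> 1"
    and adapted: "\<And>u. 0 \<le> u \<Longrightarrow> (\<lambda>\<omega>. if S \<omega> \<le> u \<and> u < T \<omega> then Y \<omega> else 0) \<in> borel_measurable (F u)"
    and loc: "\<And>\<omega> u. \<omega> \<in> space M \<Longrightarrow> Y \<omega> \<noteq> 0 \<Longrightarrow> S \<omega> \<le> u \<Longrightarrow> u < T \<omega> \<Longrightarrow> \<bar>X u \<omega> - z\<bar> \<le> 1"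
  shows "expectation (\<lambda>\<omega>. Y \<omega> * (exp (- l * T \<omega>) * g (X (T \<omega>) \<omega>) - exp (- l * S \<omega>) * g (X (S \<omega>) \<omega>))) = 0"
proof -
  define J where "J = nat \<lceil>L\<rceil>"
  define \<Phi> where "\<Phi> u \<omega> = exp (- l * u) * g (X u \<omega>)" for u \<omega>
  \<comment> \<open>Rounding up: a grid point lies in [S, T) exactly if its index lies between
    \<open>k N S\<close> and \<open>k N T\<close>, the latter excluded, so the sum telescopes
    without boundary cells.\<close>
  define k where "k N u = nat \<lceil>u * 2 ^ N\<rceil>" for N and u :: real
  have contg: "continuous_on UNIV g" using g by (auto intro!: DERIV_continuous_on simp: has_field_derivative_at_within)
  have [measurable]: "g \<in> borel_measurable borel" using contg by (auto intro: borel_measurable_continuous_onI)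
  have \<Phi>_cont: "continuous_on {0..} (\<lambda>u. \<Phi> u \<omega>)" if "\<omega> \<in> space M" for \<omega>
    unfolding \<Phi>_def by (intro continuous_intros continuous_on_compose2[OF contg X_cont[OF that]]) auto
  have \<Phi>_le: "\<bar>\<Phi> u \<omega>\<bar> \<le> B" if "0 \<le> u" for u \<omega>
    using mult_mono[of "exp (- l * u)" 1 "\<bar>g (X u \<omega>)\<bar>" B] that l B(1) B(2)[of "X u \<omega>"] by (simp add: \<Phi>_def abs_mult)
  have \<Phi>_tm [measurable]: "\<Phi> (tm N j) \<in> borel_measurable M" for N j unfolding \<Phi>_def by measurable
  have k_less: "k N u \<le> j \<longleftrightarrow> u \<le> tm N j" for N u j
  proof -
    have "k N u \<le> j \<longleftrightarrow> u * 2 ^ N \<le> real j" unfolding k_def by (simp add: ceiling_le_iff)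
    then show ?thesis by (simp add: tm_def field_simps)
  qed
  have kJ: "k N u \<le> J * 2 ^ N" if "u \<le> L" for u N
  proof -
    have "L \<le> real J" by (simp add: J_def real_nat_ceiling_ge)
    then show ?thesis unfolding k_less using that by (simp add: tm_def)
  qed
  have tele: "Y \<omega> * (\<Phi> (tm N (k N (T \<omega>))) \<omega> - \<Phi> (tm N (k N (S \<omega>))) \<omega>) = 
     (\<Sum>j<J * 2 ^ N. (if S \<omega> \<le> tm N j \<and> tm N j < T \<omega> then Y \<omega> else 0) * (\<Phi> (tm N (Suc j)) \<omega> - \<Phi> (tm N j) \<omega>))"
    if w: "\<omega> \<in> space M" for N \<omega>
  proof -
    have kST: "k N (S \<omega>) \<le> k N (T \<omega>)" unfolding k_less by (rule order_trans[OF ST(2)[OF w]]) (simp flip: k_less)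
    have set: "{j\<in>{..<J * 2 ^ N}. S \<omega> \<le> tm N j \<and> tm N j < T \<omega>} = {k N (S \<omega>)..<k N (T \<omega>)}"
      using kJ[of "T \<omega>" N] ST(3)[OF w] by (auto simp: k_less[symmetric] not_le[symmetric])
    have "(\<Sum>j<J * 2 ^ N. (if S \<omega> \<le> tm N j \<and> tm N j < T \<omega> then Y \<omega> else 0) * (\<Phi> (tm N (Suc j)) \<omega> - \<Phi> (tm N j) \<omega>)) =
      (\<Sum>j\<in>{j\<in>{..<J * 2 ^ N}. S \<omega> \<le> tm N j \<and> tm N j < T \<omega>}. Y \<omega> * (\<Phi> (tm N (Suc j)) \<omega> - \<Phi> (tm N j) \<omega>))"
      by (subst sum.inter_filter) (auto intro!: sum.cong)
    also have "\<dots> = Y \<omega> * (\<Phi> (tm N (k N (T \<omega>))) \<omega> - \<Phi> (tm N (k N (S \<omega>))) \<omega>)"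
      unfolding set sum_distrib_left[symmetric] using sum_Suc_diff'[OF kST, of "\<lambda>j. \<Phi> (tm N j) \<omega>"] by simp
    finally show ?thesis by simp
  qed
  define V where "V N \<omega> = Y \<omega> * (\<Phi> (tm N (k N (T \<omega>))) \<omega> - \<Phi> (tm N (k N (S \<omega>))) \<omega>)" for N \<omega>
  have \<Phi>k [measurable]: "(\<lambda>\<omega>. \<Phi> (tm N (k N (U \<omega>))) \<omega>) \<in> borel_measurable M" if [measurable]: "U \<in> borel_measurable M" for U N
  proof -
    have [measurable]: "(\<lambda>\<omega>. k N (U \<omega>)) \<in> measurable M (count_space UNIV)" unfolding k_def by measurable
    show ?thesis by (rule measurable_compose_countable) measurable
  qed
  have Vm [measurable]: "V N \<in> borel_measurable M" for N unfolding V_def by measurable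
  have Vle: "\<bar>V N \<omega>\<bar> \<le> 2 * B" for N \<omega>
  proof -
    have "\<bar>\<Phi> (tm N (k N (T \<omega>))) \<omega> - \<Phi> (tm N (k N (S \<omega>))) \<omega>\<bar> \<le> 2 * B"
      using \<Phi>_le[of "tm N (k N (T \<omega>))" \<omega>] \<Phi>_le[of "tm N (k N (S \<omega>))" \<omega>] by simp
    then show ?thesis using mult_mono[OF Y1[of \<omega>]] by (fastforce simp: V_def abs_mult)
  qed
  have k_lim: "(\<lambda>N. tm N (k N u)) \<longlonglongrightarrow> u" if u: "0 \<le> u" for u
  proof (rule real_tendsto_sandwich)
    have kb: "u * 2 ^ N \<le> real (k N u) \<and> real (k N u) \<le> u * 2 ^ N + 1" for N
    proof -
      have "real (k N u) = of_int \<lceil>u * 2 ^ N\<rceil>" using u by (simp add: k_def) 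
      then show ?thesis by linarith
    qed
    show "\<forall>\<^sub>F N in sequentially. u \<le> tm N (k N u)" by (intro always_eventually allI) (simp flip: k_less)
    show "\<forall>\<^sub>F N in sequentially. tm N (k N u) \<le> u + (1 / 2) ^ N"
    proof (intro always_eventually allI)
      show "tm N (k N u) \<le> u + (1 / 2) ^ N" for N
        using divide_right_mono[OF conjunct2[OF kb[of N]], of "2 ^ N"] by (simp add: add_divide_distrib power_one_over tm_def)
    qed
    have "(\<lambda>N. u + (1 / 2) ^ N) \<longlonglongrightarrow> u + 0"
      by (intro tendsto_add tendsto_const LIMSEQ_realpow_zero) auto
    then show "(\<lambda>N. u + (1 / 2) ^ N) \<longlonglongrightarrow> u" by simp
  qed auto
  have V_lim: "(\<lambda>N. V N \<omega>) \<longlonglongrightarrow> Y \<omega> * (\<Phi> (T \<omega>) \<omega> - \<Phi> (S \<omega>) \<omega>)" if w: "\<omega> \<in> space M" for \<omega>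
  proof -
    have "(\<lambda>N. \<Phi> (tm N (k N u)) \<omega>) \<longlonglongrightarrow> \<Phi> u \<omega>" if "0 \<le> u" for u
      by (rule continuous_on_tendsto_compose[OF \<Phi>_cont[OF w] k_lim[OF that]]) (use that in auto)
    then show ?thesis unfolding V_def using ST(1,2)[OF w] by (intro tendsto_mult tendsto_const tendsto_diff) auto
  qed
  have XS: "(\<lambda>\<omega>. X (S \<omega>) \<omega>) \<in> borel_measurable M" "(\<lambda>\<omega>. X (T \<omega>) \<omega>) \<in> borel_measurable M"
    using ST by (auto intro!: X_random_time[of M L] X_M intro: order_trans)
  note [measurable] = XS
  have lim: "(\<lambda>N. expectation (V N)) \<longlonglongrightarrow> expectation (\<lambda>\<omega>. Y \<omega> * (\<Phi> (T \<omega>) \<omega> - \<Phi> (S \<omega>) \<omega>))"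
    using V_lim Vle
    by (intro integral_dominated_convergence[where w="\<lambda>_. 2 * B"]) (auto simp: \<Phi>_def)
  have small: "\<forall>\<^sub>F N in sequentially. \<bar>expectation (V N)\<bar> \<le> e" if e: "e > 0" for e
  proof -
    \<comment> \<open>There are J 2^N cells of length 2^-N, each with an error of at most 2
      \<epsilon> times its length: one \<epsilon> from \<open>ito_step\<close>, one from linearising
      the exponential.\<close>
    define \<epsilon> where "\<epsilon> = e / (2 * (real J + 1))"
    have \<epsilon>: "\<epsilon> > 0" "real J * (2 * \<epsilon>) \<le> e" using e by (auto simp: \<epsilon>_def field_simps)
    obtain \<delta>0 where \<delta>0: "0 < \<delta>0" 
      "\<And>n a c G. a < c \<Longrightarrow> tm n c - tm n a \<le> \<delta>0 \<Longrightarrow> G \<in> borel_measurable (F (tm n a)) \<Longrightarrow> (\<And>\<omega>. \<bar>G \<omega>\<bar> \<le> 1) \<Longrightarrow>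
       (\<And>\<omega>. \<omega> \<in> space M \<Longrightarrow> G \<omega> \<noteq> 0 \<Longrightarrow> \<bar>X (tm n a) \<omega> - z\<bar> \<le> 1) \<Longrightarrow>
       \<bar>expectation (\<lambda>\<omega>. G \<omega> * (g (X (tm n c) \<omega>) - g (X (tm n a) \<omega>) - (tm n c - tm n a) * 
          (b (X (tm n a) \<omega>) * g' (X (tm n a) \<omega>) + (\<sigma> (X (tm n a) \<omega>))\<^sup>2 / 2 * g'' (X (tm n a) \<omega>))))\<bar> \<le> \<epsilon> * (tm n c - tm n a)"
      by (rule ito_step[OF g B cont \<epsilon>(1), of z]) blast
    have "(\<lambda>N. (1 / 2 :: real) ^ N) \<longlonglongrightarrow> 0" by (rule LIMSEQ_realpow_zero) auto
    moreover have "0 < min \<delta>0 (min (1 / (l + 1)) (\<epsilon> / (B * l\<^sup>2 + 1)))" using \<delta>0(1) l \<epsilon> B(1) by (auto simp: add_nonneg_pos)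
    ultimately have "\<forall>\<^sub>F N in sequentially. (1 / 2) ^ N < min \<delta>0 (min (1 / (l + 1)) (\<epsilon> / (B * l\<^sup>2 + 1)))" by (rule order_tendstoD)
    then show ?thesis
    proof eventually_elim
      case (elim N)
      define \<delta> :: real where "\<delta> = 1 / 2 ^ N"
      have \<delta>: "0 < \<delta>" "\<delta> \<le> \<delta>0" "\<delta> < 1 / (l + 1)" "\<delta> < \<epsilon> / (B * l\<^sup>2 + 1)" using elim by (auto simp: \<delta>_def power_divide)
      have ld: "0 \<le> l * \<delta>" "l * \<delta> \<le> 1" using l \<delta> by (auto simp: field_simps)
      have Bd: "B * (l * \<delta>)\<^sup>2 \<le> \<epsilon> * \<delta>"
      proof -
        have "0 < B * l\<^sup>2 + 1" using B(1) by (simp add: add_nonneg_pos)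
        then have "B * l\<^sup>2 * \<delta> \<le> \<epsilon>" using \<delta>(1,4) by (simp add: pos_less_divide_eq algebra_simps)
        then have "B * l\<^sup>2 * \<delta> * \<delta> \<le> \<epsilon> * \<delta>" using \<delta>(1) by (intro mult_right_mono) auto
        then show ?thesis by (simp add: power2_eq_square mult_ac)
      qed
      define G where "G j \<omega> = (if S \<omega> \<le> tm N j \<and> tm N j < T \<omega> then Y \<omega> else 0)" for j \<omega>
      have GF: "G j \<in> borel_measurable (F (tm N j))" for j unfolding G_def by (rule adapted) simp
      have G1: "\<bar>G j \<omega>\<bar> \<le> 1" for j \<omega> using Y1[of \<omega>] by (simp add: G_def)
      note [measurable] = measurable_F_M[OF GF]
      have iG: "integrable M (\<lambda>\<omega>. G j \<omega> * (\<Phi> (tm N (Suc j)) \<omega> - \<Phi> (tm N j) \<omega>))" for j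
      proof (rule integrable_boundedI)
        fix \<omega>
        have "\<bar>\<Phi> (tm N (Suc j)) \<omega> - \<Phi> (tm N j) \<omega>\<bar> \<le> 2 * B"
          using \<Phi>_le[of "tm N (Suc j)" \<omega>] \<Phi>_le[of "tm N j" \<omega>] by simp
        from mult_mono[OF G1[of j \<omega>] this] show "\<bar>G j \<omega> * (\<Phi> (tm N (Suc j)) \<omega> - \<Phi> (tm N j) \<omega>)\<bar> \<le> 2 * B"
          by (simp add: abs_mult)
      qed measurable
      have step: "\<bar>expectation (\<lambda>\<omega>. G j \<omega> * (\<Phi> (tm N (Suc j)) \<omega> - \<Phi> (tm N j) \<omega>))\<bar> \<le> 2 * \<epsilon> * \<delta>" for j
      proof -
        define E where "E = exp (- l * tm N (Suc j))"
        have E: "0 < E" "E \<le> 1" using l by (auto simp: E_def)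
        have E2: "exp (- l * tm N j) = E * exp (l * \<delta>)"
          using tm_Suc_diff[of N j] by (simp add: E_def \<delta>_def[symmetric] exp_add[symmetric] algebra_simps)
        define H where "H \<omega> = g (X (tm N (Suc j)) \<omega>) - g (X (tm N j) \<omega>) - \<delta> * 
          (b (X (tm N j) \<omega>) * g' (X (tm N j) \<omega>) + (\<sigma> (X (tm N j) \<omega>))\<^sup>2 / 2 * g'' (X (tm N j) \<omega>))" for \<omega>
        have X1: "\<bar>X (tm N j) \<omega> - z\<bar> \<le> 1" if "\<omega> \<in> space M" "G j \<omega> \<noteq> 0" for \<omega>
          using loc[OF that(1), of "tm N j"] that(2) by (auto simp: G_def split: if_splits)
        have h1: "\<bar>expectation (\<lambda>\<omega>. (E * G j \<omega>) * H \<omega>)\<bar> \<le> \<epsilon> * \<delta>"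
          using \<delta>0(2)[of j "Suc j" N "\<lambda>\<omega>. E * G j \<omega>"] \<delta>(2) tm_Suc_diff[of N j] GF[of j] X1 E mult_mono[OF E(2) G1]
          unfolding H_def \<delta>_def by (auto simp: abs_mult)
        \<comment> \<open>Effect of replacing \<open>exp (l * \<delta>)\<close> by
          \<open>1 + l * \<delta>\<close>, after which the eigenvalue term matches the generator
          term in \<open>H\<close>; it is of second order in \<delta>.\<close>
        define R where "R \<omega> = E * G j \<omega> * g (X (tm N j) \<omega>) * (1 + l * \<delta> - exp (l * \<delta>))" for \<omega>
        have [measurable]: "R \<in> borel_measurable M" unfolding R_def by measurable
        have "\<bar>1 + l * \<delta> - exp (l * \<delta>)\<bar> \<le> (l * \<delta>)\<^sup>2"
          using exp_bound[OF ld] exp_ge_add_one_self[of "l * \<delta>"] by linarith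
        moreover have "\<bar>E * G j \<omega> * g (X (tm N j) \<omega>)\<bar> \<le> B" for \<omega>
        proof -
          have "E * \<bar>G j \<omega>\<bar> \<le> 1" using mult_mono[OF E(2) G1[of j \<omega>]] by simp
          from mult_mono[OF this B(2)[of "X (tm N j) \<omega>"]] show ?thesis using E by (simp add: abs_mult)
        qed
        ultimately have Rle: "\<bar>R \<omega>\<bar> \<le> B * (l * \<delta>)\<^sup>2" for \<omega>
          unfolding R_def abs_mult[of "_ * g _"] using B(1) by (intro mult_mono) auto
        have iR: "integrable M R" by (rule integrable_boundedI[OF _ Rle]) measurable
        have "\<bar>expectation R\<bar> \<le> expectation (\<lambda>_. B * (l * \<delta>)\<^sup>2)" by (rule abs_expectation_le(2)) (use Rle in auto)
        then have h2: "\<bar>expectation R\<bar> \<le> \<epsilon> * \<delta>" using Bd by (simp add: prob_space)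
        have eq: "G j \<omega> * (\<Phi> (tm N (Suc j)) \<omega> - \<Phi> (tm N j) \<omega>) = E * G j \<omega> * H \<omega> + R \<omega>" if w: "\<omega> \<in> space M" for \<omega>
        proof (cases "G j \<omega> = 0")
          case True
          then show ?thesis by (simp add: R_def)
        next
          case False
          have Heq: "H \<omega> = g (X (tm N (Suc j)) \<omega>) - g (X (tm N j) \<omega>) - \<delta> * (l * g (X (tm N j) \<omega>))"
            unfolding H_def using eigen[OF X1[OF w False]] by simp
          show ?thesis unfolding \<Phi>_def R_def E2 E_def[symmetric] Heq by (simp add: algebra_simps)
        qed
        have "expectation (\<lambda>\<omega>. G j \<omega> * (\<Phi> (tm N (Suc j)) \<omega> - \<Phi> (tm N j) \<omega>)) - expectation R =
          expectation (\<lambda>\<omega>. G j \<omega> * (\<Phi> (tm N (Suc j)) \<omega> - \<Phi> (tm N j) \<omega>) - R \<omega>)"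
          by (rule Bochner_Integration.integral_diff[OF iG iR, symmetric])
        also have "\<dots> = expectation (\<lambda>\<omega>. E * G j \<omega> * H \<omega>)"
          by (rule Bochner_Integration.integral_cong) (auto simp: eq)
        finally show ?thesis using h1 h2 by linarith
      qed
      have "expectation (V N) = expectation (\<lambda>\<omega>. \<Sum>j<J * 2 ^ N. G j \<omega> * (\<Phi> (tm N (Suc j)) \<omega> - \<Phi> (tm N j) \<omega>))"
        unfolding V_def G_def by (rule Bochner_Integration.integral_cong) (simp_all add: tele)
      also have "\<dots> = (\<Sum>j<J * 2 ^ N. expectation (\<lambda>\<omega>. G j \<omega> * (\<Phi> (tm N (Suc j)) \<omega> - \<Phi> (tm N j) \<omega>)))"
        by (rule Bochner_Integration.integral_sum[OF iG])
      also have "\<bar>\<dots>\<bar> \<le> (\<Sum>j<J * 2 ^ N. 2 * \<epsilon> * \<delta>)" by (rule order_trans[OF sum_abs sum_mono[OF step]])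
      also have "\<dots> = real J * (2 * \<epsilon>)" by (simp add: \<delta>_def)
      also have "\<dots> \<le> e" by (rule \<epsilon>(2))
      finally show ?case .
    qed
  qed
  have "\<bar>expectation (\<lambda>\<omega>. Y \<omega> * (\<Phi> (T \<omega>) \<omega> - \<Phi> (S \<omega>) \<omega>))\<bar> \<le> e" if "e > 0" for e
    by (rule tendsto_upperbound[OF tendsto_rabs[OF lim] small[OF that]]) simp
  then have "\<bar>expectation (\<lambda>\<omega>. Y \<omega> * (\<Phi> (T \<omega>) \<omega> - \<Phi> (S \<omega>) \<omega>))\<bar> \<le> 0" by (rule field_le_epsilon[of _ 0, simplified]) 
  then show ?thesis by (simp add: \<Phi>_def)
qed

end

section \<open>Eigenfunctions of the generator\<close>

lemma DERIV_glue:
  fixes f1 f2 :: "real \<Rightarrow> real"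
  assumes "(f1 has_real_derivative D) (at a)" "(f2 has_real_derivative D) (at a)" "f1 a = f2 a"
  shows "((\<lambda>u. if u \<le> a then f1 u else f2 u) has_real_derivative D) (at a)"
proof -
  let ?f = "\<lambda>u. if u \<le> a then f1 u else f2 u"
  have "(?f has_real_derivative D) (at a within {..a})"
    by (rule has_field_derivative_transform_within[OF has_field_derivative_at_within[OF assms(1)], of 1]) auto
  moreover have "(?f has_real_derivative D) (at a within {a..})"
    by (rule has_field_derivative_transform_within[OF has_field_derivative_at_within[OF assms(2)], of 1]) (use assms(3) in auto)
  ultimately have "(?f has_real_derivative D) (at a within ({..a} \<union> {a..}))"
    unfolding has_field_derivative_iff Lim_within_Un by blast
  moreover have "{..a} \<union> {a..} = UNIV" by auto
  ultimately show ?thesis by simp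
qed

lemma DERIV_glue_everywhere:
  fixes f1 f2 :: "real \<Rightarrow> real"
  assumes "\<And>u. (f1 has_real_derivative D1 u) (at u)" "\<And>u. (f2 has_real_derivative D2 u) (at u)" "f1 a = f2 a" "D1 a = D2 a"
  shows "((\<lambda>u. if u \<le> a then f1 u else f2 u) has_real_derivative (if u \<le> a then D1 u else D2 u)) (at u)"
proof (cases u a rule: linorder_cases)
  case less
  have "((\<lambda>u. if u \<le> a then f1 u else f2 u) has_real_derivative D1 u) (at u)"
    by (rule has_field_derivative_transform_within_open[OF assms(1), of "{..<a}"]) (use less in auto)
  then show ?thesis using less by simp
next
  case equal
  show ?thesis unfolding equal using DERIV_glue[OF assms(1)[of a], of f2] assms(2)[of a] assms(3,4) by auto
next
  case greater
  have "((\<lambda>u. if u \<le> a then f1 u else f2 u) has_real_derivative D2 u) (at u)"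
    by (rule has_field_derivative_transform_within_open[OF assms(2), of "{a<..}"]) (use greater in auto)
  then show ?thesis using greater by simp
qed

text \<open>A bounded $C^2$ function that is the identity on $[-1,1]$: composition with it turns local solutions
  into bounded $C^2$ functions on the line.\<close>
definition cut :: "real \<Rightarrow> real" where
  "cut x = (if x \<le> -1 then sin (x + 1) - 1 else if x \<le> 1 then x else 1 + sin (x - 1))"

definition cut' :: "real \<Rightarrow> real" where
  "cut' x = (if x \<le> -1 then cos (x + 1) else if x \<le> 1 then 1 else cos (x - 1))"

definition cut'' :: "real \<Rightarrow> real" where
  "cut'' x = (if x \<le> -1 then - sin (x + 1) else if x \<le> 1 then 0 else - sin (x - 1))"

lemma cut_DERIV: "(cut has_real_derivative cut' x) (at x)"
proof -
  have 1: "((\<lambda>x. if x \<le> 1 then x else 1 + sin (x - 1)) has_real_derivative (if x \<le> 1 then 1 else cos (x - 1))) (at x)" for x :: real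
    by (rule DERIV_glue_everywhere) (auto intro!: derivative_eq_intros)
  have "((\<lambda>x. if x \<le> -1 then sin (x + 1) - 1 else if x \<le> 1 then x else 1 + sin (x - 1)) has_real_derivative 
     (if x \<le> -1 then cos (x + 1) else if x \<le> 1 then 1 else cos (x - 1))) (at x)"
    by (rule DERIV_glue_everywhere[OF _ 1]) (auto intro!: derivative_eq_intros)
  then show ?thesis by (simp add: cut_def[abs_def] cut'_def)
qed

lemma cut'_DERIV: "(cut' has_real_derivative cut'' x) (at x)"
proof -
  have 1: "((\<lambda>x. if x \<le> 1 then 1 else cos (x - 1)) has_real_derivative (if x \<le> 1 then 0 else - sin (x - 1))) (at x)" for x :: real
    by (rule DERIV_glue_everywhere) (auto intro!: derivative_eq_intros)
  have "((\<lambda>x. if x \<le> -1 then cos (x + 1) else if x \<le> 1 then 1 else cos (x - 1)) has_real_derivative 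
     (if x \<le> -1 then - sin (x + 1) else if x \<le> 1 then 0 else - sin (x - 1))) (at x)"
    by (rule DERIV_glue_everywhere[OF _ 1]) (auto intro!: derivative_eq_intros)
  then show ?thesis by (simp add: cut'_def[abs_def] cut''_def)
qed

lemma cut''_cont: "continuous_on UNIV cut''"
proof -
  have eq: "cut'' x = - sin (min (x + 1) 0) - sin (max (x - 1) 0)" for x by (auto simp: cut''_def min_def max_def)
  show ?thesis unfolding eq[abs_def] by (intro continuous_intros)
qed

lemma cut_range: "-2 \<le> cut x \<and> cut x \<le> 2"
  using sin_ge_minus_one[of "x + 1"] sin_le_one[of "x + 1"] sin_ge_minus_one[of "x - 1"] sin_le_one[of "x - 1"]
  unfolding cut_def by (smt (verit))

lemma cut'_le: "\<bar>cut' x\<bar> \<le> 1" and cut''_le: "\<bar>cut'' x\<bar> \<le> 1"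
  by (auto simp: cut'_def cut''_def)

lemma cut_id: "\<bar>x\<bar> \<le> 1 \<Longrightarrow> cut x = x" and cut'_id: "\<bar>x\<bar> \<le> 1 \<Longrightarrow> cut' x = 1" and cut''_id: "\<bar>x\<bar> \<le> 1 \<Longrightarrow> cut'' x = 0"
  by (auto simp: cut_def cut'_def cut''_def abs_le_iff)

text \<open>\<open>cut\<close> takes values in [-2, 2], inside the interval where f is
  differentiable, so composition is smooth and bounded with its derivatives; on [-1, 1] its
  derivatives are 1 and 0, so an equation for f persists there.\<close>

lemma bounded_C2_extension:
  fixes f f' f'' :: "real \<Rightarrow> real"
  assumes f: "\<And>x. -3 < x \<Longrightarrow> x < 3 \<Longrightarrow> (f has_real_derivative f' x) (at x)"
    "\<And>x. -3 < x \<Longrightarrow> x < 3 \<Longrightarrow> (f' has_real_derivative f'' x) (at x)"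
    and cont: "continuous_on {-2..2} f''"
  obtains g g' g'' :: "real \<Rightarrow> real" and B
  where "\<And>x. (g has_real_derivative g' x) (at x)" "\<And>x. (g' has_real_derivative g'' x) (at x)"
    "1 \<le> B" "\<And>x. \<bar>g x\<bar> \<le> B" "\<And>x. \<bar>g' x\<bar> \<le> B" "\<And>x. \<bar>g'' x\<bar> \<le> B" "continuous_on UNIV g''"
    "\<And>x. \<bar>x\<bar> \<le> 1 \<Longrightarrow> g x = f x" "\<And>x. \<bar>x\<bar> \<le> 1 \<Longrightarrow> g' x = f' x" "\<And>x. \<bar>x\<bar> \<le> 1 \<Longrightarrow> g'' x = f'' x"
proof -
  have cf: "continuous_on {-2..2} f" "continuous_on {-2..2} f'"
    using DERIV_continuous_on[of "{-2..2}" f f'] DERIV_continuous_on[of "{-2..2}" f' f'']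
      has_field_derivative_at_within[OF f(1)] has_field_derivative_at_within[OF f(2)] by force+
  have bd: "\<exists>B. \<forall>x\<in>{-2..2}. \<bar>h x\<bar> \<le> B" if "continuous_on {-2..2} h" for h :: "real \<Rightarrow> real"
    using compact_imp_bounded[OF compact_continuous_image[OF that]] by (auto simp: bounded_iff)
  obtain B0 B1 B2 where B: "\<And>x. x \<in> {-2..2} \<Longrightarrow> \<bar>f x\<bar> \<le> B0" "\<And>x. x \<in> {-2..2} \<Longrightarrow> \<bar>f' x\<bar> \<le> B1" "\<And>x. x \<in> {-2..2} \<Longrightarrow> \<bar>f'' x\<bar> \<le> B2"
    using bd[OF cf(1)] bd[OF cf(2)] bd[OF cont] by metis
  have cr: "cut x \<in> {-2..2}" for x using cut_range[of x] by simp
  have cut_cont: "continuous_on UNIV cut" "continuous_on UNIV cut'"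
    by (rule DERIV_continuous_on[OF has_field_derivative_at_within[OF cut_DERIV]],
        rule DERIV_continuous_on[OF has_field_derivative_at_within[OF cut'_DERIV]])
  have B0: "0 \<le> B0" "0 \<le> B1" "0 \<le> B2" using B(1)[OF cr[of 0]] B(2)[OF cr[of 0]] B(3)[OF cr[of 0]] by linarith+
  define g where "g x = f (cut x)" for x
  define g' where "g' x = f' (cut x) * cut' x" for x
  define g'' where "g'' x = f'' (cut x) * cut' x * cut' x + f' (cut x) * cut'' x" for x
  have df: "(f has_real_derivative f' (cut x)) (at (cut x))" "(f' has_real_derivative f'' (cut x)) (at (cut x))" for x
    using cut_range[of x] by (auto intro!: f)
  show ?thesis
  proof (rule that[of g g' g'' "1 + B0 + B1 + B2"])
    show "(g has_real_derivative g' x) (at x)" for x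
      unfolding g_def[abs_def] g'_def by (rule DERIV_chain2[OF df(1) cut_DERIV])
    show "(g' has_real_derivative g'' x) (at x)" for x
      unfolding g'_def[abs_def] g''_def
      using DERIV_mult[OF DERIV_chain2[OF df(2)[of x] cut_DERIV] cut'_DERIV] by (simp add: algebra_simps)
    show "1 \<le> 1 + B0 + B1 + B2" using B0 by simp
    show "\<bar>g x\<bar> \<le> 1 + B0 + B1 + B2" for x using B(1)[OF cr[of x]] B0 by (simp add: g_def)
    have 1: "\<bar>f' (cut x) * c\<bar> \<le> B1" if "\<bar>c\<bar> \<le> 1" for x c
      using mult_mono[OF B(2)[OF cr[of x]] that] B0 by (simp add: abs_mult)
    show "\<bar>g' x\<bar> \<le> 1 + B0 + B1 + B2" for x using 1[OF cut'_le, of x x] B0 by (simp add: g'_def)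
    have "\<bar>f'' (cut x) * cut' x\<bar> \<le> B2" for x
      using mult_mono[OF B(3)[OF cr[of x]] cut'_le[of x]] B0 by (simp add: abs_mult)
    from mult_mono[OF this cut'_le] have 2: "\<bar>f'' (cut x) * cut' x * cut' x\<bar> \<le> B2" for x using B0 by (simp add: abs_mult)
    show "\<bar>g'' x\<bar> \<le> 1 + B0 + B1 + B2" for x
      using 2[of x] 1[OF cut''_le, of x x] B0 abs_triangle_ineq[of "f'' (cut x) * cut' x * cut' x" "f' (cut x) * cut'' x"] unfolding g''_def by linarith
    show "continuous_on UNIV g''"
      unfolding g''_def[abs_def] using cr
      by (intro continuous_intros cut_cont cut''_cont continuous_on_compose2[OF cont cut_cont(1)] continuous_on_compose2[OF cf(2) cut_cont(1)]) auto
  qed (auto simp: g_def g'_def g''_def cut_id cut'_id cut''_id)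
qed

text \<open>Since p and q are nonnegative, the iteration preserves order. Started at 1 it increases,
  so the limit is automatically at least 1, and an exponential function that the iteration does not
  exceed bounds it from above.\<close>

lemma picard_exists:
  fixes p q :: "real \<Rightarrow> real"
  assumes cp: "continuous_on {-3..3} p" and cq: "continuous_on {-3..3} q"
    and p0: "\<And>x. x \<in> {-3..3} \<Longrightarrow> 0 \<le> p x" and q0: "\<And>x. x \<in> {-3..3} \<Longrightarrow> 0 \<le> q x"
  obtains f where "continuous_on {-3..3} f" "\<And>x. x \<in> {-3..3} \<Longrightarrow> 1 \<le> f x"
    "\<And>x. x \<in> {-3..3} \<Longrightarrow> f x = 1 + integral {-3..x} (\<lambda>s. p s * integral {-3..s} (\<lambda>r. q r * f r))"
proof -
  have bd: "\<exists>B. \<forall>x\<in>{-3..3}. \<bar>h x\<bar> \<le> B" if "continuous_on {-3..3} h" for h :: "real \<Rightarrow> real"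
    using compact_imp_bounded[OF compact_continuous_image[OF that]] by (auto simp: bounded_iff)
  obtain P Q where PQ: "\<And>x. x \<in> {-3..3} \<Longrightarrow> p x \<le> P" "\<And>x. x \<in> {-3..3} \<Longrightarrow> q x \<le> Q"
    using bd[OF cp] bd[OF cq] by (metis abs_le_D1)
  \<comment> \<open>Each integration of \<open>exp (\<theta> * (x + 3))\<close> gains a factor
    \<open>1 / \<theta>\<close>, so
    \<open>\<theta>\<^sup>2 \<ge> \<bar>P\<bar> * \<bar>Q\<bar>\<close> makes this function an
    invariant upper bound. The \<open>+ 1\<close> keeps \<theta> positive.\<close>
  define \<theta> where "\<theta> = sqrt (\<bar>P\<bar> * \<bar>Q\<bar>) + 1"
  have \<theta>: "\<theta> > 0" by (simp add: \<theta>_def add_nonneg_pos)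
  have \<theta>2: "\<bar>P\<bar> * \<bar>Q\<bar> \<le> \<theta>\<^sup>2"
    unfolding \<theta>_def by (simp add: power2_sum)
  define \<Gamma> where "\<Gamma> f x = 1 + integral {-3..x} (\<lambda>s. p s * integral {-3..s} (\<lambda>r. q r * f r))" for f :: "real \<Rightarrow> real" and x
  define u where "u n = (\<Gamma> ^^ n) (\<lambda>_. 1)" for n
  have u0: "u 0 = (\<lambda>_. 1)" and uS: "u (Suc n) = \<Gamma> (u n)" for n by (auto simp: u_def)
  have cI: "continuous_on {-3..3} (\<lambda>s. integral {-3..s} h)" if "continuous_on {-3..3} h" for h :: "real \<Rightarrow> real"
    using indefinite_integral_continuous_1[OF integrable_continuous_real[OF that]] .
  have c\<Gamma>: "continuous_on {-3..3} (\<Gamma> f)" if "continuous_on {-3..3} f" for f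
    unfolding \<Gamma>_def by (intro continuous_intros cI cp cq that)
  have cu: "continuous_on {-3..3} (u n)" for n
    by (induction n) (auto simp: u0 uS c\<Gamma>)
  have ii: "(\<lambda>r. q r * f r) integrable_on {-3..s}" if "continuous_on {-3..3} f" "s \<in> {-3..3}" for f s
    using that by (intro integrable_continuous_real continuous_on_subset[OF continuous_on_mult[OF cq that(1)]]) auto
  have io: "(\<lambda>s. p s * integral {-3..s} (\<lambda>r. q r * f r)) integrable_on {-3..x}" if "continuous_on {-3..3} f" "x \<in> {-3..3}" for f x
    using that by (intro integrable_continuous_real continuous_on_subset[OF continuous_on_mult[OF cp cI[OF continuous_on_mult[OF cq that(1)]]]]) auto
  have mono\<Gamma>: "\<Gamma> f x \<le> \<Gamma> h x" if "continuous_on {-3..3} f" "continuous_on {-3..3} h" 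
    "\<And>x. x \<in> {-3..3} \<Longrightarrow> f x \<le> h x" "x \<in> {-3..3}" for f h x
  proof -
    have "integral {-3..x} (\<lambda>s. p s * integral {-3..s} (\<lambda>r. q r * f r)) \<le> integral {-3..x} (\<lambda>s. p s * integral {-3..s} (\<lambda>r. q r * h r))"
    proof (rule integral_le[OF io[OF that(1,4)] io[OF that(2,4)]])
      fix s assume "s \<in> {-3..x}"
      then have s: "s \<in> {-3..3}" using that(4) by auto
      have "integral {-3..s} (\<lambda>r. q r * f r) \<le> integral {-3..s} (\<lambda>r. q r * h r)"
        using s by (intro integral_le[OF ii[OF that(1) s] ii[OF that(2) s]] mult_left_mono that(3) q0) auto
      then show "p s * integral {-3..s} (\<lambda>r. q r * f r) \<le> p s * integral {-3..s} (\<lambda>r. q r * h r)"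
        by (rule mult_left_mono[OF _ p0[OF s]])
    qed
    then show ?thesis by (simp add: \<Gamma>_def)
  qed
  have ge1: "1 \<le> u n x" if "x \<in> {-3..3}" for n x
    using that
  proof (induction n arbitrary: x)
    case 0
    then show ?case by (simp add: u0)
  next
    case (Suc n)
    have "0 \<le> q r * u n r" if "r \<in> {-3..3}" for r using Suc.IH[OF that] q0[OF that] by simp
    then have "0 \<le> integral {-3..s} (\<lambda>r. q r * u n r)" if "s \<in> {-3..3}" for s
      using that by (intro integral_nonneg ii cu) auto
    then have "0 \<le> integral {-3..x} (\<lambda>s. p s * integral {-3..s} (\<lambda>r. q r * u n r))"
      using Suc.prems p0 by (intro integral_nonneg[OF io[OF cu Suc.prems]]) auto
    then show ?case by (simp add: uS \<Gamma>_def)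
  qed
  have incr: "u n x \<le> u (Suc n) x" if "x \<in> {-3..3}" for n x
    using that
  proof (induction n arbitrary: x)
    case 0
    then show ?case using ge1[of x 1] by (simp add: u0)
  next
    case (Suc n)
    show ?case unfolding uS[of "Suc n"] uS[of n]
      using Suc by (intro mono\<Gamma> cu) (auto simp flip: uS intro: cu)
  qed
  have expint: "integral {-3..x} (\<lambda>s. exp (\<theta> * (s + 3))) = (exp (\<theta> * (x + 3)) - 1) / \<theta>" if "-3 \<le> x" for x
  proof -
    have "((\<lambda>s. exp (\<theta> * (s + 3))) has_integral (exp (\<theta> * (x + 3)) / \<theta> - exp (\<theta> * (-3 + 3)) / \<theta>)) {-3..x}"
      using that \<theta>
      by (intro fundamental_theorem_of_calculus)
         (auto intro!: derivative_eq_intros simp flip: has_real_derivative_iff_has_vector_derivative)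
    then show ?thesis by (simp add: integral_unique diff_divide_distrib)
  qed
  define E where "E x = exp (\<theta> * (x + 3))" for x
  have cE: "continuous_on A E" for A unfolding E_def by (intro continuous_intros)
  have E1: "1 \<le> E x" if "-3 \<le> x" for x using that \<theta> by (simp add: E_def)
  have upper: "u n x \<le> E x" if "x \<in> {-3..3}" for n x
    using that
  proof (induction n arbitrary: x)
    case 0
    then show ?case using E1 by (simp add: u0)
  next
    case (Suc n)
    have in1: "integral {-3..s} (\<lambda>r. q r * u n r) \<le> \<bar>Q\<bar> * (E s / \<theta>)" if s: "s \<in> {-3..3}" for s
    proof -
      have "integral {-3..s} (\<lambda>r. q r * u n r) \<le> integral {-3..s} (\<lambda>r. \<bar>Q\<bar> * E r)"
      proof (rule integral_le)
        fix r assume "r \<in> {-3..s}"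
        then have r: "r \<in> {-3..3}" using s by auto
        show "q r * u n r \<le> \<bar>Q\<bar> * E r"
          using PQ(2)[OF r] Suc.IH[OF r] ge1[OF r, of n] q0[OF r] by (intro mult_mono) auto
      qed (intro ii cu s integrable_continuous_real continuous_intros cE)+
      also have "\<dots> = \<bar>Q\<bar> * ((E s - 1) / \<theta>)" using expint[of s] s by (simp add: E_def)
      also have "\<dots> \<le> \<bar>Q\<bar> * (E s / \<theta>)" using \<theta> by (intro mult_left_mono divide_right_mono) auto
      finally show ?thesis .
    qed
    have "integral {-3..x} (\<lambda>s. p s * integral {-3..s} (\<lambda>r. q r * u n r)) \<le> integral {-3..x} (\<lambda>s. \<theta> * E s)"
    proof (rule integral_le)
      fix s assume "s \<in> {-3..x}"
      then have s: "s \<in> {-3..3}" using Suc.prems by auto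
      have "p s * integral {-3..s} (\<lambda>r. q r * u n r) \<le> p s * (\<bar>Q\<bar> * (E s / \<theta>))"
        by (rule mult_left_mono[OF in1[OF s] p0[OF s]])
      also have "\<dots> \<le> \<bar>P\<bar> * (\<bar>Q\<bar> * (E s / \<theta>))"
        using PQ(1)[OF s] \<theta> by (intro mult_right_mono) (auto simp: E_def)
      also have "\<dots> = \<bar>P\<bar> * \<bar>Q\<bar> * (E s / \<theta>)" by simp
      also have "\<dots> \<le> \<theta>\<^sup>2 * (E s / \<theta>)" using \<theta> by (intro mult_right_mono[OF \<theta>2]) (auto simp: E_def)
      also have "\<dots> = \<theta> * E s" using \<theta> by (simp add: power2_eq_square)
      finally show "p s * integral {-3..s} (\<lambda>r. q r * u n r) \<le> \<theta> * E s" .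
    qed (intro io cu Suc.prems integrable_continuous_real continuous_intros cE)+
    also have "\<dots> = E x - 1" using expint[of x] Suc.prems \<theta> by (simp add: E_def)
    finally show ?case by (simp add: uS \<Gamma>_def)
  qed
  define f where "f x = lim (\<lambda>n. u n x)" for x
  have lim: "(\<lambda>n. u n x) \<longlonglongrightarrow> f x" if x: "x \<in> {-3..3}" for x
  proof -
    have "incseq (\<lambda>n. u n x)" using incr[OF x] by (rule incseq_SucI)
    then obtain L where "(\<lambda>n. u n x) \<longlonglongrightarrow> L" using incseq_convergent[of "\<lambda>n. u n x" "E x"] upper[OF x] by blast
    then show ?thesis by (simp add: f_def limI)
  qed
  have in_lim: "(\<lambda>r. q r * f r) integrable_on {-3..s} \<and> (\<lambda>n. integral {-3..s} (\<lambda>r. q r * u n r)) \<longlonglongrightarrow> integral {-3..s} (\<lambda>r. q r * f r)"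
    if s: "s \<in> {-3..3}" for s
  proof (rule conjI; rule dominated_convergence[where h="\<lambda>r. \<bar>Q\<bar> * E r"])
    show "(\<lambda>r. q r * u k r) integrable_on {-3..s}" "(\<lambda>r. q r * u k r) integrable_on {-3..s}" for k
      by (intro ii cu s)+
    show "(\<lambda>r. \<bar>Q\<bar> * E r) integrable_on {-3..s}" "(\<lambda>r. \<bar>Q\<bar> * E r) integrable_on {-3..s}"
      by (intro integrable_continuous_real continuous_intros cE)+
    show 1: "norm (q r * u k r) \<le> \<bar>Q\<bar> * E r" if "r \<in> {-3..s}" for k r
    proof -
      have r: "r \<in> {-3..3}" using that s by auto
      show ?thesis unfolding real_norm_def abs_mult
        using PQ(2)[OF r] upper[OF r, of k] ge1[OF r, of k] q0[OF r] by (intro mult_mono) auto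
    qed
    then show "norm (q r * u k r) \<le> \<bar>Q\<bar> * E r" if "r \<in> {-3..s}" for k r using that .
    show 2: "(\<lambda>k. q r * u k r) \<longlonglongrightarrow> q r * f r" if "r \<in> {-3..s}" for r
      using that s by (intro tendsto_mult tendsto_const lim) auto
    then show "(\<lambda>k. q r * u k r) \<longlonglongrightarrow> q r * f r" if "r \<in> {-3..s}" for r using that .
  qed
  define I where "I s = integral {-3..s} (\<lambda>r. q r * f r)" for s
  have cI': "continuous_on {-3..3} I"
    unfolding I_def by (rule indefinite_integral_continuous_1) (use in_lim[of 3] in auto)
  define C where "C = integral {-3..3} (\<lambda>r. \<bar>Q\<bar> * E r)"
  have eq: "f x = 1 + integral {-3..x} (\<lambda>s. p s * I s)" if x: "x \<in> {-3..3}" for x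
  proof -
    have "(\<lambda>n. integral {-3..x} (\<lambda>s. p s * integral {-3..s} (\<lambda>r. q r * u n r))) \<longlonglongrightarrow> integral {-3..x} (\<lambda>s. p s * I s)"
    proof (rule dominated_convergence[where h="\<lambda>s. \<bar>P\<bar> * C"])
      show "(\<lambda>s. p s * integral {-3..s} (\<lambda>r. q r * u k r)) integrable_on {-3..x}" for k
        by (intro io cu x)
      show "(\<lambda>s. \<bar>P\<bar> * C) integrable_on {-3..x}" by (rule integrable_const_ivl)
      fix s assume "s \<in> {-3..x}"
      then have s: "s \<in> {-3..3}" using x by auto
      show "(\<lambda>k. p s * integral {-3..s} (\<lambda>r. q r * u k r)) \<longlonglongrightarrow> p s * I s"
        unfolding I_def using in_lim[OF s] by (intro tendsto_mult tendsto_const) auto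
      fix k
      have nn: "0 \<le> q r * u k r" if "r \<in> {-3..3}" for r using q0[OF that] ge1[OF that, of k] by simp
      have i0: "0 \<le> integral {-3..s} (\<lambda>r. q r * u k r)"
        using s nn by (intro integral_nonneg ii cu) auto
      have "integral {-3..s} (\<lambda>r. q r * u k r) \<le> integral {-3..3} (\<lambda>r. q r * u k r)"
        using s nn by (intro integral_subset_le ii cu) auto
      also have "\<dots> \<le> C" unfolding C_def
      proof (rule integral_le)
        fix r :: real assume r: "r \<in> {-3..3}"
        show "q r * u k r \<le> \<bar>Q\<bar> * E r"
          using PQ(2)[OF r] upper[OF r, of k] ge1[OF r, of k] q0[OF r] by (intro mult_mono) auto
      qed (intro ii cu integrable_continuous_real continuous_intros cE; simp)+
      finally show "norm (p s * integral {-3..s} (\<lambda>r. q r * u k r)) \<le> \<bar>P\<bar> * C"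
        unfolding real_norm_def abs_mult using i0 PQ(1)[OF s] p0[OF s] by (intro mult_mono) auto
    qed
    then have "(\<lambda>n. u (Suc n) x) \<longlonglongrightarrow> 1 + integral {-3..x} (\<lambda>s. p s * I s)"
      unfolding uS \<Gamma>_def by (intro tendsto_add tendsto_const)
    from LIMSEQ_unique[OF LIMSEQ_Suc[OF lim[OF x]] this] show ?thesis .
  qed
  show ?thesis
  proof (rule that[of f])
    show "f x = 1 + integral {-3..x} (\<lambda>s. p s * integral {-3..s} (\<lambda>r. q r * f r))" if "x \<in> {-3..3}" for x
      using eq[OF that] by (simp add: I_def)
    have "continuous_on {-3..3} (\<lambda>x. 1 + integral {-3..x} (\<lambda>s. p s * I s))"
      by (intro continuous_intros cI cp cI')
    then show "continuous_on {-3..3} f" by (rule continuous_on_eq) (simp add: eq)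
    show "1 \<le> f x" if "x \<in> {-3..3}" for x
      using lim[OF that] ge1[OF that] by (intro LIMSEQ_le_const[of "\<lambda>n. u n x"]) auto
  qed
qed

text \<open>The variable is the displacement from the start of a cycle. A running cycle has
  displacement below 1, so the equation is demanded on [-1, 1] only; the global bounds are those of
  \<open>ito_stopping\<close>.\<close>

definition eigenfun :: "(real \<Rightarrow> real) \<Rightarrow> (real \<Rightarrow> real) \<Rightarrow> real \<Rightarrow> (real \<Rightarrow> real) \<Rightarrow> bool" where
  "eigenfun b \<sigma> l g \<longleftrightarrow> (\<exists>g' g'' B. (\<forall>x. (g has_real_derivative g' x) (at x)) \<and> (\<forall>x. (g' has_real_derivative g'' x) (at x)) \<and>
     1 \<le> B \<and> (\<forall>x. \<bar>g x\<bar> \<le> B) \<and> (\<forall>x. \<bar>g' x\<bar> \<le> B) \<and> (\<forall>x. \<bar>g'' x\<bar> \<le> B) \<and> continuous_on UNIV g'' \<and>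
     (\<forall>x. \<bar>x\<bar> \<le> 1 \<longrightarrow> b x * g' x + (\<sigma> x)\<^sup>2 / 2 * g'' x = l * g x))"

text \<open>The first eigenfunction is a Picard iterate limit, the second one comes from it by reduction of order;
  \<open>p\<close> and \<open>q\<close> are the scale density and \<open>l\<close> times the speed density of the diffusion.\<close>
lemma eigenfun_pair:
  fixes b \<sigma> :: "real \<Rightarrow> real"
  assumes cont: "continuous_on UNIV b" "continuous_on UNIV \<sigma>" and pos: "\<And>x. \<sigma> x > 0" and l: "l > 0"
  obtains g1 g2 where "eigenfun b \<sigma> l g1" "eigenfun b \<sigma> l g2" "\<And>x. \<bar>x\<bar> \<le> 1 \<Longrightarrow> 1 \<le> g1 x"
    "g1 (-1) * g2 1 - g1 1 * g2 (-1) > 0"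
proof -
  have c: "continuous_on A b" "continuous_on A \<sigma>" for A using cont by (auto intro: continuous_on_subset)
  have s0: "\<sigma> x \<noteq> 0" for x using pos[of x] by simp
  have D_int: "((\<lambda>x. integral {-3..x} h) has_real_derivative h x) (at x)" 
    if "continuous_on {-3..3} h" "-3 < x" "x < 3" for h :: "real \<Rightarrow> real" and x
  proof -
    have "((\<lambda>x. integral {-3..x} h) has_real_derivative h x) (at x within {-3..3})"
      using that by (intro integral_has_real_derivative) auto
    then show ?thesis using that by (simp add: at_within_Icc_at)
  qed
  have C_int: "continuous_on {-3..3} (\<lambda>s. integral {-3..s} h)" if "continuous_on {-3..3} h" for h :: "real \<Rightarrow> real"
    using indefinite_integral_continuous_1[OF integrable_continuous_real[OF that]] .
  \<comment> \<open>The equation reads g'' + r g' = 2 l g / \<sigma>^2, and p, the exponential of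
    minus an integral of r, is its integrating factor: (g' / p)' = q g. Integrating twice gives the
    fixed point problem of \<open>picard_exists\<close>.\<close>
  define r where "r x = 2 * b x / (\<sigma> x)\<^sup>2" for x
  have cr: "continuous_on A r" for A unfolding r_def by (intro continuous_intros c) (simp add: s0)
  define E where "E x = integral {-3..x} r" for x
  have cE: "continuous_on {-3..3} E" unfolding E_def by (intro C_int cr)
  define p where "p x = exp (- E x)" for x
  define q where "q x = l * (2 * exp (E x) / (\<sigma> x)\<^sup>2)" for x
  have cp: "continuous_on {-3..3} p" and cq: "continuous_on {-3..3} q"
    unfolding p_def q_def by (intro continuous_intros cE c; simp add: s0)+
  have p_pos: "p x > 0" and q_pos: "q x > 0" for x using l pos[of x] by (auto simp: p_def q_def)
  have pq: "p x * q x = l * 2 / (\<sigma> x)\<^sup>2" for x by (simp add: p_def q_def exp_minus)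
  have dp: "(p has_real_derivative - r x * p x) (at x)" if "-3 < x" "x < 3" for x
    unfolding p_def[abs_def] using D_int[OF cr that] unfolding E_def[abs_def]
    by (auto intro!: derivative_eq_intros)
  obtain f where f: "continuous_on {-3..3} f" "\<And>x. x \<in> {-3..3} \<Longrightarrow> 1 \<le> f x"
    "\<And>x. x \<in> {-3..3} \<Longrightarrow> f x = 1 + integral {-3..x} (\<lambda>s. p s * integral {-3..s} (\<lambda>r. q r * f r))"
    by (rule picard_exists[OF cp cq]) (blast intro: less_imp_le[OF p_pos] less_imp_le[OF q_pos])+
  define I where "I s = integral {-3..s} (\<lambda>r. q r * f r)" for s
  have cqf: "continuous_on {-3..3} (\<lambda>r. q r * f r)" by (intro continuous_intros cq f)
  have cI: "continuous_on {-3..3} I" unfolding I_def by (intro C_int cqf)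
  have cpI: "continuous_on {-3..3} (\<lambda>s. p s * I s)" by (intro continuous_intros cp cI)
  have dI: "(I has_real_derivative q x * f x) (at x)" if "-3 < x" "x < 3" for x
    unfolding I_def[abs_def] by (rule D_int[OF cqf that])
  have df: "(f has_real_derivative p x * I x) (at x)" if x: "-3 < x" "x < 3" for x
  proof (rule has_field_derivative_transform_within_open[of "\<lambda>x. 1 + integral {-3..x} (\<lambda>s. p s * I s)" _ _ "{-3<..<3}"])
    show "((\<lambda>x. 1 + integral {-3..x} (\<lambda>s. p s * I s)) has_real_derivative p x * I x) (at x)"
      using D_int[OF cpI x] by (auto intro!: derivative_eq_intros)
  qed (use x f(3) in \<open>auto simp: I_def\<close>)
  define f'' where "f'' x = - r x * (p x * I x) + l * 2 / (\<sigma> x)\<^sup>2 * f x" for x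
  have ddf: "((\<lambda>x. p x * I x) has_real_derivative f'' x) (at x)" if x: "-3 < x" "x < 3" for x
  proof -
    have "((\<lambda>x. p x * I x) has_real_derivative (- r x * p x) * I x + (q x * f x) * p x) (at x)"
      by (rule DERIV_mult[OF dp[OF x] dI[OF x]])
    moreover have "(- r x * p x) * I x + (q x * f x) * p x = f'' x"
      unfolding f''_def pq[symmetric] by (simp add: algebra_simps)
    ultimately show ?thesis by simp
  qed
  have sub: "continuous_on {-2..2} h" if "continuous_on {-3..3} h" for h :: "real \<Rightarrow> real"
    by (rule continuous_on_subset[OF that]) auto
  have cf'': "continuous_on {-2..2} f''"
    unfolding f''_def by (intro continuous_intros cr c sub[OF cp] sub[OF cI] sub[OF f(1)]) (simp add: s0)
  have eig1: "b x * (p x * I x) + (\<sigma> x)\<^sup>2 / 2 * f'' x = l * f x" for x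
    using s0[of x] by (simp add: f''_def r_def field_simps)
  obtain g1 g1' g1'' B1 where g1: "\<And>x. (g1 has_real_derivative g1' x) (at x)" "\<And>x. (g1' has_real_derivative g1'' x) (at x)"
    "1 \<le> B1" "\<And>x. \<bar>g1 x\<bar> \<le> B1" "\<And>x. \<bar>g1' x\<bar> \<le> B1" "\<And>x. \<bar>g1'' x\<bar> \<le> B1" "continuous_on UNIV g1''"
    "\<And>x. \<bar>x\<bar> \<le> 1 \<Longrightarrow> g1 x = f x" "\<And>x. \<bar>x\<bar> \<le> 1 \<Longrightarrow> g1' x = p x * I x" "\<And>x. \<bar>x\<bar> \<le> 1 \<Longrightarrow> g1'' x = f'' x"
    by (rule bounded_C2_extension[OF df ddf cf'']) blast+
  have e1: "eigenfun b \<sigma> l g1"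
    unfolding eigenfun_def by (rule exI[of _ g1'], rule exI[of _ g1''], rule exI[of _ B1]) (use eig1 in \<open>auto simp: g1\<close>)
  \<comment> \<open>Reduction of order: the Wronskian of two solutions is a multiple of p, so f
    times an antiderivative of p / f^2 is a second solution.\<close>
  define v where "v x = p x / (f x)\<^sup>2" for x
  have f0: "f x \<noteq> 0" if "x \<in> {-3..3}" for x using f(2)[OF that] by simp
  have cv: "continuous_on {-3..3} v" unfolding v_def by (intro continuous_intros cp f(1)) (use f0 in auto)
  define w where "w x = integral {-3..x} v" for x
  have cw: "continuous_on {-3..3} w" unfolding w_def by (intro C_int cv)
  have dw: "(w has_real_derivative v x) (at x)" if "-3 < x" "x < 3" for x
    unfolding w_def[abs_def] by (rule D_int[OF cv that])
  define k where "k x = f x * w x" for x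
  define k' where "k' x = p x * I x * w x + p x / f x" for x
  define k'' where "k'' x = f'' x * w x - r x * p x / f x" for x
  have dk: "(k has_real_derivative k' x) (at x)" if x: "-3 < x" "x < 3" for x
  proof -
    have "(k has_real_derivative (p x * I x) * w x + v x * f x) (at x)"
      unfolding k_def[abs_def] by (rule DERIV_mult[OF df[OF x] dw[OF x]])
    moreover have "(p x * I x) * w x + v x * f x = k' x"
      using f0[of x] x by (simp add: k'_def v_def power2_eq_square)
    ultimately show ?thesis by simp
  qed
  have dk': "(k' has_real_derivative k'' x) (at x)" if x: "-3 < x" "x < 3" for x
  proof -
    have fx: "f x \<noteq> 0" using f0[of x] x by simp
    have "(k' has_real_derivative (f'' x * w x + v x * (p x * I x)) + ((- r x * p x) * f x - p x * (p x * I x)) / (f x * f x)) (at x)"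
      unfolding k'_def[abs_def]
      by (rule DERIV_add[OF DERIV_mult[OF ddf[OF x] dw[OF x]] DERIV_divide[OF dp[OF x] df[OF x] fx]])
    moreover have "(f'' x * w x + v x * (p x * I x)) + ((- r x * p x) * f x - p x * (p x * I x)) / (f x * f x) = k'' x"
      using fx by (simp add: k''_def v_def power2_eq_square diff_divide_distrib)
    ultimately show ?thesis by simp
  qed
  have ck'': "continuous_on {-2..2} k''"
    unfolding k''_def by (intro continuous_intros cf'' cr sub[OF cw] sub[OF cp] sub[OF f(1)]) (use f0 in auto)
  have eig2: "b x * k' x + (\<sigma> x)\<^sup>2 / 2 * k'' x = l * k x" if "x \<in> {-3..3}" for x
  proof -
    have "b x * k' x + (\<sigma> x)\<^sup>2 / 2 * k'' x = (b x * (p x * I x) + (\<sigma> x)\<^sup>2 / 2 * f'' x) * w x + (b x - (\<sigma> x)\<^sup>2 / 2 * r x) * (p x / f x)"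
      by (simp add: k'_def k''_def algebra_simps)
    also have "(\<sigma> x)\<^sup>2 / 2 * r x = b x" using s0[of x] by (simp add: r_def)
    finally show ?thesis unfolding eig1 by (simp add: k_def)
  qed
  have eig2': "b x * k' x + (\<sigma> x)\<^sup>2 / 2 * k'' x = l * k x" if "\<bar>x\<bar> \<le> 1" for x
    using that by (intro eig2) auto
  obtain g2 g2' g2'' B2 where g2: "\<And>x. (g2 has_real_derivative g2' x) (at x)" "\<And>x. (g2' has_real_derivative g2'' x) (at x)"
    "1 \<le> B2" "\<And>x. \<bar>g2 x\<bar> \<le> B2" "\<And>x. \<bar>g2' x\<bar> \<le> B2" "\<And>x. \<bar>g2'' x\<bar> \<le> B2" "continuous_on UNIV g2''"
    "\<And>x. \<bar>x\<bar> \<le> 1 \<Longrightarrow> g2 x = k x" "\<And>x. \<bar>x\<bar> \<le> 1 \<Longrightarrow> g2' x = k' x" "\<And>x. \<bar>x\<bar> \<le> 1 \<Longrightarrow> g2'' x = k'' x"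
    by (rule bounded_C2_extension[OF dk dk' ck'']) blast+
  have e2: "eigenfun b \<sigma> l g2"
    unfolding eigenfun_def by (rule exI[of _ g2'], rule exI[of _ g2''], rule exI[of _ B2]) (use eig2' in \<open>auto simp: g2\<close>)
  \<comment> \<open>With k = f w the determinant equals f(-1) f(1) (w(1) - w(-1)), so its sign is
    settled by monotonicity of w.\<close>
  have "w (-1) < w 1"
  proof (rule DERIV_pos_imp_increasing[of "-1" 1 w])
    fix x :: real assume x: "-1 \<le> x" "x \<le> 1"
    show "\<exists>y. (w has_real_derivative y) (at x) \<and> 0 < y"
      using dw[of x] f0[of x] p_pos[of x] x by (intro exI[of _ "v x"]) (auto simp: v_def)
  qed simp
  moreover have "f 1 > 0" "f (-1) > 0" using f(2)[of 1] f(2)[of "-1"] by auto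
  ultimately have "f (-1) * f 1 * (w 1 - w (-1)) > 0" by simp
  then have "g1 (-1) * g2 1 - g1 1 * g2 (-1) > 0" 
    by (simp add: g1(8) g2(8) k_def algebra_simps)
  then show ?thesis using e1 e2 f(2) by (intro that[of g1 g2]) (auto simp: g1(8) abs_le_iff)
qed

section \<open>Cycle times\<close>

declare cycle_time.simps(2) [simp del]

context sde
begin

abbreviation T :: "nat \<Rightarrow> 'a \<Rightarrow> ereal" where "T n \<omega> \<equiv> cycle_time X \<omega> n"

abbreviation Tr :: "nat \<Rightarrow> 'a \<Rightarrow> real" where "Tr n \<omega> \<equiv> real_of_ereal (T n \<omega>)"

text \<open>No real time lies above infinity, so the infimum runs over the empty set; the value of
  \<open>X\<close> at the meaningless time \<open>real_of_ereal \<infinity>\<close> has no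
  influence.\<close>

lemma T_Suc_infinite: "T n \<omega> = \<infinity> \<Longrightarrow> T (Suc n) \<omega> = \<infinity>"
  by (auto simp: top_ereal_def cycle_time.simps(2))

lemma X_abs_less_1:
  assumes w: "\<omega> \<in> space M" and a: "0 \<le> a" and st: "a \<le> s" 
    and ne: "\<And>r. a \<le> r \<Longrightarrow> r \<le> s \<Longrightarrow> \<bar>X r \<omega> - X a \<omega>\<bar> \<noteq> 1"
  shows "\<bar>X s \<omega> - X a \<omega>\<bar> < 1"
proof (rule ccontr)
  assume "\<not> \<bar>X s \<omega> - X a \<omega>\<bar> < 1"
  moreover have "continuous_on {a..s} (\<lambda>r. \<bar>X r \<omega> - X a \<omega>\<bar>)"
    using a by (intro continuous_intros continuous_on_subset[OF X_cont[OF w]]) auto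
  ultimately have "\<exists>r. a \<le> r \<and> r \<le> s \<and> \<bar>X r \<omega> - X a \<omega>\<bar> = 1"
    using st by (intro IVT') auto
  then show False using ne by blast
qed

text \<open>By continuity the set of hitting times is closed, so a finite infimum is attained;
  before it the intermediate value theorem keeps the displacement below 1.\<close>

lemma T_Suc_cases:
  assumes w: "\<omega> \<in> space M" and a: "T n \<omega> = ereal a" "0 \<le> a"
  obtains (infinite) "T (Suc n) \<omega> = \<infinity>" "\<And>s. a \<le> s \<Longrightarrow> \<bar>X s \<omega> - X a \<omega>\<bar> < 1"
  | (finite) c where "a < c" "T (Suc n) \<omega> = ereal c" "\<bar>X c \<omega> - X a \<omega>\<bar> = 1" "\<And>s. a \<le> s \<Longrightarrow> s < c \<Longrightarrow> \<bar>X s \<omega> - X a \<omega>\<bar> < 1"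
proof -
  define S where "S = {s. a \<le> s \<and> \<bar>X s \<omega> - X a \<omega>\<bar> = 1}"
  have T: "T (Suc n) \<omega> = Inf (ereal ` S)"
    using a by (simp add: cycle_time.simps(2) S_def image_def setcompr_eq_image[symmetric]) (metis (mono_tags, lifting) mem_Collect_eq)
  show ?thesis
  proof (cases "S = {}")
    case True
    then have "\<And>r. a \<le> r \<Longrightarrow> \<bar>X r \<omega> - X a \<omega>\<bar> \<noteq> 1" by (auto simp: S_def)
    then have "\<bar>X s \<omega> - X a \<omega>\<bar> < 1" if "a \<le> s" for s using X_abs_less_1[OF w a(2) that] by blast
    moreover have "T (Suc n) \<omega> = \<infinity>" unfolding T True by (simp add: top_ereal_def)
    ultimately show ?thesis using infinite by blast
  next
    case False
    have "continuous_on {a..} (\<lambda>s. \<bar>X s \<omega> - X a \<omega>\<bar>)"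
      using a by (intro continuous_intros continuous_on_subset[OF X_cont[OF w]]) auto
    then have "closed ({a..} \<inter> (\<lambda>s. \<bar>X s \<omega> - X a \<omega>\<bar>) -` {1})" by (rule continuous_closed_preimage) auto
    moreover have "{a..} \<inter> (\<lambda>s. \<bar>X s \<omega> - X a \<omega>\<bar>) -` {1} = S" by (auto simp: S_def)
    ultimately have cl: "closed S" by simp
    have bdd: "bdd_below S" by (rule bdd_belowI[of _ a]) (auto simp: S_def)
    define c where "c = Inf S"
    have cS: "c \<in> S" unfolding c_def by (rule closed_contains_Inf[OF False bdd cl])
    have least: "c \<le> s" if "s \<in> S" for s unfolding c_def by (rule cInf_lower[OF that bdd])
    have "T (Suc n) \<omega> = ereal c"
      unfolding T by (rule antisym) (use cS least in \<open>auto intro: Inf_lower Inf_greatest\<close>)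
    moreover have "a < c" using cS by (auto simp: S_def less_le)
    moreover have "\<bar>X s \<omega> - X a \<omega>\<bar> < 1" if "a \<le> s" "s < c" for s
    proof (rule X_abs_less_1[OF w a(2) that(1)])
      fix r assume "a \<le> r" "r \<le> s"
      then show "\<bar>X r \<omega> - X a \<omega>\<bar> \<noteq> 1" using least[of r] that(2) by (auto simp: S_def)
    qed
    ultimately show ?thesis using cS finite by (auto simp: S_def)
  qed
qed

lemma T_nonneg: "\<omega> \<in> space M \<Longrightarrow> 0 \<le> T n \<omega>"
proof (induction n)
  case (Suc n)
  show ?case
  proof (cases "T n \<omega>")
    case (real a)
    then show ?thesis using T_Suc_cases[OF Suc.prems real] Suc by (cases rule: T_Suc_cases[OF Suc.prems real]) auto
  qed (use Suc T_Suc_infinite in auto)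
qed simp

lemma T_real: 
  assumes "\<omega> \<in> space M" "T n \<omega> < \<infinity>" shows "T n \<omega> = ereal (Tr n \<omega>)" "0 \<le> Tr n \<omega>"
  using T_nonneg[OF assms(1), of n] assms(2) by (cases "T n \<omega>"; auto)+

lemma T_less_Suc: "\<omega> \<in> space M \<Longrightarrow> T n \<omega> < \<infinity> \<Longrightarrow> T n \<omega> < T (Suc n) \<omega>"
proof -
  assume w: "\<omega> \<in> space M" and fin: "T n \<omega> < \<infinity>"
  note T = T_real[OF w fin]
  show ?thesis by (cases rule: T_Suc_cases[OF w T]) (subst T, simp)+
qed

lemma T_mono: "\<omega> \<in> space M \<Longrightarrow> m \<le> n \<Longrightarrow> T m \<omega> \<le> T n \<omega>"
proof (rule lift_Suc_mono_le[of "\<lambda>n. T n \<omega>"])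
  fix k assume "\<omega> \<in> space M"
  then show "T k \<omega> \<le> T (Suc k) \<omega>" using T_less_Suc[of \<omega> k] T_Suc_infinite[of \<omega> k] by (cases "T k \<omega> < \<infinity>") auto
qed

lemma X_before_T_Suc:
  assumes "\<omega> \<in> space M" "T n \<omega> \<le> ereal s" "ereal s < T (Suc n) \<omega>"
  shows "\<bar>X s \<omega> - X (Tr n \<omega>) \<omega>\<bar> < 1"
proof -
  have fin: "T n \<omega> < \<infinity>" using assms(2) by (cases "T n \<omega>") auto
  note T = T_real[OF assms(1) fin]
  have "Tr n \<omega> \<le> s" using assms(2) T by (metis ereal_less_eq(3))
  then show ?thesis using assms(3) by (cases rule: T_Suc_cases[OF assms(1) T]) auto
qed

lemma X_T_Suc:
  assumes "\<omega> \<in> space M" "T (Suc n) \<omega> < \<infinity>"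
  shows "\<bar>X (Tr (Suc n) \<omega>) \<omega> - X (Tr n \<omega>) \<omega>\<bar> = 1"
proof -
  have fin: "T n \<omega> < \<infinity>" using assms(2) T_Suc_infinite[where n=n and \<omega>=\<omega>] by (cases "T n \<omega> = \<infinity>") auto
  show ?thesis using assms(2) by (cases rule: T_Suc_cases[OF assms(1) T_real[OF assms(1) fin]]) auto
qed

text \<open>Bounded cycle times would increase to a limit, where continuity forces the displacements
  over single cycles to 0, although each of them is 1.\<close>

lemma T_unbounded:
  assumes w: "\<omega> \<in> space M" shows "\<exists>n. ereal t < T n \<omega>"
proof (rule ccontr)
  assume "\<not> ?thesis"
  then have le: "T n \<omega> \<le> ereal t" for n by (auto simp: not_less)
  have fin: "T n \<omega> < \<infinity>" for n using le[of n] by (cases "T n \<omega>") auto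
  note Tn = T_real[OF w fin]
  have "incseq (\<lambda>n. Tr n \<omega>)"
    by (rule incseq_SucI) (metis T_less_Suc[OF w fin] Tn(1) less_imp_le ereal_less_eq(3))
  moreover have "Tr n \<omega> \<le> t" for n using le[of n] Tn(1)[of n] by (metis ereal_less_eq(3))
  ultimately obtain L where L: "(\<lambda>n. Tr n \<omega>) \<longlonglongrightarrow> L" using incseq_convergent[of "\<lambda>n. Tr n \<omega>" t] by blast
  have "0 \<le> L" using L by (rule LIMSEQ_le_const) (use Tn(2) in auto)
  then have lim: "(\<lambda>n. X (Tr n \<omega>) \<omega>) \<longlonglongrightarrow> X L \<omega>"
    by (intro continuous_on_tendsto_compose[OF X_cont[OF w] L]) (use Tn(2) in auto)
  have "(\<lambda>n. \<bar>X (Tr (Suc n) \<omega>) \<omega> - X (Tr n \<omega>) \<omega>\<bar>) \<longlonglongrightarrow> \<bar>X L \<omega> - X L \<omega>\<bar>"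
    by (intro tendsto_intros lim LIMSEQ_Suc[OF lim])
  then have "(\<lambda>n. 1 :: real) \<longlonglongrightarrow> 0" using X_T_Suc[OF w fin] by simp
  then show False using LIMSEQ_unique[OF tendsto_const, of "1 :: real" 0] by simp
qed

text \<open>The finite range of k matters: it lets \<open>cycle_ito\<close> split an expectation
  into finitely many parts, each with a deterministic starting point.\<close>

lemma X_T_integer:
  assumes "\<omega> \<in> space M" "T n \<omega> < \<infinity>"
  shows "\<exists>k\<in>{- int n..int n}. X (Tr n \<omega>) \<omega> = y + of_int k"
  using assms(2)
proof (induction n)
  case 0
  then show ?case using X_0[OF assms(1)] by (simp add: zero_ereal_def)
next
  case (Suc n)
  then have "T n \<omega> < \<infinity>" using T_Suc_infinite[where n=n and \<omega>=\<omega>] by (cases "T n \<omega> = \<infinity>") auto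
  then obtain k where k: "k \<in> {- int n..int n}" "X (Tr n \<omega>) \<omega> = y + of_int k" using Suc.IH by blast
  have "X (Tr (Suc n) \<omega>) \<omega> = y + of_int (k + 1) \<or> X (Tr (Suc n) \<omega>) \<omega> = y + of_int (k - 1)"
    using X_T_Suc[OF assms(1) Suc.prems] k(2) by (auto simp: abs_if split: if_splits)
  then show ?case
  proof
    assume "X (Tr (Suc n) \<omega>) \<omega> = y + of_int (k + 1)"
    then show ?thesis using k(1) by (intro bexI[of _ "k + 1"]) auto
  next
    assume "X (Tr (Suc n) \<omega>) \<omega> = y + of_int (k - 1)"
    then show ?thesis using k(1) by (intro bexI[of _ "k - 1"]) auto
  qed
qed

text \<open>The cycle time as far as it can be seen at time u: a finite real variable, known at u
  (\<open>Tm_F\<close>), which agrees with the cycle time once that has occurred.\<close>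

definition Tm :: "nat \<Rightarrow> real \<Rightarrow> 'a \<Rightarrow> real" where
  "Tm n u \<omega> = real_of_ereal (min (T n \<omega>) (ereal u))"

lemma Tm_ereal: "\<omega> \<in> space M \<Longrightarrow> 0 \<le> u \<Longrightarrow> ereal (Tm n u \<omega>) = min (T n \<omega>) (ereal u)"
  using T_nonneg[of \<omega> n] unfolding Tm_def by (cases "T n \<omega>") (auto simp: min_def)

lemma Tm_bounds: "\<omega> \<in> space M \<Longrightarrow> 0 \<le> u \<Longrightarrow> 0 \<le> Tm n u \<omega>" "\<omega> \<in> space M \<Longrightarrow> 0 \<le> u \<Longrightarrow> Tm n u \<omega> \<le> u"
  using T_nonneg[of \<omega> n] unfolding Tm_def by (cases "T n \<omega>"; auto simp: min_def)+

lemma Tm_le_iff: "\<omega> \<in> space M \<Longrightarrow> 0 \<le> u \<Longrightarrow> Tm n u \<omega> \<le> v \<longleftrightarrow> T n \<omega> \<le> ereal v \<or> u \<le> v"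
  using Tm_ereal[of \<omega> u n] by (metis ereal_less_eq(3) min_le_iff_disj)

lemma Tm_eq: "T n \<omega> \<le> ereal u \<Longrightarrow> Tm n u \<omega> = Tr n \<omega>"
  by (simp add: Tm_def min_def)

lemma Tm_mono: "\<omega> \<in> space M \<Longrightarrow> 0 \<le> u \<Longrightarrow> m \<le> n \<Longrightarrow> Tm m u \<omega> \<le> Tm n u \<omega>"
  using Tm_ereal[of \<omega> u n] Tm_ereal[of \<omega> u m] T_mono[of \<omega> m n] by (metis ereal_less_eq(3) min.mono order_refl)

text \<open>The first hypothesis is the stopping property for this n; \<open>T_stopping\<close>
  supplies it as its induction hypothesis.\<close>

lemma Tm_measurable_aux:
  assumes "\<And>v. 0 \<le> v \<Longrightarrow> v \<le> u \<Longrightarrow> {\<omega>\<in>space M. T n \<omega> \<le> ereal v} \<in> sets (F v)" and u: "0 \<le> u"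
  shows "Tm n u \<in> borel_measurable (F u)"
proof (rule borel_measurableI_le)
  fix v
  show "{\<omega> \<in> space (F u). Tm n u \<omega> \<le> v} \<in> sets (F u)"
  proof (cases "u \<le> v")
    case True
    then have "{\<omega> \<in> space (F u). Tm n u \<omega> \<le> v} = space (F u)" using u by (auto simp: Tm_le_iff)
    then show ?thesis by (simp only: sets.top)
  next
    case False
    show ?thesis
    proof (cases "0 \<le> v")
      case True
      then have "{\<omega> \<in> space (F u). Tm n u \<omega> \<le> v} = {\<omega>\<in>space M. T n \<omega> \<le> ereal v}" using u False by (auto simp: Tm_le_iff)
      then show ?thesis using assms(1)[of v] True False sets_F_mono[of v u] by auto
    next
      case neg: False
      have "\<not> Tm n u \<omega> \<le> v" if "\<omega> \<in> space M" for \<omega> using Tm_bounds(1)[OF that u, of n] neg by linarith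
      then have "{\<omega> \<in> space (F u). Tm n u \<omega> \<le> v} = {}" by auto
      then show ?thesis by (simp only: sets.empty_sets)
    qed
  qed
qed

text \<open>Describes the event by countably many sample times q u \<le> u, so that it belongs to
  \<open>F u\<close> itself and not to a later sigma-algebra. Approaching distance 1 arbitrarily
  well by time u is the same as reaching it, since a continuous function attains its maximum on a
  compact interval.\<close>

lemma T_Suc_le_iff:
  assumes w: "\<omega> \<in> space M" and u: "0 \<le> u"
  shows "T (Suc n) \<omega> \<le> ereal u \<longleftrightarrow> T n \<omega> \<le> ereal u \<and>
    (\<forall>k::nat. \<exists>q\<in>\<rat> \<inter> {0..1}. Tm n u \<omega> \<le> q * u \<and> \<bar>X (q * u) \<omega> - X (Tm n u \<omega>) \<omega>\<bar> > 1 - 1 / Suc k)"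
proof (intro iffI conjI allI)
  assume le: "T (Suc n) \<omega> \<le> ereal u"
  then show Tn: "T n \<omega> \<le> ereal u" using T_mono[OF w, of n "Suc n"] by auto
  have fin: "T n \<omega> < \<infinity>" using Tn by (cases "T n \<omega>") auto
  note Tr = T_real[OF w fin]
  have Tm: "Tm n u \<omega> = Tr n \<omega>" by (rule Tm_eq[OF Tn])
  fix k :: nat
  show "\<exists>q\<in>\<rat> \<inter> {0..1}. Tm n u \<omega> \<le> q * u \<and> \<bar>X (q * u) \<omega> - X (Tm n u \<omega>) \<omega>\<bar> > 1 - 1 / Suc k"
  proof (cases rule: T_Suc_cases[OF w Tr])
    case 1
    then show ?thesis using le by simp
  next
    case (2 c)
    have cu: "c \<le> u" "0 < c" "0 < u" using le 2 Tr by auto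
    have "continuous_on {0..} (\<lambda>s. \<bar>X s \<omega> - X (Tr n \<omega>) \<omega>\<bar>)" by (intro continuous_intros X_cont[OF w])
    then obtain d where d: "d > 0" "\<And>s. 0 \<le> s \<Longrightarrow> dist s c < d \<Longrightarrow> 
        dist \<bar>X s \<omega> - X (Tr n \<omega>) \<omega>\<bar> \<bar>X c \<omega> - X (Tr n \<omega>) \<omega>\<bar> < 1 / Suc k"
      using cu(2) unfolding continuous_on_iff by (metis atLeast_iff less_imp_le of_nat_0_less_iff zero_less_Suc zero_less_divide_1_iff)
    \<comment> \<open>Strictly before the hitting time c there is a rational fraction of u at which
      the displacement is already within 1 / Suc k of 1.\<close>
    have "max (Tr n \<omega>) (c - d) / u < c / u" using cu 2(1) d(1) by (intro divide_strict_right_mono) auto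
    then obtain q where q: "q \<in> \<rat>" "max (Tr n \<omega>) (c - d) / u < q" "q < c / u" using Rats_dense_in_real by blast
    have qu: "max (Tr n \<omega>) (c - d) < q * u" "q * u < c" using q cu by (auto simp: field_simps)
    have "0 < q * u" using qu Tr(2) by auto
    then have "0 < q" using cu by (simp add: zero_less_mult_iff)
    moreover have "q * u \<le> 1 * u" using qu(2) cu by linarith
    then have "q \<le> 1" using cu(3) by (simp only: mult_le_cancel_right_pos)
    moreover have "\<bar>X (q * u) \<omega> - X (Tr n \<omega>) \<omega>\<bar> > 1 - 1 / Suc k"
      using d(2)[of "q * u"] qu \<open>0 < q * u\<close> 2(3) by (auto simp: dist_real_def)
    ultimately show ?thesis using q(1) qu(1) by (intro bexI[of _ q]) (auto simp: Tm)
  qed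
next
  assume r: "T n \<omega> \<le> ereal u \<and> (\<forall>k::nat. \<exists>q\<in>\<rat> \<inter> {0..1}. Tm n u \<omega> \<le> q * u \<and> \<bar>X (q * u) \<omega> - X (Tm n u \<omega>) \<omega>\<bar> > 1 - 1 / Suc k)"
  then have Tn: "T n \<omega> \<le> ereal u" by simp
  have fin: "T n \<omega> < \<infinity>" using Tn by (cases "T n \<omega>") auto
  note Tr = T_real[OF w fin]
  have Tm: "Tm n u \<omega> = Tr n \<omega>" by (rule Tm_eq[OF Tn])
  have au: "Tr n \<omega> \<le> u" using Tn Tr(1) by (metis ereal_less_eq(3))
  have "continuous_on {Tr n \<omega>..u} (\<lambda>s. \<bar>X s \<omega> - X (Tr n \<omega>) \<omega>\<bar>)"
    using Tr(2) by (intro continuous_intros continuous_on_subset[OF X_cont[OF w]]) auto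
  then obtain s where s: "s \<in> {Tr n \<omega>..u}" "\<And>r. r \<in> {Tr n \<omega>..u} \<Longrightarrow> \<bar>X r \<omega> - X (Tr n \<omega>) \<omega>\<bar> \<le> \<bar>X s \<omega> - X (Tr n \<omega>) \<omega>\<bar>"
    using continuous_attains_sup[of "{Tr n \<omega>..u}"] au by (metis atLeastatMost_empty_iff compact_Icc)
  \<comment> \<open>The approximating times push the maximum to at least 1, and it is attained at s,
    so the cycle cannot still be running at s.\<close>
  have ge: "1 \<le> \<bar>X s \<omega> - X (Tr n \<omega>) \<omega>\<bar>"
  proof (rule field_le_epsilon)
    fix e :: real assume "0 < e"
    then obtain k where k: "1 / Suc k < e" using nat_approx_posE by blast
    obtain q where q: "q \<in> \<rat> \<inter> {0..1}" "Tr n \<omega> \<le> q * u" "\<bar>X (q * u) \<omega> - X (Tr n \<omega>) \<omega>\<bar> > 1 - 1 / Suc k"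
      using r unfolding Tm by blast
    have "q * u \<le> u" using q(1) u mult_right_mono[of q 1 u] by simp
    then show "1 \<le> \<bar>X s \<omega> - X (Tr n \<omega>) \<omega>\<bar> + e" using s(2)[of "q * u"] q k by auto
  qed
  show "T (Suc n) \<omega> \<le> ereal u"
  proof (cases rule: T_Suc_cases[OF w Tr])
    case 1
    then show ?thesis using ge s(1) by force
  next
    case (2 c)
    then show ?thesis using ge s(1) by force
  qed
qed

lemma X_random_time_F:
  assumes "0 \<le> u" "S \<in> borel_measurable (F u)" "\<And>\<omega>. \<omega> \<in> space M \<Longrightarrow> 0 \<le> S \<omega>" "\<And>\<omega>. \<omega> \<in> space M \<Longrightarrow> S \<omega> \<le> u"
  shows "(\<lambda>\<omega>. X (S \<omega>) \<omega>) \<in> borel_measurable (F u)"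
proof (rule X_random_time[where u=u])
  show "X v \<in> borel_measurable (F u)" if "0 \<le> v" "v \<le> u" for v
    by (rule measurable_F_mono[OF that(2) X_F[OF that(1)]])
qed (use assms in auto)

lemma T_stopping: "0 \<le> u \<Longrightarrow> {\<omega>\<in>space M. T n \<omega> \<le> ereal u} \<in> sets (F u)"
proof (induction n arbitrary: u)
  case 0
  have "{\<omega>\<in>space M. T 0 \<omega> \<le> ereal u} = space (F u)" using 0 by auto
  then show ?case by (simp only: sets.top)
next
  case (Suc n)
  have Tm: "Tm n u \<in> borel_measurable (F u)" by (rule Tm_measurable_aux[OF _ Suc.prems]) (rule Suc.IH)
  have XT: "(\<lambda>\<omega>. X (Tm n u \<omega>) \<omega>) \<in> borel_measurable (F u)"
    by (rule X_random_time_F[OF Suc.prems Tm]) (simp_all add: Tm_bounds Suc.prems)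
  have Xq: "X (q * u) \<in> borel_measurable (F u)" if "q \<in> \<rat> \<inter> {0..1}" for q
    by (rule measurable_F_mono[OF _ X_F]) (use that Suc.prems in \<open>auto simp: mult_left_le_one_le\<close>)
  have count: "countable (\<rat> \<inter> {0..1::real})" using countable_rat by blast
  have "{\<omega>\<in>space M. T (Suc n) \<omega> \<le> ereal u} = {\<omega>\<in>space M. T n \<omega> \<le> ereal u} \<inter>
    (\<Inter>k::nat. \<Union>q\<in>\<rat> \<inter> {0..1}. {\<omega>\<in>space (F u). Tm n u \<omega> \<le> q * u \<and> \<bar>X (q * u) \<omega> - X (Tm n u \<omega>) \<omega>\<bar> > 1 - 1 / Suc k})"
    using T_Suc_le_iff[OF _ Suc.prems] by auto
  also have "\<dots> \<in> sets (F u)"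
  proof (rule sets.Int[OF Suc.IH[OF Suc.prems]])
    have A: "{\<omega>\<in>space (F u). Tm n u \<omega> \<le> q * u \<and> \<bar>X (q * u) \<omega> - X (Tm n u \<omega>) \<omega>\<bar> > 1 - 1 / Suc k} \<in> sets (F u)"
      if q: "q \<in> \<rat> \<inter> {0..1::real}" for k :: nat and q
    proof -
      note [measurable] = Tm XT Xq[OF q]
      show ?thesis by measurable
    qed
    have B: "(\<Union>q\<in>\<rat> \<inter> {0..1}. {\<omega>\<in>space (F u). Tm n u \<omega> \<le> q * u \<and> \<bar>X (q * u) \<omega> - X (Tm n u \<omega>) \<omega>\<bar> > 1 - 1 / Suc k}) \<in> sets (F u)" for k :: nat
      by (rule sets.countable_UN'[OF count], rule image_subsetI, rule A)
    show "(\<Inter>k::nat. \<Union>q\<in>\<rat> \<inter> {0..1}. {\<omega>\<in>space (F u). Tm n u \<omega> \<le> q * u \<and> \<bar>X (q * u) \<omega> - X (Tm n u \<omega>) \<omega>\<bar> > 1 - 1 / Suc k}) \<in> sets (F u)"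
      by (rule sets.countable_INT'[OF countableI_type UNIV_not_empty], rule image_subsetI, rule B)
  qed
  finally show ?case .
qed

lemma Tm_F: "0 \<le> u \<Longrightarrow> Tm n u \<in> borel_measurable (F u)"
  by (intro Tm_measurable_aux T_stopping) auto

lemma X_Tm_F: "0 \<le> u \<Longrightarrow> (\<lambda>\<omega>. X (Tm n u \<omega>) \<omega>) \<in> borel_measurable (F u)"
  by (rule X_random_time_F[OF _ Tm_F]) (simp_all add: Tm_bounds)

end

section \<open>Ito's formula within one cycle\<close>

context sde
begin

text \<open>The start of cycle n is y + k for one of finitely many k. On each of these events
  periodicity makes g, shifted to the start, an eigenfunction for the original coefficients, so
  \<open>ito_stopping\<close> applies; summing over k gives a statement relative to the random
  start.\<close>

lemma cycle_ito:
  assumes eig: "eigenfun (\<lambda>x. b (y + x)) (\<lambda>x. \<sigma> (y + x)) l g" and l: "0 \<le> l"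
    and S [measurable]: "S \<in> borel_measurable M" and T' [measurable]: "T' \<in> borel_measurable M" 
    and Y [measurable]: "Y \<in> borel_measurable M"
    and ST: "\<And>\<omega>. \<omega> \<in> space M \<Longrightarrow> 0 \<le> S \<omega>" "\<And>\<omega>. \<omega> \<in> space M \<Longrightarrow> S \<omega> \<le> T' \<omega>" "\<And>\<omega>. \<omega> \<in> space M \<Longrightarrow> T' \<omega> \<le> L"
    and Y1: "\<And>\<omega>. \<bar>Y \<omega>\<bar> \<le> 1"
    and YS: "\<And>\<omega>. \<omega> \<in> space M \<Longrightarrow> Y \<omega> \<noteq> 0 \<Longrightarrow> T n \<omega> \<le> ereal (S \<omega>)"
    and YT: "\<And>\<omega> u. \<omega> \<in> space M \<Longrightarrow> Y \<omega> \<noteq> 0 \<Longrightarrow> S \<omega> \<le> u \<Longrightarrow> u < T' \<omega> \<Longrightarrow> ereal u < T (Suc n) \<omega>"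
    and adapted: "\<And>u. 0 \<le> u \<Longrightarrow> (\<lambda>\<omega>. if S \<omega> \<le> u \<and> u < T' \<omega> then Y \<omega> else 0) \<in> borel_measurable (F u)"
    and SF: "\<And>u. 0 \<le> u \<Longrightarrow> (\<lambda>\<omega>. min (S \<omega>) u) \<in> borel_measurable (F u)"
  shows "expectation (\<lambda>\<omega>. Y \<omega> * (exp (- l * (T' \<omega> - S \<omega>)) * g (X (T' \<omega>) \<omega> - X (Tm n L \<omega>) \<omega>)
            - g (X (S \<omega>) \<omega> - X (Tm n L \<omega>) \<omega>))) = 0"
proof -
  obtain g' g'' B where g: "\<And>x. (g has_real_derivative g' x) (at x)" "\<And>x. (g' has_real_derivative g'' x) (at x)"
     "1 \<le> B" "\<And>x. \<bar>g x\<bar> \<le> B" "\<And>x. \<bar>g' x\<bar> \<le> B" "\<And>x. \<bar>g'' x\<bar> \<le> B" "continuous_on UNIV g''"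
     "\<And>x. \<bar>x\<bar> \<le> 1 \<Longrightarrow> b (y + x) * g' x + (\<sigma> (y + x))\<^sup>2 / 2 * g'' x = l * g x"
    using eig unfolding eigenfun_def by blast
  obtain \<omega>0 where w0: "\<omega>0 \<in> space M" using not_empty by auto
  have L: "0 \<le> L" using ST[OF w0] by linarith
  define xn where "xn \<omega> = X (Tm n L \<omega>) \<omega>" for \<omega>
  have xn_M [measurable]: "xn \<in> borel_measurable M" unfolding xn_def by (rule measurable_F_M[OF X_Tm_F[OF L]])
  have contg: "continuous_on UNIV g" using g(1) by (auto intro!: DERIV_continuous_on simp: has_field_derivative_at_within)
  have [measurable]: "g \<in> borel_measurable borel" using contg by (auto intro: borel_measurable_continuous_onI)
  have XT: "(\<lambda>\<omega>. X (T' \<omega>) \<omega>) \<in> borel_measurable M" "(\<lambda>\<omega>. X (S \<omega>) \<omega>) \<in> borel_measurable M"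
    using ST by (auto intro!: X_random_time[of M L] X_M intro: order_trans)
  note [measurable] = XT
  have Tn: "T n \<omega> \<le> ereal L" if "\<omega> \<in> space M" "Y \<omega> \<noteq> 0" for \<omega>
  proof -
    have "S \<omega> \<le> L" using ST(2,3)[OF that(1)] by linarith
    then show ?thesis using YS[OF that] by (metis ereal_less_eq(3) order_trans)
  qed
  define R where "R \<omega> = exp (- l * (T' \<omega> - S \<omega>)) * g (X (T' \<omega>) \<omega> - xn \<omega>) - g (X (S \<omega>) \<omega> - xn \<omega>)" for \<omega>
  have [measurable]: "R \<in> borel_measurable M" unfolding R_def by measurable
  have Rle: "\<bar>R \<omega>\<bar> \<le> 2 * B" if w: "\<omega> \<in> space M" for \<omega>
  proof -
    have "exp (- l * (T' \<omega> - S \<omega>)) \<le> 1" using l ST(2)[OF w] by simp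
    then have "\<bar>exp (- l * (T' \<omega> - S \<omega>)) * g (X (T' \<omega>) \<omega> - xn \<omega>)\<bar> \<le> 1 * B" unfolding abs_mult by (intro mult_mono g(4)) auto
    then show ?thesis using g(4)[of "X (S \<omega>) \<omega> - xn \<omega>"] unfolding R_def by linarith
  qed
  define Z where "Z k \<omega> = (if xn \<omega> = y + of_int k then 1 else 0 :: real)" for k :: int and \<omega>
  have [measurable]: "Z k \<in> borel_measurable M" for k unfolding Z_def by measurable
  have zero: "expectation (\<lambda>\<omega>. Y \<omega> * Z k \<omega> * R \<omega>) = 0" for k
  proof -
    define z where "z = y + of_int k"
    \<comment> \<open>The factor removes the discount accumulated before S, turning exp (- l T')
      into exp (- l (T' - S)). The additional constant exp (- l L) keeps the weight below 1.\<close>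
    define U where "U \<omega> = Y \<omega> * Z k \<omega> * exp (l * (S \<omega> - L))" for \<omega>
    have [measurable]: "U \<in> borel_measurable M" unfolding U_def by measurable
    \<comment> \<open>\<open>ito_stopping\<close> wants the bound 1 at every point of the type,
      while S \<le> L is known on \<open>space M\<close> only.\<close>
    define U' where "U' \<omega> = (if \<omega> \<in> space M then U \<omega> else 0)" for \<omega>
    have "expectation (\<lambda>\<omega>. U' \<omega> * (exp (- l * T' \<omega>) * g (X (T' \<omega>) \<omega> - z) - exp (- l * S \<omega>) * g (X (S \<omega>) \<omega> - z))) = 0"
    proof (rule ito_stopping[where g="\<lambda>x. g (x - z)" and g'="\<lambda>x. g' (x - z)" and g''="\<lambda>x. g'' (x - z)" and B=B and z=z and L=L])
      show "((\<lambda>x. g (x - z)) has_real_derivative g' (x - z)) (at x)" for x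
        using g(1)[of "x + - z"] unfolding DERIV_shift by simp
      show "((\<lambda>x. g' (x - z)) has_real_derivative g'' (x - z)) (at x)" for x
        using g(2)[of "x + - z"] unfolding DERIV_shift by simp
      show "continuous_on UNIV (\<lambda>x. g'' (x - z))"
        by (intro continuous_on_compose2[OF g(7)] continuous_intros) auto
      show "b x * g' (x - z) + (\<sigma> x)\<^sup>2 / 2 * g'' (x - z) = l * g (x - z)" if "\<bar>x - z\<bar> \<le> 1" for x
      proof -
        have "x = y + (x - z) + of_int k" by (simp add: z_def)
        then have "b x = b (y + (x - z))" "\<sigma> x = \<sigma> (y + (x - z))"
          by (metis periodic_add_int per_b) (metis \<open>x = y + (x - z) + of_int k\<close> periodic_add_int per_\<sigma>)
        then show ?thesis using g(8)[OF that] by simp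
      qed
      show "\<bar>U' \<omega>\<bar> \<le> 1" for \<omega>
      proof (cases "\<omega> \<in> space M")
        case True
        have "exp (l * (S \<omega> - L)) \<le> 1" using l ST(2,3)[OF True] by (simp add: mult_nonneg_nonpos)
        moreover have "\<bar>Y \<omega> * Z k \<omega>\<bar> \<le> 1" using Y1[of \<omega>] by (simp add: Z_def)
        ultimately have "\<bar>Y \<omega> * Z k \<omega>\<bar> * exp (l * (S \<omega> - L)) \<le> 1 * 1" by (intro mult_mono) auto
        then show ?thesis using True by (simp add: U'_def U_def abs_mult)
      qed (simp add: U'_def)
      show "U' \<in> borel_measurable M" unfolding U'_def by measurable
      fix u :: real assume u: "0 \<le> u"
      \<comment> \<open>S and the starting position are replaced by versions truncated at u. Where
        the indicator is nonzero, S and \<open>T n\<close> have occurred by time u, so nothing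
        changes, and all factors are known at u.\<close>
      have "(\<lambda>\<omega>. (if S \<omega> \<le> u \<and> u < T' \<omega> then Y \<omega> else 0) * (if X (Tm n u \<omega>) \<omega> = z then 1 else 0) * exp (l * (min (S \<omega>) u - L))) \<in> borel_measurable (F u)"
      proof -
        note [measurable] = adapted[OF u] SF[OF u] X_Tm_F[OF u, of n]
        show ?thesis by measurable
      qed
      then show "(\<lambda>\<omega>. if S \<omega> \<le> u \<and> u < T' \<omega> then U' \<omega> else 0) \<in> borel_measurable (F u)"
      proof (rule measurable_cong[THEN iffD1, rotated])
        fix \<omega> assume "\<omega> \<in> space (F u)"
        then have w: "\<omega> \<in> space M" by simp
        show "(if S \<omega> \<le> u \<and> u < T' \<omega> then Y \<omega> else 0) * (if X (Tm n u \<omega>) \<omega> = z then 1 else 0) * exp (l * (min (S \<omega>) u - L)) = 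
           (if S \<omega> \<le> u \<and> u < T' \<omega> then U' \<omega> else 0)"
        proof (cases "S \<omega> \<le> u \<and> u < T' \<omega> \<and> Y \<omega> \<noteq> 0")
          case True
          then have "T n \<omega> \<le> ereal u" using YS[OF w] by (metis ereal_less_eq(3) order_trans)
          then have "Tm n u \<omega> = Tm n L \<omega>" using Tn[OF w] True by (simp add: Tm_eq)
          then show ?thesis using True w by (simp add: U'_def U_def Z_def xn_def z_def min_def)
        qed (use w in \<open>auto simp: U'_def U_def\<close>)
      qed
    next
      fix \<omega> u assume w: "\<omega> \<in> space M" and ne: "U' \<omega> \<noteq> 0" and r: "S \<omega> \<le> u" "u < T' \<omega>"
      have Y0: "Y \<omega> \<noteq> 0" "xn \<omega> = z" using ne w by (auto simp: U'_def U_def Z_def z_def split: if_splits)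
      have "xn \<omega> = X (Tr n \<omega>) \<omega>" unfolding xn_def Tm_eq[OF Tn[OF w Y0(1)]] ..
      moreover have "T n \<omega> \<le> ereal u" using YS[OF w Y0(1)] r(1) by (metis ereal_less_eq(3) order_trans)
      ultimately show "\<bar>X u \<omega> - z\<bar> \<le> 1" 
        using X_before_T_Suc[OF w _ YT[OF w Y0(1) r]] Y0(2) by simp
    qed (use g l ST S T' in auto)
    moreover have "expectation (\<lambda>\<omega>. U' \<omega> * (exp (- l * T' \<omega>) * g (X (T' \<omega>) \<omega> - z) - exp (- l * S \<omega>) * g (X (S \<omega>) \<omega> - z)))
      = expectation (\<lambda>\<omega>. exp (- l * L) * (Y \<omega> * Z k \<omega> * R \<omega>))"
    proof (rule Bochner_Integration.integral_cong[OF refl])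
      fix \<omega> assume w: "\<omega> \<in> space M"
      show "U' \<omega> * (exp (- l * T' \<omega>) * g (X (T' \<omega>) \<omega> - z) - exp (- l * S \<omega>) * g (X (S \<omega>) \<omega> - z)) = exp (- l * L) * (Y \<omega> * Z k \<omega> * R \<omega>)"
      proof (cases "xn \<omega> = z")
        case True
        have e: "exp (l * (S \<omega> - L)) * exp (- l * T' \<omega>) = exp (- l * L) * exp (- l * (T' \<omega> - S \<omega>))"
          "exp (l * (S \<omega> - L)) * exp (- l * S \<omega>) = exp (- l * L)" by (simp_all add: algebra_simps flip: exp_add)
        have "U' \<omega> * (exp (- l * T' \<omega>) * g (X (T' \<omega>) \<omega> - z) - exp (- l * S \<omega>) * g (X (S \<omega>) \<omega> - z)) =
          Y \<omega> * ((exp (l * (S \<omega> - L)) * exp (- l * T' \<omega>)) * g (X (T' \<omega>) \<omega> - z) - (exp (l * (S \<omega> - L)) * exp (- l * S \<omega>)) * g (X (S \<omega>) \<omega> - z))"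
          using w True by (simp add: U'_def U_def Z_def z_def algebra_simps)
        then show ?thesis unfolding e using True by (simp add: R_def Z_def z_def algebra_simps)
      qed (use w in \<open>simp add: U'_def U_def Z_def z_def\<close>)
    qed
    ultimately show ?thesis by simp
  qed
  have Y_eq: "Y \<omega> * R \<omega> = (\<Sum>k\<in>{- int n..int n}. Y \<omega> * Z k \<omega> * R \<omega>)" if w: "\<omega> \<in> space M" for \<omega>
  proof (cases "Y \<omega> = 0")
    case False
    have TL: "T n \<omega> \<le> ereal L" by (rule Tn[OF w False])
    then have "T n \<omega> < \<infinity>" by (cases "T n \<omega>") auto
    then obtain k where k: "k \<in> {- int n..int n}" "X (Tr n \<omega>) \<omega> = y + of_int k" using X_T_integer[OF w] by blast
    have Z: "Z j \<omega> = (if j = k then 1 else 0)" for j using k(2) Tm_eq[OF TL] by (auto simp: Z_def xn_def)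
    show ?thesis unfolding Z using k(1) by (simp add: if_distrib[of "\<lambda>c. _ * c * _"] sum.delta cong: if_cong)
  qed simp
  have "expectation (\<lambda>\<omega>. Y \<omega> * R \<omega>) = expectation (\<lambda>\<omega>. \<Sum>k\<in>{- int n..int n}. Y \<omega> * Z k \<omega> * R \<omega>)"
    by (rule Bochner_Integration.integral_cong) (simp_all add: Y_eq)
  also have "\<dots> = (\<Sum>k\<in>{- int n..int n}. expectation (\<lambda>\<omega>. Y \<omega> * Z k \<omega> * R \<omega>))"
  proof (rule Bochner_Integration.integral_sum, rule integrable_boundedI)
    fix k \<omega> assume w: "\<omega> \<in> space M"
    have "\<bar>Y \<omega> * Z k \<omega>\<bar> \<le> 1" using Y1[of \<omega>] by (simp add: Z_def)
    from mult_mono[OF this Rle[OF w]] show "\<bar>Y \<omega> * Z k \<omega> * R \<omega>\<bar> \<le> 2 * B" by (simp add: abs_mult)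
  qed measurable
  also have "\<dots> = 0" by (simp add: zero)
  finally show ?thesis by (simp add: R_def xn_def)
qed

text \<open>The past of the stopping time \<open>T n\<close>, that is, its stopping-time
  sigma-algebra as a set of events.\<close>

definition stop_ev :: "nat \<Rightarrow> 'a set set" where
  "stop_ev n = {A \<in> events. \<forall>u\<ge>0. A \<inter> {\<omega>\<in>space M. T n \<omega> \<le> ereal u} \<in> sets (F u)}"

lemma T_le_event [measurable]: "{\<omega>\<in>space M. T n \<omega> \<le> ereal u} \<in> events"
proof (cases "0 \<le> u")
  case True
  then show ?thesis using T_stopping sets_F_events by blast
next
  case False
  have "\<not> T n \<omega> \<le> ereal u" if "\<omega> \<in> space M" for \<omega>
    using order_trans[OF T_nonneg[OF that, of n], of "ereal u"] False by auto
  then have "{\<omega>\<in>space M. T n \<omega> \<le> ereal u} = {}" by blast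
  then show ?thesis by (simp only: sets.empty_sets)
qed

lemma T_measurable [measurable]: "T n \<in> borel_measurable M"
proof (rule borel_measurableI_le)
  fix x :: ereal
  show "{\<omega>\<in>space M. T n \<omega> \<le> x} \<in> events"
  proof (cases x)
    case MInf
    have "\<not> T n \<omega> \<le> x" if "\<omega> \<in> space M" for \<omega> using T_nonneg[OF that, of n] MInf by auto
    then have "{\<omega>\<in>space M. T n \<omega> \<le> x} = {}" by blast
    then show ?thesis by (simp only: sets.empty_sets)
  qed auto
qed

text \<open>Discounted value, at the end of cycle n, of an eigenfunction centred at the start of the
  cycle. The value 0 for an endless cycle is the limit of the discounted values of truncated
  cycles.\<close>

definition cycle_val :: "real \<Rightarrow> (real \<Rightarrow> real) \<Rightarrow> nat \<Rightarrow> 'a \<Rightarrow> real" where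
  "cycle_val l g n \<omega> = (if T (Suc n) \<omega> < \<infinity> 
     then exp (- l * (Tr (Suc n) \<omega> - Tr n \<omega>)) * g (X (Tr (Suc n) \<omega>) \<omega> - X (Tr n \<omega>) \<omega>) else 0)"

text \<open>Truncation at N yields bounded random times, to which \<open>cycle_ito\<close> applies;
  at the start of the cycle the displacement is 0, whence the factor g 0. Dominated convergence
  removes N.\<close>

lemma cycle_moment:
  assumes eig: "eigenfun (\<lambda>x. b (y + x)) (\<lambda>x. \<sigma> (y + x)) l g" and l: "0 < l" and A: "A \<in> stop_ev n"
  shows "cycle_val l g n \<in> borel_measurable M" "\<And>\<omega>. \<omega> \<in> space M \<Longrightarrow> \<bar>cycle_val l g n \<omega>\<bar> \<le> (SUP x. \<bar>g x\<bar>)"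
    "expectation (\<lambda>\<omega>. indicator (A \<inter> {\<omega>\<in>space M. T n \<omega> < \<infinity>}) \<omega> * cycle_val l g n \<omega>) = g 0 * prob (A \<inter> {\<omega>\<in>space M. T n \<omega> < \<infinity>})"
proof -
  obtain B where B: "1 \<le> B" "\<And>x. \<bar>g x\<bar> \<le> B" and contg: "continuous_on UNIV g"
    using eig unfolding eigenfun_def by (auto intro!: DERIV_continuous_on simp: has_field_derivative_at_within)
  have [measurable]: "g \<in> borel_measurable borel" using contg by (auto intro: borel_measurable_continuous_onI)
  have AM [measurable]: "A \<in> events" using A by (auto simp: stop_ev_def)
  define R where "R N \<omega> = (if T n \<omega> \<le> ereal (real N) then exp (- l * (Tm (Suc n) (real N) \<omega> - Tm n (real N) \<omega>)) * 
     g (X (Tm (Suc n) (real N) \<omega>) \<omega> - X (Tm n (real N) \<omega>) \<omega>) else 0)" for N \<omega>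
  have [measurable]: "Tm k (real N) \<in> borel_measurable M" "(\<lambda>\<omega>. X (Tm k (real N) \<omega>) \<omega>) \<in> borel_measurable M" for k N
    by (rule measurable_F_M[OF Tm_F] measurable_F_M[OF X_Tm_F]; simp)+
  have RM [measurable]: "R N \<in> borel_measurable M" for N unfolding R_def by measurable
  have Rle: "\<bar>R N \<omega>\<bar> \<le> B" if w: "\<omega> \<in> space M" for N \<omega>
  proof -
    have "exp (- l * (Tm (Suc n) (real N) \<omega> - Tm n (real N) \<omega>)) \<le> 1" using l Tm_mono[OF w, of "real N" n "Suc n"] by simp
    then have "\<bar>exp (- l * (Tm (Suc n) (real N) \<omega> - Tm n (real N) \<omega>)) * g (X (Tm (Suc n) (real N) \<omega>) \<omega> - X (Tm n (real N) \<omega>) \<omega>)\<bar> \<le> 1 * B"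
      unfolding abs_mult by (intro mult_mono B) auto
    then show ?thesis using B(1) by (simp add: R_def)
  qed
  have R_lim: "(\<lambda>N. R N \<omega>) \<longlonglongrightarrow> cycle_val l g n \<omega>" if w: "\<omega> \<in> space M" for \<omega>
  proof (cases "T n \<omega> < \<infinity>")
    case False
    then have "T (Suc n) \<omega> = \<infinity>" using T_Suc_infinite[where n=n and \<omega>=\<omega>] by simp
    then show ?thesis using False by (auto simp: R_def cycle_val_def not_less top.extremum_unique)
  next
    case fin: True
    note Tn = T_real[OF w fin]
    have ev: "\<forall>\<^sub>F N in sequentially. c \<le> real N" for c by (rule eventually_sequentiallyI[of "nat \<lceil>c\<rceil>"]) linarith
    show ?thesis
    proof (cases "T (Suc n) \<omega> < \<infinity>")
      case True
      have "\<forall>\<^sub>F N in sequentially. R N \<omega> = cycle_val l g n \<omega>"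
        using ev[of "Tr (Suc n) \<omega>"]
      proof eventually_elim
        case (elim N)
        then have 1: "T (Suc n) \<omega> \<le> ereal (real N)" using T_real(1)[OF w True] by (metis ereal_less_eq(3))
        then have 2: "T n \<omega> \<le> ereal (real N)" using T_mono[OF w, of n "Suc n"] by auto
        show ?case using 1 2 True by (simp add: R_def cycle_val_def Tm_eq)
      qed
      then show ?thesis by (rule tendsto_eventually)
    next
      case False
      then have inf: "T (Suc n) \<omega> = \<infinity>" by simp
      have "(\<lambda>N. exp (l * Tr n \<omega>) * B * exp (- l) ^ N) \<longlonglongrightarrow> exp (l * Tr n \<omega>) * B * 0"
        using l by (intro tendsto_mult_left LIMSEQ_realpow_zero) auto
      moreover have "exp (l * Tr n \<omega>) * B * exp (- l) ^ N = exp (- l * (real N - Tr n \<omega>)) * B" for N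
        by (simp add: exp_of_nat_mult[symmetric] algebra_simps flip: exp_add)
      ultimately have "(\<lambda>N. exp (- l * (real N - Tr n \<omega>)) * B) \<longlonglongrightarrow> 0" by simp
      then have "(\<lambda>N. R N \<omega>) \<longlonglongrightarrow> 0"
      proof (rule Lim_null_comparison[rotated])
        show "\<forall>\<^sub>F N in sequentially. norm (R N \<omega>) \<le> exp (- l * (real N - Tr n \<omega>)) * B"
          using ev[of "Tr n \<omega>"]
        proof eventually_elim
          case (elim N)
          then have 2: "T n \<omega> \<le> ereal (real N)" using Tn(1) by (metis ereal_less_eq(3))
          have "Tm (Suc n) (real N) \<omega> = real N" unfolding Tm_def inf by simp
          then show ?case using 2 B by (simp add: R_def Tm_eq abs_mult mult_left_mono)
        qed
      qed
      then show ?thesis using inf by (simp add: cycle_val_def)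
    qed
  qed
  show cM [measurable]: "cycle_val l g n \<in> borel_measurable M" by (rule borel_measurable_LIMSEQ_real[OF R_lim RM])
  show "\<bar>cycle_val l g n \<omega>\<bar> \<le> (SUP x. \<bar>g x\<bar>)" if w: "\<omega> \<in> space M" for \<omega>
  proof -
    have bdd: "bdd_above (range (\<lambda>x. \<bar>g x\<bar>))" using B(2) by (auto intro!: bdd_aboveI2)
    have sup0: "0 \<le> (SUP x. \<bar>g x\<bar>)" by (rule cSUP_upper2[OF bdd]) auto
    show ?thesis
    proof (cases "T (Suc n) \<omega> < \<infinity>")
      case True
      then have fin: "T n \<omega> < \<infinity>" using T_mono[OF w, of n "Suc n"] by auto
      have "Tr n \<omega> \<le> Tr (Suc n) \<omega>" using T_real(1)[OF w fin] T_real(1)[OF w True] T_mono[OF w, of n "Suc n"] by (metis ereal_less_eq(3) le_SucI order_refl)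
      then have "exp (- l * (Tr (Suc n) \<omega> - Tr n \<omega>)) \<le> 1" using l by simp
      then have "exp (- l * (Tr (Suc n) \<omega> - Tr n \<omega>)) * \<bar>g (X (Tr (Suc n) \<omega>) \<omega> - X (Tr n \<omega>) \<omega>)\<bar> \<le> 1 * (SUP x. \<bar>g x\<bar>)"
        by (intro mult_mono cSUP_upper bdd) auto
      then show ?thesis using True by (simp add: cycle_val_def abs_mult)
    qed (use sup0 in \<open>simp add: cycle_val_def\<close>)
  qed
  define A' where "A' = A \<inter> {\<omega>\<in>space M. T n \<omega> < \<infinity>}"
  have A'M [measurable]: "A' \<in> events" unfolding A'_def by measurable
  have zero: "expectation (\<lambda>\<omega>. indicator A \<omega> * (R N \<omega> - (if T n \<omega> \<le> ereal (real N) then g 0 else 0))) = 0" for N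
  proof -
    define AN where "AN = A \<inter> {\<omega>\<in>space M. T n \<omega> \<le> ereal (real N)}"
    have ANM [measurable]: "AN \<in> events" unfolding AN_def by measurable
    have "expectation (\<lambda>\<omega>. indicator AN \<omega> * (exp (- l * (Tm (Suc n) (real N) \<omega> - Tm n (real N) \<omega>)) * 
       g (X (Tm (Suc n) (real N) \<omega>) \<omega> - X (Tm n (real N) \<omega>) \<omega>) - g (X (Tm n (real N) \<omega>) \<omega> - X (Tm n (real N) \<omega>) \<omega>))) = 0"
    proof (rule cycle_ito[OF eig])
      fix \<omega> u assume w: "\<omega> \<in> space M" and Y: "indicator AN \<omega> \<noteq> (0::real)" and u: "u < Tm (Suc n) (real N) \<omega>"
      show "ereal u < T (Suc n) \<omega>" using u Tm_le_iff[OF w, of "real N" "Suc n" u] by (auto simp: not_le[symmetric])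
    next
      fix \<omega> assume w: "\<omega> \<in> space M" and Y: "indicator AN \<omega> \<noteq> (0::real)"
      then show "T n \<omega> \<le> ereal (Tm n (real N) \<omega>)" using Tm_ereal[OF w, of "real N" n] by (auto simp: AN_def indicator_def split: if_splits)
    next
      fix u :: real assume u: "0 \<le> u"
      have "Tm n (min (real N) u) \<in> borel_measurable (F u)" using u by (intro measurable_F_mono[OF _ Tm_F]) auto
      moreover have "min (Tm n (real N) \<omega>) u = Tm n (min (real N) u) \<omega>" if w: "\<omega> \<in> space M" for \<omega>
      proof -
        have "ereal (min (Tm n (real N) \<omega>) u) = min (ereal (Tm n (real N) \<omega>)) (ereal u)" by (simp add: min_def)
        also have "\<dots> = min (T n \<omega>) (min (ereal (real N)) (ereal u))"
          by (subst Tm_ereal[OF w]) (simp_all add: min.assoc)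
        also have "min (ereal (real N)) (ereal u) = ereal (min (real N) u)" by (simp add: min_def)
        also have "min (T n \<omega>) (ereal (min (real N) u)) = ereal (Tm n (min (real N) u) \<omega>)"
          by (subst Tm_ereal[OF w]) (use u in auto)
        finally show ?thesis by (simp only: ereal.inject)
      qed
      ultimately show "(\<lambda>\<omega>. min (Tm n (real N) \<omega>) u) \<in> borel_measurable (F u)"
        using measurable_cong[of "F u" "\<lambda>\<omega>. min (Tm n (real N) \<omega>) u" "Tm n (min (real N) u)" borel] by simp
      show "(\<lambda>\<omega>. if Tm n (real N) \<omega> \<le> u \<and> u < Tm (Suc n) (real N) \<omega> then indicator AN \<omega> else 0 :: real) \<in> borel_measurable (F u)"
      proof (cases "real N \<le> u")
        case True
        have "(if Tm n (real N) \<omega> \<le> u \<and> u < Tm (Suc n) (real N) \<omega> then indicator AN \<omega> else 0 :: real) = 0" if "\<omega> \<in> space (F u)" for \<omega>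
          using Tm_bounds(2)[of \<omega> "real N" "Suc n"] that True by auto
        then show ?thesis by (subst measurable_cong[of _ _ "\<lambda>_. 0"]) auto
      next
        case False
        \<comment> \<open>Cycle n is running at time u. That A belongs to the past of
          \<open>T n\<close> suffices for D to be known at u, because \<open>T n\<close> has
          occurred by then.\<close>
        define D where "D = (A \<inter> {\<omega>\<in>space M. T n \<omega> \<le> ereal u}) - {\<omega>\<in>space M. T (Suc n) \<omega> \<le> ereal u}"
        have "D \<in> sets (F u)" unfolding D_def using A u by (intro sets.Diff T_stopping) (auto simp: stop_ev_def)
        then have "indicator D \<in> borel_measurable (F u)" by measurable
        moreover have "(if Tm n (real N) \<omega> \<le> u \<and> u < Tm (Suc n) (real N) \<omega> then indicator AN \<omega> else 0 :: real) = indicator D \<omega>" 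
          if "\<omega> \<in> space (F u)" for \<omega>
        proof -
          have w: "\<omega> \<in> space M" using that by simp
          have 1: "Tm n (real N) \<omega> \<le> u \<longleftrightarrow> T n \<omega> \<le> ereal u" "u < Tm (Suc n) (real N) \<omega> \<longleftrightarrow> \<not> T (Suc n) \<omega> \<le> ereal u"
            using Tm_le_iff[OF w, of "real N" n u] Tm_le_iff[OF w, of "real N" "Suc n" u] False by auto
          have 2: "T n \<omega> \<le> ereal u \<Longrightarrow> T n \<omega> \<le> ereal (real N)" using False by (auto intro: order_trans)
          show ?thesis unfolding 1 D_def AN_def using w 2 by (auto simp: indicator_def)
        qed
        ultimately show ?thesis by (subst measurable_cong) auto
      qed
    qed (use l Tm_bounds Tm_mono in \<open>auto simp: indicator_def intro!: borel_measurable_indicator\<close>)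
    moreover have "indicator A \<omega> * (R N \<omega> - (if T n \<omega> \<le> ereal (real N) then g 0 else 0)) = indicator AN \<omega> * (exp (- l * (Tm (Suc n) (real N) \<omega> - Tm n (real N) \<omega>)) * 
       g (X (Tm (Suc n) (real N) \<omega>) \<omega> - X (Tm n (real N) \<omega>) \<omega>) - g (X (Tm n (real N) \<omega>) \<omega> - X (Tm n (real N) \<omega>) \<omega>))" if "\<omega> \<in> space M" for \<omega>
      using that by (auto simp: AN_def indicator_def R_def)
    ultimately show ?thesis by (simp cong: Bochner_Integration.integral_cong)
  qed
  have "(\<lambda>N. expectation (\<lambda>\<omega>. indicator A \<omega> * (R N \<omega> - (if T n \<omega> \<le> ereal (real N) then g 0 else 0)))) \<longlonglongrightarrow>
    expectation (\<lambda>\<omega>. indicator A \<omega> * (cycle_val l g n \<omega> - (if T n \<omega> < \<infinity> then g 0 else 0)))"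
  proof (rule integral_dominated_convergence[where w="\<lambda>_. 2 * B"])
    show "AE \<omega> in M. (\<lambda>N. indicator A \<omega> * (R N \<omega> - (if T n \<omega> \<le> ereal (real N) then g 0 else 0))) \<longlonglongrightarrow> 
       indicator A \<omega> * (cycle_val l g n \<omega> - (if T n \<omega> < \<infinity> then g 0 else 0))"
    proof (rule AE_I2, intro tendsto_mult tendsto_const tendsto_diff R_lim)
      fix \<omega> assume w: "\<omega> \<in> space M"
      show "(\<lambda>N. if T n \<omega> \<le> ereal (real N) then g 0 else 0) \<longlonglongrightarrow> (if T n \<omega> < \<infinity> then g 0 else 0)"
      proof (cases "T n \<omega> < \<infinity>")
        case True
        have "\<forall>\<^sub>F N in sequentially. Tr n \<omega> \<le> real N" by (rule eventually_sequentiallyI[of "nat \<lceil>Tr n \<omega>\<rceil>"]) linarith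
        then have "\<forall>\<^sub>F N in sequentially. (if T n \<omega> \<le> ereal (real N) then g 0 else 0) = g 0"
          by eventually_elim (metis T_real(1)[OF w True] ereal_less_eq(3))
        then show ?thesis using True by (simp add: tendsto_eventually)
      qed auto
    qed
    show "AE \<omega> in M. norm (indicator A \<omega> * (R N \<omega> - (if T n \<omega> \<le> ereal (real N) then g 0 else 0))) \<le> 2 * B" for N
    proof (rule AE_I2)
      fix \<omega> assume w: "\<omega> \<in> space M"
      show "norm (indicator A \<omega> * (R N \<omega> - (if T n \<omega> \<le> ereal (real N) then g 0 else 0))) \<le> 2 * B"
        using Rle[OF w, of N] B(1) B(2)[of 0] by (auto simp: indicator_def)
    qed
  qed auto
  then have "expectation (\<lambda>\<omega>. indicator A \<omega> * (cycle_val l g n \<omega> - (if T n \<omega> < \<infinity> then g 0 else 0))) = 0"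
    unfolding zero using LIMSEQ_unique tendsto_const by blast
  moreover have "indicator A \<omega> * (cycle_val l g n \<omega> - (if T n \<omega> < \<infinity> then g 0 else 0)) = indicator A' \<omega> * cycle_val l g n \<omega> - g 0 * indicator A' \<omega>" 
    if w: "\<omega> \<in> space M" for \<omega>
    using w T_mono[OF w, of n "Suc n"] by (auto simp: A'_def indicator_def cycle_val_def)
  ultimately have 0: "expectation (\<lambda>\<omega>. indicator A' \<omega> * cycle_val l g n \<omega> - g 0 * indicator A' \<omega>) = 0"
    by (simp cong: Bochner_Integration.integral_cong)
  have clim: "\<bar>cycle_val l g n \<omega>\<bar> \<le> B" if w: "\<omega> \<in> space M" for \<omega>
    by (rule LIMSEQ_le_const2[OF tendsto_rabs[OF R_lim[OF w]]]) (use Rle[OF w] in auto)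
  have i: "integrable M (\<lambda>\<omega>. indicator A' \<omega> * cycle_val l g n \<omega>)"
  proof (rule integrable_boundedI[of _ B])
    show "\<bar>indicator A' \<omega> * cycle_val l g n \<omega>\<bar> \<le> B" if "\<omega> \<in> space M" for \<omega>
      using clim[OF that] B(1) by (simp add: indicator_def)
  qed measurable
  have "integrable M (\<lambda>\<omega>. g 0 * indicator A' \<omega>)" by (rule integrable_boundedI[of _ B]) (use B in \<open>auto simp: indicator_def\<close>)
  then show "expectation (\<lambda>\<omega>. indicator (A \<inter> {\<omega>\<in>space M. T n \<omega> < \<infinity>}) \<omega> * cycle_val l g n \<omega>) = g 0 * prob (A \<inter> {\<omega>\<in>space M. T n \<omega> < \<infinity>})"
    using 0 i unfolding A'_def[symmetric] by simp
qed

end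

section \<open>The law of a cycle and the strong Markov property\<close>

text \<open>On [-1, 1] the partial sums of the exponential series are dominated by exp
  \<bar>t\<bar>, so they may be integrated term by term; hence the moments determine the
  characteristic function and the law.\<close>

lemma (in real_distribution) char_moment_series:
  assumes bd: "AE x in M. \<bar>x\<bar> \<le> 1"
  shows "(\<lambda>n. \<Sum>k<n. (\<i> * t) ^ k / fact k * complex_of_real (expectation (\<lambda>x. x ^ k))) \<longlonglongrightarrow> char M t"
proof -
  define s where "s n x = (\<Sum>k<n. (\<i> * t) ^ k / fact k * complex_of_real (x ^ k))" for n x
  have s_eq: "s n x = (\<Sum>k<n. (\<i> * of_real (t * x)) ^ k /\<^sub>R fact k)" for n x
    unfolding s_def by (intro sum.cong) (simp_all add: power_mult_distrib scaleR_conv_of_real field_simps)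
  have i: "integrable M (\<lambda>x. x ^ k)" for k
    by (rule integrable_const_bound[of _ 1]) (use bd in \<open>eventually_elim, simp add: power_abs power_le_one\<close>, simp)
  have "(\<lambda>n. \<integral>x. s n x \<partial>M) \<longlonglongrightarrow> (\<integral>x. iexp (t * x) \<partial>M)"
  proof (rule integral_dominated_convergence[where w="\<lambda>_. exp \<bar>t\<bar>"])
    show "AE x in M. (\<lambda>n. s n x) \<longlonglongrightarrow> iexp (t * x)"
      using exp_converges[of "\<i> * of_real (t * _)"] unfolding s_eq sums_def by simp
    show "AE x in M. norm (s n x) \<le> exp \<bar>t\<bar>" for n
      using bd
    proof eventually_elim
      case (elim x)
      have "norm (s n x) \<le> (\<Sum>k<n. \<bar>t\<bar> ^ k /\<^sub>R fact k)"
        unfolding s_eq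
      proof (rule order_trans[OF norm_sum sum_mono])
        fix k
        have "\<bar>x\<bar> ^ k \<le> 1" using elim by (simp add: power_le_one)
        then have "\<bar>t\<bar> ^ k * \<bar>x\<bar> ^ k \<le> \<bar>t\<bar> ^ k" by (intro mult_left_le) auto
        then show "norm ((\<i> * of_real (t * x)) ^ k /\<^sub>R fact k) \<le> \<bar>t\<bar> ^ k /\<^sub>R fact k"
          by (simp add: norm_power norm_mult power_mult_distrib divide_right_mono mult_left_mono abs_mult)
      qed
      also have "\<dots> \<le> exp \<bar>t\<bar>"
        unfolding exp_def by (intro sum_le_suminf summable_exp_generic) auto
      finally show ?case .
    qed
  qed (auto simp: s_def)
  moreover have "(\<integral>x. s n x \<partial>M) = (\<Sum>k<n. (\<i> * t) ^ k / fact k * complex_of_real (expectation (\<lambda>x. x ^ k)))" for n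
  proof -
    have ec: "(\<integral>x. complex_of_real x ^ k \<partial>M) = complex_of_real (\<integral>x. x ^ k \<partial>M)" for k
      using integral_complex_of_real[of M "\<lambda>x. x ^ k"] by simp
    have "integrable M (\<lambda>x. complex_of_real x ^ k)" for k
      using integrable_of_real[OF i[of k], where 'a=complex] by simp
    then show ?thesis unfolding s_def by (subst Bochner_Integration.integral_sum) (auto simp: ec)
  qed
  ultimately show ?thesis by (simp add: char_def)
qed

lemma real_distribution_moments_eq:
  assumes M: "real_distribution M1" "real_distribution M2"
    and bd: "AE x in M1. \<bar>x\<bar> \<le> 1" "AE x in M2. \<bar>x\<bar> \<le> 1"
    and eq: "\<And>k. (\<integral>x. x ^ k \<partial>M1) = (\<integral>x. x ^ k \<partial>M2)"
  shows "M1 = M2"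
proof (rule Levy_uniqueness[OF M], rule ext)
  fix t
  show "char M1 t = char M2 t"
    using LIMSEQ_unique[OF real_distribution.char_moment_series[OF M(1) bd(1)]
        real_distribution.char_moment_series[OF M(2) bd(2), of t, folded eq]] .
qed

context sde
begin

lemma shifted_eigenfun_pair:
  assumes "l > 0"
  obtains g1 g2 where "eigenfun (\<lambda>x. b (y + x)) (\<lambda>x. \<sigma> (y + x)) l g1" "eigenfun (\<lambda>x. b (y + x)) (\<lambda>x. \<sigma> (y + x)) l g2" 
    "\<And>x. \<bar>x\<bar> \<le> 1 \<Longrightarrow> 1 \<le> g1 x" "g1 (-1) * g2 1 - g1 1 * g2 (-1) > 0"
proof -
  have "continuous_on UNIV (\<lambda>x. b (y + x))" "continuous_on UNIV (\<lambda>x. \<sigma> (y + x))"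
    by (auto intro!: continuous_on_compose2[OF cont_b] continuous_on_compose2[OF cont_\<sigma>] continuous_intros)
  from eigenfun_pair[OF this \<sigma>_pos assms] show ?thesis using that by metis
qed

text \<open>The eigenfunction g for l = 1 is at least 1 wherever a running cycle can be, so its mean
  at time s dominates the probability that the cycle is running. By Ito's formula this mean equals
  the discounted mean at the end of the cycle or at s + K, whichever is earlier, and cycles still
  running at s + K contribute at most half of that probability. The position at time s enters only
  through g \<ge> 1, so c and K are uniform.\<close>

lemma residual_cycle_time:
  obtains c K where "0 < c" "c \<le> 1" "0 \<le> K"
    "\<And>n s A. 0 \<le> s \<Longrightarrow> A \<in> sets (F s) \<Longrightarrow> 
      c * prob {\<omega>\<in>A. T n \<omega> \<le> ereal s \<and> ereal s < T (Suc n) \<omega>} \<le> 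
      prob {\<omega>\<in>A. T n \<omega> \<le> ereal s \<and> ereal s < T (Suc n) \<omega> \<and> T (Suc n) \<omega> \<le> ereal (s + K)}"
proof -
  obtain g where eig: "eigenfun (\<lambda>x. b (y + x)) (\<lambda>x. \<sigma> (y + x)) 1 g" and g1: "\<And>x. \<bar>x\<bar> \<le> 1 \<Longrightarrow> 1 \<le> g x"
    using shifted_eigenfun_pair[of 1] by auto
  obtain B where B: "1 \<le> B" "\<And>x. \<bar>g x\<bar> \<le> B" and contg: "continuous_on UNIV g"
    using eig unfolding eigenfun_def by (auto intro!: DERIV_continuous_on simp: has_field_derivative_at_within)
  have [measurable]: "g \<in> borel_measurable borel" using contg by (auto intro: borel_measurable_continuous_onI)
  \<comment> \<open>After a waiting time K the discount has brought the bound B down to 1/2. At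
    least half of the probability then has to come from cycles that have ended, with weight at most
    B, which gives c = 1 / (2 B).\<close>
  define K where "K = ln (2 * B)"
  have K: "0 \<le> K" "exp (- K) * B = 1 / 2" using B(1) by (auto simp: K_def exp_minus field_simps)
  show ?thesis
  proof (rule that[of "1 / (2 * B)" K])
    fix n :: nat and s :: real and A assume s: "0 \<le> s" and A: "A \<in> sets (F s)"
    define L where "L = s + K"
    have L: "0 \<le> L" "s \<le> L" using s K by (auto simp: L_def)
    define D where "D = A \<inter> {\<omega>\<in>space M. T n \<omega> \<le> ereal s} - {\<omega>\<in>space M. T (Suc n) \<omega> \<le> ereal s}"
    have DF: "D \<in> sets (F s)" unfolding D_def using A s by (intro sets.Diff sets.Int T_stopping) auto
    have DM [measurable]: "D \<in> events" by (rule sets_F_events[OF DF])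
    have Asp: "A \<subseteq> space M" using sets.sets_into_space[OF A] by simp
    have D_eq: "{\<omega>\<in>A. T n \<omega> \<le> ereal s \<and> ereal s < T (Suc n) \<omega>} = D" using Asp by (auto simp: D_def)
    have DE_eq: "{\<omega>\<in>A. T n \<omega> \<le> ereal s \<and> ereal s < T (Suc n) \<omega> \<and> T (Suc n) \<omega> \<le> ereal (s + K)} = D \<inter> {\<omega>\<in>space M. T (Suc n) \<omega> \<le> ereal L}" 
      using Asp by (auto simp: D_def L_def)
    have DEM [measurable]: "D \<inter> {\<omega>\<in>space M. T (Suc n) \<omega> \<le> ereal L} \<in> events" by measurable
    \<comment> \<open>\<open>max\<close> guarantees \<open>s \<le> T'\<close> at all sample points;
      on D, where the weight is nonzero, it changes nothing (\<open>T'D\<close>).\<close>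
    define T' where "T' \<omega> = max s (Tm (Suc n) L \<omega>)" for \<omega>
    have [measurable]: "Tm k L \<in> borel_measurable M" "(\<lambda>\<omega>. X (Tm k L \<omega>) \<omega>) \<in> borel_measurable M" for k
      by (rule measurable_F_M[OF Tm_F] measurable_F_M[OF X_Tm_F]; simp add: L)+
    have T'M [measurable]: "T' \<in> borel_measurable M" unfolding T'_def by measurable
    have T'le: "T' \<omega> \<le> L" if "\<omega> \<in> space M" for \<omega> using Tm_bounds(2)[OF that L(1), of "Suc n"] L by (simp add: T'_def)
    have XT: "(\<lambda>\<omega>. X (T' \<omega>) \<omega>) \<in> borel_measurable M" "X s \<in> borel_measurable M"
      using T'le s by (auto intro!: X_random_time[of M L] X_M simp: T'_def le_max_iff_disj)
    note [measurable] = XT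
    define a where "a \<omega> = exp (- 1 * (T' \<omega> - s)) * g (X (T' \<omega>) \<omega> - X (Tm n L \<omega>) \<omega>)" for \<omega>
    define e where "e \<omega> = g (X s \<omega> - X (Tm n L \<omega>) \<omega>)" for \<omega>
    have [measurable]: "a \<in> borel_measurable M" "e \<in> borel_measurable M" unfolding a_def e_def by measurable
    have ito: "expectation (\<lambda>\<omega>. indicator D \<omega> * (a \<omega> - e \<omega>)) = 0"
      unfolding a_def e_def
    proof (rule cycle_ito[OF eig, where S="\<lambda>_. s" and T'=T'])
      fix \<omega> u assume w: "\<omega> \<in> space M" and Y: "indicator D \<omega> \<noteq> (0::real)" and u: "s \<le> u" "u < T' \<omega>"
      show "ereal u < T (Suc n) \<omega>" using u Tm_le_iff[OF w L(1), of "Suc n" u] by (auto simp: T'_def not_le[symmetric])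
    next
      fix \<omega> assume "indicator D \<omega> \<noteq> (0::real)"
      then show "T n \<omega> \<le> ereal s" by (auto simp: D_def indicator_def split: if_splits)
    next
      show "(\<lambda>_. s) \<in> borel_measurable M" "T' \<in> borel_measurable M" "indicator D \<in> borel_measurable M" by measurable
      show "\<bar>indicator D \<omega> :: real\<bar> \<le> 1" for \<omega> by (simp add: indicator_def)
      show "s \<le> T' \<omega>" for \<omega> by (simp add: T'_def)
      fix u :: real assume u: "0 \<le> u"
      show "(\<lambda>\<omega>. min s u) \<in> borel_measurable (F u)" by simp
      show "(\<lambda>\<omega>. if s \<le> u \<and> u < T' \<omega> then indicator D \<omega> else 0 :: real) \<in> borel_measurable (F u)"
      proof (cases "s \<le> u \<and> u < L")
        case True
        have DuF: "D - {\<omega>\<in>space M. T (Suc n) \<omega> \<le> ereal u} \<in> sets (F u)"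
          using DF sets_F_mono[of s u] True u by (intro sets.Diff T_stopping) auto
        have "(if s \<le> u \<and> u < T' \<omega> then indicator D \<omega> else 0 :: real) = indicator (D - {\<omega>\<in>space M. T (Suc n) \<omega> \<le> ereal u}) \<omega>" 
          if "\<omega> \<in> space (F u)" for \<omega>
          using Tm_le_iff[of \<omega> L "Suc n" u] that True L by (auto simp: T'_def indicator_def not_le[symmetric])
        then show ?thesis using DuF by (subst measurable_cong) auto
      next
        case False
        have "(if s \<le> u \<and> u < T' \<omega> then indicator D \<omega> else 0 :: real) = 0" if "\<omega> \<in> space (F u)" for \<omega>
          using T'le[of \<omega>] that False by auto
        then show ?thesis by (subst measurable_cong[of _ _ "\<lambda>_. 0"]) auto
      qed
    qed (use s T'le in auto)
    have T'D: "T' \<omega> = Tm (Suc n) L \<omega>" if "\<omega> \<in> D" for \<omega>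
    proof -
      have w: "\<omega> \<in> space M" "\<not> T (Suc n) \<omega> \<le> ereal s" using that Asp by (auto simp: D_def)
      have "ereal s \<le> ereal (Tm (Suc n) L \<omega>)" unfolding Tm_ereal[OF w(1) L(1)] using w(2) L(2) by simp
      then show ?thesis by (simp add: T'_def)
    qed
    have ale: "a \<omega> \<le> B * exp (- (T' \<omega> - s))" for \<omega>
      using mult_left_mono[of "g (X (T' \<omega>) \<omega> - X (Tm n L \<omega>) \<omega>)" B "exp (- 1 * (T' \<omega> - s))"] abs_le_D1[OF B(2)]
      by (simp add: a_def mult.commute)
    have abd: "\<bar>a \<omega>\<bar> \<le> B" "\<bar>e \<omega>\<bar> \<le> B" for \<omega>
    proof -
      have "exp (- 1 * (T' \<omega> - s)) \<le> 1" by (simp add: T'_def)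
      then have "\<bar>a \<omega>\<bar> \<le> 1 * B" unfolding a_def abs_mult by (intro mult_mono B) auto
      then show "\<bar>a \<omega>\<bar> \<le> B" by simp
      show "\<bar>e \<omega>\<bar> \<le> B" unfolding e_def by (rule B(2))
    qed
    let ?I = "indicator (D \<inter> {\<omega>\<in>space M. T (Suc n) \<omega> \<le> ereal L}) :: 'a \<Rightarrow> real"
    have i: "integrable M (\<lambda>\<omega>. indicator D \<omega> * a \<omega>)" "integrable M (\<lambda>\<omega>. indicator D \<omega> * e \<omega>)"
      by (rule integrable_boundedI[of _ B]; use abd B(1) in \<open>auto simp: indicator_def\<close>)+
    have iI: "integrable M (indicator E :: 'a \<Rightarrow> real)" if [measurable]: "E \<in> events" for E
      by (rule integrable_boundedI[of _ 1]) (auto simp: indicator_def)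
    have "prob D = expectation (indicator D)" by simp
    also have "\<dots> \<le> expectation (\<lambda>\<omega>. indicator D \<omega> * e \<omega>)"
    proof (rule integral_mono[OF _ i(2)])
      fix \<omega> assume w: "\<omega> \<in> space M"
      show "indicator D \<omega> \<le> indicator D \<omega> * e \<omega>"
      proof (cases "\<omega> \<in> D")
        case True
        then have h: "T n \<omega> \<le> ereal s" "ereal s < T (Suc n) \<omega>" using w by (auto simp: D_def)
        have "T n \<omega> \<le> ereal L" using h(1) L(2) by (auto intro: order_trans)
        then have "1 \<le> e \<omega>" unfolding e_def Tm_eq[OF \<open>T n \<omega> \<le> ereal L\<close>] using X_before_T_Suc[OF w h] by (intro g1) auto
        then show ?thesis using True by simp
      qed simp
    qed (rule iI[OF DM])
    also have "\<dots> = expectation (\<lambda>\<omega>. indicator D \<omega> * a \<omega>)" using ito i by (simp add: right_diff_distrib)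
    also have "\<dots> \<le> expectation (\<lambda>\<omega>. B * ?I \<omega> + 1 / 2 * indicator D \<omega>)"
    proof (rule integral_mono[OF i(1)])
      fix \<omega> assume w: "\<omega> \<in> space M"
      show "indicator D \<omega> * a \<omega> \<le> B * ?I \<omega> + 1 / 2 * indicator D \<omega>"
      proof (cases "\<omega> \<in> D")
        case D: True
        show ?thesis
        proof (cases "T (Suc n) \<omega> \<le> ereal L")
          case True
          then show ?thesis using D w abd(1)[of \<omega>] by simp
        next
          case False
          then have "T' \<omega> = L" unfolding T'D[OF D] by (simp add: Tm_def min_def)
          then have "a \<omega> \<le> 1 / 2" using ale[of \<omega>] K(2) by (simp add: L_def mult.commute)
          then show ?thesis using D False by simp
        qed
      qed simp
    qed (intro Bochner_Integration.integrable_add integrable_mult_right iI DM DEM)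
    also have "\<dots> = B * prob (D \<inter> {\<omega>\<in>space M. T (Suc n) \<omega> \<le> ereal L}) + 1 / 2 * prob D"
      using iI[OF DM] iI[OF DEM] by simp
    finally have "prob D / 2 \<le> B * prob (D \<inter> {\<omega>\<in>space M. T (Suc n) \<omega> \<le> ereal L})" by simp
    then show "1 / (2 * B) * prob {\<omega>\<in>A. T n \<omega> \<le> ereal s \<and> ereal s < T (Suc n) \<omega>} \<le> 
      prob {\<omega>\<in>A. T n \<omega> \<le> ereal s \<and> ereal s < T (Suc n) \<omega> \<and> T (Suc n) \<omega> \<le> ereal (s + K)}"
      unfolding D_eq DE_eq using B(1) by (simp add: field_simps)
  qed (use B(1) K in \<open>auto simp: field_simps\<close>)
qed

text \<open>One bounded variable encodes both the direction of a cycle (its sign) and its duration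
  (its modulus is \<open>exp (- duration)\<close>), so that moments determine the joint law.\<close>
definition V :: "nat \<Rightarrow> 'a \<Rightarrow> real" where "V = cycle_val 1 (\<lambda>x. x)"

lemma X_Tr_measurable [measurable]: "(\<lambda>\<omega>. if T n \<omega> < \<infinity> then X (Tr n \<omega>) \<omega> else 0) \<in> borel_measurable M"
proof (rule borel_measurable_LIMSEQ_real)
  have [measurable]: "(\<lambda>\<omega>. X (Tm n (real N) \<omega>) \<omega>) \<in> borel_measurable M" for N by (rule measurable_F_M[OF X_Tm_F]) simp
  show "(\<lambda>\<omega>. if T n \<omega> \<le> ereal (real N) then X (Tm n (real N) \<omega>) \<omega> else 0) \<in> borel_measurable M" for N by measurable
  fix \<omega> assume w: "\<omega> \<in> space M"
  show "(\<lambda>N. if T n \<omega> \<le> ereal (real N) then X (Tm n (real N) \<omega>) \<omega> else 0) \<longlonglongrightarrow> (if T n \<omega> < \<infinity> then X (Tr n \<omega>) \<omega> else 0)"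
  proof (cases "T n \<omega> < \<infinity>")
    case True
    have "\<forall>\<^sub>F N in sequentially. Tr n \<omega> \<le> real N" by (rule eventually_sequentiallyI[of "nat \<lceil>Tr n \<omega>\<rceil>"]) linarith
    then have "\<forall>\<^sub>F N in sequentially. (if T n \<omega> \<le> ereal (real N) then X (Tm n (real N) \<omega>) \<omega> else 0) = X (Tr n \<omega>) \<omega>"
    proof eventually_elim
      case (elim N)
      then have "T n \<omega> \<le> ereal (real N)" by (metis T_real(1)[OF w True] ereal_less_eq(3))
      then show ?case by (simp add: Tm_eq)
    qed
    then show ?thesis using True by (simp add: tendsto_eventually)
  qed auto
qed

lemma V_alt: "V n \<omega> = (if T (Suc n) \<omega> < \<infinity> then exp (- (Tr (Suc n) \<omega> - Tr n \<omega>)) * (X (Tr (Suc n) \<omega>) \<omega> - X (Tr n \<omega>) \<omega>) else 0)"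
  by (simp add: V_def cycle_val_def)

lemma T_finite_mono: "\<omega> \<in> space M \<Longrightarrow> T (Suc n) \<omega> < \<infinity> \<Longrightarrow> T n \<omega> < \<infinity>"
  using T_mono[of \<omega> n "Suc n"] by auto

lemma V_measurable [measurable]: "V n \<in> borel_measurable M"
proof -
  let ?x = "\<lambda>n \<omega>. if T n \<omega> < \<infinity> then X (Tr n \<omega>) \<omega> else 0"
  have "(\<lambda>\<omega>. if T (Suc n) \<omega> < \<infinity> then exp (- (Tr (Suc n) \<omega> - Tr n \<omega>)) * (?x (Suc n) \<omega> - ?x n \<omega>) else 0) \<in> borel_measurable M"
    by measurable
  then show ?thesis
    by (rule measurable_cong[THEN iffD1, rotated]) (use T_finite_mono in \<open>auto simp: V_alt\<close>)
qed

lemma V_abs: 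
  assumes "\<omega> \<in> space M" "T (Suc n) \<omega> < \<infinity>" 
  shows "\<bar>V n \<omega>\<bar> = exp (- (Tr (Suc n) \<omega> - Tr n \<omega>))" "\<bar>V n \<omega>\<bar> < 1" "V n \<omega> \<noteq> 0"
proof -
  show 1: "\<bar>V n \<omega>\<bar> = exp (- (Tr (Suc n) \<omega> - Tr n \<omega>))" using assms X_T_Suc[OF assms] by (simp add: V_alt abs_mult)
  have "Tr n \<omega> < Tr (Suc n) \<omega>"
    using T_less_Suc[OF assms(1) T_finite_mono[OF assms]] T_real(1)[OF assms(1) T_finite_mono[OF assms]] T_real(1)[OF assms]
    by (metis ereal_less(3) ereal_less_eq(3) not_le)
  then show "\<bar>V n \<omega>\<bar> < 1" unfolding 1 by simp
  show "V n \<omega> \<noteq> 0" using 1 by auto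
qed

lemma V_bound: "\<omega> \<in> space M \<Longrightarrow> \<bar>V n \<omega>\<bar> \<le> 1"
  using V_abs(2)[of \<omega> n] by (cases "T (Suc n) \<omega> < \<infinity>") (auto simp: V_alt)

lemma V_eq_0_iff: "\<omega> \<in> space M \<Longrightarrow> V n \<omega> = 0 \<longleftrightarrow> T (Suc n) \<omega> = \<infinity>"
  using V_abs(3)[of \<omega> n] by (cases "T (Suc n) \<omega> < \<infinity>") (auto simp: V_alt)

text \<open>Once \<open>T (Suc n)\<close> has occurred by time u, \<open>V n\<close> agrees with the
  expression built from the truncated times, which is known at u.\<close>

lemma stop_ev_step:
  assumes A: "A \<in> stop_ev n" and B: "B \<in> sets borel"
  shows "A \<inter> {\<omega>\<in>space M. V n \<omega> \<in> B} \<in> stop_ev (Suc n)"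
  unfolding stop_ev_def
proof (safe)
  have [measurable]: "A \<in> events" "B \<in> sets borel" using A B by (auto simp: stop_ev_def)
  show "A \<inter> {\<omega>\<in>space M. V n \<omega> \<in> B} \<in> events" by measurable
  fix u :: real assume u: "0 \<le> u"
  define Vu where "Vu \<omega> = exp (- (Tm (Suc n) u \<omega> - Tm n u \<omega>)) * (X (Tm (Suc n) u \<omega>) \<omega> - X (Tm n u \<omega>) \<omega>)" for \<omega>
  have VuF: "Vu \<in> borel_measurable (F u)"
  proof -
    note [measurable] = Tm_F[OF u] X_Tm_F[OF u]
    show ?thesis unfolding Vu_def by measurable
  qed
  have "A \<inter> {\<omega>\<in>space M. V n \<omega> \<in> B} \<inter> {\<omega>\<in>space M. T (Suc n) \<omega> \<le> ereal u} =
    (A \<inter> {\<omega>\<in>space M. T n \<omega> \<le> ereal u}) \<inter> (Vu -` B \<inter> space (F u)) \<inter> {\<omega>\<in>space M. T (Suc n) \<omega> \<le> ereal u}"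
  proof -
    have "T n \<omega> \<le> ereal u \<and> Vu \<omega> = V n \<omega>" if w: "\<omega> \<in> space M" and le: "T (Suc n) \<omega> \<le> ereal u" for \<omega>
    proof -
      have 1: "T n \<omega> \<le> ereal u" using T_mono[OF w, of n "Suc n"] le by (auto intro: order_trans)
      have "T (Suc n) \<omega> < \<infinity>" using le by (cases "T (Suc n) \<omega>") auto
      then show ?thesis using 1 le by (simp add: Vu_def V_alt Tm_eq)
    qed
    then show ?thesis by auto
  qed
  also have "\<dots> \<in> sets (F u)"
  proof (rule sets.Int[OF sets.Int[OF _ measurable_sets[OF VuF B]] T_stopping[OF u]])
    show "A \<inter> {\<omega>\<in>space M. T n \<omega> \<le> ereal u} \<in> sets (F u)" using A u by (auto simp: stop_ev_def)
  qed
  finally show "A \<inter> {\<omega>\<in>space M. V n \<omega> \<in> B} \<inter> {\<omega>\<in>space M. T (Suc n) \<omega> \<le> ereal u} \<in> sets (F u)" .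
qed

lemma space_stop_ev: "space M \<in> stop_ev n"
  unfolding stop_ev_def using T_stopping by (auto simp: Int_absorb1)

text \<open>The constant m is fixed before n and A. It is the value at 0 of a combination of
  eigenfunctions, and so depends neither on the cycle nor on its past.\<close>

lemma V_moment: 
  obtains m where "\<And>n A. A \<in> stop_ev n \<Longrightarrow> 
    expectation (\<lambda>\<omega>. indicator (A \<inter> {\<omega>\<in>space M. T n \<omega> < \<infinity>}) \<omega> * V n \<omega> ^ Suc k) = m * prob (A \<inter> {\<omega>\<in>space M. T n \<omega> < \<infinity>})"
proof -
  let ?l = "real (Suc k)"
  obtain g1 g2 where g: "eigenfun (\<lambda>x. b (y + x)) (\<lambda>x. \<sigma> (y + x)) ?l g1" "eigenfun (\<lambda>x. b (y + x)) (\<lambda>x. \<sigma> (y + x)) ?l g2" 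
    and d: "g1 (-1) * g2 1 - g1 1 * g2 (-1) > 0"
    using shifted_eigenfun_pair[of ?l] by (metis of_nat_0_less_iff zero_less_Suc)
  define d' where "d' = g1 (-1) * g2 1 - g1 1 * g2 (-1)"
  define s :: real where "s = (-1) ^ Suc k"
  \<comment> \<open>Cramer's rule for the combination of g1 and g2 with value 1 at 1 and value
    (-1)^(k+1) at -1, the power \<open>Suc k\<close> of the two possible displacements.\<close>
  define a1 where "a1 = (s * g2 1 - g2 (-1)) / d'"
  define a2 where "a2 = (g1 (-1) - s * g1 1) / d'"
  have d'0: "d' \<noteq> 0" using d by (simp add: d'_def)
  have "a1 * g1 1 + a2 * g2 1 = d' / d'" "a1 * g1 (-1) + a2 * g2 (-1) = s * d' / d'"
    unfolding a1_def a2_def times_divide_eq_left add_divide_distrib[symmetric]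
    by (rule arg_cong[of _ _ "\<lambda>x. x / d'"], simp add: d'_def algebra_simps)+
  then have a: "a1 * g1 1 + a2 * g2 1 = 1" "a1 * g1 (-1) + a2 * g2 (-1) = s" using d'0 by auto
  show ?thesis
  proof (rule that[of "a1 * g1 0 + a2 * g2 0"])
    fix n A assume A: "A \<in> stop_ev n"
    let ?A = "A \<inter> {\<omega>\<in>space M. T n \<omega> < \<infinity>}"
    have [measurable]: "A \<in> events" using A by (auto simp: stop_ev_def)
    have Veq: "V n \<omega> ^ Suc k = a1 * cycle_val ?l g1 n \<omega> + a2 * cycle_val ?l g2 n \<omega>" if w: "\<omega> \<in> space M" for \<omega>
    proof (cases "T (Suc n) \<omega> < \<infinity>")
      case True
      define \<xi> where "\<xi> = X (Tr (Suc n) \<omega>) \<omega> - X (Tr n \<omega>) \<omega>"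
      have "\<xi> = 1 \<or> \<xi> = -1" using X_T_Suc[OF w True] by (auto simp: \<xi>_def abs_if split: if_splits)
      then have "\<xi> ^ Suc k = a1 * g1 \<xi> + a2 * g2 \<xi>" using a by (auto simp: s_def)
      moreover have "V n \<omega> ^ Suc k = exp (- ?l * (Tr (Suc n) \<omega> - Tr n \<omega>)) * \<xi> ^ Suc k"
        using True exp_of_nat_mult[of "Suc k" "- (Tr (Suc n) \<omega> - Tr n \<omega>)"]
        unfolding V_alt \<xi>_def by (simp only: if_True power_mult_distrib mult_minus_left mult_minus_right)
      ultimately show ?thesis using True by (simp add: cycle_val_def \<xi>_def algebra_simps del: power_Suc)
    qed (simp add: V_alt cycle_val_def)
    have i: "integrable M (\<lambda>\<omega>. indicator ?A \<omega> * cycle_val ?l g n \<omega>)" 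
      if c: "cycle_val ?l g n \<in> borel_measurable M" "\<And>\<omega>. \<omega> \<in> space M \<Longrightarrow> \<bar>cycle_val ?l g n \<omega>\<bar> \<le> C" for g C
    proof (rule integrable_boundedI[of _ "\<bar>C\<bar>"])
      note [measurable] = c(1)
      show "(\<lambda>\<omega>. indicator ?A \<omega> * cycle_val ?l g n \<omega>) \<in> borel_measurable M" by measurable
      show "\<bar>indicator ?A \<omega> * cycle_val ?l g n \<omega>\<bar> \<le> \<bar>C\<bar>" if "\<omega> \<in> space M" for \<omega>
        using c(2)[OF that] by (auto simp: indicator_def)
    qed
    note m1 = cycle_moment[OF g(1) _ A] and m2 = cycle_moment[OF g(2) _ A]
    have l0: "0 < ?l" by simp
    have i1: "integrable M (\<lambda>\<omega>. indicator ?A \<omega> * cycle_val ?l g1 n \<omega>)" by (rule i[OF m1(1,2)[OF l0]])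
    have i2: "integrable M (\<lambda>\<omega>. indicator ?A \<omega> * cycle_val ?l g2 n \<omega>)" by (rule i[OF m2(1,2)[OF l0]])
    have "expectation (\<lambda>\<omega>. indicator ?A \<omega> * V n \<omega> ^ Suc k) = 
       expectation (\<lambda>\<omega>. a1 * (indicator ?A \<omega> * cycle_val ?l g1 n \<omega>) + a2 * (indicator ?A \<omega> * cycle_val ?l g2 n \<omega>))"
      by (rule Bochner_Integration.integral_cong[OF refl]) (simp only: Veq distrib_left mult.left_commute)
    also have "\<dots> = a1 * (g1 0 * prob ?A) + a2 * (g2 0 * prob ?A)"
      using i1 i2 m1(3)[OF l0] m2(3)[OF l0] by (subst Bochner_Integration.integral_add) (auto simp del: of_nat_Suc)
    finally show "expectation (\<lambda>\<omega>. indicator ?A \<omega> * V n \<omega> ^ Suc k) = (a1 * g1 0 + a2 * g2 0) * prob ?A"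
      by (simp add: algebra_simps)
  qed
qed

end

section \<open>Independence of the cycles\<close>

context sde
begin

text \<open>By \<open>V_moment\<close> the moments of V n conditioned on a past event equal those of
  V 0, and laws on [-1, 1] are determined by their moments.\<close>

lemma V_law:
  assumes A: "A \<in> stop_ev n" and B: "B \<in> sets borel"
  shows "prob (A \<inter> {\<omega>\<in>space M. T n \<omega> < \<infinity>} \<inter> {\<omega>\<in>space M. V n \<omega> \<in> B}) = 
    prob (A \<inter> {\<omega>\<in>space M. T n \<omega> < \<infinity>}) * prob {\<omega>\<in>space M. V 0 \<omega> \<in> B}"
proof -
  define D where "D = A \<inter> {\<omega>\<in>space M. T n \<omega> < \<infinity>}"
  have [measurable]: "A \<in> events" "B \<in> sets borel" using A B by (auto simp: stop_ev_def)
  have DM [measurable]: "D \<in> events" unfolding D_def by measurable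
  have EM [measurable]: "{\<omega>\<in>space M. V k \<omega> \<in> B} \<in> events" for k by measurable
  show ?thesis
  proof (cases "prob D = 0")
    case True
    have "prob (D \<inter> {\<omega>\<in>space M. V n \<omega> \<in> B}) \<le> prob D" by (rule finite_measure_mono) auto
    then have "prob (D \<inter> {\<omega>\<in>space M. V n \<omega> \<in> B}) = 0" using True by (simp add: measure_le_0_iff)
    then show ?thesis using True unfolding D_def[symmetric] by simp
  next
    case False
    then have p: "prob D > 0" by (simp add: zero_less_measure_iff)
    define f where "f \<omega> = indicator D \<omega> / prob D" for \<omega>
    have fM [measurable]: "f \<in> borel_measurable M" unfolding f_def by measurable
    have f0: "0 \<le> f \<omega>" for \<omega> by (simp add: f_def)
    define U where "U = density M (\<lambda>\<omega>. ennreal (f \<omega>))"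
    have iD: "integrable M (indicator D :: 'a \<Rightarrow> real)" by (rule integrable_boundedI[of _ 1]) (auto simp: indicator_def)
    have intU: "(\<integral>\<omega>. h \<omega> \<partial>U) = expectation (\<lambda>\<omega>. indicator D \<omega> * h \<omega>) / prob D" 
      if [measurable]: "h \<in> borel_measurable M" for h :: "'a \<Rightarrow> real"
    proof -
      have "(\<integral>\<omega>. h \<omega> \<partial>U) = expectation (\<lambda>\<omega>. f \<omega> *\<^sub>R h \<omega>)"
        unfolding U_def by (rule integral_density) (use f0 in auto)
      then show ?thesis by (simp add: f_def)
    qed
    have "emeasure U (space U) = (\<integral>\<^sup>+\<omega>. ennreal (f \<omega>) \<partial>M)"
      unfolding U_def by (subst emeasure_density) (auto intro!: nn_integral_cong simp: indicator_def)
    also have "\<dots> = ennreal (expectation f)" 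
      using iD f0 unfolding f_def by (intro nn_integral_eq_integral) auto
    also have "expectation f = 1" using p unfolding f_def by simp
    finally interpret U: prob_space U by (intro prob_spaceI) simp
    have mU: "measurable U N = measurable M N" for N :: "real measure" by (rule measurable_cong_sets) (auto simp: U_def)
    have spU: "space U = space M" by (simp add: U_def)
    have rd: "real_distribution (distr U borel (V n))" "real_distribution (distr M borel (V 0))"
      by (rule U.real_distribution_distr; simp add: mU) (rule real_distribution_distr; simp)
    have dE: "distr U borel (V n) = distr M borel (V 0)"
    proof (rule real_distribution_moments_eq[OF rd])
      show "AE x in distr U borel (V n). \<bar>x\<bar> \<le> 1"
        by (subst AE_distr_iff) (auto simp: mU spU intro!: AE_I2 V_bound)
      show "AE x in distr M borel (V 0). \<bar>x\<bar> \<le> 1"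
        by (subst AE_distr_iff) (auto intro!: AE_I2 V_bound)
      fix k
      show "(\<integral>x. x ^ k \<partial>distr U borel (V n)) = (\<integral>x. x ^ k \<partial>distr M borel (V 0))"
      \<comment> \<open>\<open>V_moment\<close> covers the positive powers; the power 0 is the total
        mass.\<close>
      proof (cases k)
        case 0
        then show ?thesis using real_distribution.axioms(1)[OF rd(1)] real_distribution.axioms(1)[OF rd(2)]
          by (simp add: prob_space.prob_space del: space_distr)
      next
        case (Suc j)
        obtain m where m: "\<And>n A. A \<in> stop_ev n \<Longrightarrow> 
           expectation (\<lambda>\<omega>. indicator (A \<inter> {\<omega>\<in>space M. T n \<omega> < \<infinity>}) \<omega> * V n \<omega> ^ Suc j) = m * prob (A \<inter> {\<omega>\<in>space M. T n \<omega> < \<infinity>})"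
          using V_moment by blast
        have "(\<integral>x. x ^ k \<partial>distr U borel (V n)) = (\<integral>\<omega>. V n \<omega> ^ k \<partial>U)" by (rule integral_distr) (auto simp: mU)
        also have "\<dots> = m" using m[OF A] p unfolding D_def[symmetric] Suc by (subst intU) auto
        also have "m = expectation (\<lambda>\<omega>. V 0 \<omega> ^ k)"
        proof -
          have "space M \<inter> {\<omega>\<in>space M. T 0 \<omega> < \<infinity>} = space M" by auto
          from m[OF space_stop_ev[of 0], unfolded this]
          have "expectation (\<lambda>\<omega>. indicator (space M) \<omega> * V 0 \<omega> ^ Suc j) = m" by (simp add: prob_space)
          moreover have "expectation (\<lambda>\<omega>. indicator (space M) \<omega> * V 0 \<omega> ^ Suc j) = expectation (\<lambda>\<omega>. V 0 \<omega> ^ k)"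
            unfolding Suc by (rule Bochner_Integration.integral_cong) auto
          ultimately show ?thesis by simp
        qed
        also have "\<dots> = (\<integral>x. x ^ k \<partial>distr M borel (V 0))" by (rule integral_distr[symmetric]) auto
        finally show ?thesis .
      qed
    qed
    have "prob {\<omega>\<in>space M. V 0 \<omega> \<in> B} = measure (distr M borel (V 0)) B"
      by (subst measure_distr) (auto simp: vimage_def Int_def conj_commute)
    also have "\<dots> = measure U {\<omega>\<in>space M. V n \<omega> \<in> B}"
      unfolding dE[symmetric] by (subst measure_distr) (auto simp: vimage_def Int_def conj_commute mU spU)
    also have "\<dots> = (\<integral>\<omega>. indicator {\<omega>\<in>space M. V n \<omega> \<in> B} \<omega> \<partial>U)"
      by (simp add: spU Int_absorb1)
    also have "\<dots> = expectation (\<lambda>\<omega>. indicator D \<omega> * indicator {\<omega>\<in>space M. V n \<omega> \<in> B} \<omega>) / prob D" by (rule intU) measurable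
    also have "\<dots> = prob (D \<inter> {\<omega>\<in>space M. V n \<omega> \<in> B}) / prob D"
      by (simp flip: indicator_inter_arith)
    finally show ?thesis using p unfolding D_def[symmetric] by simp
  qed
qed

text \<open>\<open>residual_cycle_time\<close> at the times j K gives a geometric tail for the first
  cycle, so V 0 vanishes with probability 0. By \<open>V_law\<close> the same holds for every later
  cycle that starts, and V n = 0 is exactly the event that cycle n does not end.\<close>

lemma AE_T_finite: "AE \<omega> in M. \<forall>n. T n \<omega> < \<infinity>"
proof -
  obtain c K where cK: "0 < c" "c \<le> 1" "0 \<le> K" and
    res: "\<And>n s A. 0 \<le> s \<Longrightarrow> A \<in> sets (F s) \<Longrightarrow> 
      c * prob {\<omega>\<in>A. T n \<omega> \<le> ereal s \<and> ereal s < T (Suc n) \<omega>} \<le> 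
      prob {\<omega>\<in>A. T n \<omega> \<le> ereal s \<and> ereal s < T (Suc n) \<omega> \<and> T (Suc n) \<omega> \<le> ereal (s + K)}"
    using residual_cycle_time by blast
  define G where "G s = prob {\<omega>\<in>space M. ereal s < T 1 \<omega>}" for s
  have step: "G (s + K) \<le> (1 - c) * G s" if s: "0 \<le> s" for s
  proof -
    have sub: "{\<omega>\<in>space M. ereal s < T 1 \<omega> \<and> T 1 \<omega> \<le> ereal (s + K)} \<subseteq> {\<omega>\<in>space M. ereal s < T 1 \<omega>}" by auto
    have "{\<omega>\<in>space M. ereal (s + K) < T 1 \<omega>} = {\<omega>\<in>space M. ereal s < T 1 \<omega>} - {\<omega>\<in>space M. ereal s < T 1 \<omega> \<and> T 1 \<omega> \<le> ereal (s + K)}"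
    proof -
      have "ereal s < T 1 \<omega>" if "ereal (s + K) < T 1 \<omega>" for \<omega>
        by (rule le_less_trans[OF _ that]) (use cK in simp)
      then show ?thesis by (auto simp: not_le)
    qed
    then have "G (s + K) = G s - prob {\<omega>\<in>space M. ereal s < T 1 \<omega> \<and> T 1 \<omega> \<le> ereal (s + K)}"
      unfolding G_def by (subst finite_measure_Diff[symmetric]) (use sub in auto)
    moreover have "space M \<in> sets (F s)" using sets.top[of "F s"] by simp
    from res[OF s this, of 0] have "c * G s \<le> prob {\<omega>\<in>space M. ereal s < T 1 \<omega> \<and> T 1 \<omega> \<le> ereal (s + K)}"
      using s by (simp add: G_def)
    ultimately show ?thesis by (simp add: algebra_simps)
  qed
  have Gj: "G (real j * K) \<le> (1 - c) ^ j" for j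
  proof (induction j)
    case 0
    then show ?case by (simp add: G_def)
  next
    case (Suc j)
    have "G (real (Suc j) * K) = G (real j * K + K)" by (simp add: algebra_simps)
    also have "\<dots> \<le> (1 - c) * G (real j * K)" by (rule step) (use cK in simp)
    also have "\<dots> \<le> (1 - c) * (1 - c) ^ j" using Suc cK by (intro mult_left_mono) auto
    finally show ?case by simp
  qed
  have inf_le: "prob {\<omega>\<in>space M. T 1 \<omega> = \<infinity>} \<le> (1 - c) ^ j" for j
    by (rule order_trans[OF finite_measure_mono Gj[of j, unfolded G_def]]) auto
  have "(\<lambda>j. (1 - c) ^ j) \<longlonglongrightarrow> 0" using cK by (intro LIMSEQ_realpow_zero) auto
  then have "prob {\<omega>\<in>space M. T 1 \<omega> = \<infinity>} \<le> 0" by (rule LIMSEQ_le_const) (use inf_le in auto)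
  moreover have "{\<omega>\<in>space M. T 1 \<omega> = \<infinity>} = {\<omega>\<in>space M. V 0 \<omega> \<in> {0}}" using V_eq_0_iff[of _ 0] by auto
  ultimately have V0: "prob {\<omega>\<in>space M. V 0 \<omega> \<in> {0}} = 0" by (simp add: measure_le_0_iff)
  have "AE \<omega> in M. T n \<omega> < \<infinity>" for n
  proof (induction n)
    case (Suc n)
    have "prob (space M \<inter> {\<omega>\<in>space M. T n \<omega> < \<infinity>} \<inter> {\<omega>\<in>space M. V n \<omega> \<in> {0}}) = 0"
      using V_law[OF space_stop_ev, of "{0}" n] V0 by simp
    then have "AE \<omega> in M. \<omega> \<notin> space M \<inter> {\<omega>\<in>space M. T n \<omega> < \<infinity>} \<inter> {\<omega>\<in>space M. V n \<omega> \<in> {0}}"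
      by (subst prob_eq_0[symmetric]) auto
    then show ?case using Suc AE_space
      by eventually_elim (use V_eq_0_iff in auto)
  qed simp
  then show ?thesis by (simp add: AE_all_countable)
qed

lemma prob_T_finite:
  assumes [measurable]: "A \<in> events"
  shows "prob (A \<inter> {\<omega>\<in>space M. T n \<omega> < \<infinity>}) = prob A"
  by (rule finite_measure_eq_AE) (use AE_T_finite in \<open>auto elim: eventually_mono\<close>)

text \<open>Induction on the number of cycles: the condition on the first of them is moved into the
  past event, which then belongs to the past of the next cycle time
  (\<open>stop_ev_step\<close>).\<close>

lemma strong_markov_cylinder:
  assumes A: "A \<in> stop_ev n" and B: "\<And>i. i < k \<Longrightarrow> B i \<in> sets borel"
  shows "prob (A \<inter> {\<omega>\<in>space M. \<forall>i<k. V (n + i) \<omega> \<in> B i}) = prob A * (\<Prod>i<k. prob {\<omega>\<in>space M. V 0 \<omega> \<in> B i})"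
  using A B
proof (induction k arbitrary: n A B)
  case 0
  then have "A \<inter> space M = A" by (auto simp: stop_ev_def dest: sets.sets_into_space)
  then show ?case by simp
next
  case (Suc k)
  have AM [measurable]: "A \<in> events" using Suc.prems by (auto simp: stop_ev_def)
  have BM [measurable]: "B 0 \<in> sets borel" using Suc.prems by simp
  define A1 where "A1 = A \<inter> {\<omega>\<in>space M. V n \<omega> \<in> B 0}"
  have A1: "A1 \<in> stop_ev (Suc n)" unfolding A1_def by (rule stop_ev_step[OF Suc.prems(1) BM])
  have A1M [measurable]: "A1 \<in> events" using A1 by (auto simp: stop_ev_def)
  have "prob A1 = prob (A1 \<inter> {\<omega>\<in>space M. T n \<omega> < \<infinity>})" by (rule prob_T_finite[symmetric]) measurable
  also have "A1 \<inter> {\<omega>\<in>space M. T n \<omega> < \<infinity>} = A \<inter> {\<omega>\<in>space M. T n \<omega> < \<infinity>} \<inter> {\<omega>\<in>space M. V n \<omega> \<in> B 0}" by (auto simp: A1_def)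
  also have "prob \<dots> = prob A * prob {\<omega>\<in>space M. V 0 \<omega> \<in> B 0}"
    unfolding V_law[OF Suc.prems(1) BM] prob_T_finite[OF AM] ..
  finally have p: "prob A1 = prob A * prob {\<omega>\<in>space M. V 0 \<omega> \<in> B 0}" .
  have eq: "A \<inter> {\<omega>\<in>space M. \<forall>i<Suc k. V (n + i) \<omega> \<in> B i} = A1 \<inter> {\<omega>\<in>space M. \<forall>i<k. V (Suc n + i) \<omega> \<in> B (Suc i)}"
    unfolding A1_def by (auto simp: less_Suc_eq_0_disj)
  show ?case
    unfolding eq using Suc.IH[OF A1, of "\<lambda>i. B (Suc i)"] Suc.prems(2) by (simp add: p prod.lessThan_Suc_shift mult.assoc del: prod.lessThan_Suc)
qed

abbreviation seqs :: "(nat \<Rightarrow> real) measure" where "seqs \<equiv> PiM UNIV (\<lambda>_. borel)"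

definition Vs :: "nat \<Rightarrow> 'a \<Rightarrow> nat \<Rightarrow> real" where "Vs n \<omega> i = V (n + i) \<omega>"

lemma Vs_measurable [measurable]: "Vs n \<in> measurable M seqs"
proof -
  have "(\<lambda>\<omega> i. V (n + i) \<omega>) \<in> measurable M seqs"
    by (rule measurable_PiM_single') (auto simp: PiE_def)
  then show ?thesis by (simp add: Vs_def[abs_def])
qed

text \<open>\<open>P\<close> is the law of the future on A, \<open>Q\<close> the unconditional law
  scaled by the probability of A. They are finite and agree on cylinders, which suffices on the
  product sigma-algebra.\<close>

theorem strong_markov:
  assumes A: "A \<in> stop_ev n" and B: "B \<in> sets seqs"
  shows "prob (A \<inter> {\<omega>\<in>space M. Vs n \<omega> \<in> B}) = prob A * prob {\<omega>\<in>space M. Vs 0 \<omega> \<in> B}"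
proof -
  have AM [measurable]: "A \<in> events" using A by (auto simp: stop_ev_def)
  define P where "P = distr (density M (indicator A)) seqs (Vs n)"
  define Q where "Q = scale_measure (ennreal (prob A)) (distr M seqs (Vs 0))"
  have Pe: "emeasure P C = ennreal (prob (A \<inter> {\<omega>\<in>space M. Vs n \<omega> \<in> C}))" if C [measurable]: "C \<in> sets seqs" for C
  proof -
    have "emeasure P C = emeasure (density M (indicator A)) {\<omega>\<in>space M. Vs n \<omega> \<in> C}"
      unfolding P_def by (subst emeasure_distr) (auto simp: vimage_def Int_def conj_commute)
    also have "\<dots> = emeasure M (A \<inter> {\<omega>\<in>space M. Vs n \<omega> \<in> C})" by (rule emeasure_restricted) auto
    finally show ?thesis by (simp add: emeasure_eq_measure)
  qed
  have Qe: "emeasure Q C = ennreal (prob A * prob {\<omega>\<in>space M. Vs 0 \<omega> \<in> C})" if C [measurable]: "C \<in> sets seqs" for C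
    unfolding Q_def by (simp add: emeasure_distr emeasure_eq_measure ennreal_mult vimage_def Int_def conj_commute)
  have "P = Q"
  proof (rule measure_eqI_PiM_infinite)
    show "sets P = sets seqs" "sets Q = sets seqs" by (auto simp: P_def Q_def)
    show "finite_measure P" by (rule finite_measureI) (use Pe[OF sets.top] in \<open>simp add: P_def\<close>)
    fix J :: "nat set" and C assume J: "finite J" and C: "\<And>i. i \<in> J \<Longrightarrow> C i \<in> sets (borel :: real measure)"
    obtain k where k: "J \<subseteq> {..<k}" using J by (meson finite_nat_iff_bounded)
    \<comment> \<open>Leaving the coordinates outside J free turns a cylinder over J into one over
      an initial segment.\<close>
    define D where "D i = (if i \<in> J then C i else UNIV)" for i
    have DM: "D i \<in> sets borel" for i using C by (simp add: D_def)
    have eq: "{\<omega>\<in>space M. Vs n \<omega> \<in> prod_emb UNIV (\<lambda>_. borel) J (Pi\<^sub>E J C)} = {\<omega>\<in>space M. \<forall>i<k. V (n + i) \<omega> \<in> D i}" for n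
      using k by (auto simp: prod_emb_def Vs_def D_def PiE_iff)
    have CM: "prod_emb UNIV (\<lambda>_. borel) J (Pi\<^sub>E J C) \<in> sets seqs" using J C by (intro sets_PiM_I) auto
    have "prob (A \<inter> {\<omega>\<in>space M. \<forall>i<k. V (n + i) \<omega> \<in> D i}) = prob A * (\<Prod>i<k. prob {\<omega>\<in>space M. V 0 \<omega> \<in> D i})"
      by (rule strong_markov_cylinder[OF A DM])
    moreover have "prob (space M \<inter> {\<omega>\<in>space M. \<forall>i<k. V (0 + i) \<omega> \<in> D i}) = prob (space M) * (\<Prod>i<k. prob {\<omega>\<in>space M. V 0 \<omega> \<in> D i})"
      by (rule strong_markov_cylinder[OF space_stop_ev DM])
    moreover have "space M \<inter> {\<omega>\<in>space M. \<forall>i<k. V (0 + i) \<omega> \<in> D i} = {\<omega>\<in>space M. \<forall>i<k. V (0 + i) \<omega> \<in> D i}"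
      by (rule Int_absorb1) blast
    ultimately show "emeasure P (prod_emb UNIV (\<lambda>_. borel) J (Pi\<^sub>E J C)) = emeasure Q (prod_emb UNIV (\<lambda>_. borel) J (Pi\<^sub>E J C))"
      unfolding Pe[OF CM] Qe[OF CM] eq by (simp only: prob_space mult_1)
  qed
  then have "emeasure P B = emeasure Q B" by simp
  then show ?thesis unfolding Pe[OF B] Qe[OF B] by simp
qed

lemma indep_V: "indep_vars (\<lambda>_. borel) V UNIV"
  unfolding indep_vars_def2
proof (intro conjI ballI indep_setsI)
  fix J and C :: "nat \<Rightarrow> 'a set" assume J: "J \<noteq> {}" "finite J" "\<forall>j\<in>J. C j \<in> {V j -` A \<inter> space M |A. A \<in> sets borel}"
  then obtain B where B: "\<And>j. j \<in> J \<Longrightarrow> B j \<in> sets borel" "\<And>j. j \<in> J \<Longrightarrow> C j = V j -` B j \<inter> space M" by (auto simp: bchoice_iff)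
  define D where "D i = (if i \<in> J then B i else UNIV)" for i
  have DM: "D i \<in> sets borel" for i using B by (simp add: D_def)
  obtain k where k: "J \<subseteq> {..<k}" using J by (meson finite_nat_iff_bounded)
  have sm: "prob {\<omega>\<in>space M. \<forall>i<l. V (j + i) \<omega> \<in> E i} = (\<Prod>i<l. prob {\<omega>\<in>space M. V 0 \<omega> \<in> E i})" if "\<And>i. E i \<in> sets borel" for j l E
    using strong_markov_cylinder[OF space_stop_ev[of j], of l E] that by (simp add: prob_space Int_absorb1)
  have pV: "prob (C j) = prob {\<omega>\<in>space M. V 0 \<omega> \<in> B j}" if "j \<in> J" for j
    using sm[of "\<lambda>_. B j" 1 j] B[OF that] by (simp add: vimage_def Int_def conj_commute)
  have "(\<Inter>j\<in>J. C j) = {\<omega>\<in>space M. \<forall>i<k. V (0 + i) \<omega> \<in> D i}"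
    using k J(1) B(2) by (auto simp: D_def)
  then have "prob (\<Inter>j\<in>J. C j) = (\<Prod>i<k. prob {\<omega>\<in>space M. V 0 \<omega> \<in> D i})" using sm[of D k 0] DM by simp
  also have "\<dots> = (\<Prod>i\<in>J. prob {\<omega>\<in>space M. V 0 \<omega> \<in> D i})"
    by (rule prod.mono_neutral_right) (use k in \<open>auto simp: D_def prob_space\<close>)
  also have "\<dots> = (\<Prod>j\<in>J. prob (C j))" by (rule prod.cong) (auto simp: D_def pV)
  finally show "prob (\<Inter>j\<in>J. C j) = (\<Prod>j\<in>J. prob (C j))" .
qed auto

text \<open>Markov's inequality for exp (- T n), which is the product of the independent variables
  \<bar>V i\<bar>; their common mean is below 1 because a cycle has positive length.\<close>

lemma T_tail:
  obtains \<rho> where "0 < \<rho>" "\<rho> < 1" "\<And>n t. prob {\<omega>\<in>space M. T n \<omega> \<le> ereal t} \<le> exp t * \<rho> ^ n"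
proof -
  define \<rho>0 where "\<rho>0 = expectation (\<lambda>\<omega>. \<bar>V 0 \<omega>\<bar>)"
  have iV: "integrable M (\<lambda>\<omega>. \<bar>V n \<omega>\<bar>)" for n by (rule integrable_boundedI[of _ 1]) (use V_bound in auto)
  have "\<rho>0 < 1"
  proof -
    have "expectation (\<lambda>\<omega>. \<bar>V 0 \<omega>\<bar>) < expectation (\<lambda>\<omega>. 1)"
    proof (rule integral_less_AE_space[OF iV])
      show "AE \<omega> in M. \<bar>V 0 \<omega>\<bar> < 1" using AE_T_finite AE_space
        by eventually_elim (use V_abs(2)[of _ 0] in auto)
    qed (auto simp: emeasure_space_1)
    then show ?thesis by (simp add: \<rho>0_def prob_space)
  qed
  have same: "expectation (\<lambda>\<omega>. \<bar>V n \<omega>\<bar>) = \<rho>0" for n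
  proof -
    have "distr M borel (V n) = distr M borel (V 0)"
    proof (rule measure_eqI)
      fix B assume "B \<in> sets (distr M borel (V n))"
      then have B [measurable]: "B \<in> sets borel" by simp
      have "prob {\<omega>\<in>space M. V n \<omega> \<in> B} = prob {\<omega>\<in>space M. V 0 \<omega> \<in> B}"
        using strong_markov_cylinder[OF space_stop_ev[of n], of 1 "\<lambda>_. B"] B by (simp add: prob_space Int_absorb1)
      then show "emeasure (distr M borel (V n)) B = emeasure (distr M borel (V 0)) B"
        by (simp add: emeasure_distr emeasure_eq_measure vimage_def Int_def conj_commute)
    qed simp
    then have "(\<integral>x. \<bar>x\<bar> \<partial>distr M borel (V n)) = (\<integral>x. \<bar>x\<bar> \<partial>distr M borel (V 0))" by simp
    then show ?thesis by (simp add: integral_distr \<rho>0_def)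
  qed
  \<comment> \<open>The maximum with 1/2 secures \<rho> > 0, so that ln \<rho> can be used in
    \<open>Z_exp_tight\<close>.\<close>
  define \<rho> where "\<rho> = max \<rho>0 (1/2)"
  have \<rho>: "0 < \<rho>" "\<rho> < 1" using \<open>\<rho>0 < 1\<close> by (auto simp: \<rho>_def)
  have \<rho>0: "0 \<le> \<rho>0" by (simp add: \<rho>0_def)
  show ?thesis
  proof (rule that[OF \<rho>])
    fix n t
    have ind: "indep_vars (\<lambda>_. borel) (\<lambda>i \<omega>. \<bar>V i \<omega>\<bar>) {..<n}"
      using indep_vars_compose2[OF indep_vars_subset[OF indep_V, of "{..<n}"], of "\<lambda>_ x. \<bar>x\<bar>" "\<lambda>_. borel"] by simp
    have prodE: "expectation (\<lambda>\<omega>. \<Prod>i<n. \<bar>V i \<omega>\<bar>) = \<rho>0 ^ n" and iP: "integrable M (\<lambda>\<omega>. \<Prod>i<n. \<bar>V i \<omega>\<bar>)"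
      using indep_vars_lebesgue_integral[OF _ ind iV] indep_vars_integrable[OF _ ind iV] by (auto simp: same)
    have le: "AE \<omega> in M. indicator {\<omega>\<in>space M. T n \<omega> \<le> ereal t} \<omega> \<le> exp t * (\<Prod>i<n. \<bar>V i \<omega>\<bar>)"
      using AE_T_finite AE_space
    proof eventually_elim
      case (elim \<omega>)
      have fin: "T k \<omega> < \<infinity>" for k using elim by blast
      have "(\<Prod>i<n. \<bar>V i \<omega>\<bar>) = exp (- Tr n \<omega>)"
      proof (induction n)
        case (Suc n)
        then show ?case using V_abs(1)[OF elim(2) fin, of n] by (simp flip: exp_add)
      qed (simp add: zero_ereal_def)
      moreover have "Tr n \<omega> \<le> t" if "T n \<omega> \<le> ereal t" using that T_real(1)[OF elim(2) fin] by (metis ereal_less_eq(3))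
      ultimately show ?case by (auto simp: indicator_def simp flip: exp_add)
    qed
    have "prob {\<omega>\<in>space M. T n \<omega> \<le> ereal t} = expectation (indicator {\<omega>\<in>space M. T n \<omega> \<le> ereal t})"
      using T_le_event by simp
    also have "\<dots> \<le> expectation (\<lambda>\<omega>. exp t * (\<Prod>i<n. \<bar>V i \<omega>\<bar>))"
      by (rule integral_mono_AE[OF _ _ le]) (use iP in \<open>auto intro!: integrable_boundedI[of _ 1] simp: indicator_def\<close>)
    also have "\<dots> = exp t * \<rho>0 ^ n" using prodE by simp
    also have "\<dots> \<le> exp t * \<rho> ^ n" using \<rho>0 by (intro mult_left_mono power_mono) (auto simp: \<rho>_def)
    finally show "prob {\<omega>\<in>space M. T n \<omega> \<le> ereal t} \<le> exp t * \<rho> ^ n" .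
  qed
qed

end

section \<open>Renewal functionals\<close>

text \<open>The sequence v stands for the encoded cycles \<open>Vs 0 \<omega>\<close>: - ln \<bar>v
  i\<bar> is a duration, so \<open>rsum\<close> is the cycle time, \<open>rcnt\<close> the number of
  cycles completed by time t, and \<open>rpos\<close> the pair of counts by direction. As functions
  on sequence space they can be applied to the future after a renewal.\<close>

definition rsum :: "(nat \<Rightarrow> real) \<Rightarrow> nat \<Rightarrow> real" where
  "rsum v n = (\<Sum>i<n. - ln \<bar>v i\<bar>)"

definition rcnt :: "(nat \<Rightarrow> real) \<Rightarrow> real \<Rightarrow> nat" where
  "rcnt v t = (LEAST n. t < rsum v (Suc n))"

definition dir :: "real \<Rightarrow> real \<times> real" where
  "dir x = (if x > 0 then 1 else 0, if x < 0 then 1 else 0)"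

definition rpos :: "(nat \<Rightarrow> real) \<Rightarrow> real \<Rightarrow> real \<times> real" where
  "rpos v t = (\<Sum>i<rcnt v t. dir (v i))"

text \<open>The almost sure properties of the encoded cycles: positive finite durations, and
  divergence of the cycle times, which gives the minimum in \<open>rcnt\<close> a meaning.\<close>

definition good_seq :: "(nat \<Rightarrow> real) \<Rightarrow> bool" where
  "good_seq v \<longleftrightarrow> (\<forall>i. v i \<noteq> 0 \<and> \<bar>v i\<bar> < 1) \<and> (\<forall>t. \<exists>n. t < rsum v n)"

lemma norm_dir: "norm (dir x) \<le> 1"
  by (simp add: dir_def norm_Pair)

lemma rsum_Suc_less: "good_seq v \<Longrightarrow> rsum v n < rsum v (Suc n)"
  by (auto simp: good_seq_def rsum_def)

lemma rsum_mono: "good_seq v \<Longrightarrow> m \<le> n \<Longrightarrow> rsum v m \<le> rsum v n"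
  using lift_Suc_mono_le[of "rsum v" m n] rsum_Suc_less[of v] by (simp add: less_imp_le)

lemma ex_rsum_Suc: "good_seq v \<Longrightarrow> \<exists>n. t < rsum v (Suc n)"
  using rsum_Suc_less[of v] by (meson good_seq_def less_trans)

lemma rcnt_le: "t < rsum v (Suc n) \<Longrightarrow> rcnt v t \<le> n"
  unfolding rcnt_def by (rule Least_le)

lemma less_rsum_rcnt: "good_seq v \<Longrightarrow> t < rsum v (Suc (rcnt v t))"
  unfolding rcnt_def using ex_rsum_Suc by (rule LeastI_ex)

lemma rsum_rcnt_le: assumes "good_seq v" "0 \<le> t" shows "rsum v (rcnt v t) \<le> t"
proof (cases "rcnt v t")
  case 0
  then show ?thesis using assms(2) by (simp add: rsum_def)
next
  case (Suc k)
  then have "\<not> t < rsum v (Suc k)" using rcnt_le[of t v k] by auto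
  then show ?thesis using Suc by simp
qed

lemma rcnt_eqI:
  assumes "good_seq v" "rsum v n \<le> t" "t < rsum v (Suc n)" shows "rcnt v t = n"
proof (rule antisym[OF rcnt_le[OF assms(3)]])
  show "n \<le> rcnt v t"
  proof (rule ccontr)
    assume "\<not> n \<le> rcnt v t"
    then have "rsum v (Suc (rcnt v t)) \<le> rsum v n" by (intro rsum_mono assms) auto
    then show False using less_rsum_rcnt[OF assms(1), of t] assms(2) by simp
  qed
qed

lemma rcnt_mono: "good_seq v \<Longrightarrow> s \<le> t \<Longrightarrow> rcnt v s \<le> rcnt v t"
  using less_rsum_rcnt[of v t] by (intro rcnt_le) auto

lemma sum_lessThan_add: "(\<Sum>i<m + n. f i) = (\<Sum>i<m. f i) + (\<Sum>i<n. f (m + i))" for f :: "nat \<Rightarrow> 'b::comm_monoid_add"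
  by (induction n) (simp_all add: add.assoc)

lemma rsum_add: "rsum v (m + n) = rsum v m + rsum (\<lambda>i. v (m + i)) n"
  by (simp add: rsum_def sum_lessThan_add)

lemma good_seq_shift:
  assumes "good_seq v" shows "good_seq (\<lambda>i. v (k + i))"
proof -
  have "\<exists>n. t < rsum (\<lambda>i. v (k + i)) n" for t
  proof -
    obtain n where "t + rsum v k < rsum v n" using assms by (auto simp: good_seq_def)
    also have "\<dots> \<le> rsum v (k + n)" by (rule rsum_mono[OF assms]) simp
    finally show ?thesis by (auto simp: rsum_add)
  qed
  then show ?thesis using assms by (simp add: good_seq_def)
qed

text \<open>Renewal identity: after k cycles the count restarts with the shifted sequence and the
  time that is left. Through it the fresh copy after a renewal enters
  \<open>Z_superadd\<close>.\<close>

lemma rpos_shift: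
  assumes v: "good_seq v" and k: "rsum v k \<le> t"
  shows "rpos v t = (\<Sum>i<k. dir (v i)) + rpos (\<lambda>i. v (k + i)) (t - rsum v k)"
proof -
  let ?w = "\<lambda>i. v (k + i)"
  let ?n = "rcnt ?w (t - rsum v k)"
  have w: "good_seq ?w" by (rule good_seq_shift[OF v])
  have "rcnt v t = k + ?n"
    using rsum_rcnt_le[OF w, of "t - rsum v k"] less_rsum_rcnt[OF w, of "t - rsum v k"] k rsum_add[of v k "Suc ?n"]
    by (intro rcnt_eqI[OF v]) (auto simp: rsum_add)
  then show ?thesis by (simp add: rpos_def sum_lessThan_add)
qed

lemma rpos_diff:
  assumes v: "good_seq v" and st: "s \<le> t"
  shows "norm (rpos v t - rpos v s) \<le> real (rcnt v t) - real (rcnt v s)"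
proof -
  obtain m where m: "rcnt v t = rcnt v s + m" using rcnt_mono[OF v st] le_iff_add by blast
  have "norm (\<Sum>i<m. dir (v (rcnt v s + i))) \<le> (\<Sum>i<m. 1)"
    by (rule sum_norm_le) (rule norm_dir)
  then show ?thesis by (simp add: rpos_def m sum_lessThan_add)
qed

lemma rpos_norm: "norm (rpos v t) \<le> real (rcnt v t)"
  using sum_norm_le[of "{..<rcnt v t}" "\<lambda>i. dir (v i)" "\<lambda>_. 1"] norm_dir by (simp add: rpos_def)

lemma rsum_measurable [measurable]: "(\<lambda>v. rsum v n) \<in> borel_measurable (PiM UNIV (\<lambda>_. borel))"
  unfolding rsum_def by measurable

lemma rcnt_measurable [measurable]: "(\<lambda>v. rcnt v t) \<in> measurable (PiM UNIV (\<lambda>_. borel)) (count_space UNIV)"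
  unfolding rcnt_def by measurable

lemma dir_measurable [measurable]: "dir \<in> borel_measurable borel"
proof -
  have "(\<lambda>x. (if x > 0 then 1 else 0 :: real, if x < 0 then 1 else 0 :: real)) \<in> borel_measurable (borel :: real measure)"
    by (rule borel_measurable_Pair) measurable
  then show ?thesis by (simp add: dir_def[abs_def])
qed

lemma rpos_measurable [measurable]: "(\<lambda>v. rpos v t) \<in> borel_measurable (PiM UNIV (\<lambda>_. borel))"
proof -
  have "(\<lambda>v. \<Sum>i<n. dir (v i)) \<in> borel_measurable (PiM UNIV (\<lambda>_. borel))" for n :: nat
    by (rule borel_measurable_sum) measurable
  then show ?thesis unfolding rpos_def by (rule measurable_compose_countable) measurable
qed

section \<open>The cycle counts of the diffusion\<close>

context sde
begin

definition Z :: "real \<Rightarrow> 'a \<Rightarrow> real \<times> real" where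
  "Z t \<omega> = (real (cycle_count_dir 1 X t \<omega>), real (cycle_count_dir (-1) X t \<omega>))"

lemma cycle_count_measurable [measurable]: "cycle_count X t \<in> measurable M (count_space UNIV)"
  unfolding cycle_count_def by measurable

lemma cycle_count_dir_measurable [measurable]: "(\<lambda>\<omega>. real (cycle_count_dir d X t \<omega>)) \<in> borel_measurable M"
proof -
  define x where "x n \<omega> = (if T n \<omega> < \<infinity> then X (Tr n \<omega>) \<omega> else 0)" for n \<omega>
  have [measurable]: "x n \<in> borel_measurable M" for n unfolding x_def by (rule X_Tr_measurable)
  have "(\<lambda>\<omega>. \<Sum>n\<in>{1..k}. (if x n \<omega> - x (n - 1) \<omega> = d then 1 else 0 :: real)) \<in> borel_measurable M" for k :: nat
    by measurable
  then have "(\<lambda>\<omega>. \<Sum>n\<in>{1..cycle_count X t \<omega>}. (if x n \<omega> - x (n - 1) \<omega> = d then 1 else 0 :: real)) \<in> borel_measurable M"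
    by (rule measurable_compose_countable) measurable
  then show ?thesis
  proof (rule measurable_cong[THEN iffD1, rotated])
    fix \<omega> assume w: "\<omega> \<in> space M"
    have fin: "T n \<omega> < \<infinity>" if "n \<le> cycle_count X t \<omega>" for n
    proof (cases n)
      case (Suc k)
      then have "\<not> ereal t < T (Suc k) \<omega>" using that not_less_Least[of k "\<lambda>n. ereal t < T (Suc n) \<omega>"] by (simp add: cycle_count_def)
      then show ?thesis using Suc by (cases "T n \<omega>") auto
    qed simp
    have "(\<Sum>n\<in>{1..cycle_count X t \<omega>}. (if x n \<omega> - x (n - 1) \<omega> = d then 1 else 0 :: real)) =
       real (card {n\<in>{1..cycle_count X t \<omega>}. x n \<omega> - x (n - 1) \<omega> = d})"
      by (simp add: sum.inter_filter[symmetric])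
    also have "{n\<in>{1..cycle_count X t \<omega>}. x n \<omega> - x (n - 1) \<omega> = d} = {n\<in>{1..cycle_count X t \<omega>}. X (Tr n \<omega>) \<omega> - X (Tr (n - 1) \<omega>) \<omega> = d}"
      using fin by (auto simp: x_def)
    finally show "(\<Sum>n\<in>{1..cycle_count X t \<omega>}. (if x n \<omega> - x (n - 1) \<omega> = d then 1 else 0 :: real)) = real (cycle_count_dir d X t \<omega>)"
      by (simp add: cycle_count_dir_def)
  qed
qed

lemma Z_measurable [measurable]: "Z t \<in> borel_measurable M"
  unfolding Z_def by (rule borel_measurable_Pair) measurable

lemma rsum_Vs:
  assumes w: "\<omega> \<in> space M" and fin: "\<And>n. T n \<omega> < \<infinity>"
  shows "rsum (Vs 0 \<omega>) n = Tr n \<omega>"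
proof (induction n)
  case (Suc n)
  then show ?case using V_abs(1)[OF w fin, of n] by (simp add: rsum_def Vs_def)
qed (simp add: rsum_def zero_ereal_def)

lemma good_seq_Vs:
  assumes w: "\<omega> \<in> space M" and fin: "\<And>n. T n \<omega> < \<infinity>"
  shows "good_seq (Vs 0 \<omega>)"
proof -
  have "\<exists>n. t < rsum (Vs 0 \<omega>) n" for t
    using T_unbounded[OF w, of t] T_real(1)[OF w fin] unfolding rsum_Vs[OF w fin] by (metis ereal_less_eq(3) not_le)
  then show ?thesis using V_abs(2,3)[OF w fin] by (simp add: good_seq_def Vs_def)
qed

lemma T_iff_rsum:
  assumes w: "\<omega> \<in> space M" and fin: "\<And>n. T n \<omega> < \<infinity>"
  shows "T n \<omega> \<le> ereal t \<longleftrightarrow> rsum (Vs 0 \<omega>) n \<le> t" "ereal t < T n \<omega> \<longleftrightarrow> t < rsum (Vs 0 \<omega>) n"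
  unfolding rsum_Vs[OF w fin] using T_real(1)[OF w fin[of n]] by (metis ereal_less_eq(3), metis ereal_less_eq(3) not_le)

lemma dir_V:
  assumes w: "\<omega> \<in> space M" and fin: "\<And>n. T n \<omega> < \<infinity>"
  shows "V n \<omega> > 0 \<longleftrightarrow> X (Tr (Suc n) \<omega>) \<omega> - X (Tr n \<omega>) \<omega> = 1"
    "V n \<omega> < 0 \<longleftrightarrow> X (Tr (Suc n) \<omega>) \<omega> - X (Tr n \<omega>) \<omega> = -1"
    "dir (V n \<omega>) = dir (X (Tr (Suc n) \<omega>) \<omega> - X (Tr n \<omega>) \<omega>)"
proof -
  define \<xi> where "\<xi> = X (Tr (Suc n) \<omega>) \<omega> - X (Tr n \<omega>) \<omega>"
  have x: "\<xi> = 1 \<or> \<xi> = -1" using X_T_Suc[OF w fin, of n] by (auto simp: \<xi>_def abs_if split: if_splits)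
  have V: "V n \<omega> = exp (- (Tr (Suc n) \<omega> - Tr n \<omega>)) * \<xi>" using fin by (simp add: V_alt \<xi>_def)
  have "V n \<omega> > 0 \<longleftrightarrow> \<xi> > 0" "V n \<omega> < 0 \<longleftrightarrow> \<xi> < 0" unfolding V by (simp_all add: zero_less_mult_iff mult_less_0_iff)
  then show "V n \<omega> > 0 \<longleftrightarrow> X (Tr (Suc n) \<omega>) \<omega> - X (Tr n \<omega>) \<omega> = 1"
    "V n \<omega> < 0 \<longleftrightarrow> X (Tr (Suc n) \<omega>) \<omega> - X (Tr n \<omega>) \<omega> = -1" 
    "dir (V n \<omega>) = dir (X (Tr (Suc n) \<omega>) \<omega> - X (Tr n \<omega>) \<omega>)"
    using x unfolding \<xi>_def[symmetric] dir_def by auto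
qed

lemma Z_eq_rpos:
  assumes w: "\<omega> \<in> space M" and fin: "\<And>n. T n \<omega> < \<infinity>"
  shows "Z t \<omega> = rpos (Vs 0 \<omega>) t"
proof -
  have N: "cycle_count X t \<omega> = rcnt (Vs 0 \<omega>) t"
    unfolding cycle_count_def rcnt_def T_iff_rsum(2)[OF w fin] ..
  have c: "real (cycle_count_dir d X t \<omega>) = (\<Sum>i<rcnt (Vs 0 \<omega>) t. if X (Tr (Suc i) \<omega>) \<omega> - X (Tr i \<omega>) \<omega> = d then 1 else 0)" for d
  proof -
    have "{n \<in> {1..rcnt (Vs 0 \<omega>) t}. X (Tr n \<omega>) \<omega> - X (Tr (n - 1) \<omega>) \<omega> = d} =
      Suc ` {i\<in>{..<rcnt (Vs 0 \<omega>) t}. X (Tr (Suc i) \<omega>) \<omega> - X (Tr i \<omega>) \<omega> = d}"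
    proof (safe, goal_cases)
      case (1 n)
      then show ?case by (intro image_eqI[of _ _ "n - 1"]) auto
    qed auto
    then have "cycle_count_dir d X t \<omega> = card {i\<in>{..<rcnt (Vs 0 \<omega>) t}. X (Tr (Suc i) \<omega>) \<omega> - X (Tr i \<omega>) \<omega> = d}"
      unfolding cycle_count_dir_def N by (simp add: card_image)
    then show ?thesis by (simp add: sum.inter_filter[symmetric])
  qed
  show ?thesis
    unfolding Z_def c rpos_def using dir_V(1,2)[OF w fin]
    by (intro prod_eqI) (auto simp: fst_sum snd_sum dir_def Vs_def intro!: sum.cong)
qed

text \<open>The counts after n cycles as read off at time s: the truncated times make each summand
  known at s, and the sum equals \<open>Z s\<close> when \<open>T n \<le> s < T (Suc n)\<close> and
  all cycle times are finite (\<open>Z_eq_zn\<close>).\<close>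

definition zn :: "nat \<Rightarrow> real \<Rightarrow> 'a \<Rightarrow> real \<times> real" where
  "zn n s \<omega> = (\<Sum>i<n. dir (X (Tm (Suc i) s \<omega>) \<omega> - X (Tm i s \<omega>) \<omega>))"

text \<open>The event that Z s is close to p is split according to the cycle running at time s: each
  part is known at s, and on it the next renewal time has the fixed index \<open>Suc n\<close>, as
  the strong Markov property requires.\<close>

definition cyl :: "nat \<Rightarrow> real \<Rightarrow> real \<times> real \<Rightarrow> real \<Rightarrow> 'a set" where
  "cyl n s p r = {\<omega>\<in>space M. norm (zn n s \<omega> - p) \<le> r \<and> T n \<omega> \<le> ereal s \<and> ereal s < T (Suc n) \<omega>}"

lemma cyl_F:
  assumes s: "0 \<le> s" shows "cyl n s p r \<in> sets (F s)"
proof -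
  note [measurable] = X_Tm_F[OF s]
  have "(\<lambda>\<omega>. dir (X (Tm (Suc i) s \<omega>) \<omega> - X (Tm i s \<omega>) \<omega>)) \<in> borel_measurable (F s)" for i by measurable
  then have [measurable]: "zn n s \<in> borel_measurable (F s)" unfolding zn_def by (rule borel_measurable_sum)
  have "{\<omega>\<in>space (F s). norm (zn n s \<omega> - p) \<le> r} \<in> sets (F s)" by measurable
  then have "{\<omega>\<in>space (F s). norm (zn n s \<omega> - p) \<le> r} \<inter> {\<omega>\<in>space M. T n \<omega> \<le> ereal s} - {\<omega>\<in>space M. T (Suc n) \<omega> \<le> ereal s} \<in> sets (F s)"
    using s by (intro sets.Diff sets.Int T_stopping) auto
  also have "{\<omega>\<in>space (F s). norm (zn n s \<omega> - p) \<le> r} \<inter> {\<omega>\<in>space M. T n \<omega> \<le> ereal s} - {\<omega>\<in>space M. T (Suc n) \<omega> \<le> ereal s} = cyl n s p r"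
    by (auto simp: cyl_def)
  finally show ?thesis .
qed

text \<open>If \<open>T n\<close> comes after s on E, then \<open>T n \<le> u\<close> forces u to be
  later than s, when E is already known; for earlier u the intersection is empty.\<close>

lemma stop_evI:
  assumes s: "0 \<le> s" and E: "E \<in> sets (F s)" "\<And>\<omega>. \<omega> \<in> E \<Longrightarrow> ereal s < T n \<omega>"
  shows "E \<in> stop_ev n" "E \<inter> {\<omega>\<in>space M. T n \<omega> \<le> ereal v} \<in> stop_ev n"
proof -
  have EM [measurable]: "E \<in> events" by (rule sets_F_events[OF E(1)])
  have *: "E \<inter> {\<omega>\<in>space M. T n \<omega> \<le> ereal u} \<in> sets (F u')" if "u \<le> u'" "0 \<le> u'" for u u'
  proof (cases "s \<le> u")
    case True
    have "{\<omega>\<in>space M. T n \<omega> \<le> ereal u} \<in> sets (F u')" 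
      using T_stopping[of u n] sets_F_mono[OF that(1)] True s by auto
    moreover have "E \<in> sets (F u')" using E(1) sets_F_mono[of s u'] True that by auto
    ultimately show ?thesis by (rule sets.Int[rotated])
  next
    case False
    have "\<not> T n \<omega> \<le> ereal u" if "\<omega> \<in> E" for \<omega>
      using E(2)[OF that] False by (metis ereal_less_eq(3) le_less_trans less_le_not_le nle_le order_trans)
    then have "E \<inter> {\<omega>\<in>space M. T n \<omega> \<le> ereal u} = {}" by auto
    then show ?thesis by (simp only: sets.empty_sets)
  qed
  show "E \<in> stop_ev n" unfolding stop_ev_def using * EM by auto
  have "E \<inter> {\<omega>\<in>space M. T n \<omega> \<le> ereal v} \<inter> {\<omega>\<in>space M. T n \<omega> \<le> ereal u} = E \<inter> {\<omega>\<in>space M. T n \<omega> \<le> ereal (min u v)}" for u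
    by (auto simp: min_def intro: order_trans)
  then show "E \<inter> {\<omega>\<in>space M. T n \<omega> \<le> ereal v} \<in> stop_ev n"
    unfolding stop_ev_def using *[of "min _ v"] by auto
qed

lemma Z_eq_zn:
  assumes w: "\<omega> \<in> space M" and fin: "\<And>n. T n \<omega> < \<infinity>" and s: "T n \<omega> \<le> ereal s" "ereal s < T (Suc n) \<omega>"
  shows "rcnt (Vs 0 \<omega>) s = n" "Z s \<omega> = (\<Sum>i<n. dir (Vs 0 \<omega> i))" "zn n s \<omega> = Z s \<omega>"
proof -
  show N: "rcnt (Vs 0 \<omega>) s = n" using s T_iff_rsum[OF w fin] by (intro rcnt_eqI good_seq_Vs[OF w fin]) auto
  then show Z: "Z s \<omega> = (\<Sum>i<n. dir (Vs 0 \<omega> i))" unfolding Z_eq_rpos[OF w fin] rpos_def by simp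
  have "Tm i s \<omega> = Tr i \<omega>" if "i \<le> n" for i
    by (rule Tm_eq) (use T_mono[OF w that] s(1) in \<open>auto intro: order_trans\<close>)
  then show "zn n s \<omega> = Z s \<omega>" unfolding Z zn_def using dir_V(3)[OF w fin] by (auto intro!: sum.cong simp: Vs_def)
qed

lemma cyl_disjoint: "disjoint_family (\<lambda>n. cyl n s p r)"
proof -
  have "m = n" if "\<omega> \<in> cyl m s p r" "\<omega> \<in> cyl n s p r" for m n \<omega>
  proof -
    have *: "False" if "m < n" "\<omega> \<in> space M" "T n \<omega> \<le> ereal s" "ereal s < T (Suc m) \<omega>" for m n
      using T_mono[OF that(2), of "Suc m" n] that by (metis Suc_leI leD order_trans)
    show ?thesis using that *[of m n] *[of n m] by (cases m n rule: linorder_cases) (auto simp: cyl_def)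
  qed
  then show ?thesis by (auto simp: disjoint_family_on_def)
qed

lemma cyl_sums:
  assumes s: "0 \<le> s"
  shows "(\<lambda>n. prob (cyl n s p r)) sums prob {\<omega>\<in>space M. norm (Z s \<omega> - p) \<le> r}"
proof -
  have cM: "cyl n s p r \<in> events" for n by (rule sets_F_events[OF cyl_F[OF s]])
  have "(\<lambda>n. prob (cyl n s p r)) sums prob (\<Union>n. cyl n s p r)"
    by (rule finite_measure_UNION) (use cM cyl_disjoint in auto)
  also have "prob (\<Union>n. cyl n s p r) = prob {\<omega>\<in>space M. norm (Z s \<omega> - p) \<le> r}"
  proof (rule finite_measure_eq_AE)
    show "AE \<omega> in M. (\<omega> \<in> (\<Union>n. cyl n s p r)) = (\<omega> \<in> {\<omega>\<in>space M. norm (Z s \<omega> - p) \<le> r})"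
      using AE_T_finite AE_space
    proof eventually_elim
      case (elim \<omega>)
      have fin: "T n \<omega> < \<infinity>" for n using elim by blast
      note w = elim(2)
      let ?n = "rcnt (Vs 0 \<omega>) s"
      have n: "T ?n \<omega> \<le> ereal s" "ereal s < T (Suc ?n) \<omega>"
        unfolding T_iff_rsum[OF w fin] using rsum_rcnt_le[OF good_seq_Vs[OF w fin] s] less_rsum_rcnt[OF good_seq_Vs[OF w fin]] by auto
      have zn: "zn k s \<omega> = Z s \<omega>" if "T k \<omega> \<le> ereal s" "ereal s < T (Suc k) \<omega>" for k
        by (rule Z_eq_zn(3)[OF w fin that])
      show ?case
      proof
        assume "\<omega> \<in> (\<Union>n. cyl n s p r)"
        then obtain k where k: "norm (zn k s \<omega> - p) \<le> r" "T k \<omega> \<le> ereal s" "ereal s < T (Suc k) \<omega>" 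
          unfolding cyl_def by blast
        then show "\<omega> \<in> {\<omega>\<in>space M. norm (Z s \<omega> - p) \<le> r}" using zn[OF k(2,3)] w by simp
      next
        assume "\<omega> \<in> {\<omega>\<in>space M. norm (Z s \<omega> - p) \<le> r}"
        then have "\<omega> \<in> cyl ?n s p r" unfolding cyl_def mem_Collect_eq zn[OF n] using n w by blast
        then show "\<omega> \<in> (\<Union>n. cyl n s p r)" by blast
      qed
    qed
  qed (use cM in auto)
  finally show ?thesis .
qed

lemma Vs_shift: "Vs k \<omega> = (\<lambda>i. Vs 0 \<omega> (k + i))"
  by (simp add: Vs_def fun_eq_iff)

text \<open>The cycle running at s ends at some \<tau> in (s, s + K] with conditional probability at
  least \<open>c\<close>, and from \<tau> on the cycles are a fresh copy. The time left for the copy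
  is not t but somewhere between t and t + K, so the copy must also be prevented from completing
  many cycles within an additional time K.\<close>

lemma Z_superadd:
  obtains K m c where "0 \<le> K" "0 \<le> m" "0 < c" "c \<le> 1"
    "\<And>s t p q r1 r2. 0 \<le> s \<Longrightarrow> 0 \<le> t \<Longrightarrow>
        c * prob {\<omega>\<in>space M. norm (Z s \<omega> - p) \<le> r1} * prob {\<omega>\<in>space M. norm (Z t \<omega> - q) \<le> r2}
        \<le> prob {\<omega>\<in>space M. norm (Z (s + K + t) \<omega> - (p + q)) \<le> r1 + r2 + m}"
proof -
  obtain c K where cK: "0 < c" "c \<le> 1" "0 \<le> K" and
    res: "\<And>n s A. 0 \<le> s \<Longrightarrow> A \<in> sets (F s) \<Longrightarrow> 
      c * prob {\<omega>\<in>A. T n \<omega> \<le> ereal s \<and> ereal s < T (Suc n) \<omega>} \<le> 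
      prob {\<omega>\<in>A. T n \<omega> \<le> ereal s \<and> ereal s < T (Suc n) \<omega> \<and> T (Suc n) \<omega> \<le> ereal (s + K)}"
    using residual_cycle_time by blast
  obtain \<rho> where \<rho>: "0 < \<rho>" "\<rho> < 1" "\<And>n t. prob {\<omega>\<in>space M. T n \<omega> \<le> ereal t} \<le> exp t * \<rho> ^ n"
    using T_tail by blast
  have "(\<lambda>n. exp K * \<rho> ^ n) \<longlonglongrightarrow> exp K * 0" using \<rho> by (intro tendsto_mult_left LIMSEQ_realpow_zero) auto
  then have "\<forall>\<^sub>F n in sequentially. exp K * \<rho> ^ n < 1 / 2" by (rule order_tendstoD) simp
  \<comment> \<open>A number of cycles whose total duration exceeds K with probability at least
    1/2.\<close>
  then obtain k where k: "exp K * \<rho> ^ k < 1 / 2" by (auto dest: eventually_happens)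
  have half: "1 / 2 \<le> prob {\<omega>\<in>space M. Vs 0 \<omega> \<in> {v\<in>space seqs. K < rsum v k}}"
  proof -
    have "1 / 2 \<le> prob (space M - {\<omega>\<in>space M. T k \<omega> \<le> ereal K})"
      using \<rho>(3)[of k K] k by (subst prob_compl) auto
    also have "\<dots> = prob {\<omega>\<in>space M. Vs 0 \<omega> \<in> {v\<in>space seqs. K < rsum v k}}"
    proof (rule finite_measure_eq_AE)
      show "AE \<omega> in M. (\<omega> \<in> space M - {\<omega>\<in>space M. T k \<omega> \<le> ereal K}) = (\<omega> \<in> {\<omega>\<in>space M. Vs 0 \<omega> \<in> {v\<in>space seqs. K < rsum v k}})"
        using AE_T_finite AE_space
        by eventually_elim (auto simp: T_iff_rsum not_le space_PiM)
    qed measurable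
    finally show ?thesis .
  qed
  show ?thesis
  \<comment> \<open>\<open>real k\<close> pays for the cycles in the surplus time and 1 for the
    cycle in progress at s; keeping the former bounded costs the factor 1/2.\<close>
  proof (rule that[of K "real k + 1" "c / 2"])
    fix s t :: real and p q r1 r2 assume s: "0 \<le> s" and t: "0 \<le> t"
    \<comment> \<open>The condition on the fresh copy: it is near q at time t and completes at most
      k further cycles up to t + K.\<close>
    define B where "B = {v\<in>space seqs. norm (rpos v t - q) \<le> r2 \<and> rcnt v (t + K) \<le> rcnt v t + k}"
    have BM [measurable]: "B \<in> sets seqs" unfolding B_def by measurable
    let ?PB = "prob {\<omega>\<in>space M. Vs 0 \<omega> \<in> B}"
    have RM [measurable]: "{v\<in>space seqs. K < rsum v k} \<in> sets seqs" by measurable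
    have cylE: "\<omega> \<in> cyl n u p r \<Longrightarrow> ereal u < T (Suc n) \<omega>" for \<omega> n u p r by (simp add: cyl_def)
    \<comment> \<open>The two conditions in \<open>B\<close> are not independent. Strong Markov at
      the first renewal after t bounds the second one given the first: the k cycles that follow take
      longer than K with probability at least 1/2.\<close>
    have PB: "1 / 2 * prob {\<omega>\<in>space M. norm (Z t \<omega> - q) \<le> r2} \<le> ?PB"
    proof -
      define C where "C n = cyl n t q r2 \<inter> {\<omega>\<in>space M. Vs (Suc n) \<omega> \<in> {v\<in>space seqs. K < rsum v k}}" for n
      have cM [measurable]: "cyl n t q r2 \<in> events" for n by (rule sets_F_events[OF cyl_F[OF t]])
      have CM [measurable]: "C n \<in> events" for n unfolding C_def by measurable
      have "disjoint_family C" using cyl_disjoint[of t q r2] by (auto simp: disjoint_family_on_def C_def)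
      then have s1: "(\<lambda>n. prob (C n)) sums prob (\<Union>n. C n)" by (intro finite_measure_UNION) auto
      have s2: "(\<lambda>n. 1 / 2 * prob (cyl n t q r2)) sums (1 / 2 * prob {\<omega>\<in>space M. norm (Z t \<omega> - q) \<le> r2})"
        by (rule sums_mult[OF cyl_sums[OF t]])
      have "1 / 2 * prob (cyl n t q r2) \<le> prob (C n)" for n
      proof -
        have "prob (C n) = prob (cyl n t q r2) * prob {\<omega>\<in>space M. Vs 0 \<omega> \<in> {v\<in>space seqs. K < rsum v k}}"
          unfolding C_def by (rule strong_markov[OF stop_evI(1)[OF t cyl_F[OF t] cylE] RM])
        also have "\<dots> \<ge> prob (cyl n t q r2) * (1 / 2)" by (rule mult_left_mono[OF half]) simp
        finally show ?thesis by (simp only: mult.commute)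
      qed
      from sums_le[OF this s2 s1] have "1 / 2 * prob {\<omega>\<in>space M. norm (Z t \<omega> - q) \<le> r2} \<le> prob (\<Union>n. C n)" .
      also have "\<dots> \<le> ?PB"
      proof (rule finite_measure_mono_AE)
        show "AE \<omega> in M. \<omega> \<in> (\<Union>n. C n) \<longrightarrow> \<omega> \<in> {\<omega>\<in>space M. Vs 0 \<omega> \<in> B}"
          using AE_T_finite AE_space
        proof (eventually_elim, intro impI)
          fix \<omega> assume f: "\<forall>n. T n \<omega> < \<infinity>" and w: "\<omega> \<in> space M" and "\<omega> \<in> (\<Union>n. C n)"
          then obtain n where n: "\<omega> \<in> C n" by blast
          have fin: "T n \<omega> < \<infinity>" for n using f by blast
          let ?v = "Vs 0 \<omega>"
          have n': "norm (zn n t \<omega> - q) \<le> r2" "T n \<omega> \<le> ereal t" "ereal t < T (Suc n) \<omega>" "K < rsum (Vs (Suc n) \<omega>) k"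
            using n by (auto simp: C_def cyl_def)
          note zn = Z_eq_zn[OF w fin n'(2,3)]
          \<comment> \<open>The cycle in progress at t ends after t, and k more cycles need more
            than K; hence at most n + k cycles are complete at t + K.\<close>
          have "t < rsum ?v (Suc n)" using n'(3) T_iff_rsum[OF w fin] by simp
          then have "t + K < rsum ?v (Suc n + k)" using n'(4) unfolding rsum_add Vs_shift[of "Suc n"] by simp
          then have "rcnt ?v (t + K) \<le> n + k" by (intro rcnt_le) simp
          then have "Vs 0 \<omega> \<in> B" using n'(1) zn Z_eq_rpos[OF w fin, of t] by (simp add: B_def space_PiM)
          then show "\<omega> \<in> {\<omega>\<in>space M. Vs 0 \<omega> \<in> B}" using w by simp
        qed
      qed measurable
      finally show ?thesis .
    qed
    \<comment> \<open>The running cycle ends within K. This event is in the past of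
      \<open>T (Suc n)\<close> (\<open>stop_evI\<close>), so \<open>strong_markov\<close> applies
      there.\<close>
    define A where "A n = cyl n s p r1 \<inter> {\<omega>\<in>space M. T (Suc n) \<omega> \<le> ereal (s + K)}" for n
    define D where "D n = A n \<inter> {\<omega>\<in>space M. Vs (Suc n) \<omega> \<in> B}" for n
    have cM [measurable]: "cyl n s p r1 \<in> events" for n by (rule sets_F_events[OF cyl_F[OF s]])
    have DM [measurable]: "D n \<in> events" for n unfolding D_def A_def by measurable
    have "disjoint_family D" using cyl_disjoint[of s p r1] by (auto simp: disjoint_family_on_def D_def A_def)
    then have s1: "(\<lambda>n. prob (D n)) sums prob (\<Union>n. D n)" by (intro finite_measure_UNION) auto
    have s2: "(\<lambda>n. c * ?PB * prob (cyl n s p r1)) sums (c * ?PB * prob {\<omega>\<in>space M. norm (Z s \<omega> - p) \<le> r1})"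
      by (rule sums_mult[OF cyl_sums[OF s]])
    have "c * ?PB * prob (cyl n s p r1) \<le> prob (D n)" for n
    proof -
      have e1: "{\<omega>\<in>cyl n s p r1. T n \<omega> \<le> ereal s \<and> ereal s < T (Suc n) \<omega>} = cyl n s p r1" by (auto simp: cyl_def)
      have e2: "{\<omega>\<in>cyl n s p r1. T n \<omega> \<le> ereal s \<and> ereal s < T (Suc n) \<omega> \<and> T (Suc n) \<omega> \<le> ereal (s + K)} = A n" 
        by (auto simp: cyl_def A_def)
      have "c * prob (cyl n s p r1) \<le> prob (A n)" using res[OF s cyl_F[OF s], of n p r1 n] unfolding e1 e2 .
      then have "c * prob (cyl n s p r1) * ?PB \<le> prob (A n) * ?PB" by (intro mult_right_mono) auto
      also have "\<dots> = prob (D n)"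
        unfolding D_def A_def by (rule strong_markov[OF stop_evI(2)[OF s cyl_F[OF s] cylE] BM, symmetric])
      finally show ?thesis by (simp add: mult_ac)
    qed
    from sums_le[OF this s2 s1] have "c * ?PB * prob {\<omega>\<in>space M. norm (Z s \<omega> - p) \<le> r1} \<le> prob (\<Union>n. D n)" .
    also have "\<dots> \<le> prob {\<omega>\<in>space M. norm (Z (s + K + t) \<omega> - (p + q)) \<le> r1 + r2 + (real k + 1)}"
    proof (rule finite_measure_mono_AE)
      show "AE \<omega> in M. \<omega> \<in> (\<Union>n. D n) \<longrightarrow> \<omega> \<in> {\<omega>\<in>space M. norm (Z (s + K + t) \<omega> - (p + q)) \<le> r1 + r2 + (real k + 1)}"
        using AE_T_finite AE_space
      proof (eventually_elim, intro impI)
        fix \<omega> assume f: "\<forall>n. T n \<omega> < \<infinity>" and w: "\<omega> \<in> space M" and "\<omega> \<in> (\<Union>n. D n)"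
        then obtain n where n: "\<omega> \<in> D n" by blast
        have fin: "T n \<omega> < \<infinity>" for n using f by blast
        let ?v = "Vs 0 \<omega>" and ?w = "Vs (Suc n) \<omega>"
        have gv: "good_seq ?v" by (rule good_seq_Vs[OF w fin])
        have gw: "good_seq ?w" unfolding Vs_shift[of "Suc n"] by (rule good_seq_shift[OF gv])
        have n': "norm (zn n s \<omega> - p) \<le> r1" "T n \<omega> \<le> ereal s" "ereal s < T (Suc n) \<omega>" "T (Suc n) \<omega> \<le> ereal (s + K)"
          "norm (rpos ?w t - q) \<le> r2" "rcnt ?w (t + K) \<le> rcnt ?w t + k"
          using n by (auto simp: D_def A_def cyl_def B_def)
        note zn = Z_eq_zn[OF w fin n'(2,3)]
        define \<tau> where "\<tau> = rsum ?v (Suc n)"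
        have \<tau>: "s < \<tau>" "\<tau> \<le> s + K" using n'(3,4) T_iff_rsum[OF w fin] by (auto simp: \<tau>_def)
        \<comment> \<open>Time left after the renewal at \<tau>. It depends on the path, but stays
          between t and t + K, where the counts of the copy differ by at most k.\<close>
        define x where "x = s + K + t - \<tau>"
        have x: "t \<le> x" "x \<le> t + K" using \<tau> by (auto simp: x_def)
        have "Z (s + K + t) \<omega> = (\<Sum>i<Suc n. dir (?v i)) + rpos ?w x"
          unfolding Z_eq_rpos[OF w fin] Vs_shift[of "Suc n"] x_def \<tau>_def using \<tau> t by (intro rpos_shift[OF gv]) (simp add: \<tau>_def)
        then have Zeq: "Z (s + K + t) \<omega> = Z s \<omega> + dir (?v n) + rpos ?w x" by (simp add: zn(2))
        have d: "norm (rpos ?w x - rpos ?w t) \<le> real k"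
          using rpos_diff[OF gw x(1)] rcnt_mono[OF gw x(2)] n'(6) by linarith
        have "Z (s + K + t) \<omega> - (p + q) = (Z s \<omega> - p) + (dir (?v n) + ((rpos ?w x - rpos ?w t) + (rpos ?w t - q)))"
          unfolding Zeq by simp
        also have "norm \<dots> \<le> norm (Z s \<omega> - p) + (norm (dir (?v n)) + (norm (rpos ?w x - rpos ?w t) + norm (rpos ?w t - q)))"
          by (intro order_trans[OF norm_triangle_ineq] add_left_mono order_refl)
        also have "\<dots> \<le> r1 + r2 + (real k + 1)"
          using n'(1,5) d norm_dir[of "?v n"] zn(3) by simp
        finally show "\<omega> \<in> {\<omega>\<in>space M. norm (Z (s + K + t) \<omega> - (p + q)) \<le> r1 + r2 + (real k + 1)}" using w by simp
      qed
    qed measurable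
    finally have le: "c * ?PB * prob {\<omega>\<in>space M. norm (Z s \<omega> - p) \<le> r1} \<le> 
      prob {\<omega>\<in>space M. norm (Z (s + K + t) \<omega> - (p + q)) \<le> r1 + r2 + (real k + 1)}" .
    have "c / 2 * prob {\<omega>\<in>space M. norm (Z s \<omega> - p) \<le> r1} * prob {\<omega>\<in>space M. norm (Z t \<omega> - q) \<le> r2} =
      c * prob {\<omega>\<in>space M. norm (Z s \<omega> - p) \<le> r1} * (1 / 2 * prob {\<omega>\<in>space M. norm (Z t \<omega> - q) \<le> r2})" by simp
    also have "\<dots> \<le> c * prob {\<omega>\<in>space M. norm (Z s \<omega> - p) \<le> r1} * ?PB" using PB cK(1) by (intro mult_left_mono) auto
    also have "\<dots> \<le> prob {\<omega>\<in>space M. norm (Z (s + K + t) \<omega> - (p + q)) \<le> r1 + r2 + (real k + 1)}" using le by (simp add: mult_ac)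
    finally show "c / 2 * prob {\<omega>\<in>space M. norm (Z s \<omega> - p) \<le> r1} * prob {\<omega>\<in>space M. norm (Z t \<omega> - q) \<le> r2}
        \<le> prob {\<omega>\<in>space M. norm (Z (s + K + t) \<omega> - (p + q)) \<le> r1 + r2 + (real k + 1)}" .
  qed (use cK in auto)
qed

lemma Z_norm_le:
  assumes w: "\<omega> \<in> space M" and fin: "\<And>n. T n \<omega> < \<infinity>" and t: "ereal t < T n \<omega>"
  shows "norm (Z t \<omega>) \<le> real n"
proof -
  have g: "good_seq (Vs 0 \<omega>)" by (rule good_seq_Vs[OF w fin])
  have "t < rsum (Vs 0 \<omega>) (Suc n)" using t rsum_Suc_less[OF g, of n] unfolding T_iff_rsum(2)[OF w fin] by simp
  then have "rcnt (Vs 0 \<omega>) t \<le> n" by (rule rcnt_le)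
  then show ?thesis using rpos_norm[of "Vs 0 \<omega>" t] unfolding Z_eq_rpos[OF w fin] by simp
qed

text \<open>For a suitable k the first k cycles outlast T0 with probability at least 1/2, and then
  the counts stay at most k at all times up to T0.\<close>

lemma Z_locally_tight:
  assumes "0 \<le> T0" shows "\<exists>R. \<forall>t\<in>{0..T0}. 1 / 2 \<le> prob {\<omega>\<in>space M. norm (Z t \<omega>) \<le> R}"
proof -
  obtain \<rho> where \<rho>: "0 < \<rho>" "\<rho> < 1" "\<And>n t. prob {\<omega>\<in>space M. T n \<omega> \<le> ereal t} \<le> exp t * \<rho> ^ n"
    using T_tail by blast
  have "(\<lambda>n. exp T0 * \<rho> ^ n) \<longlonglongrightarrow> exp T0 * 0" using \<rho> by (intro tendsto_mult_left LIMSEQ_realpow_zero) auto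
  then have "\<forall>\<^sub>F n in sequentially. exp T0 * \<rho> ^ n < 1 / 2" by (rule order_tendstoD) simp
  then obtain k where k: "exp T0 * \<rho> ^ k < 1 / 2" by (auto dest: eventually_happens)
  have "1 / 2 \<le> prob {\<omega>\<in>space M. norm (Z t \<omega>) \<le> real k}" if t: "t \<in> {0..T0}" for t
  proof -
    have "1 / 2 \<le> prob (space M - {\<omega>\<in>space M. T k \<omega> \<le> ereal T0})"
      using \<rho>(3)[of k T0] k by (subst prob_compl) auto
    also have "\<dots> \<le> prob {\<omega>\<in>space M. norm (Z t \<omega>) \<le> real k}"
    proof (rule finite_measure_mono_AE)
      show "AE \<omega> in M. \<omega> \<in> space M - {\<omega>\<in>space M. T k \<omega> \<le> ereal T0} \<longrightarrow> \<omega> \<in> {\<omega>\<in>space M. norm (Z t \<omega>) \<le> real k}"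
        using AE_T_finite AE_space
      proof eventually_elim
        case (elim \<omega>)
        have "ereal t < T k \<omega>" if "\<not> T k \<omega> \<le> ereal T0"
          using t that by (metis atLeastAtMost_iff ereal_less_eq(3) le_less_trans not_le)
        then show ?case using Z_norm_le[of \<omega> t k] elim by auto
      qed
    qed measurable
    finally show ?thesis .
  qed
  then show ?thesis by blast
qed

text \<open>Counts above R t force at least R t cycles to end by time t, and the probability of this
  decays geometrically in the number of cycles (\<open>T_tail\<close>).\<close>

lemma Z_exp_tight: "\<exists>R>0. \<forall>\<^sub>F t in at_top. prob {\<omega>\<in>space M. norm (Z t \<omega>) > R * t} \<le> exp (- \<alpha> * t)"
proof -
  obtain \<rho> where \<rho>: "0 < \<rho>" "\<rho> < 1" "\<And>n t. prob {\<omega>\<in>space M. T n \<omega> \<le> ereal t} \<le> exp t * \<rho> ^ n"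
    using T_tail by blast
  define \<kappa> where "\<kappa> = - ln \<rho>"
  have \<kappa>: "\<kappa> > 0" using \<rho> by (simp add: \<kappa>_def)
  \<comment> \<open>\<open>\<kappa> * R = 1 + \<bar>\<alpha>\<bar>\<close>: the 1 compensates the
    factor exp t of \<open>T_tail\<close>, the rest gives the decay rate \<alpha>.\<close>
  define R where "R = (1 + \<bar>\<alpha>\<bar>) / \<kappa>"
  have R: "R > 0" "\<kappa> * R = 1 + \<bar>\<alpha>\<bar>" using \<kappa> by (auto simp: R_def add_pos_nonneg)
  show ?thesis
  proof (intro exI[of _ R] conjI R(1))
    show "\<forall>\<^sub>F t in at_top. prob {\<omega>\<in>space M. norm (Z t \<omega>) > R * t} \<le> exp (- \<alpha> * t)"
      using eventually_ge_at_top[of 0]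
    proof eventually_elim
      case (elim t)
      have Rt: "0 \<le> R * t" using R elim by simp
      define n where "n = nat \<lceil>R * t\<rceil>"
      have n: "R * t \<le> real n" using Rt by (simp add: n_def real_nat_ceiling_ge)
      have "prob {\<omega>\<in>space M. norm (Z t \<omega>) > R * t} \<le> prob {\<omega>\<in>space M. T n \<omega> \<le> ereal t}"
      proof (rule finite_measure_mono_AE)
        show "AE \<omega> in M. \<omega> \<in> {\<omega>\<in>space M. norm (Z t \<omega>) > R * t} \<longrightarrow> \<omega> \<in> {\<omega>\<in>space M. T n \<omega> \<le> ereal t}"
          using AE_T_finite AE_space
        proof (eventually_elim, intro impI)
          fix \<omega> assume f: "\<forall>n. T n \<omega> < \<infinity>" and w: "\<omega> \<in> space M" and big: "\<omega> \<in> {\<omega>\<in>space M. norm (Z t \<omega>) > R * t}"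
          have fin: "T n \<omega> < \<infinity>" for n using f by blast
          have "R * t < real (rcnt (Vs 0 \<omega>) t)" using big rpos_norm[of "Vs 0 \<omega>" t] unfolding Z_eq_rpos[OF w fin, of t, symmetric] by simp
          then have "n \<le> rcnt (Vs 0 \<omega>) t" unfolding n_def by (simp add: ceiling_le_iff nat_le_iff)
          then have "rsum (Vs 0 \<omega>) n \<le> t" 
            using rsum_mono[OF good_seq_Vs[OF w fin]] rsum_rcnt_le[OF good_seq_Vs[OF w fin] elim] by (meson order_trans)
          then show "\<omega> \<in> {\<omega>\<in>space M. T n \<omega> \<le> ereal t}" using w T_iff_rsum[OF w fin] by simp
        qed
      qed measurable
      also have "\<dots> \<le> exp t * \<rho> ^ n" by (rule \<rho>(3))
      also have "\<rho> ^ n = exp (- (\<kappa> * real n))" using \<rho>(1) by (simp add: \<kappa>_def ln_realpow[symmetric] mult.commute)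
      also have "exp t * exp (- (\<kappa> * real n)) = exp (t - \<kappa> * real n)" by (simp add: exp_diff exp_minus field_simps)
      also have "\<dots> \<le> exp (- \<alpha> * t)"
      proof -
        have "\<kappa> * (R * t) \<le> \<kappa> * real n" using n \<kappa> by (intro mult_left_mono) auto
        moreover have "\<kappa> * (R * t) = t + \<bar>\<alpha>\<bar> * t" using R(2) by (simp add: mult.assoc[symmetric] distrib_right)
        moreover have "\<alpha> * t \<le> \<bar>\<alpha>\<bar> * t" using elim by (intro mult_right_mono) auto
        ultimately show ?thesis by simp
      qed
      finally show ?case .
    qed
  qed
qed

theorem circulation_LDP:
  "\<exists>I1 :: real \<times> real \<Rightarrow> ereal. 
     satisfies_LDP (\<lambda>t. distr M borel (\<lambda>\<omega>. (circ_plus X t \<omega>, circ_minus X t \<omega>))) I1 \<and> convex_ereal_fun I1"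
proof -
  obtain K m c where S: "0 \<le> K" "0 \<le> m" "0 < c" "c \<le> 1"
    "\<And>s t p q r1 r2. 0 \<le> s \<Longrightarrow> 0 \<le> t \<Longrightarrow>
        c * prob {\<omega>\<in>space M. norm (Z s \<omega> - p) \<le> r1} * prob {\<omega>\<in>space M. norm (Z t \<omega> - q) \<le> r2}
        \<le> prob {\<omega>\<in>space M. norm (Z (s + K + t) \<omega> - (p + q)) \<le> r1 + r2 + m}"
    using Z_superadd by blast
  interpret approx_superadditive M Z K m c
    by unfold_locales (use S Z_locally_tight Z_exp_tight in auto)
  have "(\<lambda>\<omega>. (circ_plus X t \<omega>, circ_minus X t \<omega>)) = (\<lambda>\<omega>. Z t \<omega> /\<^sub>R t)" for t
    by (simp add: circ_plus_def circ_minus_def Z_def divide_inverse mult.commute)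
  then show ?thesis using LDP convex_rate by auto
qed

end

theorem theorem4p3:
  fixes b \<sigma> :: "real \<Rightarrow> real" and y :: real
    and M :: "'a measure" and F :: "real \<Rightarrow> 'a measure"
    and W X :: "real \<Rightarrow> 'a \<Rightarrow> real"
  assumes "continuous_on UNIV b" and "continuous_on UNIV \<sigma>"
    and "\<And>x. b (x + 1) = b x" and "\<And>x. \<sigma> (x + 1) = \<sigma> x"
    and "\<And>x. \<sigma> x > 0"
    and "weak_solution M F W X b \<sigma> y"
  shows "\<exists>I1 :: real \<times> real \<Rightarrow> ereal.
           satisfies_LDP (\<lambda>t. distr M borel (\<lambda>\<omega>. (circ_plus X t \<omega>, circ_minus X t \<omega>))) I1
           \<and> convex_ereal_fun I1"
proof -
  interpret prob_space M using assms(6) by (simp add: weak_solution_def)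
  interpret sde M F W X b \<sigma> y by unfold_locales (use assms in auto)
  show ?thesis by (rule circulation_LDP)
qed


end
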